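(* Let $X$ be a smooth, connected, quasi-projective variety over $\mathbb{C}$ of dimension $n$ embedded in $\mathbb{P}^N$, with $N=n+c$. For $k=k_1+\dots+k_r$ with integers $k_i>0$, let $OH_{(k_1,\dots,k_r)}(X)$ be the ordered Hilbert scheme of aligned, finite, degree $k$ subschemes of $X$ with (ordered) multiplicities $k_i$ at the ordered points $x_i$ (possibly coinciding). Consider the natural projective line bundle $OH_{(k_1,\dots,k_r)}(X)\times_G\mathcal{I}$ over $OH_{(k_1,\dots,k_r)}(X)$ and the projection $$\theta_{(k_1,\dots,k_r)}: OH_{(k_1,\dots,k_r)}(X)\times_G\mathcal{I}\to\mathcal{I}\to\mathbb{P}^N.$$ Then the general fibre of $\theta_{(k_1,\dots,k_r)}$ is smooth of dimension $N-1+r-kc$.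
   Context: The ground field is $\mathbb{C}$. $G=G(1,N)$ is the Grassmann variety of lines in $\mathbb{P}^N$, and $\mathcal{I}\subset G\times\mathbb{P}^N$ is the incidence variety of pairs (line, point lying on it); it is a projective line bundle over $G$. The empty set is considered to have every dimension. Definition of $OH_{(k_1,\dots,k_r)}(X)$: it is the subscheme of the $r$-fold fibre product $\mathcal{I}\times_G\dots\times_G\mathcal{I}$, which parametrizes $(L,x_1,\dots,x_r)$ with $L$ a line and $x_i\in L$, over which the relative effective divisor $Z=\sum_i k_ix_i$ of degree $k$ on $L$, as a subscheme of $\mathbb{P}^N$, is contained in $X$. If some of the points $x_i$ coincide, the multiplicity of $Z$ at the common point is the sum of the corresponding $k_i$. The map $OH_{(k_1,\dots,k_r)}(X)\to G$ sends a point to the line $L$. *)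

theory Defs
  imports
    "HOL-Analysis.Analysis"
    "HOL-Algebra.Algebraic_Closure_Type"
    "HOL-Computational_Algebra.Polynomial"
    "HOL-Library.Poly_Mapping"
    "HOL-Library.Extended_Nat"
begin

no_notation Polynomials.var (\<open>X\<index>\<close>)

section \<open>Polynomials over the complex numbers\<close>

type_synonym 'v mpoly = "('v \<Rightarrow>\<^sub>0 nat) \<Rightarrow>\<^sub>0 complex"

definition Const :: "complex \<Rightarrow> 'v mpoly" where
  "Const c = Poly_Mapping.single 0 c"

definition Var :: "'v \<Rightarrow> 'v mpoly" where
  "Var v = Poly_Mapping.single (Poly_Mapping.single v 1) 1"

text \<open>Evaluation of a polynomial at a tuple \<open>x\<close> of elements of a \<open>\<complex>\<close>-algebra with structure map \<open>h\<close>.\<close>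

definition subst :: "(complex \<Rightarrow> 'a) \<Rightarrow> ('v \<Rightarrow> 'a) \<Rightarrow> 'v mpoly \<Rightarrow> 'a::comm_ring_1" where
  "subst h x f = (\<Sum>m\<in>Poly_Mapping.keys f. h (Poly_Mapping.lookup f m) *
     (\<Prod>v\<in>Poly_Mapping.keys m. x v ^ Poly_Mapping.lookup m v))"

definition peval :: "'v::finite mpoly \<Rightarrow> complex^'v \<Rightarrow> complex" where
  "peval f z = subst id (($) z) f"

definition homogeneous :: "'v mpoly \<Rightarrow> bool" where
  "homogeneous f \<longleftrightarrow> (\<exists>d. \<forall>m\<in>Poly_Mapping.keys f.
     (\<Sum>v\<in>Poly_Mapping.keys m. Poly_Mapping.lookup m v) = d)"

abbreviation poly_ideal :: "'v mpoly set \<Rightarrow> bool" where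
  "poly_ideal J \<equiv> ideal J ring_of_type_algebra"

abbreviation ideal_gen :: "'v mpoly set \<Rightarrow> 'v mpoly set" where
  "ideal_gen S \<equiv> genideal ring_of_type_algebra S"

definition zeros :: "'v::finite mpoly set \<Rightarrow> (complex^'v) set" where
  "zeros J = {z. \<forall>f\<in>J. peval f z = 0}"

definition vanishing_ideal :: "(complex^'v::finite) set \<Rightarrow> 'v mpoly set" where
  "vanishing_ideal S = {f. \<forall>z\<in>S. peval f z = 0}"

section \<open>Schemes of finite type given by affine charts\<close>

text \<open>A chart \<open>(J, W)\<close> stands for the open subscheme, with set of closed points \<open>W\<close>, of
  \<open>Spec \<complex>[v]/J\<close>; here \<open>W\<close> is Zariski open in \<open>zeros J\<close>, and \<open>J\<close> need not be radical. A scheme is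
  represented by the set of the charts of an open cover.\<close>

type_synonym 'v chart = "'v mpoly set \<times> (complex^'v) set"

text \<open>The Krull dimension of the local ring at \<open>z\<close>: its primes are the primes of
  the polynomial ring which lie between \<open>J\<close> and the maximal ideal of \<open>z\<close>.\<close>

definition local_krull_dim :: "'v::finite mpoly set \<Rightarrow> complex^'v \<Rightarrow> enat" where
  "local_krull_dim J z = Sup {enat l | l. \<exists>P :: nat \<Rightarrow> 'v mpoly set.
     (\<forall>i\<le>l. primeideal (P i) ring_of_type_algebra \<and> J \<subseteq> P i \<and> P i \<subseteq> vanishing_ideal {z}) \<and>
     (\<forall>i<l. P i \<subset> P (Suc i))}"

text \<open>The Zariski tangent space at \<open>z\<close>: the linear term of \<open>f(z + \<epsilon>w)\<close> is \<open>df\<^sub>z(w)\<close>.\<close>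

definition tangent_space :: "'v::finite mpoly set \<Rightarrow> complex^'v \<Rightarrow> (complex^'v) set" where
  "tangent_space J z = {w. \<forall>f\<in>J.
     Polynomial.coeff (subst (\<lambda>c. [:c:]) (\<lambda>v. [:z $ v, w $ v:]) f) 1 = 0}"

text \<open>Over \<open>\<complex>\<close>, smooth of dimension \<open>d\<close> means that all local rings at closed points are regular
  of dimension \<open>d\<close>. The empty scheme is smooth of every dimension, including the negative ones.\<close>

definition smooth_of_dim :: "'v::finite chart set \<Rightarrow> int \<Rightarrow> bool" where
  "smooth_of_dim S d \<longleftrightarrow> (\<forall>(J, W)\<in>S. \<forall>z\<in>W.
     int (vec.dim (tangent_space J z)) = d \<and> local_krull_dim J z = enat (nat d))"

section \<open>Projective space and its quasi-projective subvarieties\<close>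

text \<open>The points of the projective space of \<open>\<complex>\<^sup>m\<close> are the one-dimensional subspaces of \<open>\<complex>\<^sup>m\<close>.\<close>

definition proj_space :: "(complex^'m::finite) set set" where
  "proj_space = {vec.span {x} | x. x \<noteq> 0}"

definition zariski :: "(complex^'m::finite) set topology" where
  "zariski = topology_generated_by
     {{P \<in> proj_space. \<exists>x\<in>P. peval F x \<noteq> 0} | F. homogeneous F}"

definition quasi_projective :: "(complex^'m::finite) set set \<Rightarrow> bool" where
  "quasi_projective X \<longleftrightarrow> (\<exists>U C. openin zariski U \<and> closedin zariski C \<and> X = U \<inter> C)"

definition vanishing_forms :: "(complex^'m::finite) set set \<Rightarrow> 'm mpoly set" where
  "vanishing_forms X = {F. homogeneous F \<and> (\<forall>P\<in>X. \<forall>x\<in>P. peval F x = 0)}"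

text \<open>The open set where the linear form \<open>\<xi>\<close> does not vanish is identified with the affine
  hyperplane \<open>\<xi> = 1\<close>; \<open>X\<close> carries its reduced structure.\<close>

definition variety_charts :: "(complex^'m::finite) set set \<Rightarrow> 'm chart set" where
  "variety_charts X = {(vanishing_ideal W, W) | W \<xi>.
     W = {x. (\<Sum>l\<in>UNIV. \<xi> $ l * x $ l) = 1 \<and> vec.span {x} \<in> X}}"

section \<open>The ordered aligned Hilbert scheme\<close>

text \<open>Charts of the \<open>r\<close>-fold fibre product of the incidence variety over the Grassmannian
  of lines. Let \<open>\<xi>\<close>, \<open>\<eta>\<close> be linear forms. Each line
  on which \<open>(\<xi>, \<eta>)\<close> restricts to a pair of coordinates is spanned by a unique pair \<open>a\<close>, \<open>b\<close> with
  \<open>\<xi>(a) = \<eta>(b) = 1\<close> and \<open>\<eta>(a) = \<xi>(b) = 0\<close>, and a point \<open>x\<^sub>q\<close> of the line with \<open>\<xi>(x\<^sub>q) \<noteq> 0\<close> is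
  uniquely of the form \<open>a + u\<^sub>q b\<close>. So the tuples \<open>(a, b, u)\<close> subject to these
  four affine linear equations form a chart (empty if \<open>\<xi>\<close>, \<open>\<eta>\<close> are dependent). Every \<open>(L, x\<^sub>1, \<dots>, x\<^sub>r)\<close>
  lies in such a chart, as \<open>\<xi>\<close> can be chosen not to vanish at finitely many given points.\<close>

type_synonym ('m, 'r) inc_var = "'m + 'm + 'r"

abbreviation a_var :: "'m \<Rightarrow> ('m, 'r) inc_var" where "a_var l \<equiv> Inl l"
abbreviation b_var :: "'m \<Rightarrow> ('m, 'r) inc_var" where "b_var l \<equiv> Inr (Inl l)"
abbreviation u_var :: "'r \<Rightarrow> ('m, 'r) inc_var" where "u_var q \<equiv> Inr (Inr q)"

definition frame_equations ::
    "complex^'m::finite \<Rightarrow> complex^'m \<Rightarrow> ('m, 'r) inc_var mpoly set" where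
  "frame_equations \<xi> \<eta> =
     {(\<Sum>l\<in>UNIV. Const (\<xi> $ l) * Var (a_var l)) - 1, (\<Sum>l\<in>UNIV. Const (\<eta> $ l) * Var (a_var l)),
      (\<Sum>l\<in>UNIV. Const (\<xi> $ l) * Var (b_var l)), (\<Sum>l\<in>UNIV. Const (\<eta> $ l) * Var (b_var l)) - 1}"

text \<open>The restriction of a form to the universal line \<open>t \<mapsto> a + t b\<close>, and the local equation of
  the universal divisor \<open>Z = \<Sum>\<^sub>q k\<^sub>q x\<^sub>q\<close> on it.\<close>

definition restrict_to_line :: "'m mpoly \<Rightarrow> ('m, 'r) inc_var mpoly poly" where
  "restrict_to_line F = subst (\<lambda>c. [:Const c:]) (\<lambda>l. [:Var (a_var l), Var (b_var l):]) F"

definition divisor_equation :: "('r::finite \<Rightarrow> nat) \<Rightarrow> ('m, 'r) inc_var mpoly poly" where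
  "divisor_equation k = (\<Prod>q\<in>UNIV. [:- Var (u_var q), 1:] ^ k q)"

text \<open>Over the closed subscheme with ideal \<open>J\<close>, the divisor \<open>Z\<close> is contained in the closure of
  \<open>X\<close>: modulo \<open>J\<close>, the restrictions to the line of the equations of \<open>X\<close> lie in the ideal of \<open>Z\<close>.\<close>

definition divisor_contained ::
    "(complex^'m::finite) set set \<Rightarrow> ('r::finite \<Rightarrow> nat) \<Rightarrow> ('m, 'r) inc_var mpoly set \<Rightarrow> bool" where
  "divisor_contained X k J \<longleftrightarrow> (\<forall>F\<in>vanishing_forms X. \<exists>Q. \<forall>i.
     Polynomial.coeff (restrict_to_line F - divisor_equation k * Q) i \<in> J)"

text \<open>The ideal of the largest closed subscheme of the chart over which \<open>Z\<close> is contained in the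
  closure of \<open>X\<close>; it exists because \<open>divisor_equation k\<close> is monic: the ideal is
  generated by the coefficients of the remainders of division by it.\<close>

definition OH_ideal ::
    "(complex^'m::finite) set set \<Rightarrow> ('r::finite \<Rightarrow> nat) \<Rightarrow> complex^'m \<Rightarrow> complex^'m \<Rightarrow>
     ('m, 'r) inc_var mpoly set" where
  "OH_ideal X k \<xi> \<eta> =
     \<Inter>{J. poly_ideal J \<and> frame_equations \<xi> \<eta> \<subseteq> J \<and> divisor_contained X k J}"

text \<open>\<open>X\<close> is open in its closure, so containment of \<open>Z\<close> in \<open>X\<close> itself is the further open condition
  that the support of \<open>Z\<close> lies in \<open>X\<close>.\<close>

definition OH_points ::
    "(complex^'m::finite) set set \<Rightarrow> ('r::finite \<Rightarrow> nat) \<Rightarrow> complex^'m \<Rightarrow> complex^'m \<Rightarrow>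
     (complex^('m, 'r) inc_var) set" where
  "OH_points X k \<xi> \<eta> = {z \<in> zeros (OH_ideal X k \<xi> \<eta>).
     \<forall>q. vec.span {\<chi> l. z $ a_var l + z $ u_var q * z $ b_var l} \<in> X}"

definition OH ::
    "(complex^'m::finite) set set \<Rightarrow> ('r::finite \<Rightarrow> nat) \<Rightarrow> ('m, 'r) inc_var chart set" where
  "OH X k = {(OH_ideal X k \<xi> \<eta>, OH_points X k \<xi> \<eta>) | \<xi> \<eta>. True}"

section \<open>The projective line bundle and the fibres of its projection\<close>

text \<open>A further variable \<open>w = None\<close> describes the additional point \<open>a + w b\<close> of the line.
  The base change of \<open>OH X k\<close> is covered by the products of its charts with the affine \<open>w\<close>-line, since
  \<open>\<xi>\<close> can also be chosen not to vanish at the additional point.\<close>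

definition OH_bundle ::
    "(complex^'m::finite) set set \<Rightarrow> ('r::finite \<Rightarrow> nat) \<Rightarrow> ('m, 'r) inc_var option chart set" where
  "OH_bundle X k = {(ideal_gen (subst Const (\<lambda>v. Var (Some v)) ` J), {z. (\<chi> v. z $ Some v) \<in> W})
     | J W. (J, W) \<in> OH X k}"

definition theta :: "complex^(('m::finite, 'r::finite) inc_var option) \<Rightarrow> (complex^'m) set" where
  "theta z = vec.span {\<chi> l. z $ Some (a_var l) + z $ None * z $ Some (b_var l)}"

text \<open>The equations expressing that \<open>a + w b\<close> is proportional to \<open>p \<in> P\<close>.\<close>

definition theta_equations ::
    "(complex^'m::finite) set \<Rightarrow> ('m, 'r) inc_var option mpoly set" where
  "theta_equations P =
     (let y = (\<lambda>l. Var (Some (a_var l)) + Var None * Var (Some (b_var l)))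
      in {Const (p $ i) * y j - Const (p $ j) * y i | p i j. p \<in> P})"

definition theta_fibre ::
    "(complex^'m::finite) set set \<Rightarrow> ('r::finite \<Rightarrow> nat) \<Rightarrow> (complex^'m) set \<Rightarrow>
     ('m, 'r) inc_var option chart set" where
  "theta_fibre X k P = {(ideal_gen (J \<union> theta_equations P), {z \<in> W. theta z = P})
     | J W. (J, W) \<in> OH_bundle X k}"

end

theory Submission
  imports Defs
begin

text \<open>Let \<open>x(t) = a + t b\<close> be a line through the point \<open>p = a + w b\<close>, let \<open>D = \<Prod>\<^sub>q (t - u\<^sub>q)\<^bsup>k\<^sub>q\<^esup>\<close> be the
  equation of the divisor on it, and let \<open>\<tau> = t - w\<close>. The first-order deformations of the line and the divisor that
  fix \<open>p\<close> are given by a vector \<open>b'\<close> and numbers \<open>u'\<^sub>q\<close> such that \<open>D\<close> divides \<open>\<tau> dF\<^sub>x(b') - D' F(x)/D\<close> for all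
  equations \<open>F\<close> of \<open>X\<close>, where \<open>D'\<close> is the derivative of \<open>D\<close> in the direction \<open>u'\<close>. As \<open>X\<close> is smooth, \<open>c\<close> equations
  with independent differentials along the divisor suffice, which makes \<open>k c\<close> linear conditions. The vectors \<open>s(t)\<close>
  of velocities of \<open>x(t)\<close> that preserve the equations form a \<open>\<complex>[t]\<close>-module \<open>N\<close> which contains \<open>D \<complex>[t]\<^sup>m\<close>.
  At a generic point of the bundle, by generic smoothness, \<open>p\<close> moves in all directions, so every constant vector
  lies in \<open>N + \<tau> \<complex>\<^sup>m\<close>; by an argument of Nakayama type the same holds for every vector of polynomials. Hence the
  \<open>k c\<close> conditions are independent at a generic point, and then over a general \<open>p\<close>.

  So a general fibre is defined near each of its points by as many equations as the codimension of its tangent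
  space. Regularity follows by comparing the ideal with the ideal of all formal arcs on which these equations vanish,
  by means of Krull's intersection theorem. The \<open>c\<close> local equations control all others, since \<open>D\<close> divides \<open>F\<close> if it
  divides multiples \<open>G\<^sub>q F\<close> such that \<open>G\<^sub>q\<close> does not vanish at \<open>x\<^sub>q\<close>.\<close>

section \<open>Polynomials as functions\<close>

text \<open>The scheme of aligned divisors may be singular, non-reduced or too large, so it is not
  studied as a whole: the proof shows that the points of the bundle where the dimension bound fails
  do not dominate projective space. All relevant equations have coefficients in a countable ring
  \<open>K\<close>. If the bad points did dominate, there would be a complex point satisfying every
  relation over \<open>K\<close> that holds on all of them, with tangent vectors that map onto all
  directions of the target. It exists because countably many nonzero polynomials cannot exclude
  every complex number as the value of a transcendental, and because derivations extend through
  algebraic steps in characteristic zero. The bound holds there, hence by semicontinuity of rank at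
  some bad point, a contradiction. The same construction at a prime with a chain above it bounds
  Krull dimensions from above. The count: the pair (b', u') has (N + 1) + r coordinates, the divisor
  imposes k c conditions, and 2 dimensions come from moving \<open>a\<close> and \<open>b\<close>
  within the line, which leaves N - 1 + r - k c.\<close>

definition rhom :: "('a::comm_ring_1 \<Rightarrow> 'b::comm_ring_1) \<Rightarrow> bool" where
  "rhom h \<longleftrightarrow> h 1 = 1 \<and> (\<forall>x y. h (x + y) = h x + h y) \<and> (\<forall>x y. h (x * y) = h x * h y)"

lemma rhomD:
  assumes "rhom h"
  shows rhom_1: "h 1 = 1" and rhom_add: "h (x + y) = h x + h y"
    and rhom_mult: "h (x * y) = h x * h y" and rhom_0: "h 0 = 0"
    and rhom_minus: "h (- x) = - h x" and rhom_diff: "h (x - y) = h x - h y"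
proof -
  show a: "h (x + y) = h x + h y" for x y using assms by (simp add: rhom_def)
  show "h 1 = 1" "h (x * y) = h x * h y" using assms by (simp_all add: rhom_def)
  show z: "h 0 = 0" using a[of 0 0] by simp
  show m: "h (- x) = - h x" for x using a[of x "-x"] z by (simp add: eq_neg_iff_add_eq_0 add.commute)
  show "h (x - y) = h x - h y" using a[of x "-y"] m by simp
qed

lemma rhom_sum: "rhom h \<Longrightarrow> h (sum f A) = (\<Sum>a\<in>A. h (f a))"
  by (induction A rule: infinite_finite_induct) (auto simp: rhom_0 rhom_add)

lemma rhom_prod: "rhom h \<Longrightarrow> h (prod f A) = (\<Prod>a\<in>A. h (f a))"
  by (induction A rule: infinite_finite_induct) (auto simp: rhom_1 rhom_mult)

lemma rhom_power: "rhom h \<Longrightarrow> h (x ^ n) = h x ^ n"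
  by (induction n) (auto simp: rhom_1 rhom_mult)

lemma rhom_id: "rhom id" "rhom (\<lambda>x. x)"
  by (auto simp: rhom_def)

lemma rhom_comp: "rhom g \<Longrightarrow> rhom h \<Longrightarrow> rhom (\<lambda>x. g (h x))"
  by (auto simp: rhom_def)

lemma rhom_pCons: "rhom (\<lambda>c. [:c:])"
  by (auto simp: rhom_def pCons_one)

lemma rhom_fps_const: "rhom fps_const"
  by (auto simp: rhom_def)

lemma rhom_Const: "rhom Const"
  by (auto simp: rhom_def Const_def mult_single single_add)

lemmas Const_simps = rhomD[OF rhom_Const]

abbreviation (input) mon :: "('v \<Rightarrow> 'a) \<Rightarrow> ('v \<Rightarrow>\<^sub>0 nat) \<Rightarrow> 'a::comm_ring_1" where
  "mon x m \<equiv> (\<Prod>v\<in>Poly_Mapping.keys m. x v ^ Poly_Mapping.lookup m v)"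

lemma mon_superset:
  assumes "finite A" "Poly_Mapping.keys m \<subseteq> A"
  shows "mon x m = (\<Prod>v\<in>A. x v ^ Poly_Mapping.lookup m v)"
  by (rule prod.mono_neutral_left) (use assms in \<open>auto simp: in_keys_iff\<close>)

lemma mon_add: "mon x (m + n) = mon x m * mon x n"
proof -
  let ?A = "Poly_Mapping.keys m \<union> Poly_Mapping.keys n"
  have "mon x (m + n) = (\<Prod>v\<in>?A. x v ^ Poly_Mapping.lookup (m + n) v)"
    by (rule mon_superset) (simp, rule keys_add)
  also have "\<dots> = (\<Prod>v\<in>?A. x v ^ Poly_Mapping.lookup m v) * (\<Prod>v\<in>?A. x v ^ Poly_Mapping.lookup n v)"
    by (simp add: lookup_add power_add prod.distrib)
  also have "\<dots> = mon x m * mon x n"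
    by (subst (1 2) mon_superset[of ?A]) auto
  finally show ?thesis .
qed

lemma poly_mapping_sum_single:
  fixes f :: "'a \<Rightarrow>\<^sub>0 'b::comm_monoid_add"
  shows "f = (\<Sum>m\<in>Poly_Mapping.keys f. Poly_Mapping.single m (Poly_Mapping.lookup f m))"
proof (rule poly_mapping_eqI)
  fix k
  have "(\<Sum>m\<in>Poly_Mapping.keys f. Poly_Mapping.lookup (Poly_Mapping.single m (Poly_Mapping.lookup f m)) k)
      = (\<Sum>m\<in>Poly_Mapping.keys f. if m = k then Poly_Mapping.lookup f k else 0)"
    by (intro sum.cong) (auto simp: lookup_single when_def)
  then show "Poly_Mapping.lookup f k = Poly_Mapping.lookup (\<Sum>m\<in>Poly_Mapping.keys f. Poly_Mapping.single m (Poly_Mapping.lookup f m)) k"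
    by (simp add: lookup_sum in_keys_iff)
qed

lemma subst_cong [cong]:
  "h = h' \<Longrightarrow> (\<And>v. x v = x' v) \<Longrightarrow> f = f' \<Longrightarrow> subst h x f = subst h' x' f'"
  by (simp add: subst_def)

lemma subst_superset:
  assumes "finite A" "Poly_Mapping.keys f \<subseteq> A" "rhom h"
  shows "subst h x f = (\<Sum>m\<in>A. h (Poly_Mapping.lookup f m) * mon x m)"
  unfolding subst_def
  by (rule sum.mono_neutral_left) (use assms in \<open>auto simp: in_keys_iff rhom_0\<close>)

lemma subst_single: "rhom h \<Longrightarrow> subst h x (Poly_Mapping.single m c) = h c * mon x m"
  by (subst subst_superset[of "{m}"]) (auto simp: )

lemma subst_add: assumes "rhom h" shows "subst h x (f + g) = subst h x f + subst h x g"
proof -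
  let ?A = "Poly_Mapping.keys f \<union> Poly_Mapping.keys g"
  have "subst h x (f + g) = (\<Sum>m\<in>?A. h (Poly_Mapping.lookup (f + g) m) * mon x m)"
    by (rule subst_superset) (simp, rule keys_add, rule assms)
  also have "\<dots> = (\<Sum>m\<in>?A. h (Poly_Mapping.lookup f m) * mon x m) + (\<Sum>m\<in>?A. h (Poly_Mapping.lookup g m) * mon x m)"
    by (simp add: lookup_add rhom_add[OF assms] algebra_simps sum.distrib)
  also have "\<dots> = subst h x f + subst h x g"
    by (subst (1 2) subst_superset[of ?A]) (use assms in auto)
  finally show ?thesis .
qed

lemma subst_0: "subst h x 0 = 0"
  by (simp add: subst_def)

lemma subst_sum: "rhom h \<Longrightarrow> subst h x (sum f A) = (\<Sum>a\<in>A. subst h x (f a))"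
  by (induction A rule: infinite_finite_induct) (auto simp: subst_add subst_0)

lemma subst_mult: assumes "rhom h" shows "subst h x (f * g) = subst h x f * subst h x g"
proof -
  let ?s = "\<lambda>f m. Poly_Mapping.single m (Poly_Mapping.lookup f m)"
  have "subst h x (f * g) = subst h x ((\<Sum>m\<in>Poly_Mapping.keys f. ?s f m) * (\<Sum>m\<in>Poly_Mapping.keys g. ?s g m))"
    by (simp flip: poly_mapping_sum_single)
  also have "\<dots> = (\<Sum>m\<in>Poly_Mapping.keys f. \<Sum>n\<in>Poly_Mapping.keys g. subst h x (?s f m) * subst h x (?s g n))"
    by (simp add: sum_product subst_sum[OF assms] mult_single subst_single[OF assms] mon_add
        rhom_mult[OF assms] algebra_simps)
  also have "\<dots> = subst h x (\<Sum>m\<in>Poly_Mapping.keys f. ?s f m) * subst h x (\<Sum>m\<in>Poly_Mapping.keys g. ?s g m)"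
    by (simp add: sum_product subst_sum[OF assms])
  finally show ?thesis by (simp flip: poly_mapping_sum_single)
qed

lemma subst_Const: "rhom h \<Longrightarrow> subst h x (Const c) = h c"
  by (simp add: Const_def subst_single)

lemma subst_Var: "rhom h \<Longrightarrow> subst h x (Var v) = x v"
  by (simp add: Var_def subst_single rhom_1)

lemma subst_1: "rhom h \<Longrightarrow> subst h x 1 = 1"
  using subst_Const[of h x 1] by (simp add: Const_simps rhom_1)

lemma rhom_subst: "rhom h \<Longrightarrow> rhom (subst h x)"
  by (auto simp: rhom_def[of "subst h x"] subst_add subst_mult subst_1)

lemmas subst_hom = rhomD[OF rhom_subst] rhom_sum[OF rhom_subst] rhom_prod[OF rhom_subst] rhom_power[OF rhom_subst]

lemma Const_mon: "Const c * mon Var m = Poly_Mapping.single m c"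
proof -
  have 1: "Var v ^ n = (Poly_Mapping.single (Poly_Mapping.single v n) 1 :: 'v mpoly)" for v :: 'v and n
    by (induction n) (auto simp: Var_def mult_single simp flip: single_add)
  have 2: "(\<Prod>v\<in>A. (Poly_Mapping.single (f v) 1 :: 'v mpoly)) = Poly_Mapping.single (sum f A) 1" 
    for A :: "'v set" and f
    by (induction A rule: infinite_finite_induct) (auto simp: mult_single)
  have "mon Var m = (Poly_Mapping.single m 1 :: 'v mpoly)" for m :: "'v \<Rightarrow>\<^sub>0 nat"
    by (simp add: 1 2 flip: poly_mapping_sum_single)
  from this[of m] show ?thesis by (simp only: Const_def mult_single) simp
qed

lemma mpoly_eq_sum: "f = (\<Sum>m\<in>Poly_Mapping.keys f. Const (Poly_Mapping.lookup f m) * mon Var m)"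
  by (simp add: Const_mon flip: poly_mapping_sum_single)

text \<open>A polynomial is a finite sum of products of constants and variables. Identities between
  homomorphisms or derivations are reduced to these generators by this rule.\<close>

lemma mpoly_induct [case_names Const Var add mult]:
  fixes f :: "'v mpoly"
  assumes C: "\<And>c. P (Const c)" and V: "\<And>v. P (Var v)"
    and A: "\<And>f g. P f \<Longrightarrow> P g \<Longrightarrow> P (f + g)" and M: "\<And>f g. P f \<Longrightarrow> P g \<Longrightarrow> P (f * g)"
  shows "P f"
proof -
  have 0: "P 0" and 1: "P 1" using C[of 0] C[of 1] by (simp_all add: Const_simps)
  have P: "P (prod f A)" if "\<And>a. P (f a)" for f :: "'a \<Rightarrow> 'v mpoly" and A
    using that by (induction A rule: infinite_finite_induct) (auto intro: 1 M)
  have E: "P (f ^ n)" if "P f" for f n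
    using that by (induction n) (auto intro: 1 M)
  have S: "P (sum f A)" if "\<And>a. P (f a)" for f :: "'a \<Rightarrow> 'v mpoly" and A
    using that by (induction A rule: infinite_finite_induct) (auto intro: 0 A)
  show ?thesis
    by (subst mpoly_eq_sum) (intro S M P E C V)
qed

lemma rhom_eqI:
  assumes "rhom g" "rhom h" "\<And>c. g (Const c) = h (Const c)" "\<And>v. g (Var v) = h (Var v)"
  shows "g f = h f"
  by (induction f rule: mpoly_induct) (use assms in \<open>auto simp: rhom_add rhom_mult\<close>)

text \<open>Both sides are homomorphisms in \<open>f\<close> that agree on constants and variables.
  With it evaluations, truncations and changes of coefficients pass through a substitution.\<close>

lemma rhom_subst_comp:
  assumes "rhom g" "rhom h"
  shows "g (subst h x f) = subst (\<lambda>c. g (h c)) (\<lambda>v. g (x v)) f"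
proof -
  note gh = rhom_comp[OF assms]
  show ?thesis
    by (rule rhom_eqI[OF rhom_comp[OF assms(1) rhom_subst[OF assms(2)]] rhom_subst[OF gh]])
      (simp_all add: subst_Const subst_Var assms gh)
qed

lemma subst_Const_Var: "subst Const Var f = f"
  by (rule rhom_eqI[of "subst Const Var" "\<lambda>x. x"]) (auto simp: subst_Const subst_Var rhom_Const rhom_id rhom_subst)

lemma rhom_peval: "rhom (\<lambda>f. peval f z)"
  unfolding peval_def by (rule rhom_subst) (rule rhom_id)

lemmas peval_hom = rhomD[OF rhom_peval] rhom_sum[OF rhom_peval] rhom_prod[OF rhom_peval] rhom_power[OF rhom_peval]

lemma peval_Const [simp]: "peval (Const c) z = c"
  by (simp add: peval_def subst_Const rhom_id)

lemma peval_Var [simp]: "peval (Var v) z = z $ v"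
  by (simp add: peval_def subst_Var rhom_id)

lemma peval_subst_Const: "peval (subst Const x f) z = peval f (\<chi> v. peval (x v) z)"
  by (subst rhom_subst_comp[OF rhom_peval rhom_Const]) (simp add: peval_def[of f] id_def)

lemma rhom_poly: "rhom (\<lambda>p. poly p a)"
  by (auto simp: rhom_def)

lemma rhom_coeff_0: "rhom (\<lambda>p. Polynomial.coeff p 0)"
  by (auto simp: rhom_def coeff_mult)

lemma rhom_map_poly: assumes "rhom h" shows "rhom (map_poly h)"
proof -
  have [simp]: "h 0 = 0" using assms by (rule rhom_0)
  show ?thesis unfolding rhom_def
    by (auto simp: poly_eq_iff coeff_map_poly coeff_mult rhom_add[OF assms] rhom_mult[OF assms]
        rhom_sum[OF assms] rhom_1[OF assms])
qed

lemma line_poly: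
  obtains q :: "complex poly" where "\<And>t. poly q t = peval f (a + t *s b)"
proof
  fix t
  show "poly (subst (\<lambda>c. [:c:]) (\<lambda>v. [:a $ v, b $ v:]) f) t = peval f (a + t *s b)"
    by (subst rhom_subst_comp[OF rhom_poly rhom_pCons]) (simp add: peval_def id_def)
qed

text \<open>Induction on the set of variables that occur: some coefficient with respect to the
  variable \<open>v\<close> is nonzero at a point \<open>x\<close> of the remaining variables, and
  then a value of \<open>v\<close> avoids the finitely many roots of the resulting polynomial in one
  variable.\<close>

lemma peval_nonzero_exists:
  assumes "f \<noteq> 0" obtains z where "peval f z \<noteq> 0"
proof -
  have "\<exists>x. subst id x f \<noteq> 0" if "f \<noteq> 0" "finite A" "\<And>m. m \<in> Poly_Mapping.keys f \<Longrightarrow> Poly_Mapping.keys m \<subseteq> A" 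
    for A and f :: "'a mpoly"
    using that(2,1,3)
  proof (induction A arbitrary: f rule: finite_induct)
    case empty
    then have "f = Poly_Mapping.single 0 (Poly_Mapping.lookup f 0)"
      by (intro poly_mapping_eqI) (auto simp: lookup_single when_def in_keys_iff)
    then have "subst id x f = Poly_Mapping.lookup f 0" "Poly_Mapping.lookup f 0 \<noteq> 0" for x
      using empty.prems(1) subst_single[of id x 0 "Poly_Mapping.lookup f 0"] by (auto simp: rhom_id)
    then show ?case by metis
  next
    case (insert v A)
    \<comment> \<open>The coefficient of the i-th power of \<open>v\<close>;
      \<open>Poly_Mapping.update v 0\<close> deletes that power from a monomial.\<close>
    define g where "g i = (\<Sum>m | m \<in> Poly_Mapping.keys f \<and> Poly_Mapping.lookup m v = i.
        Poly_Mapping.single (Poly_Mapping.update v 0 m) (Poly_Mapping.lookup f m))" for i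
    have inj: "m = m'" if "Poly_Mapping.lookup m v = Poly_Mapping.lookup m' v"
      "Poly_Mapping.update v 0 m = Poly_Mapping.update v 0 m'" for m m' :: "'a \<Rightarrow>\<^sub>0 nat"
    proof (rule poly_mapping_eqI)
      fix k show "Poly_Mapping.lookup m k = Poly_Mapping.lookup m' k"
        using that(1) arg_cong[OF that(2), of "\<lambda>p. Poly_Mapping.lookup p k"]
        by (cases "k = v") (simp_all add: lookup_update)
    qed
    have lg: "Poly_Mapping.lookup (g i) (Poly_Mapping.update v 0 m) = Poly_Mapping.lookup f m" 
      if "Poly_Mapping.lookup m v = i" for m i
    proof -
      have "Poly_Mapping.lookup (g i) (Poly_Mapping.update v 0 m) = 
        (\<Sum>m' | m' \<in> Poly_Mapping.keys f \<and> Poly_Mapping.lookup m' v = i.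
          if m' = m then Poly_Mapping.lookup f m else 0)"
        unfolding g_def lookup_sum
        by (intro sum.cong refl) (use inj that in \<open>auto simp: lookup_single when_def\<close>)
      also have "\<dots> = Poly_Mapping.lookup f m"
        using that by (auto simp: in_keys_iff)
      finally show ?thesis .
    qed
    have kg: "Poly_Mapping.keys m \<subseteq> A" if "m \<in> Poly_Mapping.keys (g i)" for i m
    proof -
      have "m \<in> (\<Union>m'\<in>{m' \<in> Poly_Mapping.keys f. Poly_Mapping.lookup m' v = i}. {Poly_Mapping.update v 0 m'})"
        using that keys_sum[of "\<lambda>m. Poly_Mapping.single (Poly_Mapping.update v 0 m) (Poly_Mapping.lookup f m)"
            "{m' \<in> Poly_Mapping.keys f. Poly_Mapping.lookup m' v = i}"]
        unfolding g_def by (auto split: if_splits)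
      then show ?thesis using insert.prems(2) by (fastforce simp: keys_update)
    qed
    obtain m0 where m0: "m0 \<in> Poly_Mapping.keys f" using insert.prems(1) by (metis ex_in_conv keys_eq_empty)
    define i0 where "i0 = Poly_Mapping.lookup m0 v"
    have "g i0 \<noteq> 0" using lg[of m0 i0] m0 by (auto simp: i0_def in_keys_iff)
    then obtain x where x: "subst id x (g i0) \<noteq> 0" using insert.IH kg by blast
    define I where "I = (\<lambda>m. Poly_Mapping.lookup m v) ` Poly_Mapping.keys f"
    define q where "q = (\<Sum>i\<in>I. Polynomial.monom (subst id x (g i)) i)"
    have "finite I" "i0 \<in> I" using m0 by (auto simp: I_def i0_def)
    then have "Polynomial.coeff q i0 = subst id x (g i0)"
      by (auto simp: q_def coeff_sum if_distrib cong: if_cong)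
    then have "q \<noteq> 0" using x by auto
    then obtain t where t: "poly q t \<noteq> 0" using poly_all_0_iff_0 by blast
    have monv: "mon (x(v := t)) m = t ^ Poly_Mapping.lookup m v * mon x (Poly_Mapping.update v 0 m)" 
      if "m \<in> Poly_Mapping.keys f" for m
    proof -
      have "mon (x(v := t)) m = (\<Prod>u\<in>insert v A. (x(v := t)) u ^ Poly_Mapping.lookup m u)"
        by (rule mon_superset) (use insert that in auto)
      also have "\<dots> = t ^ Poly_Mapping.lookup m v * (\<Prod>u\<in>A. x u ^ Poly_Mapping.lookup m u)"
      proof -
        have "(\<Prod>u\<in>A. (x(v := t)) u ^ Poly_Mapping.lookup m u) = (\<Prod>u\<in>A. x u ^ Poly_Mapping.lookup m u)"
          by (rule prod.cong) (use insert.hyps in auto)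
        then show ?thesis using insert.hyps by simp
      qed
      also have "(\<Prod>u\<in>A. x u ^ Poly_Mapping.lookup m u) = (\<Prod>u\<in>A. x u ^ Poly_Mapping.lookup (Poly_Mapping.update v 0 m) u)"
        by (intro prod.cong) (use insert.hyps in \<open>auto simp: lookup_update\<close>)
      also have "\<dots> = mon x (Poly_Mapping.update v 0 m)"
        by (rule mon_superset[symmetric]) (use insert that in \<open>auto simp: keys_update\<close>)
      finally show ?thesis .
    qed
    have "subst id (x(v := t)) f = (\<Sum>m\<in>Poly_Mapping.keys f. Poly_Mapping.lookup f m * (t ^ Poly_Mapping.lookup m v * mon x (Poly_Mapping.update v 0 m)))"
      unfolding subst_def by (intro sum.cong refl) (simp only: monv id_apply)
    also have "\<dots> = (\<Sum>i\<in>I. \<Sum>m | m \<in> Poly_Mapping.keys f \<and> Poly_Mapping.lookup m v = i. Poly_Mapping.lookup f m * (t ^ Poly_Mapping.lookup m v * mon x (Poly_Mapping.update v 0 m)))"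
      unfolding I_def by (rule sum.image_gen) simp
    also have "\<dots> = poly q t"
      unfolding q_def poly_sum poly_monom
      by (intro sum.cong refl) (simp add: g_def subst_sum subst_single rhom_id sum_distrib_left algebra_simps)
    finally show ?case using t by metis
  qed
  from this[OF assms, of UNIV] obtain x where "subst id x f \<noteq> 0" by auto
  then have "peval f (\<chi> v. x v) \<noteq> 0" by (simp add: peval_def id_def)
  then show ?thesis by (rule that)
qed


section \<open>Directional and partial derivatives\<close>

lemma coeff_mult_1: "Polynomial.coeff (p * q) (Suc 0) =
    Polynomial.coeff p 0 * Polynomial.coeff q (Suc 0) + Polynomial.coeff p (Suc 0) * Polynomial.coeff q 0"
  by (simp add: coeff_mult)

text \<open>The derivative at \<open>z\<close> in the direction \<open>w\<close>, written exactly as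
  in \<open>tangent_space\<close>. Its analogue \<open>pd\<close> shifts one variable only and keeps
  a polynomial as value.\<close>

definition dd :: "complex^'v \<Rightarrow> complex^'v \<Rightarrow> 'v mpoly \<Rightarrow> complex" where
  "dd z w f = Polynomial.coeff (subst (\<lambda>c. [:c:]) (\<lambda>v. [:z $ v, w $ v:]) f) 1"

definition pd :: "'v \<Rightarrow> 'v mpoly \<Rightarrow> 'v mpoly" where
  "pd v f = Polynomial.coeff (subst (\<lambda>c. [:Const c:]) (\<lambda>u. [:Var u, if u = v then 1 else 0:]) f) 1"

lemma tangent_space_dd: "tangent_space J z = {w. \<forall>f\<in>J. dd z w f = 0}"
  by (simp add: tangent_space_def dd_def)

lemma rhom_pCons_Const: "rhom (\<lambda>c. [:Const c:])"
  by (rule rhom_comp[OF rhom_pCons rhom_Const])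

lemma pd_simps [simp]:
  "pd v (Const c) = 0" "pd v (Var u) = (if u = v then 1 else 0)"
  "pd v (f + g) = pd v f + pd v g" "pd v (f * g) = f * pd v g + pd v f * g"
proof -
  have 0: "Polynomial.coeff (subst (\<lambda>c. [:Const c:]) (\<lambda>u. [:Var u, if u = v then 1 else 0:]) f) 0 = f" for f
    by (subst rhom_subst_comp[OF rhom_coeff_0 rhom_pCons_Const]) (simp add: subst_Const_Var)
  show "pd v (f * g) = f * pd v g + pd v f * g"
    using 0 by (simp add: pd_def subst_mult[OF rhom_pCons_Const] coeff_mult_1)
qed (auto simp: pd_def subst_Const[OF rhom_pCons_Const] subst_Var[OF rhom_pCons_Const] subst_add[OF rhom_pCons_Const])

lemma coeff_0_subst_line:
  assumes "rhom h"
  shows "Polynomial.coeff (subst (\<lambda>c. [:h c:]) (\<lambda>v. [:x v, s v:]) f) 0 = subst h x f"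
  by (subst rhom_subst_comp[OF rhom_coeff_0 rhom_comp[OF rhom_pCons assms]]) simp

text \<open>The algebra that receives the coefficients is arbitrary because Euler's relation is
  later derived from this rule over a polynomial ring.\<close>

lemma chain_rule:
  fixes f :: "'v::finite mpoly"
  assumes "rhom h"
  shows "Polynomial.coeff (subst (\<lambda>c. [:h c:]) (\<lambda>v. [:x v, s v:]) f) 1 = (\<Sum>v\<in>UNIV. subst h x (pd v f) * s v)"
proof -
  note hp = rhom_comp[OF rhom_pCons assms] and c0 = coeff_0_subst_line[OF assms]
  note [simp] = subst_hom[OF assms] subst_Const[OF assms] subst_Var[OF assms]
  show ?thesis
  proof (induction f rule: mpoly_induct)
    case (mult f g)
    then show ?case
      by (simp add: subst_mult[OF hp] coeff_mult_1 c0 algebra_simps sum.distrib sum_distrib_left)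
  qed (simp_all add: subst_Const[OF hp] subst_Var[OF hp] subst_add[OF hp] algebra_simps sum.distrib
         if_distrib[of "subst h x"] if_distrib[of "\<lambda>a. _ * a"] cong: if_cong)
qed

lemma dd_pd: "dd z w f = (\<Sum>v\<in>UNIV. peval (pd v f) z * w $ v)"
  using chain_rule[OF rhom_id(2), of "($) z" "($) w" f] by (simp add: dd_def peval_def id_def)

lemma dd_simps [simp]:
  "dd z w (Const c) = 0" "dd z w (Var u) = w $ u"
  "dd z w (f + g) = dd z w f + dd z w g" "dd z w (f * g) = peval f z * dd z w g + dd z w f * peval g z"
  by (simp_all add: dd_pd peval_hom algebra_simps sum.distrib sum_distrib_left
      if_distrib[of "\<lambda>f. peval f z"] if_distrib[of "\<lambda>a. _ * a"] cong: if_cong)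

lemma dd_0 [simp]: "dd z w 0 = 0" "dd z w 1 = 0"
  using dd_simps(1)[of z w 0] dd_simps(1)[of z w 1] by (simp_all add: Const_simps)

lemma dd_minus [simp]: "dd z w (- f) = - dd z w f"
  using dd_simps(3)[of z w f "-f"] by (simp add: eq_neg_iff_add_eq_0 add.commute)

lemma dd_diff [simp]: "dd z w (f - g) = dd z w f - dd z w g"
  using dd_simps(3)[of z w f "-g"] by simp

lemma dd_sum: "dd z w (sum f A) = (\<Sum>a\<in>A. dd z w (f a))"
  by (induction A rule: infinite_finite_induct) auto

lemma dd_lin: "dd z (w + w') f = dd z w f + dd z w' f" "dd z (c *s w) f = c * dd z w f"
  by (simp_all add: dd_pd algebra_simps sum.distrib sum_distrib_left)

section \<open>Subrings\<close>

text \<open>Subrings are sets, not types: the domain of a generic point grows step by step inside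
  one fixed polynomial ring.\<close>

definition srng :: "'a::comm_ring_1 set \<Rightarrow> bool" where
  "srng B \<longleftrightarrow> 1 \<in> B \<and> (\<forall>x\<in>B. - x \<in> B) \<and> (\<forall>x\<in>B. \<forall>y\<in>B. x + y \<in> B \<and> x * y \<in> B)"

lemma srngD:
  assumes "srng B"
  shows srng_1: "1 \<in> B" and srng_add: "x \<in> B \<Longrightarrow> y \<in> B \<Longrightarrow> x + y \<in> B"
    and srng_mult: "x \<in> B \<Longrightarrow> y \<in> B \<Longrightarrow> x * y \<in> B" and srng_minus: "x \<in> B \<Longrightarrow> - x \<in> B"
    and srng_diff: "x \<in> B \<Longrightarrow> y \<in> B \<Longrightarrow> x - y \<in> B" and srng_0: "0 \<in> B"
proof -
  show a: "x \<in> B \<Longrightarrow> y \<in> B \<Longrightarrow> x + y \<in> B" and m: "x \<in> B \<Longrightarrow> - x \<in> B" and o: "1 \<in> B" for x y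
    using assms by (auto simp: srng_def)
  show "x \<in> B \<Longrightarrow> y \<in> B \<Longrightarrow> x * y \<in> B" using assms by (auto simp: srng_def)
  show "x \<in> B \<Longrightarrow> y \<in> B \<Longrightarrow> x - y \<in> B" using a[OF _ m, of x y] by simp
  show "0 \<in> B" using a[OF o m[OF o]] by simp
qed

lemma srng_sum: "srng B \<Longrightarrow> (\<And>a. a \<in> A \<Longrightarrow> f a \<in> B) \<Longrightarrow> sum f A \<in> B"
  by (induction A rule: infinite_finite_induct) (auto intro: srngD)

lemma srng_prod: "srng B \<Longrightarrow> (\<And>a. a \<in> A \<Longrightarrow> f a \<in> B) \<Longrightarrow> prod f A \<in> B"
  by (induction A rule: infinite_finite_induct) (auto intro: srngD)

lemma srng_power: "srng B \<Longrightarrow> x \<in> B \<Longrightarrow> x ^ n \<in> B"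
  by (induction n) (auto intro: srngD)

inductive_set sgen :: "'a::comm_ring_1 set \<Rightarrow> 'a set" for X where
  sgen_base: "x \<in> X \<Longrightarrow> x \<in> sgen X"
| sgen_1: "1 \<in> sgen X"
| sgen_minus: "x \<in> sgen X \<Longrightarrow> - x \<in> sgen X"
| sgen_add: "x \<in> sgen X \<Longrightarrow> y \<in> sgen X \<Longrightarrow> x + y \<in> sgen X"
| sgen_mult: "x \<in> sgen X \<Longrightarrow> y \<in> sgen X \<Longrightarrow> x * y \<in> sgen X"

lemma srng_sgen: "srng (sgen X)"
  by (auto simp: srng_def intro: sgen.intros)

lemma sgen_least:
  assumes "srng B" "X \<subseteq> B" shows "sgen X \<subseteq> B"
proof
  fix x assume "x \<in> sgen X"
  then show "x \<in> B" by induction (use assms in \<open>auto intro: srngD\<close>)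
qed

lemma countable_sgen:
  assumes "countable X" shows "countable (sgen X)"
proof -
  define S where "S = rec_nat (insert 1 X) (\<lambda>_ A. A \<union> uminus ` A \<union> (\<lambda>(a, b). a + b) ` (A \<times> A) \<union> (\<lambda>(a, b). a * b) ` (A \<times> A))"
  have S0: "S 0 = insert 1 X" and SS: "S (Suc n) = S n \<union> uminus ` S n \<union> (\<lambda>(a, b). a + b) ` (S n \<times> S n) \<union> (\<lambda>(a, b). a * b) ` (S n \<times> S n)" for n
    by (simp_all add: S_def)
  have m: "S i \<subseteq> S j" if "i \<le> j" for i j
    using that by (rule lift_Suc_mono_le[rotated]) (auto simp: SS)
  have c: "countable (S n)" for n
    by (induction n) (use assms in \<open>auto simp: S0 SS\<close>)
  have "x \<in> (\<Union>n. S n)" if "x \<in> sgen X" for x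
    using that
  proof induction
    case (sgen_add x y)
    then obtain i j where "x \<in> S i" "y \<in> S j" by auto
    then have "x \<in> S (max i j)" "y \<in> S (max i j)" using m[of i "max i j"] m[of j "max i j"] by auto
    then have "x + y \<in> S (Suc (max i j))" by (auto simp: SS)
    then show ?case by blast
  next
    case (sgen_mult x y)
    then obtain i j where "x \<in> S i" "y \<in> S j" by auto
    then have "x \<in> S (max i j)" "y \<in> S (max i j)" using m[of i "max i j"] m[of j "max i j"] by auto
    then have "x * y \<in> S (Suc (max i j))" by (auto simp: SS)
    then show ?case by blast
  next
    case (sgen_minus x)
    then obtain i where "x \<in> S i" by auto
    then have "- x \<in> S (Suc i)" by (auto simp: SS)
    then show ?case by blast
  next
    case (sgen_base x)
    then have "x \<in> S 0" by (simp add: S0)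
    then show ?case by blast
  next
    case sgen_1
    have "1 \<in> S 0" by (simp add: S0)
    then show ?case by blast
  qed
  then have "sgen X \<subseteq> (\<Union>n. S n)" by blast
  then show ?thesis by (rule countable_subset) (use c in auto)
qed

section \<open>Polynomials over a subring and adjunction of an element\<close>

definition PB :: "'a::comm_ring_1 set \<Rightarrow> 'a poly set" where
  "PB B = {q. \<forall>n. Polynomial.coeff q n \<in> B}"

definition adjoin :: "'a::comm_ring_1 set \<Rightarrow> 'a \<Rightarrow> 'a set" where
  "adjoin B x = (\<lambda>q. poly q x) ` PB B"

lemma PB_D: "q \<in> PB B \<Longrightarrow> Polynomial.coeff q n \<in> B"
  by (simp add: PB_def)

lemma PB_pCons: "srng B \<Longrightarrow> pCons a q \<in> PB B \<longleftrightarrow> a \<in> B \<and> q \<in> PB B"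
  by (force simp: PB_def coeff_pCons split: nat.splits)

lemma PB_0: "srng B \<Longrightarrow> 0 \<in> PB B"
  by (auto simp: PB_def srng_0)

lemma PB_monom: "srng B \<Longrightarrow> a \<in> B \<Longrightarrow> Polynomial.monom a n \<in> PB B"
  by (auto simp: PB_def srng_0)

lemma PB_smult: "srng B \<Longrightarrow> a \<in> B \<Longrightarrow> q \<in> PB B \<Longrightarrow> Polynomial.smult a q \<in> PB B"
  by (auto simp: PB_def srng_mult)

lemma srng_PB: assumes "srng B" shows "srng (PB B)"
  using assms PB_pCons[OF assms, of 1 0] PB_0[OF assms]
  by (auto simp: srng_def[of "PB B"] one_pCons srng_1)
    (auto simp: PB_def coeff_mult srngD intro!: srng_sum)

lemma srng_adjoin: assumes "srng B" shows "srng (adjoin B x)"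
proof -
  note P = srngD[OF srng_PB[OF assms]]
  show ?thesis unfolding srng_def adjoin_def
  proof (intro conjI ballI)
    show "1 \<in> (\<lambda>q. poly q x) ` PB B" by (rule image_eqI[of _ _ 1]) (auto intro: P)
  qed (auto simp flip: poly_minus poly_add poly_mult intro!: imageI P)
qed

lemma adjoin_base: assumes "srng B" "b \<in> B" shows "b \<in> adjoin B x"
  unfolding adjoin_def by (rule image_eqI[of _ _ "[:b:]"]) (use assms in \<open>auto simp: PB_pCons PB_0\<close>)

lemma adjoin_self: assumes "srng B" shows "x \<in> adjoin B x"
  unfolding adjoin_def by (rule image_eqI[of _ _ "[:0, 1:]"]) (use assms in \<open>auto simp: PB_pCons PB_0 srngD\<close>)

lemma adjoin_least:
  assumes "srng C" "B \<subseteq> C" "x \<in> C" shows "adjoin B x \<subseteq> C"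
proof -
  have "poly q x \<in> C" if "q \<in> PB B" for q
    unfolding poly_altdef using that assms by (intro srng_sum srng_mult srng_power) (auto simp: PB_def)
  then show ?thesis by (auto simp: adjoin_def)
qed

lemma countable_PB: assumes "countable B" shows "countable (PB B)"
proof -
  have "PB B \<subseteq> Poly ` lists B"
  proof
    fix q assume "q \<in> PB B"
    then have "set (Polynomial.coeffs q) \<subseteq> B" using coeffs_nth[of q] by (auto simp: PB_def coeffs_def split: if_splits)
    then show "q \<in> Poly ` lists B" by (intro image_eqI[of _ _ "Polynomial.coeffs q"]) auto
  qed
  then show ?thesis by (rule countable_subset) (use assms in auto)
qed

lemma countable_adjoin: "countable B \<Longrightarrow> countable (adjoin B x)"
  by (simp add: adjoin_def countable_PB)

text \<open>Each step cancels the top term of \<open>q\<close> after multiplying by the leading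
  coefficient of \<open>g\<close>, which need not be invertible in \<open>B\<close>. Bounding the
  remainder by its coefficients instead of its degree also covers a constant \<open>g\<close>, where
  the remainder is zero.\<close>

lemma pseudo_division:
  assumes B: "srng B" "g \<in> PB B" and q: "q \<in> PB B"
  obtains k s r where "s \<in> PB B" "r \<in> PB B" "Polynomial.smult (Polynomial.lead_coeff g ^ k) q = g * s + r"
    "\<And>i. i \<ge> Polynomial.degree g \<Longrightarrow> Polynomial.coeff r i = 0"
proof -
  note P = srngD[OF srng_PB[OF B(1)]]
  have lg: "Polynomial.lead_coeff g \<in> B" using B by (simp add: PB_def)
  have "\<exists>k s r. s \<in> PB B \<and> r \<in> PB B \<and> Polynomial.smult (Polynomial.lead_coeff g ^ k) q = g * s + r \<and>
    (\<forall>i\<ge>Polynomial.degree g. Polynomial.coeff r i = 0)" 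
    if "\<forall>i\<ge>n. Polynomial.coeff q i = 0" "q \<in> PB B" for n q
    using that
  proof (induction n arbitrary: q)
    case 0
    then have "q = 0" by (auto simp: poly_eq_iff)
    then show ?case by (intro exI[of _ 0]) (auto simp: P)
  next
    case (Suc n)
    show ?case
    proof (cases "n < Polynomial.degree g")
      case True
      then show ?thesis using Suc.prems by (intro exI[of _ 0] exI[of _ q]) (auto simp: P)
    next
      case False
      define t where "t = Polynomial.monom (Polynomial.coeff q n) (n - Polynomial.degree g)"
      define q' where "q' = Polynomial.smult (Polynomial.lead_coeff g) q - t * g"
      have t: "t \<in> PB B" unfolding t_def using Suc.prems B by (intro PB_monom) (auto simp: PB_def)
      have "q' \<in> PB B" unfolding q'_def using Suc.prems lg t B by (intro P PB_smult) auto
      moreover have "Polynomial.coeff q' i = 0" if "i \<ge> n" for i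
      proof (cases "i = n")
        case True
        then show ?thesis using False by (simp add: q'_def t_def coeff_monom_mult mult.commute[of "Polynomial.lead_coeff g"])
      next
        case ne: False
        then have "Polynomial.coeff g (i - (n - Polynomial.degree g)) = 0"
          using False that by (intro coeff_eq_0) auto
        then show ?thesis using ne that Suc.prems(1) by (simp add: q'_def t_def coeff_monom_mult)
      qed
      ultimately obtain k s r where *: "s \<in> PB B" "r \<in> PB B" "Polynomial.smult (Polynomial.lead_coeff g ^ k) q' = g * s + r"
        "\<forall>i\<ge>Polynomial.degree g. Polynomial.coeff r i = 0" using Suc.IH by blast
      have "Polynomial.smult (Polynomial.lead_coeff g ^ Suc k) q = Polynomial.smult (Polynomial.lead_coeff g ^ k) (q' + t * g)"
        by (simp add: q'_def mult.commute)
      also have "\<dots> = g * (s + Polynomial.smult (Polynomial.lead_coeff g ^ k) t) + r"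
        by (simp add: *(3) smult_add_right algebra_simps)
      finally show ?thesis using * t lg B
        by (intro exI[of _ "Suc k"] exI[of _ "s + Polynomial.smult (Polynomial.lead_coeff g ^ k) t"] exI[of _ r])
          (auto intro!: P PB_smult srng_power)
    qed
  qed
  from this[of "Suc (Polynomial.degree q)" q] q obtain k s r where "s \<in> PB B" "r \<in> PB B"
    "Polynomial.smult (Polynomial.lead_coeff g ^ k) q = g * s + r" "\<forall>i\<ge>Polynomial.degree g. Polynomial.coeff r i = 0"
    using coeff_eq_0[of q] by (auto simp: Suc_le_eq)
  then show ?thesis using that by blast
qed

section \<open>Generic points with tangent vectors\<close>

text \<open>\<open>P\<close> may reach outside \<open>R\<close>, so that a prime of the full
  polynomial ring can stand for its trace on \<open>R\<close>.\<close>

definition prim :: "'a::comm_ring_1 set \<Rightarrow> 'a set \<Rightarrow> bool" where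
  "prim R P \<longleftrightarrow> srng R \<and> 0 \<in> P \<and> 1 \<notin> P \<and> (\<forall>x\<in>P. \<forall>y\<in>P. x + y \<in> P) \<and> (\<forall>x\<in>P. \<forall>r\<in>R. r * x \<in> P) \<and>
     (\<forall>x\<in>R. \<forall>y\<in>R. x * y \<in> P \<longrightarrow> x \<in> P \<or> y \<in> P)"

text \<open>A complex point of \<open>B\<close> modulo \<open>P\<close> that satisfies no further
  relation, with a sequence of tangent vectors at it: \<open>\<phi>\<close> is the evaluation and
  the \<open>\<delta> i\<close> are derivations along it.\<close>

definition genhom :: "'a::comm_ring_1 set \<Rightarrow> 'a set \<Rightarrow> ('a \<Rightarrow> complex) \<Rightarrow> (nat \<Rightarrow> 'a \<Rightarrow> complex) \<Rightarrow> bool" where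
  "genhom B P \<phi> \<delta> \<longleftrightarrow> \<phi> 1 = 1 \<and> (\<forall>a\<in>B. \<forall>b\<in>B. \<phi> (a + b) = \<phi> a + \<phi> b \<and> \<phi> (a * b) = \<phi> a * \<phi> b) \<and>
     (\<forall>b\<in>B. \<phi> b = 0 \<longleftrightarrow> b \<in> P) \<and>
     (\<forall>i. \<forall>a\<in>B. \<forall>b\<in>B. \<delta> i (a + b) = \<delta> i a + \<delta> i b \<and> \<delta> i (a * b) = \<phi> a * \<delta> i b + \<delta> i a * \<phi> b) \<and>
     (\<forall>i. \<forall>b\<in>B. b \<in> P \<longrightarrow> \<delta> i b = 0)"

text \<open>Transcendence of \<open>x\<close> over the fraction field of \<open>B\<close> modulo
  \<open>P\<close>, stated without forming quotients.\<close>

definition transc :: "'a::comm_ring_1 set \<Rightarrow> 'a set \<Rightarrow> 'a \<Rightarrow> bool" where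
  "transc B P x \<longleftrightarrow> (\<forall>q\<in>PB B. poly q x \<in> P \<longrightarrow> (\<forall>n. Polynomial.coeff q n \<in> P))"

context
  fixes R P B :: "'a::comm_ring_1 set" and \<phi> :: "'a \<Rightarrow> complex" and \<delta> :: "nat \<Rightarrow> 'a \<Rightarrow> complex"
  assumes P: "prim R P" and B: "srng B" "B \<subseteq> R" and gh: "genhom B P \<phi> \<delta>"
begin

lemma primD:
  shows P_0: "0 \<in> P" and P_1: "1 \<notin> P" and P_add: "x \<in> P \<Longrightarrow> y \<in> P \<Longrightarrow> x + y \<in> P"
    and P_mult: "x \<in> P \<Longrightarrow> r \<in> R \<Longrightarrow> r * x \<in> P" and P_mult': "x \<in> P \<Longrightarrow> r \<in> R \<Longrightarrow> x * r \<in> P"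
    and P_minus: "x \<in> P \<Longrightarrow> - x \<in> P"
    and P_diff: "x \<in> P \<Longrightarrow> y \<in> P \<Longrightarrow> x - y \<in> P"
    and P_prime: "x * y \<in> P \<Longrightarrow> x \<in> R \<Longrightarrow> y \<in> R \<Longrightarrow> x \<in> P \<or> y \<in> P"
proof -
  have R: "srng R" using P by (simp add: prim_def)
  show "0 \<in> P" "1 \<notin> P" "x * y \<in> P \<Longrightarrow> x \<in> R \<Longrightarrow> y \<in> R \<Longrightarrow> x \<in> P \<or> y \<in> P" for x y
    using P by (auto simp: prim_def)
  show a: "x \<in> P \<Longrightarrow> y \<in> P \<Longrightarrow> x + y \<in> P" and m: "x \<in> P \<Longrightarrow> r \<in> R \<Longrightarrow> r * x \<in> P" for x y r
    using P by (auto simp: prim_def)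
  show "x \<in> P \<Longrightarrow> r \<in> R \<Longrightarrow> x * r \<in> P" for x r using m[of x r] by (simp add: mult.commute)
  show n: "x \<in> P \<Longrightarrow> - x \<in> P" for x using m[of x "-1"] R by (simp add: srngD)
  show "x \<in> P \<Longrightarrow> y \<in> P \<Longrightarrow> x - y \<in> P" using a[OF _ n, of x y] by simp
qed

lemma P_sum: "(\<And>a. a \<in> A \<Longrightarrow> f a \<in> P) \<Longrightarrow> sum f A \<in> P"
  by (induction A rule: infinite_finite_induct) (auto intro: P_0 P_add)

lemma P_power: "x ^ n \<in> P \<Longrightarrow> x \<in> R \<Longrightarrow> x \<in> P"
proof (induction n)
  case (Suc n)
  have "x ^ n \<in> R" using P Suc.prems by (auto simp: prim_def intro: srng_power)
  then show ?case using P_prime[of x "x ^ n"] Suc by auto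
qed (use P_1 in auto)

lemma \<phi>: "\<phi> 1 = 1" "a \<in> B \<Longrightarrow> b \<in> B \<Longrightarrow> \<phi> (a + b) = \<phi> a + \<phi> b"
    "a \<in> B \<Longrightarrow> b \<in> B \<Longrightarrow> \<phi> (a * b) = \<phi> a * \<phi> b" "b \<in> B \<Longrightarrow> \<phi> b = 0 \<longleftrightarrow> b \<in> P" "\<phi> 0 = 0"
  and \<delta>: "a \<in> B \<Longrightarrow> b \<in> B \<Longrightarrow> \<delta> i (a + b) = \<delta> i a + \<delta> i b"
    "a \<in> B \<Longrightarrow> b \<in> B \<Longrightarrow> \<delta> i (a * b) = \<phi> a * \<delta> i b + \<delta> i a * \<phi> b"
    "b \<in> B \<Longrightarrow> b \<in> P \<Longrightarrow> \<delta> i b = 0" "\<delta> i 0 = 0"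
  using gh srng_0[OF B(1)] P_0 by (auto simp: genhom_def)

lemma \<phi>_sum: "(\<And>a. a \<in> A \<Longrightarrow> f a \<in> B) \<Longrightarrow> \<phi> (sum f A) = (\<Sum>a\<in>A. \<phi> (f a))"
  and \<delta>_sum: "(\<And>a. a \<in> A \<Longrightarrow> f a \<in> B) \<Longrightarrow> \<delta> i (sum f A) = (\<Sum>a\<in>A. \<delta> i (f a))"
  by (induction A rule: infinite_finite_induct) (auto simp: \<phi> \<delta> srng_sum[OF B(1)])

lemma \<phi>_power: "b \<in> B \<Longrightarrow> \<phi> (b ^ n) = \<phi> b ^ n"
  by (induction n) (auto simp: \<phi> srng_power[OF B(1)])

lemma \<phi>_minus: assumes "b \<in> B" shows "\<phi> (- b) = - \<phi> b" and \<delta>_minus: "\<delta> i (- b) = - \<delta> i b"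
  using \<phi>(2)[of b "-b"] \<delta>(1)[of b "-b" i] assms srng_minus[OF B(1)] 
  by (auto simp: \<phi>(5) \<delta>(4) eq_neg_iff_add_eq_0 add.commute)

abbreviation "M\<phi> \<equiv> map_poly \<phi>"
abbreviation "M\<delta> i \<equiv> map_poly (\<delta> i)"

lemma M_add: assumes "q \<in> PB B" "s \<in> PB B"
  shows "M\<phi> (q + s) = M\<phi> q + M\<phi> s" "M\<delta> i (q + s) = M\<delta> i q + M\<delta> i s"
  using assms by (auto simp: poly_eq_iff coeff_map_poly \<phi> \<delta> PB_D)

lemma M_mult: assumes "q \<in> PB B" "s \<in> PB B"
  shows "M\<phi> (q * s) = M\<phi> q * M\<phi> s" "M\<delta> i (q * s) = M\<phi> q * M\<delta> i s + M\<delta> i q * M\<phi> s"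
  using assms by (auto simp: poly_eq_iff coeff_map_poly coeff_mult \<phi> \<delta> PB_D \<phi>_sum \<delta>_sum srngD[OF B(1)] sum.distrib)

lemma M_P: assumes "q \<in> PB B" "\<And>n. Polynomial.coeff q n \<in> P"
  shows "M\<phi> q = 0" "M\<delta> i q = 0"
  using assms by (auto simp: poly_eq_iff coeff_map_poly \<phi> \<delta> PB_D)

lemma M\<phi>_0_iff: assumes "q \<in> PB B" shows "M\<phi> q = 0 \<longleftrightarrow> (\<forall>n. Polynomial.coeff q n \<in> P)"
  using assms by (auto simp: poly_eq_iff coeff_map_poly \<phi> PB_D)

lemma M_const: "b \<in> B \<Longrightarrow> M\<phi> [:b:] = [:\<phi> b:]" "M\<delta> i [:b:] = [:\<delta> i b:]"
  by (auto simp: map_poly_pCons \<phi> \<delta>)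

lemma poly_in_P: assumes "q \<in> PB B" "\<And>n. Polynomial.coeff q n \<in> P" "x \<in> R" shows "poly q x \<in> P"
  unfolding poly_altdef using assms P by (intro P_sum P_mult') (auto simp: prim_def srng_power)

text \<open>The two evaluations at \<open>c + d \<epsilon>\<close> of a polynomial whose coefficients are mapped to dual numbers.\<close>

definition ev0 :: "complex \<Rightarrow> 'a poly \<Rightarrow> complex" where
  "ev0 c q = poly (M\<phi> q) c"
definition ev1 :: "complex \<Rightarrow> complex \<Rightarrow> nat \<Rightarrow> 'a poly \<Rightarrow> complex" where
  "ev1 c d i q = poly (M\<delta> i q) c + d * poly (Polynomial.pderiv (M\<phi> q)) c"

lemma ev_add: assumes "q \<in> PB B" "s \<in> PB B"
  shows "ev0 c (q + s) = ev0 c q + ev0 c s" "ev1 c d i (q + s) = ev1 c d i q + ev1 c d i s"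
  using assms by (auto simp: ev0_def ev1_def M_add pderiv_add algebra_simps)

lemma ev_mult: assumes "q \<in> PB B" "s \<in> PB B"
  shows "ev0 c (q * s) = ev0 c q * ev0 c s" "ev1 c d i (q * s) = ev0 c q * ev1 c d i s + ev1 c d i q * ev0 c s"
  using assms by (auto simp: ev0_def ev1_def M_mult pderiv_mult algebra_simps)

lemma ev_P: assumes "q \<in> PB B" "\<And>n. Polynomial.coeff q n \<in> P"
  shows "ev0 c q = 0" "ev1 c d i q = 0"
  using M_P[OF assms] by (auto simp: ev0_def ev1_def)

lemma ev_const: "b \<in> B \<Longrightarrow> ev0 c [:b:] = \<phi> b" "b \<in> B \<Longrightarrow> ev1 c d i [:b:] = \<delta> i b"
  by (auto simp: ev0_def ev1_def M_const)

text \<open>A value in \<open>adjoin B x\<close> is defined through a representing polynomial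
  \<open>q\<close>. The hypotheses \<open>c\<close> and \<open>d\<close> say that the relations
  satisfied by \<open>x\<close> modulo \<open>P\<close> are respected, which makes the result
  independent of \<open>q\<close>.\<close>

lemma gen_extend:
  assumes x: "x \<in> R"
    and c: "\<And>q. q \<in> PB B \<Longrightarrow> poly q x \<in> P \<longleftrightarrow> ev0 c q = 0"
    and d: "\<And>q i. q \<in> PB B \<Longrightarrow> poly q x \<in> P \<Longrightarrow> ev1 c (d i) i q = 0"
  shows "\<exists>\<phi>' \<delta>'. genhom (adjoin B x) P \<phi>' \<delta>' \<and> (\<forall>b\<in>B. \<phi>' b = \<phi> b \<and> (\<forall>i. \<delta>' i b = \<delta> i b)) \<and>
    \<phi>' x = c \<and> (\<forall>i. \<delta>' i x = d i)"
proof -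
  note PBr = srngD[OF srng_PB[OF B(1)]]
  define rep where "rep y = (SOME q. q \<in> PB B \<and> poly q x = y)" for y
  define \<phi>' where "\<phi>' y = ev0 c (rep y)" for y
  define \<delta>' where "\<delta>' i y = ev1 c (d i) i (rep y)" for i y
  have neg: "ev0 c (- s) = - ev0 c s" "ev1 c (d i) i (- s) = - ev1 c (d i) i s" if "s \<in> PB B" for s i
    using ev_add(1)[of s "-s" c] ev_add(2)[of s "-s" c "d i" i] ev_P(1)[of 0 c] ev_P(2)[of 0 c "d i" i] that PBr P_0
    by (auto simp: eq_neg_iff_add_eq_0 add.commute)
  have r: "\<phi>' (poly q x) = ev0 c q" "\<delta>' i (poly q x) = ev1 c (d i) i q" if q: "q \<in> PB B" for q i
  proof -
    have "rep (poly q x) \<in> PB B \<and> poly (rep (poly q x)) x = poly q x"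
      unfolding rep_def by (rule someI[of _ q]) (use q in auto)
    then obtain s where s: "s = rep (poly q x)" "s \<in> PB B" "poly s x = poly q x" by blast
    have "q + (- s) \<in> PB B" "poly (q + (- s)) x \<in> P" using s q P_0 by (auto intro: PBr)
    then have "ev0 c (q + (- s)) = 0" "ev1 c (d i) i (q + (- s)) = 0" using c d by blast+
    then have "ev0 c q = ev0 c s" "ev1 c (d i) i q = ev1 c (d i) i s"
      using ev_add(1)[OF q, of "- s" c] ev_add(2)[OF q, of "- s" c "d i" i] s q neg[OF s(2)] by (auto intro: PBr)
    then show "\<phi>' (poly q x) = ev0 c q" "\<delta>' i (poly q x) = ev1 c (d i) i q"
      using s by (auto simp: \<phi>'_def \<delta>'_def)
  qed
  have b: "\<phi>' b = \<phi> b" "\<delta>' i b = \<delta> i b" if "b \<in> B" for b i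
    using r(1)[of "[:b:]"] r(2)[of "[:b:]" i] ev_const[OF that] that by (auto simp: PB_pCons[OF B(1)] PBr)
  have X: "[:0, 1:] \<in> PB B" using B(1) by (simp add: PB_pCons PBr srngD)
  have [simp]: "M\<phi> [:0, 1:] = [:0, 1:]" "M\<delta> i [:0, 1:] = 0" for i
  proof -
    have "\<delta> i 1 = 0" using \<delta>(2)[of 1 1 i] srng_1[OF B(1)] by (simp add: \<phi>)
    then show "M\<phi> [:0, 1:] = [:0, 1:]" "M\<delta> i [:0, 1:] = 0" by (auto simp: map_poly_pCons \<phi> \<delta>)
  qed
  have "\<phi>' x = c" "\<delta>' i x = d i" for i
    using r(1)[OF X] r(2)[OF X, of i] by (auto simp: ev0_def ev1_def pderiv_pCons)
  moreover have "genhom (adjoin B x) P \<phi>' \<delta>'"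
    unfolding genhom_def
  proof (intro conjI ballI allI impI)
    show "\<phi>' 1 = 1" using b[OF srng_1[OF B(1)]] by (simp add: \<phi>)
  next
    fix a1 a2 i assume "a1 \<in> adjoin B x" "a2 \<in> adjoin B x"
    then obtain q1 q2 where q: "q1 \<in> PB B" "q2 \<in> PB B" "a1 = poly q1 x" "a2 = poly q2 x"
      by (auto simp: adjoin_def)
    have *: "a1 + a2 = poly (q1 + q2) x" "a1 * a2 = poly (q1 * q2) x" using q by simp_all
    note rr = r[OF PBr(2)[OF q(1,2)]] r[OF PBr(3)[OF q(1,2)]] r[OF q(1)] r[OF q(2)]
    show "\<phi>' (a1 + a2) = \<phi>' a1 + \<phi>' a2" "\<phi>' (a1 * a2) = \<phi>' a1 * \<phi>' a2"
      "\<delta>' i (a1 + a2) = \<delta>' i a1 + \<delta>' i a2" "\<delta>' i (a1 * a2) = \<phi>' a1 * \<delta>' i a2 + \<delta>' i a1 * \<phi>' a2"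
      unfolding * unfolding q(3,4) rr using q by (simp_all add: ev_add ev_mult)
  next
    fix a i assume "a \<in> adjoin B x"
    then obtain q where q: "q \<in> PB B" "a = poly q x" by (auto simp: adjoin_def)
    show "(\<phi>' a = 0) = (a \<in> P)" using c[OF q(1)] by (simp add: q r)
    show "a \<in> P \<Longrightarrow> \<delta>' i a = 0" using d[OF q(1)] by (simp add: q r)
  qed
  ultimately show ?thesis using b by blast
qed

text \<open>The value \<open>c\<close> of \<open>x\<close> has to avoid the roots of countably many
  nonzero polynomials, which is possible in an uncountable field. No relation then restricts the
  derivatives, so they can be prescribed.\<close>

lemma gen_step_transc:
  assumes x: "x \<in> R" "transc B P x" and B': "countable B"
  shows "\<exists>\<phi>' \<delta>'. genhom (adjoin B x) P \<phi>' \<delta>' \<and> (\<forall>b\<in>B. \<phi>' b = \<phi> b \<and> (\<forall>i. \<delta>' i b = \<delta> i b)) \<and> (\<forall>i. \<delta>' i x = d i)"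
proof -
  define Z where "Z = (\<Union>q\<in>{q \<in> PB B. M\<phi> q \<noteq> 0}. {c. poly (M\<phi> q) c = 0})"
  have "countable Z" unfolding Z_def
    by (rule countable_UN) (use countable_PB[OF B'] in \<open>auto intro: countable_finite poly_roots_finite\<close>)
  then have "Z \<noteq> UNIV" using uncountable_UNIV_complex by metis
  then obtain c where c: "c \<notin> Z" by auto
  have c: "ev0 c q = 0 \<longleftrightarrow> M\<phi> q = 0" if "q \<in> PB B" for q
    using c that by (auto simp: Z_def ev0_def)
  have t: "poly q x \<in> P \<longleftrightarrow> (\<forall>n. Polynomial.coeff q n \<in> P)" if "q \<in> PB B" for q
    using x that poly_in_P[OF that] by (auto simp: transc_def)
  have "\<exists>\<phi>' \<delta>'. genhom (adjoin B x) P \<phi>' \<delta>' \<and> (\<forall>b\<in>B. \<phi>' b = \<phi> b \<and> (\<forall>i. \<delta>' i b = \<delta> i b)) \<and>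
    \<phi>' x = c \<and> (\<forall>i. \<delta>' i x = d i)"
    by (rule gen_extend[OF x(1)]) (use c t M\<phi>_0_iff ev_P in auto)
  then show ?thesis by blast
qed

text \<open>The value of \<open>x\<close> has to be a root \<open>c\<close> of a relation
  \<open>g\<close> of least degree, and the derivatives are forced by differentiating the minimal
  relation \<open>h\<close> of \<open>c\<close>; this can be solved because \<open>c\<close> is a
  simple root of \<open>h\<close> in characteristic zero.\<close>

lemma gen_step_alg:
  assumes x: "x \<in> R" "\<not> transc B P x"
  shows "\<exists>\<phi>' \<delta>'. genhom (adjoin B x) P \<phi>' \<delta>' \<and> (\<forall>b\<in>B. \<phi>' b = \<phi> b \<and> (\<forall>i. \<delta>' i b = \<delta> i b))"
proof -
  note PBr = srngD[OF srng_PB[OF B(1)]]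
  define A where "A = {g \<in> PB B. poly g x \<in> P \<and> M\<phi> g \<noteq> 0}"
  obtain g0 where "g0 \<in> A" using x(2) M\<phi>_0_iff by (auto simp: transc_def A_def)
  then obtain g where g: "g \<in> A" and gmin: "\<And>q. q \<in> A \<Longrightarrow> Polynomial.degree (M\<phi> g) \<le> Polynomial.degree (M\<phi> q)"
    using ex_has_least_nat[of "\<lambda>q. q \<in> A" g0 "\<lambda>q. Polynomial.degree (M\<phi> q)"] by auto
  have "Polynomial.degree (M\<phi> g) \<noteq> 0"
  proof
    assume 0: "Polynomial.degree (M\<phi> g) = 0"
    have cP: "Polynomial.coeff g n \<in> P" if "n > 0" for n
      using coeff_eq_0[of "M\<phi> g" n] that 0 g by (auto simp: coeff_map_poly \<phi> PB_D A_def)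
    have g': "pCons 0 (poly_cutoff 0 0) = (0::'a poly)" by simp
    define h where "h = g - [:Polynomial.coeff g 0:]"
    have "h \<in> PB B" using g B(1) by (auto simp: h_def A_def PB_pCons PBr PB_D intro!: PBr(5))
    moreover have "Polynomial.coeff h n \<in> P" for n using cP[of n] P_0 by (cases n) (auto simp: h_def coeff_pCons)
    ultimately have "poly h x \<in> P" using poly_in_P x by blast
    then have "poly g x - poly h x \<in> P" using g P_diff by (auto simp: A_def)
    then have "Polynomial.coeff g 0 \<in> P" by (simp add: h_def)
    then have "M\<phi> g = 0" using M\<phi>_0_iff[of g] g cP by (metis (no_types, lifting) A_def gr0I mem_Collect_eq)
    then show False using g by (simp add: A_def)
  qed
  then have "\<not> constant (poly (M\<phi> g))" by (simp add: constant_degree)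
  then obtain c where c: "poly (M\<phi> g) c = 0" using fundamental_theorem_of_algebra by blast
  \<comment> \<open>\<open>h1\<close> becomes the minimal polynomial of \<open>c\<close> over the
    image of \<open>B\<close>. It could a priori be a proper factor of \<open>g\<close>, so that
    \<open>h(x)\<close> in \<open>P\<close> needs the argument for \<open>hx\<close>.\<close>
  define C where "C = {h \<in> PB B. ev0 c h = 0 \<and> M\<phi> h \<noteq> 0}"
  have "g \<in> C" using g c by (auto simp: A_def C_def ev0_def)
  then obtain h1 where h1: "h1 \<in> C" and hmin1: "\<And>q. q \<in> C \<Longrightarrow> Polynomial.degree (M\<phi> h1) \<le> Polynomial.degree (M\<phi> q)"
    using ex_has_least_nat[of "\<lambda>q. q \<in> C" g "\<lambda>q. Polynomial.degree (M\<phi> q)"] by auto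
  define m where "m = Polynomial.degree (M\<phi> h1)"
  text \<open>Drop the higher coefficients, which are all in \<open>P\<close>.\<close>
  define h where "h = (\<Sum>i\<le>m. Polynomial.monom (Polynomial.coeff h1 i) i)"
  have ch: "Polynomial.coeff h i = (if i \<le> m then Polynomial.coeff h1 i else 0)" for i
    by (simp add: h_def coeff_sum)
  have hB: "h \<in> PB B" using h1 B(1) by (auto simp: PB_def ch C_def srng_0)
  have Mh: "M\<phi> h = M\<phi> h1"
    using coeff_eq_0[of "M\<phi> h1"] by (auto simp: poly_eq_iff coeff_map_poly \<phi> ch m_def not_le)
  have lc: "Polynomial.coeff h m \<notin> P"
  proof -
    have "Polynomial.coeff (M\<phi> h) m \<noteq> 0" using h1 by (simp add: Mh m_def C_def)
    then show ?thesis using hB by (auto simp: coeff_map_poly \<phi> PB_D)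
  qed
  have dh: "Polynomial.degree h = m"
    using lc P_0 by (intro antisym degree_le le_degree) (auto simp: ch)
  have hC: "h \<in> C" using h1 hB by (auto simp: C_def ev0_def Mh)
  have hmin: "M\<phi> r = 0" if "r \<in> PB B" "\<And>i. i \<ge> m \<Longrightarrow> Polynomial.coeff r i = 0" "ev0 c r = 0" for r
  proof (rule ccontr)
    assume n: "M\<phi> r \<noteq> 0"
    then have "m \<le> Polynomial.degree (M\<phi> r)" using hmin1[of r] that by (auto simp: C_def m_def)
    then have "Polynomial.coeff (M\<phi> r) (Polynomial.degree (M\<phi> r)) = 0" using that by (simp add: coeff_map_poly \<phi>)
    then show False using n by simp
  qed
  have m0: "m \<noteq> 0"
  proof
    assume "m = 0"
    then have "M\<phi> h = [:\<phi> (Polynomial.coeff h 0):]"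
      by (auto simp: poly_eq_iff coeff_map_poly \<phi> ch coeff_pCons split: nat.splits)
    then show False using hC by (auto simp: C_def ev0_def)
  qed
  define L where "L k = [:Polynomial.coeff h m ^ k:]" for k
  have div: "\<exists>k s r. s \<in> PB B \<and> r \<in> PB B \<and> L k * q = h * s + r \<and>
     (\<forall>i\<ge>m. Polynomial.coeff r i = 0)" if q: "q \<in> PB B" for q
  proof -
    obtain k s r where "s \<in> PB B" "r \<in> PB B" "Polynomial.smult (Polynomial.lead_coeff h ^ k) q = h * s + r"
      "\<And>i. i \<ge> Polynomial.degree h \<Longrightarrow> Polynomial.coeff r i = 0"
      by (rule pseudo_division[OF B(1) hB q]) blast
    then show ?thesis by (intro exI[of _ k] exI[of _ s] exI[of _ r]) (simp add: dh L_def)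
  qed
  have lB: "Polynomial.coeff h m ^ k \<in> B" for k using hB B(1) by (auto simp: PB_D srng_power)
  have lk: "Polynomial.coeff h m ^ k \<notin> P" for k using lc P_power[of "Polynomial.coeff h m" k] PB_D[OF hB] B(2) by blast
  have lP: "L k \<in> PB B" for k using lB B(1) by (auto simp: PB_pCons PBr L_def)
  have [simp]: "ev0 c (L k) = \<phi> (Polynomial.coeff h m ^ k)" "ev1 c e i (L k) = \<delta> i (Polynomial.coeff h m ^ k)"
    "M\<phi> (L k) = [:\<phi> (Polynomial.coeff h m ^ k):]" "poly (L k) x = Polynomial.coeff h m ^ k" for k e i
    using lB by (simp_all add: L_def ev_const M_const)
  have xR: "poly q x \<in> R" if "q \<in> PB B" for q
    using adjoin_least[of R B x] that B x P by (auto simp: adjoin_def prim_def)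
  \<comment> \<open>Pseudo-division of \<open>g\<close> by \<open>h\<close> leaves a remainder that
    vanishes at \<open>c\<close>, so its coefficients lie in \<open>P\<close>. Hence
    \<open>h(x) s(x)\<close> is in \<open>P\<close>, and \<open>s(x)\<close> in \<open>P\<close>
    would give a relation of smaller degree than \<open>g\<close>.\<close>
  have hx: "poly h x \<in> P"
  proof -
    obtain k s r where d: "s \<in> PB B" "r \<in> PB B" "L k * g = h * s + r"
      "\<forall>i\<ge>m. Polynomial.coeff r i = 0" using div[of g] g by (auto simp: A_def)
    have gB: "g \<in> PB B" using g by (simp add: A_def)
    have "ev0 c (L k * g) = 0" using c gB lP by (simp add: ev_mult ev0_def[of _ g])
    then have "ev0 c r = 0" using d hB hC by (auto simp: ev_add ev_mult PBr C_def)
    then have r0: "M\<phi> r = 0" using hmin d by blast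
    then have rx: "poly r x \<in> P" using poly_in_P[OF d(2)] M\<phi>_0_iff[OF d(2)] x by blast
    have "poly (L k * g) x \<in> P" using P_mult[of "poly g x"] g lB B by (auto simp: A_def)
    then have "(poly h x * poly s x + poly r x) - poly r x \<in> P" unfolding d(3) poly_add poly_mult by (rule P_diff[OF _ rx])
    then have "poly h x * poly s x \<in> P" by simp
    then consider "poly h x \<in> P" | "poly s x \<in> P" using P_prime xR d hB by blast
    then show ?thesis
    proof cases
      case 2
      have Mg: "M\<phi> (L k) * M\<phi> g = M\<phi> h * M\<phi> s"
        using arg_cong[OF d(3), of M\<phi>] r0 d(1,2) gB hB lP by (simp add: M_add M_mult PBr)
      have l0: "\<phi> (Polynomial.coeff h m ^ k) \<noteq> 0" using lB lk by (simp add: \<phi>)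
      then have ns: "M\<phi> s \<noteq> 0" using Mg g lB by (auto simp: M_const A_def)
      have "Polynomial.degree (M\<phi> g) = Polynomial.degree (M\<phi> h * M\<phi> s)"
        using l0 lB by (simp flip: Mg add: M_const)
      also have "\<dots> = m + Polynomial.degree (M\<phi> s)"
        using ns hC by (simp add: degree_mult_eq C_def Mh m_def)
      finally have "Polynomial.degree (M\<phi> s) < Polynomial.degree (M\<phi> g)" using m0 by simp
      moreover have "s \<in> A" using ns 2 d by (simp add: A_def)
      ultimately show ?thesis using gmin by fastforce
    qed
  qed
  have key: "poly q x \<in> P \<longleftrightarrow> ev0 c q = 0" if q: "q \<in> PB B" for q
  proof -
    obtain k s r where d: "s \<in> PB B" "r \<in> PB B" "L k * q = h * s + r"
      "\<forall>i\<ge>m. Polynomial.coeff r i = 0" using div[OF q] by blast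
    have e: "\<phi> (Polynomial.coeff h m ^ k) * ev0 c q = ev0 c r"
      using arg_cong[OF d(3), of "ev0 c"] d(1,2) q hB lP hC lB by (simp add: ev_add ev_mult PBr C_def ev_const)
    have f: "Polynomial.coeff h m ^ k * poly q x = poly h x * poly s x + poly r x"
      using arg_cong[OF d(3), of "\<lambda>p. poly p x"] by simp
    have l0: "\<phi> (Polynomial.coeff h m ^ k) \<noteq> 0" using lB lk by (simp add: \<phi>)
    have hs: "poly h x * poly s x \<in> P" using hx xR d P_mult' by blast
    show ?thesis
    proof
      assume "poly q x \<in> P"
      then have "Polynomial.coeff h m ^ k * poly q x \<in> P" using P_mult lB B by blast
      then have rx: "poly r x \<in> P" using P_diff[OF _ hs] f by (metis add_diff_cancel_left')
      have "M\<phi> r = 0"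
      proof (rule ccontr)
        assume n: "M\<phi> r \<noteq> 0"
        then have "r \<in> A" using rx d by (simp add: A_def)
        moreover have "Polynomial.degree (M\<phi> g) \<ge> m" using hmin1[OF \<open>g \<in> C\<close>] by (simp add: m_def)
        ultimately have "Polynomial.degree (M\<phi> r) \<ge> m" using gmin by fastforce
        then have "Polynomial.coeff (M\<phi> r) (Polynomial.degree (M\<phi> r)) = 0" using d by (simp add: coeff_map_poly \<phi>)
        then show False using n by simp
      qed
      then show "ev0 c q = 0" using e l0 by (simp add: ev0_def)
    next
      assume "ev0 c q = 0"
      then have "ev0 c r = 0" using e by simp
      then have "M\<phi> r = 0" using hmin d by blast
      then have "poly r x \<in> P" using poly_in_P[OF d(2)] M\<phi>_0_iff[OF d(2)] x by blast
      then have "Polynomial.coeff h m ^ k * poly q x \<in> P" using P_add[OF hs] f by simp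
      then show "poly q x \<in> P" using P_prime lk lB B xR q by blast
    qed
  qed
  \<comment> \<open>The derivative has smaller degree than \<open>h\<close>. If it vanished at
    \<open>c\<close>, minimality would make its image zero, and in characteristic zero the image of
    \<open>h\<close> would be constant.\<close>
  have sep: "poly (Polynomial.pderiv (M\<phi> h)) c \<noteq> 0"
  proof
    assume 0: "poly (Polynomial.pderiv (M\<phi> h)) c = 0"
    define h' where "h' = (\<Sum>i<m. Polynomial.monom (of_nat (Suc i) * Polynomial.coeff h (Suc i)) i)"
    have ch': "Polynomial.coeff h' n = of_nat (Suc n) * Polynomial.coeff h (Suc n)" for n
      using ch[of "Suc n"] by (cases "n < m") (auto simp: h'_def coeff_sum simp del: of_nat_Suc)
    have oB: "of_nat n \<in> B" for n by (induction n) (auto simp: srngD[OF B(1)])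
    have oX: "\<phi> (of_nat n) = of_nat n" for n by (induction n) (auto simp: \<phi> srngD[OF B(1)] oB)
    have h'B: "h' \<in> PB B" 
      using oB hB srng_mult[OF B(1)] by (auto simp: PB_def ch' simp del: of_nat_Suc)
    have M: "M\<phi> h' = Polynomial.pderiv (M\<phi> h)"
      using oB oX hB by (auto simp: poly_eq_iff coeff_map_poly \<phi> coeff_pderiv ch' PB_D simp del: of_nat_Suc)
    have "M\<phi> h' = 0"
      by (rule hmin) (use h'B 0 in \<open>auto simp: ch' ch ev0_def M\<close>)
    then have "Polynomial.degree (M\<phi> h) = 0" using M by (simp add: pderiv_eq_0_iff)
    then show False using m0 by (simp add: Mh m_def)
  qed
  \<comment> \<open>The solution of \<open>ev1 c (d i) i h = 0\<close>: the derivation has to kill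
    \<open>h(x)\<close>.\<close>
  define d where "d i = - poly (M\<delta> i h) c / poly (Polynomial.pderiv (M\<phi> h)) c" for i
  have e1h: "ev1 c (d i) i h = 0" for i using sep by (simp add: ev1_def d_def)
  have "ev1 c (d i) i q = 0" if q: "q \<in> PB B" and qx: "poly q x \<in> P" for q i
  proof -
    obtain k s r where D: "s \<in> PB B" "r \<in> PB B" "L k * q = h * s + r"
      "\<forall>i\<ge>m. Polynomial.coeff r i = 0" using div[OF q] by blast
    have q0: "ev0 c q = 0" using key q qx by blast
    have "\<phi> (Polynomial.coeff h m ^ k) * ev0 c q = ev0 c r"
      using arg_cong[OF D(3), of "ev0 c"] D(1,2) q hB lP hC lB by (simp add: ev_add ev_mult PBr C_def ev_const)
    then have "M\<phi> r = 0" using hmin D q0 by simp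
    then have r1: "ev1 c (d i) i r = 0" using ev_P(2)[OF D(2)] M\<phi>_0_iff[OF D(2)] by blast
    have "\<phi> (Polynomial.coeff h m ^ k) * ev1 c (d i) i q = 0"
      using arg_cong[OF D(3), of "ev1 c (d i) i"] D(1,2) q hB lP hC lB e1h q0 r1
      by (simp add: ev_add ev_mult PBr C_def ev_const)
    then show ?thesis using lB lk by (simp add: \<phi>)
  qed
  then have "\<exists>\<phi>' \<delta>'. genhom (adjoin B x) P \<phi>' \<delta>' \<and> (\<forall>b\<in>B. \<phi>' b = \<phi> b \<and> (\<forall>i. \<delta>' i b = \<delta> i b)) \<and>
    \<phi>' x = c \<and> (\<forall>i. \<delta>' i x = d i)"
    by (intro gen_extend[OF x(1)]) (use key in auto)
  then show ?thesis by blast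
qed

end


lemma mpoly_sgen: "sgen (range Const \<union> range Var) = UNIV"
proof -
  have "f \<in> sgen (range Const \<union> range Var)" for f :: "'v mpoly"
    by (induction f rule: mpoly_induct) (auto intro: sgen.intros)
  then show ?thesis by auto
qed

text \<open>The \<open>y j\<close> are adjoined first; each is transcendental over the previous
  stage, so the derivatives can be chosen dual to them. Then the variables are adjoined one by one,
  with whatever derivatives the extension yields. All stages stay countable, as the transcendental
  steps require.\<close>

theorem generic_point:
  fixes P :: "'v::finite mpoly set" and K :: "complex set" and y :: "nat \<Rightarrow> 'v mpoly" and Bs :: "nat \<Rightarrow> 'v mpoly set"
  assumes K: "srng K" "countable K"
    and P: "prim (sgen (Const ` K \<union> range Var)) P" "Const ` K \<inter> P \<subseteq> {0}"
    and y: "\<And>j. j < l \<Longrightarrow> y j \<in> sgen (Const ` K \<union> range Var)" "\<And>j. j < l \<Longrightarrow> transc (Bs j) P (y j)"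
    and Bs: "Bs 0 = Const ` K" "\<And>j. Bs (Suc j) = adjoin (Bs j) (y j)"
  obtains \<zeta> w where "\<And>f. f \<in> sgen (Const ` K \<union> range Var) \<Longrightarrow> peval f \<zeta> = 0 \<longleftrightarrow> f \<in> P"
    "\<And>f i. f \<in> sgen (Const ` K \<union> range Var) \<Longrightarrow> f \<in> P \<Longrightarrow> dd \<zeta> (w i) f = 0"
    "\<And>i j. j < l \<Longrightarrow> dd \<zeta> (w i) (y j) = (if i = j then 1 else 0)"
proof -
  define R where "R = sgen (Const ` K \<union> range (Var :: 'v \<Rightarrow> 'v mpoly))"
  have R: "srng R" "Const ` K \<subseteq> R" "Var v \<in> R" for v by (auto simp: R_def srng_sgen intro: sgen_base)
  note P = P[folded R_def] and y = y[folded R_def]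
  define ok where "ok B \<phi> \<delta> \<longleftrightarrow> srng B \<and> B \<subseteq> R \<and> countable B \<and> genhom B P \<phi> \<delta> \<and>
    (\<forall>c\<in>K. Const c \<in> B \<and> \<phi> (Const c) = c \<and> (\<forall>i. \<delta> i (Const c) = 0))" for B \<phi> \<delta>
  have 1: "\<exists>\<phi> \<delta>. ok (Bs j) \<phi> \<delta> \<and> (\<forall>i<j. y i \<in> Bs j \<and> (\<forall>i'. \<delta> i' (y i) = (if i' = i then 1 else 0)))" if "j \<le> l" for j
    using that
  proof (induction j)
    case 0
    have "srng (Const ` K)" using K(1) unfolding srng_def
      by (auto simp flip: Const_simps intro!: imageI)
    moreover have "genhom (Const ` K) P (\<lambda>f. peval f 0) (\<lambda>_ _. 0)"
    proof -
      have "Const c \<in> P \<longleftrightarrow> c = 0" if "c \<in> K" for c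
      proof
        assume "Const c \<in> P"
        then have "Const c = (0 :: 'v mpoly)" using P(2) that by blast
        from arg_cong[OF this, of "\<lambda>f. peval f 0"] show "c = 0" by (simp add: peval_hom)
      qed (use P(1) in \<open>simp add: prim_def Const_simps\<close>)
      then show ?thesis by (auto simp: genhom_def peval_hom)
    qed
    ultimately have "ok (Const ` K) (\<lambda>f. peval f 0) (\<lambda>_ _. 0)"
      using K(2) R by (auto simp: ok_def)
    then show ?case by (auto simp: Bs)
  next
    case (Suc j)
    then obtain \<phi> \<delta> where *: "ok (Bs j) \<phi> \<delta>" "\<And>i i'. i < j \<Longrightarrow> \<delta> i' (y i) = (if i' = i then 1 else 0)"
        "\<And>i. i < j \<Longrightarrow> y i \<in> Bs j"
      by auto
    have B: "srng (Bs j)" "Bs j \<subseteq> R" "countable (Bs j)" "genhom (Bs j) P \<phi> \<delta>" 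
      and C: "\<And>c. c \<in> K \<Longrightarrow> Const c \<in> Bs j \<and> \<phi> (Const c) = c \<and> (\<forall>i. \<delta> i (Const c) = 0)"
      using *(1) by (auto simp: ok_def)
    obtain \<phi>' \<delta>' where n: "genhom (adjoin (Bs j) (y j)) P \<phi>' \<delta>'" 
      "\<And>b. b \<in> Bs j \<Longrightarrow> \<phi>' b = \<phi> b \<and> (\<forall>i. \<delta>' i b = \<delta> i b)" "\<And>i. \<delta>' i (y j) = (if i = j then 1 else 0)"
      using gen_step_transc[OF P(1) B(1,2,4) y(1,2)[of j] B(3), of "\<lambda>i. if i = j then 1 else 0"] Suc.prems by force
    have "ok (adjoin (Bs j) (y j)) \<phi>' \<delta>'"
      using B C n adjoin_least[OF R(1) B(2), of "y j"] y(1)[of j] Suc.prems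
      by (auto simp: ok_def srng_adjoin countable_adjoin adjoin_base)
    moreover have "y i \<in> adjoin (Bs j) (y j)" "\<delta>' i' (y i) = (if i' = i then 1 else 0)" if "i < Suc j" for i i'
      using that n *(2,3) B by (auto simp: less_Suc_eq adjoin_self adjoin_base)
    ultimately show ?case unfolding Bs by blast
  qed
  have 2: "\<exists>B \<phi> \<delta>. ok B \<phi> \<delta> \<and> Var ` V \<subseteq> B \<and> (\<forall>i<l. y i \<in> B \<and> (\<forall>i'. \<delta> i' (y i) = (if i' = i then 1 else 0)))" 
    if "finite V" for V
    using that
  proof (induction V)
    case empty
    have "Var ` {} \<subseteq> Bs l" by simp
    then show ?case using 1[OF order.refl] by blast
  next
    case (insert v V)
    then obtain B \<phi> \<delta> where *: "ok B \<phi> \<delta>" "Var ` V \<subseteq> B" 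
      "\<And>i. i < l \<Longrightarrow> y i \<in> B" "\<And>i i'. i < l \<Longrightarrow> \<delta> i' (y i) = (if i' = i then 1 else 0)" by metis
    have B: "srng B" "B \<subseteq> R" "countable B" "genhom B P \<phi> \<delta>" 
      and C: "\<And>c. c \<in> K \<Longrightarrow> Const c \<in> B \<and> \<phi> (Const c) = c \<and> (\<forall>i. \<delta> i (Const c) = 0)"
      using *(1) by (auto simp: ok_def)
    obtain \<phi>' \<delta>' where n: "genhom (adjoin B (Var v)) P \<phi>' \<delta>'" 
      "\<And>b. b \<in> B \<Longrightarrow> \<phi>' b = \<phi> b \<and> (\<forall>i. \<delta>' i b = \<delta> i b)"
      using gen_step_transc[OF P(1) B(1,2,4) R(3) _ B(3)] gen_step_alg[OF P(1) B(1,2,4) R(3)] by metis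
    have "ok (adjoin B (Var v)) \<phi>' \<delta>'"
      using B C n adjoin_least[OF R(1) B(2) R(3)]
      by (auto simp: ok_def srng_adjoin countable_adjoin adjoin_base)
    moreover have "Var ` insert v V \<subseteq> adjoin B (Var v)"
      using *(2) B(1) by (auto simp: adjoin_self adjoin_base)
    moreover have "y i \<in> adjoin B (Var v)" "\<delta>' i' (y i) = (if i' = i then 1 else 0)" if "i < l" for i i'
      using that n *(3,4) B by (auto simp: adjoin_base)
    ultimately show ?case by blast
  qed
  obtain B \<phi> \<delta> where *: "ok B \<phi> \<delta>" "range Var \<subseteq> B" 
      "\<And>i i'. i < l \<Longrightarrow> \<delta> i' (y i) = (if i' = i then 1 else 0)" using 2[of UNIV] by auto
  have B: "srng B" "B \<subseteq> R" "genhom B P \<phi> \<delta>" 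
    and C: "\<And>c. c \<in> K \<Longrightarrow> Const c \<in> B \<and> \<phi> (Const c) = c \<and> (\<forall>i. \<delta> i (Const c) = 0)"
    using *(1) by (auto simp: ok_def)
  have RB: "R = B" using B(1,2) *(2) C sgen_least[of B "Const ` K \<union> range Var"] by (auto simp: R_def)
  note \<phi> = \<phi>[OF P(1) B] and \<delta> = \<delta>[OF P(1) B] and mn = \<phi>_minus[OF P(1) B] \<delta>_minus[OF P(1) B]
  define \<zeta> where "\<zeta> = (\<chi> v. \<phi> (Var v))"
  define w where "w i = (\<chi> v. \<delta> i (Var v))" for i
  have E: "\<phi> f = peval f \<zeta> \<and> (\<forall>i. \<delta> i f = dd \<zeta> (w i) f)" if "f \<in> R" for f
    using that unfolding R_def
  proof (induction f)
    case (sgen_base x)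
    then show ?case using C by (auto simp: \<zeta>_def w_def)
  next
    case sgen_1
    have "\<delta> i 1 = 0" for i using \<delta>(2)[of 1 1 i] srng_1[OF B(1)] by (simp add: \<phi>)
    then show ?case by (simp add: \<phi> peval_hom)
  qed (auto simp flip: R_def simp: RB \<phi> \<delta> mn peval_hom)
  show ?thesis
  proof (rule that)
    fix f :: "'v mpoly" assume "f \<in> sgen (Const ` K \<union> range Var)"
    then have f: "f \<in> R" by (simp add: R_def)
    then show "(peval f \<zeta> = 0) = (f \<in> P)" using E[of f] \<phi>(4)[of f] by (simp add: RB)
    show "f \<in> P \<Longrightarrow> dd \<zeta> (w i) f = 0" for i using E[OF f] \<delta>(3)[of f i] f by (simp add: RB)
  next
    fix i j assume "j < l"
    then show "dd \<zeta> (w i) (y j) = (if i = j then 1 else 0)"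
      using E[of "y j"] *(3)[of j i] y(1)[of j] by simp
  qed
qed

section \<open>Noetherian subrings and Krull's intersection theorem\<close>

definition ideal_in :: "'a::comm_ring_1 set \<Rightarrow> 'a set \<Rightarrow> bool" where
  "ideal_in B I \<longleftrightarrow> I \<subseteq> B \<and> 0 \<in> I \<and> (\<forall>x\<in>I. \<forall>y\<in>I. x + y \<in> I) \<and> (\<forall>b\<in>B. \<forall>x\<in>I. b * x \<in> I)"

text \<open>The ideal generated by \<open>F\<close>, built by adding one multiple of a generator at
  a time, so that properties of combinations of equations follow by induction.\<close>

inductive_set igen :: "'a::comm_ring_1 set \<Rightarrow> 'a set \<Rightarrow> 'a set" for B F where
  igen_0: "0 \<in> igen B F"
| igen_step: "b \<in> B \<Longrightarrow> f \<in> F \<Longrightarrow> x \<in> igen B F \<Longrightarrow> b * f + x \<in> igen B F"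

lemma igen_add: "x \<in> igen B F \<Longrightarrow> y \<in> igen B F \<Longrightarrow> x + y \<in> igen B F"
  by (induction rule: igen.induct) (auto simp: add.assoc intro: igen.intros)

lemma igen_mult: "x \<in> igen B F \<Longrightarrow> srng B \<Longrightarrow> b \<in> B \<Longrightarrow> b * x \<in> igen B F"
  by (induction rule: igen.induct) (auto simp: distrib_left srng_mult simp flip: mult.assoc intro: igen.intros)

lemma igen_base: "f \<in> F \<Longrightarrow> srng B \<Longrightarrow> f \<in> igen B F"
  using igen_step[of 1 B f F 0] by (simp add: srng_1 igen_0)

lemma ideal_in_igen: "srng B \<Longrightarrow> F \<subseteq> B \<Longrightarrow> ideal_in B (igen B F)"
  unfolding ideal_in_def
proof (intro conjI subsetI)
  fix x assume "srng B" "F \<subseteq> B" "x \<in> igen B F"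
  from this(3,1,2) show "x \<in> B" by (induction rule: igen.induct) (auto simp: srngD)
qed (auto intro: igen_0 igen_add igen_mult)

lemma ideal_inD:
  assumes "ideal_in B I"
  shows ideal_in_0: "0 \<in> I" and ideal_in_add: "x \<in> I \<Longrightarrow> y \<in> I \<Longrightarrow> x + y \<in> I"
    and ideal_in_mult: "b \<in> B \<Longrightarrow> x \<in> I \<Longrightarrow> b * x \<in> I" and ideal_in_sub: "I \<subseteq> B"
  using assms by (auto simp: ideal_in_def)

lemma ideal_in_minus: "srng B \<Longrightarrow> ideal_in B I \<Longrightarrow> x \<in> I \<Longrightarrow> - x \<in> I"
  using ideal_in_mult[of B I "-1" x] by (simp add: srngD)

lemma ideal_in_diff: "srng B \<Longrightarrow> ideal_in B I \<Longrightarrow> x \<in> I \<Longrightarrow> y \<in> I \<Longrightarrow> x - y \<in> I"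
  using ideal_in_add[of B I x "-y"] by (simp add: ideal_in_minus)

lemma ideal_in_sum: "ideal_in B I \<Longrightarrow> (\<And>a. a \<in> A \<Longrightarrow> f a \<in> I) \<Longrightarrow> sum f A \<in> I"
  by (induction A rule: infinite_finite_induct) (auto intro: ideal_inD)

lemma igen_least: "ideal_in B I \<Longrightarrow> F \<subseteq> I \<Longrightarrow> igen B F \<subseteq> I"
proof
  fix x assume "ideal_in B I" "F \<subseteq> I" "x \<in> igen B F"
  from this(3,1,2) show "x \<in> I" by (induction rule: igen.induct) (auto intro: ideal_inD)
qed

definition noeth :: "'a::comm_ring_1 set \<Rightarrow> bool" where
  "noeth B \<longleftrightarrow> srng B \<and> (\<forall>I. ideal_in B I \<longrightarrow> (\<exists>F. finite F \<and> F \<subseteq> I \<and> I \<subseteq> igen B F))"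

lemma noeth_field:
  fixes h :: "complex \<Rightarrow> 'a::comm_ring_1"
  assumes h: "rhom h" shows "noeth (range h)"
  unfolding noeth_def
proof (intro conjI allI impI)
  show s: "srng (range h)"
    unfolding srng_def by (auto simp flip: rhomD[OF h])
  fix I assume I: "ideal_in (range h) I"
  show "\<exists>F. finite F \<and> F \<subseteq> I \<and> I \<subseteq> igen (range h) F"
  proof (cases "\<exists>c. c \<noteq> 0 \<and> h c \<in> I")
    case True
    then obtain c where c: "c \<noteq> 0" "h c \<in> I" by auto
    have "h d \<in> igen (range h) {h c}" for d
    proof -
      have "h d = h (d / c) * h c" using c by (simp flip: rhomD[OF h])
      then show ?thesis using igen_mult[OF igen_base[of "h c" "{h c}"], OF _ s s, of "h (d / c)"] by simp
    qed
    then show ?thesis using c ideal_in_sub[OF I] by (intro exI[of _ "{h c}"]) auto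
  next
    case False
    have "x = 0" if x: "x \<in> I" for x
    proof -
      obtain c where c: "x = h c" using x ideal_in_sub[OF I] by auto
      then have "c = 0" using False x by auto
      then show ?thesis using c rhom_0[OF h] by simp
    qed
    then have "I \<subseteq> igen (range h) {}" by (auto intro: igen_0)
    then show ?thesis by (intro exI[of _ "{}"]) auto
  qed
qed

text \<open>Hilbert's argument with ideals of leading coefficients. Since \<open>x\<close> may
  satisfy relations over \<open>B\<close>, degrees belong to the polynomials \<open>q\<close> with
  \<open>q(x)\<close> in \<open>I\<close> and not to the elements of \<open>I\<close>.\<close>

theorem hilbert_basis:
  assumes "noeth B" shows "noeth (adjoin B x)"
  unfolding noeth_def
proof (intro conjI allI impI)
  have B: "srng B" and fg: "\<And>I. ideal_in B I \<Longrightarrow> \<exists>F. finite F \<and> F \<subseteq> I \<and> I \<subseteq> igen B F"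
    using assms by (auto simp: noeth_def)
  define A where "A = adjoin B x"
  show sA: "srng (adjoin B x)" using B by (rule srng_adjoin)
  note PBr = srngD[OF srng_PB[OF B]]
  fix I assume "ideal_in (adjoin B x) I"
  then have I: "ideal_in A I" by (simp add: A_def)
  have sA: "srng A" using sA by (simp add: A_def)
  have pA: "poly q x \<in> A" if "q \<in> PB B" for q using that by (auto simp: A_def adjoin_def)
  \<comment> \<open>The degree is at most \<open>j\<close> and the j-th coefficient may be zero,
    which makes \<open>L j\<close> an ideal and the sequence increasing by multiplication with
    \<open>x\<close>.\<close>
  define L where "L j = {b. \<exists>q\<in>PB B. (\<forall>i>j. Polynomial.coeff q i = 0) \<and> Polynomial.coeff q j = b \<and> poly q x \<in> I}" for j
  have LI: "ideal_in B (L j)" for j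
    unfolding ideal_in_def
  proof (intro conjI ballI subsetI)
    show "0 \<in> L j" unfolding L_def using ideal_in_0[OF I] by (auto intro!: bexI[of _ 0] PBr)
  next
    fix b c assume "b \<in> L j" "c \<in> L j"
    then obtain q r where "q \<in> PB B" "r \<in> PB B" "\<forall>i>j. Polynomial.coeff q i = 0" "\<forall>i>j. Polynomial.coeff r i = 0"
      "Polynomial.coeff q j = b" "Polynomial.coeff r j = c" "poly q x \<in> I" "poly r x \<in> I" by (auto simp: L_def)
    then show "b + c \<in> L j" unfolding L_def by (auto intro!: bexI[of _ "q + r"] PBr ideal_in_add[OF I])
  next
    fix b c assume "b \<in> B" "c \<in> L j"
    then obtain r where "r \<in> PB B" "\<forall>i>j. Polynomial.coeff r i = 0"
      "Polynomial.coeff r j = c" "poly r x \<in> I" by (auto simp: L_def)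
    then show "b * c \<in> L j" unfolding L_def using \<open>b \<in> B\<close> adjoin_base[OF B]
      by (auto intro!: bexI[of _ "Polynomial.smult b r"] PB_smult B ideal_in_mult[OF I] simp: A_def)
  qed (auto simp: L_def PB_D)
  have shift: "b \<in> L (Suc j)" if b: "b \<in> L j" for b j
  proof -
    obtain r where r: "r \<in> PB B" "\<forall>i>j. Polynomial.coeff r i = 0"
      "Polynomial.coeff r j = b" "poly r x \<in> I" using b by (auto simp: L_def)
    have "pCons 0 r \<in> PB B" using r B by (simp add: PB_pCons srng_0)
    moreover have "poly (pCons 0 r) x \<in> I" using r ideal_in_mult[OF I, of x] adjoin_self[OF B] by (simp add: A_def)
    ultimately show ?thesis unfolding L_def using r
      by (auto intro!: bexI[of _ "pCons 0 r"] simp: coeff_pCons split: nat.splits)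
  qed
  have mono: "L i \<subseteq> L j" if "i \<le> j" for i j
    by (rule lift_Suc_mono_le[OF _ that]) (use shift in auto)
  have "ideal_in B (\<Union>j. L j)"
    unfolding ideal_in_def
  proof (intro conjI ballI subsetI)
    fix b c assume "b \<in> (\<Union>j. L j)" "c \<in> (\<Union>j. L j)"
    then obtain i j where "b \<in> L i" "c \<in> L j" by auto
    then have "b + c \<in> L (max i j)" using mono[of i "max i j"] mono[of j "max i j"] by (auto intro: ideal_in_add[OF LI])
    then show "b + c \<in> (\<Union>j. L j)" by blast
  next
    fix b assume "b \<in> (\<Union>j. L j)"
    then show "b \<in> B" by (auto simp: L_def PB_D)
  next
    show "0 \<in> (\<Union>j. L j)" using ideal_in_0[OF LI] by blast
  next
    fix b c assume "b \<in> B" "c \<in> (\<Union>j. L j)"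
    then obtain j where "c \<in> L j" by auto
    then have "b * c \<in> L j" by (rule ideal_in_mult[OF LI \<open>b \<in> B\<close>])
    then show "b * c \<in> (\<Union>j. L j)" by blast
  qed
  then obtain F where F: "finite F" "F \<subseteq> (\<Union>j. L j)" "(\<Union>j. L j) \<subseteq> igen B F" using fg by metis
  have "\<exists>j0. F \<subseteq> L j0" using F(1,2)
  proof (induction F)
    case (insert b F)
    then obtain i j where "F \<subseteq> L i" "b \<in> L j" by auto
    then have "insert b F \<subseteq> L (max i j)" using mono[of i "max i j"] mono[of j "max i j"] by auto
    then show ?case ..
  qed auto
  then obtain j0 where "F \<subseteq> L j0" ..
  then have L0: "L j \<subseteq> L j0" for j using F(3) igen_least[OF LI] by blast
  obtain Fj where Fj: "\<And>j. finite (Fj j)" "\<And>j. Fj j \<subseteq> L j" "\<And>j. L j \<subseteq> igen B (Fj j)" using fg[OF LI] by metis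
  have "\<forall>j b. \<exists>q. b \<in> L j \<longrightarrow> q \<in> PB B \<and> (\<forall>i>j. Polynomial.coeff q i = 0) \<and> Polynomial.coeff q j = b \<and> poly q x \<in> I"
    by (auto simp: L_def)
  then obtain Q where Q: "\<And>j b. b \<in> L j \<Longrightarrow> Q j b \<in> PB B \<and> (\<forall>i>j. Polynomial.coeff (Q j b) i = 0) \<and> Polynomial.coeff (Q j b) j = b \<and> poly (Q j b) x \<in> I"
    by metis
  define G where "G = (\<Union>j\<le>j0. (\<lambda>b. poly (Q j b) x) ` Fj j)"
  have G: "finite G" "G \<subseteq> I" using Fj Q by (fastforce simp: G_def)+
  have GI: "igen A G \<subseteq> I" by (rule igen_least[OF I G(2)])
  have 1: "\<exists>q\<in>PB B. (\<forall>i>j. Polynomial.coeff q i = 0) \<and> Polynomial.coeff q j = b \<and> poly q x \<in> igen A G"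
    if "j \<le> j0" "b \<in> igen B (Fj j)" for j b
    using that(2)
  proof (induction rule: igen.induct)
    case igen_0
    show ?case by (rule bexI[of _ 0]) (auto intro: igen.igen_0 PBr)
  next
    case (igen_step b f y)
    then obtain q where q: "q \<in> PB B" "\<forall>i>j. Polynomial.coeff q i = 0" "Polynomial.coeff q j = y" "poly q x \<in> igen A G"
      by auto
    have f: "f \<in> L j" using igen_step Fj by auto
    have "poly (Q j f) x \<in> G" using that(1) igen_step by (auto simp: G_def)
    then have "b * poly (Q j f) x + poly q x \<in> igen A G"
      using q adjoin_base[OF B igen_step(1), of x] by (intro igen.igen_step) (auto simp: A_def)
    then show ?case using Q[OF f] q igen_step
      by (intro bexI[of _ "Polynomial.smult b (Q j f) + q"]) (auto intro: PBr PB_smult B)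
  qed
  have 2: "\<exists>q\<in>PB B. (\<forall>i>j. Polynomial.coeff q i = 0) \<and> Polynomial.coeff q j = b \<and> poly q x \<in> igen A G"
    if bL: "b \<in> L j" for j b
  proof (cases "j \<le> j0")
    case True
    then show ?thesis using 1 bL Fj by blast
  next
    case False
    then obtain q where q: "q \<in> PB B" "\<forall>i>j0. Polynomial.coeff q i = 0" "Polynomial.coeff q j0 = b" "poly q x \<in> igen A G"
      using 1[of j0 b] L0 bL Fj(3) by blast
    define s where "s = Polynomial.monom 1 (j - j0) * q"
    have "s \<in> PB B" unfolding s_def using q B by (intro PBr PB_monom) (auto simp: srng_1)
    moreover have "Polynomial.coeff s i = (if j - j0 \<le> i then Polynomial.coeff q (i - (j - j0)) else 0)" for i
      by (auto simp: s_def coeff_monom_mult)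
    moreover have "poly s x \<in> igen A G" unfolding s_def poly_mult poly_monom
      using q sA adjoin_self[OF B, of x] by (intro igen_mult) (auto simp: A_def srng_power)
    ultimately show ?thesis using q False by (intro bexI[of _ s]) auto
  qed
  have 3: "poly q x \<in> igen A G" if "q \<in> PB B" "\<forall>i\<ge>n. Polynomial.coeff q i = 0" "poly q x \<in> I" for q n
    using that
  proof (induction n arbitrary: q)
    case 0
    then have "q = 0" by (auto simp: poly_eq_iff)
    then show ?case by (auto intro: igen_0)
  next
    case (Suc n)
    then have "Polynomial.coeff q n \<in> L n" by (auto simp: L_def Suc_le_eq)
    then obtain r where r: "r \<in> PB B" "\<forall>i>n. Polynomial.coeff r i = 0" "Polynomial.coeff r n = Polynomial.coeff q n"
      "poly r x \<in> igen A G" using 2 by metis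
    have "poly (q - r) x \<in> igen A G"
    proof (rule Suc.IH)
      show "q - r \<in> PB B" using Suc r by (auto intro: PBr)
      show "\<forall>i\<ge>n. Polynomial.coeff (q - r) i = 0"
      proof (intro allI impI)
        fix i assume "n \<le> i"
        then show "Polynomial.coeff (q - r) i = 0"
          using Suc.prems(2) r(2,3) by (cases "i = n") simp_all
      qed
      show "poly (q - r) x \<in> I" using Suc.prems r GI by (auto intro!: ideal_in_diff[OF sA I])
    qed
    then show ?case using igen_add[OF _ r(4), of "poly (q - r) x"] by simp
  qed
  have "I \<subseteq> igen A G"
  proof
    fix y assume y: "y \<in> I"
    then obtain q where "q \<in> PB B" "y = poly q x" using ideal_in_sub[OF I] by (auto simp: A_def adjoin_def)
    then show "y \<in> igen A G" using 3[of q "Suc (Polynomial.degree q)"] y coeff_eq_0[of q] by (auto simp: Suc_le_eq)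
  qed
  then show "\<exists>F. finite F \<and> F \<subseteq> I \<and> I \<subseteq> igen (adjoin B x) F" using G by (auto simp: A_def)
qed

lemma sgen_mono: "X \<subseteq> Y \<Longrightarrow> sgen X \<subseteq> sgen Y"
  by (intro sgen_least srng_sgen) (auto intro: sgen_base)

lemma noeth_sgen:
  fixes h :: "complex \<Rightarrow> 'a::comm_ring_1"
  assumes "rhom h" "finite X" shows "noeth (sgen (range h \<union> X))"
  using assms(2)
proof induction
  case empty
  have "sgen (range h) = range h"
    using sgen_least[of "range h" "range h"] noeth_field[OF assms(1)] by (auto simp: noeth_def intro: sgen_base)
  then show ?case using noeth_field[OF assms(1)] by simp
next
  case (insert x X)
  let ?B = "sgen (range h \<union> X)"
  have "sgen (range h \<union> insert x X) = adjoin ?B x"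
  proof
    show "sgen (range h \<union> insert x X) \<subseteq> adjoin ?B x"
      by (intro sgen_least srng_adjoin srng_sgen)
        (auto intro!: adjoin_base adjoin_self srng_sgen intro: sgen_base)
    show "adjoin ?B x \<subseteq> sgen (range h \<union> insert x X)"
      by (intro adjoin_least srng_sgen sgen_mono) (auto intro: sgen_base)
  qed
  then show ?case using hilbert_basis[OF insert.IH] by simp
qed

lemma srng_UNIV: "srng UNIV"
  by (simp add: srng_def)

lemma noeth_mpoly: "noeth (UNIV :: 'v::finite mpoly set)"
  using noeth_sgen[OF rhom_Const finite_imageI[OF finite_class.finite_UNIV], of "Var :: 'v \<Rightarrow> 'v mpoly"]
  by (simp add: mpoly_sgen)

section \<open>Powers of the maximal ideal of a point, and their Rees algebra\<close>

primrec mpow :: "complex^'v \<Rightarrow> nat \<Rightarrow> 'v mpoly set" where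
  "mpow z 0 = UNIV"
| "mpow z (Suc k) = igen UNIV {(Var v - Const (z $ v)) * h | v h. h \<in> mpow z k}"

lemma ideal_mpow: "ideal_in UNIV (mpow z k)"
  by (cases k) (auto intro: ideal_in_igen srng_UNIV simp: ideal_in_def[of _ UNIV])

lemma mpow_Suc: "h \<in> mpow z k \<Longrightarrow> (Var v - Const (z $ v)) * h \<in> mpow z (Suc k)"
  by (auto intro!: igen_base srng_UNIV)

lemma mpow_mult: "f \<in> mpow z i \<Longrightarrow> g \<in> mpow z j \<Longrightarrow> f * g \<in> mpow z (i + j)"
proof (induction i arbitrary: f)
  case 0
  then show ?case using ideal_in_mult[OF ideal_mpow] by simp
next
  case (Suc i)
  from Suc.prems(1) have "f \<in> igen UNIV {(Var v - Const (z $ v)) * h | v h. h \<in> mpow z i}" by simp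
  then show ?case
  proof (induction rule: igen.induct)
    case igen_0
    then show ?case using ideal_in_0[OF ideal_mpow] by (simp del: mpow.simps)
  next
    case (igen_step b f x)
    then obtain v h where f: "f = (Var v - Const (z $ v)) * h" "h \<in> mpow z i" by auto
    have 1: "b * ((Var v - Const (z $ v)) * (h * g)) \<in> mpow z (Suc (i + j))"
      by (rule ideal_in_mult[OF ideal_mpow UNIV_I mpow_Suc[OF Suc.IH[OF f(2) Suc.prems(2)]]])
    have 2: "x * g \<in> mpow z (Suc (i + j))" using igen_step.IH by (simp only: add_Suc)
    from ideal_in_add[OF ideal_mpow 1 2]
    show ?case by (simp add: f algebra_simps del: mpow.simps)
  qed
qed

lemma mpow_anti: "i \<le> j \<Longrightarrow> mpow z j \<subseteq> mpow z i"
proof (induction j arbitrary: i)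
  case (Suc j)
  have "mpow z (Suc j) \<subseteq> mpow z j"
    unfolding mpow.simps by (rule igen_least[OF ideal_mpow]) (auto intro: ideal_in_mult[OF ideal_mpow])
  then show ?case using Suc.IH[of i] Suc.prems by (metis le_SucE order.trans order.refl)
qed simp

lemma mpow_1_peval: "e \<in> mpow z 1 \<Longrightarrow> peval e z = 0"
proof -
  assume "e \<in> mpow z 1"
  then have "e \<in> igen UNIV {(Var v - Const (z $ v)) * h | v h. h \<in> mpow z 0}" by simp
  then show ?thesis by (induction rule: igen.induct) (auto simp: peval_hom)
qed

text \<open>The Rees algebra of the maximal ideal: the polynomials in a new variable whose k-th
  coefficient lies in \<open>mpow z k\<close>. Presenting it by finitely many generators makes it
  noetherian at once; \<open>rees_coeff\<close> and \<open>monom_rees\<close> link it to the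
  powers.\<close>

definition rees :: "complex^'v \<Rightarrow> 'v mpoly poly set" where
  "rees z = sgen (range (\<lambda>c. [:Const c:]) \<union> (range (\<lambda>v. [:Var v:]) \<union> range (\<lambda>v. [:0, Var v - Const (z $ v):])))"

lemma srng_rees: "srng (rees z)"
  by (simp add: rees_def srng_sgen)

lemma noeth_rees: "noeth (rees (z :: complex^'v::finite))"
  unfolding rees_def by (intro noeth_sgen rhom_pCons_Const) auto

lemma rees_coeff: "q \<in> rees z \<Longrightarrow> Polynomial.coeff q k \<in> mpow z k"
proof -
  let ?S = "{q. \<forall>k. Polynomial.coeff q k \<in> mpow z k}"
  have 1: "Var v - Const (z $ v) \<in> mpow z 1" for v using mpow_Suc[of 1 z 0 v] by simp
  note 0 = ideal_in_0[OF ideal_mpow]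
  have "srng ?S" unfolding srng_def
  proof (intro conjI ballI)
    fix p q assume p: "p \<in> ?S" and q: "q \<in> ?S"
    show "p * q \<in> ?S" 
    proof (intro CollectI allI)
      fix k
      have "Polynomial.coeff p i * Polynomial.coeff q (k - i) \<in> mpow z k" if "i \<le> k" for i
        using mpow_mult[of "Polynomial.coeff p i" z i "Polynomial.coeff q (k - i)" "k - i"] p q that by auto
      then show "Polynomial.coeff (p * q) k \<in> mpow z k" unfolding coeff_mult
        by (intro ideal_in_sum[OF ideal_mpow]) auto
    qed
  qed (auto intro: ideal_inD[OF ideal_mpow] ideal_in_minus[OF srng_UNIV ideal_mpow] simp: 0 simp del: mpow.simps(2))
  moreover have "[:0, Var v - Const (z $ v):] \<in> ?S" for v
    using 1[of v] 0 by (auto simp: coeff_pCons simp del: mpow.simps(2) split: nat.splits)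
  moreover have "[:f:] \<in> ?S" for f
    using 0 by (auto simp: coeff_pCons simp del: mpow.simps(2) split: nat.splits)
  ultimately have "rees z \<subseteq> ?S" unfolding rees_def by (intro sgen_least) auto
  then show "q \<in> rees z \<Longrightarrow> Polynomial.coeff q k \<in> mpow z k" by auto
qed

lemma monom_rees: "h \<in> mpow z k \<Longrightarrow> Polynomial.monom h k \<in> rees z"
proof -
  note S = srngD[OF srng_rees[of z]]
  have cst: "[:h:] \<in> rees z" for h
  proof (induction h rule: mpoly_induct)
    case (mult f g)
    have "[:f * g:] = [:f:] * [:g:]" by simp
    then show ?case using mult S by metis
  next
    case (add f g)
    have "[:f + g:] = [:f:] + [:g:]" by simp
    then show ?case using add S by metis
  qed (auto simp: rees_def intro: sgen_base)
  show "h \<in> mpow z k \<Longrightarrow> Polynomial.monom h k \<in> rees z"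
  proof (induction k arbitrary: h)
    case 0
    show ?case using cst[of h] by (simp add: monom_0)
  next
    case (Suc k)
    from Suc.prems have "h \<in> igen UNIV {(Var v - Const (z $ v)) * h | v h. h \<in> mpow z k}" by simp
    then show ?case
    proof (induction rule: igen.induct)
      case (igen_step b f x)
      then obtain v h where f: "f = (Var v - Const (z $ v)) * h" "h \<in> mpow z k" by auto
      have "[:b:] * ([:0, Var v - Const (z $ v):] * Polynomial.monom h k) + Polynomial.monom x (Suc k) \<in> rees z"
        using Suc.IH[OF f(2)] igen_step.IH by (intro S cst) (auto simp: rees_def intro: sgen_base)
      also have "[:b:] * ([:0, Var v - Const (z $ v):] * Polynomial.monom h k) + Polynomial.monom x (Suc k)
        = Polynomial.monom (b * f + x) (Suc k)"
        by (simp add: f monom_Suc smult_monom add_monom)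
      finally show ?case .
    qed (simp add: S)
  qed
qed

text \<open>The elements of the Rees algebra with all coefficients in \<open>Q\<close> form a
  finitely generated ideal. If the generators have degree at most \<open>c\<close>, then the
  coefficient of degree \<open>k + c\<close> of a combination uses Rees factors of degree at least
  \<open>k\<close> only.\<close>

lemma artin_rees:
  fixes z :: "complex^'v::finite"
  assumes Q: "ideal_in UNIV Q"
  obtains c where "\<And>k. mpow z (k + c) \<inter> Q \<subseteq> igen UNIV {a * q | a q. a \<in> mpow z k \<and> q \<in> Q}"
proof -
  define T where "T k = igen UNIV {a * q | a q. a \<in> mpow z k \<and> q \<in> Q}" for k
  have T: "ideal_in UNIV (T k)" for k unfolding T_def by (rule ideal_in_igen[OF srng_UNIV]) simp
  define I where "I = {g \<in> rees z. \<forall>k. Polynomial.coeff g k \<in> Q}"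
  have "ideal_in (rees z) I"
    unfolding ideal_in_def I_def using srngD[OF srng_rees[of z]]
    by (auto simp: coeff_mult intro!: ideal_inD[OF Q] ideal_in_sum[OF Q])
  then obtain G where G: "finite G" "G \<subseteq> I" "I \<subseteq> igen (rees z) G" using noeth_rees[of z] by (auto simp: noeth_def)
  define c where "c = Max (insert 0 (Polynomial.degree ` G))"
  have c: "Polynomial.degree g \<le> c" if "g \<in> G" for g using G that by (auto simp: c_def)
  have coeff_T: "Polynomial.coeff g (k + c) \<in> T k" if "g \<in> igen (rees z) G" for g k
    using that
  proof (induction rule: igen.induct)
    case (igen_step b g x)
    have "Polynomial.coeff g i * Polynomial.coeff b (k + c - i) \<in> T k" if "i \<le> k + c" for i
    proof (cases "i \<le> c")
      case True
      have "Polynomial.coeff b (k + c - i) \<in> mpow z k"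
        using rees_coeff[OF igen_step(1)] True by (intro subsetD[OF mpow_anti[of k "k + c - i" z]]) auto
      moreover have "Polynomial.coeff g i \<in> Q" using igen_step(2) G by (auto simp: I_def)
      ultimately have "Polynomial.coeff b (k + c - i) * Polynomial.coeff g i \<in> T k"
        unfolding T_def by (intro igen_base srng_UNIV) auto
      then show ?thesis by (simp add: mult.commute)
    next
      case False
      then have "Polynomial.coeff g i = 0" using c[OF igen_step(2)] by (auto intro: coeff_eq_0)
      then show ?thesis using ideal_in_0[OF T] by simp
    qed
    then have "Polynomial.coeff (g * b) (k + c) \<in> T k" unfolding coeff_mult by (intro ideal_in_sum[OF T]) auto
    then show ?case using igen_step.IH by (auto simp: mult.commute intro: ideal_in_add[OF T])
  qed (simp add: ideal_in_0[OF T])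
  have monom_I: "Polynomial.monom h (k + c) \<in> I" if "h \<in> mpow z (k + c)" "h \<in> Q" for h k
    using monom_rees[OF that(1)] that(2) ideal_in_0[OF Q] by (auto simp: I_def)
  have "h \<in> T k" if "h \<in> mpow z (k + c)" "h \<in> Q" for h k
    using coeff_T[of "Polynomial.monom h (k + c)" k] monom_I[OF that] G(3) by auto
  then show ?thesis using that[of c] by (auto simp: T_def)
qed

text \<open>Let \<open>Q\<close> be generated by \<open>I\<close> and \<open>h\<close>. For
  \<open>i\<close> in \<open>I\<close> close enough to \<open>h\<close>, the difference
  \<open>h - i\<close> lies in the maximal ideal times \<open>Q\<close> by the Artin-Rees lemma, so
  \<open>h - i = j + e h\<close> with \<open>j\<close> in \<open>I\<close> and \<open>e\<close>
  vanishing at \<open>z\<close>; then \<open>g = 1 - e\<close>.\<close>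

theorem krull_intersection:
  fixes z :: "complex^'v::finite"
  assumes I: "ideal_in UNIV I" and h: "\<And>k. \<exists>i\<in>I. h - i \<in> mpow z k"
  obtains g where "peval g z = 1" "g * h \<in> I"
proof -
  define Q where "Q = {i + r * h | i r. i \<in> I}"
  have Q: "ideal_in UNIV Q" unfolding ideal_in_def
  proof (intro conjI ballI)
    show "0 \<in> Q" unfolding Q_def using ideal_in_0[OF I] by (intro CollectI exI[of _ 0]) auto
  next
    fix x y assume "x \<in> Q" "y \<in> Q"
    then obtain i r j s where "x = i + r * h" "y = j + s * h" "i \<in> I" "j \<in> I" by (auto simp: Q_def)
    then have "x + y = (i + j) + (r + s) * h" "i + j \<in> I" by (auto simp: algebra_simps intro: ideal_in_add[OF I])
    then show "x + y \<in> Q" unfolding Q_def by blast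
  next
    fix b x assume "x \<in> Q"
    then obtain i r where "x = i + r * h" "i \<in> I" by (auto simp: Q_def)
    then have "b * x = b * i + (b * r) * h" "b * i \<in> I" by (auto simp: algebra_simps intro: ideal_in_mult[OF I])
    then show "b * x \<in> Q" unfolding Q_def by blast
  qed simp
  obtain c where c: "\<And>k. mpow z (k + c) \<inter> Q \<subseteq> igen UNIV {a * q | a q. a \<in> mpow z k \<and> q \<in> Q}"
    by (rule artin_rees[OF Q, where z = z]) blast
  obtain i where i: "i \<in> I" "h - i \<in> mpow z (1 + c)" using h by blast
  have "h - i = - i + 1 * h" "- i \<in> I" using i ideal_in_minus[OF srng_UNIV I] by auto
  then have "h - i \<in> Q" unfolding Q_def by blast
  then have hi: "h - i \<in> igen UNIV {a * q | a q. a \<in> mpow z 1 \<and> q \<in> Q}" using c[of 1] i by blast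
  have "\<exists>j e. x = j + e * h \<and> j \<in> I \<and> e \<in> mpow z 1" if "x \<in> igen UNIV {a * q | a q. a \<in> mpow z 1 \<and> q \<in> Q}" for x
    using that
  proof (induction rule: igen.induct)
    case igen_0
    show ?case using ideal_in_0[OF I] ideal_in_0[OF ideal_mpow[of z 1]] by (intro exI[of _ 0]) simp
  next
    case (igen_step b f x)
    then obtain j e a q where *: "x = j + e * h" "j \<in> I" "e \<in> mpow z 1" "f = a * q" "a \<in> mpow z 1" "q \<in> Q" by auto
    then obtain j' r where q: "q = j' + r * h" "j' \<in> I" by (auto simp: Q_def)
    have "b * f + x = ((b * a) * j' + j) + ((b * r) * a + e) * h" by (simp add: * q algebra_simps)
    moreover have "(b * a) * j' + j \<in> I" "(b * r) * a + e \<in> mpow z 1"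
      using * q by (auto intro: ideal_inD[OF I] ideal_inD[OF ideal_mpow] simp del: mpow.simps)
    ultimately show ?case by blast
  qed
  then obtain j e where je: "h - i = j + e * h" "j \<in> I" "e \<in> mpow z 1" using hi by blast
  then have "(1 - e) * h = j + i" by (simp add: algebra_simps)
  then have "(1 - e) * h \<in> I" using je i by (auto intro: ideal_in_add[OF I])
  moreover have "peval (1 - e) z = 1" using mpow_1_peval[OF je(3)] by (simp add: peval_hom)
  ultimately show ?thesis using that by blast
qed

no_notation fps_nth (infixl \<open>$\<close> 75)

section \<open>Formal arcs\<close>

text \<open>Evaluation of a polynomial on a formal arc. Besides the complex numbers
  (\<open>fe\<close>), the coefficients of the arc may be polynomials in a parameter, which
  describes a family of arcs.\<close>

definition fev :: "(complex \<Rightarrow> 'a::comm_ring_1) \<Rightarrow> ('v \<Rightarrow> 'a fps) \<Rightarrow> 'v mpoly \<Rightarrow> 'a fps" where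
  "fev h \<phi> f = subst (\<lambda>c. fps_const (h c)) \<phi> f"

abbreviation "fe \<equiv> fev (\<lambda>c. c)"

lemma rhom_fev: "rhom h \<Longrightarrow> rhom (fev h \<phi>)"
  unfolding fev_def by (intro rhom_subst rhom_comp[OF rhom_fps_const])

lemmas fev_hom = rhomD[OF rhom_fev] rhom_sum[OF rhom_fev] rhom_prod[OF rhom_fev] rhom_power[OF rhom_fev]
lemmas fe_hom = fev_hom[OF rhom_id(2)]

lemma fev_Const: "rhom h \<Longrightarrow> fev h \<phi> (Const c) = fps_const (h c)"
  and fev_Var: "rhom h \<Longrightarrow> fev h \<phi> (Var v) = \<phi> v"
  by (simp_all add: fev_def subst_Const subst_Var rhom_comp[OF rhom_fps_const])

lemmas fe_Const = fev_Const[OF rhom_id(2)] and fe_Var = fev_Var[OF rhom_id(2)]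

lemma rhom_fps_nth_0: "rhom (\<lambda>f :: 'a::comm_ring_1 fps. fps_nth f 0)"
  by (auto simp: rhom_def)

lemma fev_nth_0:
  assumes "rhom h" "\<And>v. fps_nth (\<phi> v) 0 = h (z $ v)"
  shows "fps_nth (fev h \<phi> f) 0 = h (peval f z)"
proof -
  have "fps_nth (fev h \<phi> f) 0 = subst h (\<lambda>v. h (z $ v)) f"
    unfolding fev_def
    by (subst rhom_subst_comp[OF rhom_fps_nth_0 rhom_comp[OF rhom_fps_const assms(1)]]) (simp add: assms(2))
  also have "\<dots> = h (peval f z)"
    unfolding peval_def by (subst rhom_subst_comp[OF assms(1) rhom_id(1)]) simp
  finally show ?thesis .
qed

definition jac :: "('v \<Rightarrow> 'v mpoly) \<Rightarrow> complex^'v \<Rightarrow> complex^'v^'v::finite" where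
  "jac f z = (\<chi> i v. peval (pd v (f i)) z)"

definition agree :: "nat \<Rightarrow> ('v \<Rightarrow> 'a::comm_ring_1 fps) \<Rightarrow> ('v \<Rightarrow> 'a fps) \<Rightarrow> bool" where
  "agree n \<phi> \<psi> \<longleftrightarrow> (\<forall>v. \<forall>i<n. fps_nth (\<phi> v) i = fps_nth (\<psi> v) i)"

lemma agree_trans: "agree n \<phi> \<psi> \<Longrightarrow> agree n \<phi>' \<psi> \<Longrightarrow> agree n \<phi> \<phi>'"
  by (simp add: agree_def)

lemma agree_trans': "agree n \<phi> \<psi> \<Longrightarrow> agree m \<psi> \<phi>' \<Longrightarrow> n \<le> m \<Longrightarrow> agree n \<phi> \<phi>'"
  by (simp add: agree_def)

lemma fps_mult_low:
  fixes f d :: "'a::comm_ring_1 fps"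
  assumes "\<And>i. i < n \<Longrightarrow> fps_nth d i = 0"
  shows "i < n \<Longrightarrow> fps_nth (f * d) i = 0" "fps_nth (f * d) n = fps_nth f 0 * fps_nth d n"
proof -
  show "i < n \<Longrightarrow> fps_nth (f * d) i = 0" using assms by (auto simp: fps_mult_nth intro!: sum.neutral)
  have "fps_nth (f * d) n = (\<Sum>i=0..n. if i = 0 then fps_nth f 0 * fps_nth d n else 0)"
    unfolding fps_mult_nth using assms by (intro sum.cong) auto
  then show "fps_nth (f * d) n = fps_nth f 0 * fps_nth d n" by simp
qed

text \<open>Two arcs that agree below order \<open>n \<ge> 1\<close> have the same constant term
  \<open>z\<close>. A product rule for the difference of values suffices, because multiplying a
  series of order \<open>n\<close> changes its leading coefficient only by a constant term.\<close>

lemma taylor_fps: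
  fixes f :: "'v::finite mpoly"
  assumes h: "rhom h" and n: "n \<ge> 1" and ag: "agree n \<phi> \<psi>"
    and z: "\<And>v. fps_nth (\<phi> v) 0 = h (z $ v)"
  shows "i < n \<Longrightarrow> fps_nth (fev h \<phi> f - fev h \<psi> f) i = 0"
    "fps_nth (fev h \<phi> f - fev h \<psi> f) n = (\<Sum>v\<in>UNIV. h (peval (pd v f) z) * fps_nth (\<phi> v - \<psi> v) n)"
proof -
  note hs = fev_hom[OF h] rhomD[OF h] fev_Const[OF h] fev_Var[OF h]
  have z': "fps_nth (\<psi> v) 0 = h (z $ v)" for v using ag n z by (auto simp: agree_def)
  have "(\<forall>i<n. fps_nth (fev h \<phi> f - fev h \<psi> f) i = 0) \<and>
    fps_nth (fev h \<phi> f - fev h \<psi> f) n = (\<Sum>v\<in>UNIV. h (peval (pd v f) z) * fps_nth (\<phi> v - \<psi> v) n)"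
  proof (induction f rule: mpoly_induct)
    case (Const c)
    then show ?case by (simp add: hs peval_hom)
  next
    case (Var v)
    then show ?case using ag
      by (simp add: hs agree_def peval_hom if_distrib[of "\<lambda>f. h (peval f z)"] if_distrib[of "\<lambda>a. a * _"] cong: if_cong)
  next
    case (add f g)
    have "fev h \<phi> (f + g) - fev h \<psi> (f + g) = (fev h \<phi> f - fev h \<psi> f) + (fev h \<phi> g - fev h \<psi> g)"
      by (simp add: hs)
    then show ?case using add by (simp only: fps_add_nth) (simp add: hs peval_hom algebra_simps sum.distrib sum_subtractf)
  next
    case (mult f g)
    define df where "df = fev h \<phi> f - fev h \<psi> f"
    define dg where "dg = fev h \<phi> g - fev h \<psi> g"
    have e: "fev h \<phi> (f * g) - fev h \<psi> (f * g) = fev h \<phi> f * dg + fev h \<psi> g * df"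
      by (simp add: hs df_def dg_def algebra_simps)
    have f: "\<And>i. i < n \<Longrightarrow> fps_nth df i = 0" and g: "\<And>i. i < n \<Longrightarrow> fps_nth dg i = 0"
      using mult by (auto simp: df_def dg_def)
    define a where "a v = fps_nth (\<phi> v - \<psi> v) n" for v
    have lf: "fps_nth (X * df) i = 0" if "i < n" for X i using fps_mult_low(1)[of n df i X] f that by blast
    have lg: "fps_nth (X * dg) i = 0" if "i < n" for X i using fps_mult_low(1)[of n dg i X] g that by blast
    have nf: "fps_nth (X * df) n = fps_nth X 0 * (\<Sum>v\<in>UNIV. h (peval (pd v f) z) * a v)" for X
      using fps_mult_low(2)[of n df X] f mult.IH by (auto simp: df_def a_def)
    have ng: "fps_nth (X * dg) n = fps_nth X 0 * (\<Sum>v\<in>UNIV. h (peval (pd v g) z) * a v)" for X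
      using fps_mult_low(2)[of n dg X] g mult.IH by (auto simp: dg_def a_def)
    show ?case unfolding e fps_add_nth nf ng fev_nth_0[OF h z] fev_nth_0[OF h z'] a_def[symmetric]
      by (intro conjI allI impI, simp only: lf lg add_0_left)
        (simp add: hs peval_hom sum_distrib_left sum.distrib[symmetric] algebra_simps)
  qed
  then show "i < n \<Longrightarrow> fps_nth (fev h \<phi> f - fev h \<psi> f) i = 0"
    "fps_nth (fev h \<phi> f - fev h \<psi> f) n = (\<Sum>v\<in>UNIV. h (peval (pd v f) z) * fps_nth (\<phi> v - \<psi> v) n)"
    by auto
qed

text \<open>If the arcs agree below order \<open>n\<close>, then the Jacobian kills the difference
  of their n-th coefficients, and it is invertible.\<close>

lemma arc_unique:
  fixes f :: "'v::finite \<Rightarrow> 'v mpoly"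
  assumes h: "rhom h" and inv: "invertible (jac f z)"
    and z: "\<And>v. fps_nth (\<phi> v) 0 = h (z $ v)" "\<And>v. fps_nth (\<psi> v) 0 = h (z $ v)"
    and eq: "\<And>i. fev h \<phi> (f i) = fev h \<psi> (f i)"
  shows "\<phi> = \<psi>"
proof -
  obtain A where A: "A ** jac f z = mat 1" using inv by (auto simp: invertible_def)
  have A': "(\<Sum>i\<in>UNIV. A $ v $ i * peval (pd u (f i)) z) = (if v = u then 1 else 0)" for u v
    using arg_cong[OF A, of "\<lambda>M. M $ v $ u"] by (simp add: matrix_matrix_mult_def jac_def mat_def)
  have ag: "agree n \<phi> \<psi>" for n
  proof (induction n)
    case 0
    show ?case by (simp add: agree_def)
  next
    case (Suc n)
    show ?case
    proof (cases "n = 0")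
      case True
      then show ?thesis using z by (simp add: agree_def)
    next
      case False
      have 0: "(\<Sum>u\<in>UNIV. h (peval (pd u (f i)) z) * fps_nth (\<phi> u - \<psi> u) n) = 0" for i
        using taylor_fps(2)[OF h _ Suc z(1), of "f i"] False eq by simp
      have "fps_nth (\<phi> v - \<psi> v) n = (\<Sum>u\<in>UNIV. h (\<Sum>i\<in>UNIV. A $ v $ i * peval (pd u (f i)) z) * fps_nth (\<phi> u - \<psi> u) n)" for v
        unfolding A' by (simp add: if_distrib[of h] rhom_0[OF h] rhom_1[OF h] if_distrib[of "\<lambda>a. a * _"] cong: if_cong)
      also have "\<dots> v = (\<Sum>i\<in>UNIV. h (A $ v $ i) * (\<Sum>u\<in>UNIV. h (peval (pd u (f i)) z) * fps_nth (\<phi> u - \<psi> u) n))" for v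
        unfolding rhom_sum[OF h] rhom_mult[OF h] sum_distrib_left sum_distrib_right
        by (subst sum.swap) (simp add: mult.assoc)
      finally have "fps_nth (\<phi> v - \<psi> v) n = 0" for v unfolding 0 by simp
      then show ?thesis using Suc by (auto simp: agree_def less_Suc_eq)
    qed
  qed
  have "fps_nth (\<phi> v) n = fps_nth (\<psi> v) n" for v n using ag[of "Suc n"] by (simp add: agree_def)
  then show ?thesis by (simp add: fun_eq_iff fps_eq_iff)
qed

text \<open>Newton's iteration with the constant matrix \<open>A\<close> is a contraction for the \<open>T\<close>-adic distance.\<close>

lemma arc_exists:
  fixes f :: "'v::finite \<Rightarrow> 'v mpoly"
  assumes h: "rhom h" and inv: "invertible (jac f z)" and f: "\<And>i. peval (f i) z = 0"
    and \<gamma>: "\<And>i. fps_nth (\<gamma> i) 0 = 0"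
  obtains \<phi> where "\<And>v. fps_nth (\<phi> v) 0 = h (z $ v)" "\<And>i. fev h \<phi> (f i) = \<gamma> i"
proof -
  obtain A where A: "A ** jac f z = mat 1" "jac f z ** A = mat 1" using inv by (auto simp: invertible_def)
  have A1: "(\<Sum>i\<in>UNIV. A $ v $ i * peval (pd u (f i)) z) = (if v = u then 1 else 0)" for u v
    using arg_cong[OF A(1), of "\<lambda>M. M $ v $ u"] by (simp add: matrix_matrix_mult_def jac_def mat_def)
  have A2: "(\<Sum>v\<in>UNIV. peval (pd v (f i)) z * A $ v $ j) = (if i = j then 1 else 0)" for i j
    using arg_cong[OF A(2), of "\<lambda>M. M $ i $ j"] by (simp add: matrix_matrix_mult_def jac_def mat_def)
  define \<Psi> where "\<Psi> \<phi> v = \<phi> v + (\<Sum>i\<in>UNIV. fps_const (h (A $ v $ i)) * (\<gamma> i - fev h \<phi> (f i)))" for \<phi> v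
  define ok where "ok \<phi> \<longleftrightarrow> (\<forall>v. fps_nth (\<phi> v) 0 = h (z $ v))" for \<phi> :: "'v \<Rightarrow> 'a fps"
  have ok_\<Psi>: "ok (\<Psi> \<phi>)" if "ok \<phi>" for \<phi>
    using that fev_nth_0[OF h, of \<phi> z] by (simp add: ok_def \<Psi>_def fps_sum_nth \<gamma> f rhom_0[OF h])
  have contr: "agree (Suc n) (\<Psi> \<phi>) (\<Psi> \<psi>)" if ag: "agree n \<phi> \<psi>" and o: "ok \<phi>" "ok \<psi>" for \<phi> \<psi> n
  proof (cases "n = 0")
    case True
    then show ?thesis using ok_\<Psi>[OF o(1)] ok_\<Psi>[OF o(2)] by (simp add: ok_def agree_def)
  next
    case False
    then have n: "n \<ge> 1" by simp
    have z: "\<And>v. fps_nth (\<phi> v) 0 = h (z $ v)" using o by (simp add: ok_def)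
    note T = taylor_fps[OF h n ag z]
    have d: "\<Psi> \<phi> v - \<Psi> \<psi> v = (\<phi> v - \<psi> v) - (\<Sum>i\<in>UNIV. fps_const (h (A $ v $ i)) * (fev h \<phi> (f i) - fev h \<psi> (f i)))" for v
      by (simp add: \<Psi>_def algebra_simps sum_subtractf)
    have "fps_nth (\<Psi> \<phi> v - \<Psi> \<psi> v) i = 0" if "i < n" for i v
      unfolding d using T(1)[OF that] ag that by (simp add: fps_sum_nth agree_def)
    moreover have "fps_nth (\<Psi> \<phi> v - \<Psi> \<psi> v) n = 0" for v
    proof -
      have "fps_nth (\<phi> v - \<psi> v) n = (\<Sum>u\<in>UNIV. h (\<Sum>i\<in>UNIV. A $ v $ i * peval (pd u (f i)) z) * fps_nth (\<phi> u - \<psi> u) n)"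
        unfolding A1 by (simp add: if_distrib[of h] rhom_0[OF h] rhom_1[OF h] if_distrib[of "\<lambda>a. a * _"] cong: if_cong)
      also have "\<dots> = (\<Sum>i\<in>UNIV. h (A $ v $ i) * (\<Sum>u\<in>UNIV. h (peval (pd u (f i)) z) * fps_nth (\<phi> u - \<psi> u) n))"
        unfolding rhom_sum[OF h] rhom_mult[OF h] sum_distrib_left sum_distrib_right
        by (subst sum.swap) (simp add: mult.assoc)
      finally show ?thesis
        unfolding d fps_sub_nth[of "\<phi> v - \<psi> v"] fps_sum_nth fps_mult_left_const_nth T(2) by simp
    qed
    ultimately show ?thesis by (auto simp: agree_def less_Suc_eq)
  qed
  define it where "it n = (\<Psi> ^^ n) (\<lambda>v. fps_const (h (z $ v)))" for n
  have it_Suc: "it (Suc n) = \<Psi> (it n)" for n by (simp add: it_def)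
  have ok_it: "ok (it n)" for n
    by (induction n) (auto simp: it_Suc ok_\<Psi>, auto simp: it_def ok_def)
  have it1: "agree (Suc n) (it n) (it (Suc n))" for n
  proof (induction n)
    case 0
    show ?case using ok_it by (simp add: agree_def ok_def)
  next
    case (Suc n)
    then show ?case using contr[OF Suc ok_it ok_it] by (simp add: it_Suc)
  qed
  have it2: "agree (Suc n) (it n) (it (n + m))" for n m
  proof (induction m)
    case (Suc m)
    show ?case using agree_trans'[OF Suc it1[of "n + m"]] by simp
  qed (simp add: agree_def)
  \<comment> \<open>The n-th coefficient is final from the n-th iterate on, by \<open>it2\<close>;
    so the diagonal is the limit.\<close>
  define L where "L v = Abs_fps (\<lambda>n. fps_nth (it n v) n)" for v
  have L: "agree (Suc n) L (it n)" for n
    unfolding agree_def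
  proof (intro allI impI)
    fix v i assume "i < Suc n"
    then show "fps_nth (L v) i = fps_nth (it n v) i"
      using it2[of i "n - i"] by (simp add: L_def agree_def)
  qed
  have okL: "ok L" using L[of 0] ok_it[of 0] by (simp add: agree_def ok_def)
  have ag: "agree (Suc (Suc n)) (\<Psi> L) L" for n
    using agree_trans[OF contr[OF L[of n] okL ok_it]] L[of "Suc n"] by (simp add: it_Suc)
  have "fps_nth (\<Psi> L x) n = fps_nth (L x) n" for x n
    using ag[of n] by (simp add: agree_def)
  then have "\<Psi> L = L" by (simp add: fun_eq_iff fps_eq_iff)
  then have 0: "(\<Sum>i\<in>UNIV. fps_const (h (A $ v $ i)) * (\<gamma> i - fev h L (f i))) = 0" for v
  proof -
    have "L v + (\<Sum>i\<in>UNIV. fps_const (h (A $ v $ i)) * (\<gamma> i - fev h L (f i))) = \<Psi> L v"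
      by (simp only: \<Psi>_def)
    also have "\<dots> = L v + 0" by (simp only: \<open>\<Psi> L = L\<close> add_0_right)
    finally show ?thesis by (rule add_left_imp_eq)
  qed
  have "\<gamma> j - fev h L (f j) = (\<Sum>i\<in>UNIV. fps_const (h (if j = i then 1 else 0)) * (\<gamma> i - fev h L (f i)))" for j
    by (simp add: if_distrib[of h] rhom_0[OF h] rhom_1[OF h] if_distrib[of fps_const] if_distrib[of "\<lambda>a. a * _"] cong: if_cong)
  also have "\<dots> j = (\<Sum>v\<in>UNIV. fps_const (h (peval (pd v (f j)) z)) * (\<Sum>i\<in>UNIV. fps_const (h (A $ v $ i)) * (\<gamma> i - fev h L (f i))))" for j
    unfolding A2[symmetric] rhom_sum[OF h] rhom_mult[OF h] rhom_sum[OF rhom_fps_const] rhom_mult[OF rhom_fps_const] sum_distrib_left sum_distrib_right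
    by (subst sum.swap) (simp only: mult.assoc)
  finally have "fev h L (f j) = \<gamma> j" for j unfolding 0 by simp
  then show ?thesis using okL by (intro that[of L]) (auto simp: ok_def)
qed

section \<open>Complex arcs at a point, and the polynomials that vanish on them\<close>

definition arc :: "complex^'v \<Rightarrow> ('v \<Rightarrow> complex fps) \<Rightarrow> bool" where
  "arc z \<phi> \<longleftrightarrow> (\<forall>v. fps_nth (\<phi> v) 0 = z $ v)"

text \<open>A substitute for the extension of an ideal to the completed local ring at \<open>z\<close>.\<close>

definition Ihat :: "complex^'v \<Rightarrow> 'v mpoly set \<Rightarrow> 'v mpoly set" where
  "Ihat z F = {g. \<forall>\<phi>. arc z \<phi> \<longrightarrow> (\<forall>f\<in>F. fe \<phi> f = 0) \<longrightarrow> fe \<phi> g = 0}"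

lemma not_Ihat: "g \<notin> Ihat z F \<Longrightarrow> \<exists>\<phi>. arc z \<phi> \<and> (\<forall>f\<in>F. fe \<phi> f = 0) \<and> fe \<phi> g \<noteq> 0"
  by (simp add: Ihat_def)

lemma Ihat_superset: "F \<subseteq> Ihat z F"
  by (auto simp: Ihat_def)

lemma ideal_Ihat: "ideal_in UNIV (Ihat z F)"
  unfolding ideal_in_def Ihat_def by (intro conjI ballI CollectI allI impI) (simp_all add: fe_hom)

lemma Ihat_mono: "F \<subseteq> G \<Longrightarrow> Ihat z F \<subseteq> Ihat z G"
  unfolding Ihat_def by blast

lemma arc_peval: "arc z \<phi> \<Longrightarrow> fps_nth (fe \<phi> f) 0 = peval f z"
  by (rule fev_nth_0[OF rhom_id(2)]) (simp add: arc_def)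

definition fps_map :: "('a::comm_ring_1 \<Rightarrow> 'b::comm_ring_1) \<Rightarrow> 'a fps \<Rightarrow> 'b fps" where
  "fps_map g F = Abs_fps (\<lambda>n. g (fps_nth F n))"

lemma rhom_fps_map: assumes "rhom g" shows "rhom (fps_map g)"
  unfolding rhom_def
proof (intro conjI allI)
  show "fps_map g 1 = 1" by (simp add: fps_eq_iff fps_map_def rhom_0[OF assms] rhom_1[OF assms])
  show "fps_map g (x + y) = fps_map g x + fps_map g y" for x y
    by (simp add: fps_eq_iff fps_map_def rhom_add[OF assms])
  show "fps_map g (x * y) = fps_map g x * fps_map g y" for x y
    by (simp add: fps_eq_iff fps_map_def fps_mult_nth rhom_sum[OF assms] rhom_mult[OF assms])
qed

text \<open>A full system of local parameters, indexed by the variables so that the Jacobian is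
  square. Subsets \<open>S\<close> of the indices then cut out regular subschemes.\<close>

definition param_system :: "complex^'v \<Rightarrow> ('v \<Rightarrow> 'v mpoly) \<Rightarrow> bool" where
  "param_system z f \<longleftrightarrow> (\<forall>i. peval (f i) z = 0) \<and> invertible (jac f z)"

lemma param_system_arc:
  fixes f :: "'v::finite \<Rightarrow> 'v mpoly"
  assumes "param_system z f" "\<And>i. fps_nth (\<gamma> i) 0 = 0"
  obtains \<phi> where "arc z \<phi>" "\<And>i. fe \<phi> (f i) = \<gamma> i"
proof -
  have f: "invertible (jac f z)" "\<And>i. peval (f i) z = 0" using assms(1) by (auto simp: param_system_def)
  obtain \<phi> where "\<And>v. fps_nth (\<phi> v) 0 = z $ v" "\<And>i. fe \<phi> (f i) = \<gamma> i"
    by (rule arc_exists[OF rhom_id(2) f, where \<gamma> = \<gamma>, OF assms(2)]) blast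
  then show ?thesis by (intro that[of \<phi>]) (auto simp: arc_def)
qed

text \<open>Two arcs annihilated by part of a system of parameters lie in a family of such arcs which is
  parametrized by the affine line.\<close>

lemma Ihat_prime:
  fixes f :: "'v::finite \<Rightarrow> 'v mpoly"
  assumes f: "param_system z f" and gh: "g * h \<in> Ihat z (f ` S)"
  shows "g \<in> Ihat z (f ` S) \<or> h \<in> Ihat z (f ` S)"
proof (rule ccontr)
  assume n: "\<not> ?thesis"
  obtain \<phi> where \<phi>: "arc z \<phi>" "\<forall>i\<in>S. fe \<phi> (f i) = 0" "fe \<phi> g \<noteq> 0"
    using not_Ihat[of g z "f ` S"] n by auto
  obtain \<psi> where \<psi>: "arc z \<psi>" "\<forall>i\<in>S. fe \<psi> (f i) = 0" "fe \<psi> h \<noteq> 0"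
    using not_Ihat[of h z "f ` S"] n by auto
  have inv: "invertible (jac f z)" and f0: "\<And>i. peval (f i) z = 0" using f by (auto simp: param_system_def)
  \<comment> \<open>In the parameters, the straight line from \<open>\<phi>\<close> at s = 0 to
    \<open>\<psi>\<close> at s = 1, where s is the variable of the coefficient polynomials.\<close>
  define \<gamma> where "\<gamma> i = Abs_fps (\<lambda>n. [:fps_nth (fe \<phi> (f i)) n, fps_nth (fe \<psi> (f i)) n - fps_nth (fe \<phi> (f i)) n:])" for i
  have "fps_nth (\<gamma> i) 0 = 0" for i using arc_peval[OF \<phi>(1), of "f i"] arc_peval[OF \<psi>(1), of "f i"] f0 by (simp add: \<gamma>_def)
  then obtain \<Phi> where \<Phi>: "\<And>v. fps_nth (\<Phi> v) 0 = [:z $ v:]" "\<And>i. fev (\<lambda>c. [:c:]) \<Phi> (f i) = \<gamma> i"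
    using arc_exists[OF rhom_pCons inv f0] by blast
  define sp where "sp s = fps_map (\<lambda>p :: complex poly. poly p s)" for s
  have sp: "rhom (sp s)" for s unfolding sp_def by (rule rhom_fps_map[OF rhom_poly])
  have sp_fev: "sp s (fev (\<lambda>c. [:c:]) \<Phi> q) = fe (\<lambda>v. sp s (\<Phi> v)) q" for s q
  proof -
    have "sp s (fps_const [:c:]) = fps_const c" for c
      by (simp add: sp_def fps_map_def fps_eq_iff)
    then show ?thesis
      unfolding fev_def by (subst rhom_subst_comp[OF sp rhom_comp[OF rhom_fps_const rhom_pCons]]) simp
  qed
  have arc: "arc z (\<lambda>v. sp s (\<Phi> v))" for s using \<Phi>(1) by (simp add: arc_def sp_def fps_map_def)
  have fs: "fe (\<lambda>v. sp s (\<Phi> v)) (f i) = sp s (\<gamma> i)" for s i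
    by (simp add: \<Phi>(2) flip: sp_fev)
  have "(\<lambda>v. sp 0 (\<Phi> v)) = \<phi>"
    by (rule arc_unique[OF rhom_id(2) inv])
      (use arc[of 0] \<phi>(1) in \<open>auto simp: arc_def fs, auto simp: sp_def fps_map_def \<gamma>_def fps_eq_iff\<close>)
  then have 1: "fev (\<lambda>c. [:c:]) \<Phi> g \<noteq> 0" using \<phi>(3) sp_fev[of 0 g] rhom_0[OF sp] by auto
  have "(\<lambda>v. sp 1 (\<Phi> v)) = \<psi>"
    by (rule arc_unique[OF rhom_id(2) inv])
      (use arc[of 1] \<psi>(1) in \<open>auto simp: arc_def fs, auto simp: sp_def fps_map_def \<gamma>_def fps_eq_iff\<close>)
  then have 2: "fev (\<lambda>c. [:c:]) \<Phi> h \<noteq> 0" using \<psi>(3) sp_fev[of 1 h] rhom_0[OF sp] by auto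
  \<comment> \<open>Power series over the polynomials in s form a domain. Some coefficient is a
    nonzero polynomial, and a value of s where it does not vanish gives an arc in the family on
    which \<open>g * h\<close> is nonzero.\<close>
  have "fev (\<lambda>c. [:c:]) \<Phi> (g * h) \<noteq> 0" using 1 2 by (simp add: fev_hom[OF rhom_pCons])
  then obtain n where "fps_nth (fev (\<lambda>c. [:c:]) \<Phi> (g * h)) n \<noteq> 0" by (auto simp: fps_eq_iff)
  then obtain s where "poly (fps_nth (fev (\<lambda>c. [:c:]) \<Phi> (g * h)) n) s \<noteq> 0" using poly_all_0_iff_0 by blast
  then have "fps_nth (sp s (fev (\<lambda>c. [:c:]) \<Phi> (g * h))) n \<noteq> 0" by (simp add: sp_def fps_map_def)
  then have "fe (\<lambda>v. sp s (\<Phi> v)) (g * h) \<noteq> 0" by (auto simp: sp_fev)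
  moreover have "fe (\<lambda>v. sp s (\<Phi> v)) (f i) = 0" if "i \<in> S" for i
    unfolding fs using that \<phi>(2) \<psi>(2) by (simp add: sp_def fps_map_def \<gamma>_def fps_eq_iff)
  moreover have "fe (\<lambda>v. sp s (\<Phi> v)) (g * h) = 0" if "\<forall>i\<in>S. fe (\<lambda>v. sp s (\<Phi> v)) (f i) = 0"
    using gh arc[of s] that by (simp add: Ihat_def)
  ultimately show False by blast
qed

section \<open>Linear algebra\<close>

definition dotp :: "complex^'v::finite \<Rightarrow> complex^'v \<Rightarrow> complex" where
  "dotp g w = (\<Sum>v\<in>UNIV. g $ v * w $ v)"

lemma dotp_lin: "dotp (g + h) w = dotp g w + dotp h w" "dotp (c *s g) w = c * dotp g w" "dotp 0 w = 0"
  "dotp g (w + u) = dotp g w + dotp g u" "dotp g (c *s w) = c * dotp g w" "dotp g 0 = 0"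
  by (simp_all add: dotp_def algebra_simps sum.distrib sum_distrib_left)

lemma matvec_dotp: "((\<chi> i. b i) *v w) $ i = dotp (b i) w"
  by (simp add: matrix_vector_mult_def dotp_def)

lemma dotp_span:
  assumes "g \<in> vec.span B" "\<And>b. b \<in> B \<Longrightarrow> dotp b w = 0" shows "dotp g w = 0"
  using assms(1) by (induction rule: vec.span_induct_alt) (auto simp: dotp_lin assms(2))

lemma dim_rows:
  fixes A :: "complex^'v::finite^'v"
  assumes "invertible A"
  shows "vec.dim {w. \<forall>i\<in>S. (A *v w) $ i = 0} = card (- S)"
proof -
  obtain B where B: "A ** B = mat 1" "B ** A = mat 1" using assms by (auto simp: invertible_def)
  let ?U = "{x :: complex^'v. \<forall>i. i \<notin> - S \<longrightarrow> x $ i = 0}"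
  have "{w. \<forall>i\<in>S. (A *v w) $ i = 0} = (\<lambda>x. B *v x) ` ?U"
  proof safe
    fix w assume "\<forall>i\<in>S. (A *v w) $ i = 0"
    moreover have "w = B *v (A *v w)" by (simp add: matrix_vector_mul_assoc B)
    ultimately show "w \<in> (\<lambda>x. B *v x) ` ?U" by (intro image_eqI[of _ _ "A *v w"]) auto
  next
    fix x :: "complex^'v" and i assume "\<forall>i. i \<notin> - S \<longrightarrow> x $ i = 0" "i \<in> S"
    moreover have "A *v (B *v x) = x" by (simp add: matrix_vector_mul_assoc B)
    ultimately show "(A *v (B *v x)) $ i = 0" by simp
  qed
  moreover have "vec.dim ((\<lambda>x. B *v x) ` ?U) = vec.dim ?U"
  proof (rule vec.dim_image_eq)
    show "inj_on ((*v) B) (vec.span ?U)"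
      by (rule inj_on_inverseI[of _ "(*v) A"]) (simp add: matrix_vector_mul_assoc B)
  qed (rule matrix_vector_mul_linear_gen)
  ultimately show ?thesis using dim_substandard_cart[where 'a = complex, of "- S"] by simp
qed

text \<open>A maximal independent subset of \<open>G\<close> containing \<open>I0\<close> is
  completed by unit vectors to a basis, and the basis is indexed by the variables to form a matrix.
  The completing rows are constant, so they survive a later specialization of the other
  rows.\<close>

lemma choose_rows:
  fixes G :: "(complex^'v::finite) set"
  assumes I0: "I0 \<subseteq> G" "vec.independent I0"
  obtains b :: "'v \<Rightarrow> complex^'v" and S where "b ` S \<subseteq> G" "I0 \<subseteq> b ` S" "b ` (- S) \<subseteq> range (\<lambda>v. axis v 1)" "inj b"
    "invertible (\<chi> i. b i)" "G \<subseteq> vec.span (b ` S)"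
proof -
  obtain B1 where B1: "I0 \<subseteq> B1" "B1 \<subseteq> G" "vec.independent B1" "G \<subseteq> vec.span B1"
    using vec.maximal_independent_subset_extend[OF I0] by blast
  have "B1 \<subseteq> B1 \<union> range (\<lambda>v. axis v 1)" by simp
  then obtain B2 where B2: "B1 \<subseteq> B2" "B2 \<subseteq> B1 \<union> range (\<lambda>v. axis v 1)" "vec.independent B2"
    "B1 \<union> range (\<lambda>v. axis v 1) \<subseteq> vec.span B2"
    using vec.maximal_independent_subset_extend[OF _ B1(3)] by blast
  have ax: "x \<in> vec.span (range (\<lambda>v. axis v 1))" for x :: "complex^'v"
  proof -
    have "x = (\<Sum>v\<in>UNIV. x $ v *s axis v 1)" by (simp add: basis_expansion)
    moreover have "\<dots> \<in> vec.span (range (\<lambda>v. axis v 1))"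
      by (intro vec.span_sum vec.span_scale vec.span_base) auto
    ultimately show ?thesis by simp
  qed
  have "UNIV \<subseteq> vec.span B2" using B2(4) vec.span_mono[of "range (\<lambda>v. axis v 1)" "vec.span B2"] ax unfolding vec.span_span by blast
  then have c: "card B2 = CARD('v)" using vec.basis_card_eq_dim[of B2 UNIV] B2(3) vec_dim_card by simp
  have fin: "finite B2" using B2(3) vec.finiteI_independent by blast
  then obtain b :: "'v \<Rightarrow> complex^'v" where b: "bij_betw b UNIV B2" using c finite_same_card_bij[of "UNIV :: 'v set" B2] by auto
  define S where "S = b -` B1"
  have bS: "b ` S = B1" using b B2(1) by (auto simp: S_def bij_betw_def)
  have inj: "inj b" using b by (simp add: bij_betw_def)
  have "\<forall>c. (\<Sum>i\<in>UNIV. c i *s row i (\<chi> i. b i)) = 0 \<longrightarrow> (\<forall>i. c i = 0)"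
  proof (intro allI impI)
    fix c i assume 0: "(\<Sum>i\<in>UNIV. c i *s row i (\<chi> i. b i)) = 0"
    have r: "row i (\<chi> i. b i) = b i" for i by (simp add: row_def)
    have "(\<Sum>x\<in>B2. c (Hilbert_Choice.inv b x) *s x) = (\<Sum>i\<in>UNIV. c (Hilbert_Choice.inv b (b i)) *s b i)"
      by (rule sum.reindex_bij_betw[OF b, symmetric])
    also have "\<dots> = 0" using 0 inj by (simp add: r)
    finally have "c (Hilbert_Choice.inv b (b i)) = 0"
      by (intro vec.independentD[OF B2(3) fin order.refl, of "\<lambda>x. c (Hilbert_Choice.inv b x)" "b i"])
        (use b in \<open>auto simp: bij_betw_def\<close>)
    then show "c i = 0" using inj by simp
  qed
  then have "\<exists>B. (\<chi> i. b i) ** B = mat 1" by (simp only: matrix_right_invertible_independent_rows)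
  then have inv: "invertible (\<chi> i. b i)" by (auto simp: invertible_right_inverse)
  have ax: "b ` (- S) \<subseteq> range (\<lambda>v. axis v 1)"
  proof
    fix x assume "x \<in> b ` (- S)"
    then obtain i where "x = b i" "b i \<notin> B1" by (auto simp: S_def)
    moreover have "b i \<in> B2" using b by (auto simp: bij_betw_def)
    ultimately show "x \<in> range (\<lambda>v. axis v 1)" using B2(2) by auto
  qed
  show ?thesis
    by (rule that[of b S]) (use bS B1 in \<open>simp_all add: inj inv ax\<close>)
qed

lemma rows_ann:
  assumes "b ` S \<subseteq> G" "G \<subseteq> vec.span (b ` S)"
  shows "{w. \<forall>g\<in>G. dotp g w = 0} = {w. \<forall>i\<in>S. ((\<chi> i. b i) *v w) $ i = 0}"
proof -
  have "(\<forall>g\<in>G. dotp g w = 0) \<longleftrightarrow> (\<forall>i\<in>S. dotp (b i) w = 0)" for w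
  proof
    assume "\<forall>i\<in>S. dotp (b i) w = 0"
    then have "dotp g w = 0" if "g \<in> G" for g
      using dotp_span[OF subsetD[OF assms(2) that], of w] by auto
    then show "\<forall>g\<in>G. dotp g w = 0" by simp
  qed (use assms(1) in auto)
  then show ?thesis by (simp only: matvec_dotp)
qed

text \<open>The hypothesis \<open>e\<close> is independence of the vectors modulo \<open>T\<close>:
  together with a basis of \<open>T\<close> they are independent in \<open>U\<close>.\<close>

lemma dim_mod:
  fixes T :: "(complex^'v::finite) set"
  assumes T: "vec.subspace T" "T \<subseteq> U" and J: "finite J" "\<And>j. j \<in> J \<Longrightarrow> e j \<in> U"
    and e: "\<And>a. (\<Sum>j\<in>J. a j *s e j) \<in> T \<Longrightarrow> \<forall>j\<in>J. a j = 0"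
  shows "vec.dim T + card J \<le> vec.dim U"
proof -
  obtain B where B: "B \<subseteq> T" "vec.independent B" "T \<subseteq> vec.span B" "card B = vec.dim T"
    using vec.basis_exists by blast
  have fB: "finite B" using B(2) vec.finiteI_independent by blast
  have inj: "inj_on e J"
  proof (rule inj_onI, rule ccontr)
    fix i j assume ij: "i \<in> J" "j \<in> J" "e i = e j" "i \<noteq> j"
    define a where "a k = (if k = i then 1 else if k = j then -1 else 0 :: complex)" for k
    have "(\<Sum>k\<in>J. a k *s e k) = (\<Sum>k\<in>{i, j}. a k *s e k)"
      by (rule sum.mono_neutral_right) (use ij J in \<open>auto simp: a_def\<close>)
    also have "\<dots> = 0" using ij by (simp add: a_def)
    finally have "a i = 0" using e[of a] ij vec.subspace_0[OF T(1)] by simp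
    then show False by (simp add: a_def)
  qed
  have BT: "vec.span B \<subseteq> T" using vec.span_minimal[OF B(1) T(1)] .
  have ne: "e j \<notin> T" if "j \<in> J" for j
  proof
    assume "e j \<in> T"
    moreover have "(\<Sum>k\<in>J. (if k = j then 1 else 0) *s e k) = e j"
      using that J by (simp add: if_distrib[of "\<lambda>c. c *s _"] cong: if_cong)
    ultimately show False using e[of "\<lambda>k. if k = j then 1 else 0"] that by auto
  qed
  have "vec.independent (B \<union> e ` J)"
  proof (rule vec.independent_if_scalars_zero)
    show "finite (B \<union> e ` J)" using fB J by simp
    fix f x assume s: "(\<Sum>x\<in>B \<union> e ` J. f x *s x) = 0" and x: "x \<in> B \<union> e ` J"
    have d: "B \<inter> e ` J = {}" using ne B(1) by auto
    have "(\<Sum>x\<in>B. f x *s x) + (\<Sum>j\<in>J. f (e j) *s e j) = 0"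
      using s by (simp add: sum.union_disjoint[OF fB finite_imageI[OF J(1)] d] sum.reindex[OF inj])
    moreover have bT: "(\<Sum>x\<in>B. f x *s x) \<in> T"
      using B(1) by (intro vec.subspace_sum[OF T(1)] vec.subspace_scale[OF T(1)]) auto
    moreover have "(\<Sum>j\<in>J. f (e j) *s e j) = - (\<Sum>x\<in>B. f x *s x)"
      using calculation(1) by (simp add: eq_neg_iff_add_eq_0 add.commute)
    ultimately have "(\<Sum>j\<in>J. f (e j) *s e j) \<in> T"
      using vec.subspace_neg[OF T(1) bT] by (simp only:)
    then have z: "\<forall>j\<in>J. f (e j) = 0" by (rule e)
    then have "(\<Sum>x\<in>B. f x *s x) = 0" using \<open>(\<Sum>x\<in>B. f x *s x) + (\<Sum>j\<in>J. f (e j) *s e j) = 0\<close> by simp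
    then have "f x = 0" if "x \<in> B" using vec.independentD[OF B(2) fB order.refl] that by blast
    then show "f x = 0" using x z by auto
  qed
  moreover have "B \<union> e ` J \<subseteq> U" using B(1) T(2) J(2) by auto
  ultimately have "card (B \<union> e ` J) \<le> vec.dim U"
    using vec.independent_card_le_dim[of "B \<union> e ` J" U] by simp
  moreover have "card (B \<union> e ` J) = card B + card J"
    using fB J ne B(1) by (subst card_Un_disjoint) (auto simp: card_image[OF inj])
  ultimately show ?thesis using B(4) by simp
qed

section \<open>Ideals of the polynomial ring\<close>

lemma rta_simps [simp]:
  "carrier (ring_of_type_algebra :: 'a::comm_ring_1 ring) = UNIV"
  "x \<otimes>\<^bsub>ring_of_type_algebra\<^esub> y = x * (y :: 'a)"
  "\<one>\<^bsub>ring_of_type_algebra\<^esub> = (1 :: 'a)" "\<zero>\<^bsub>ring_of_type_algebra\<^esub> = (0 :: 'a)"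
  "x \<oplus>\<^bsub>ring_of_type_algebra\<^esub> y = x + (y :: 'a)"
  by (simp_all add: ring_of_type_algebra_def)

lemma ideal_iff: "ideal (I :: 'a::comm_ring_1 set) ring_of_type_algebra \<longleftrightarrow> ideal_in UNIV I"
proof
  assume "ideal I ring_of_type_algebra"
  then interpret ideal I "ring_of_type_algebra :: 'a ring" .
  show "ideal_in UNIV I"
    unfolding ideal_in_def using additive_subgroup.zero_closed[OF is_additive_subgroup]
      additive_subgroup.a_closed[OF is_additive_subgroup] I_l_closed by auto
next
  assume I: "ideal_in UNIV I"
  interpret ring "ring_of_type_algebra :: 'a ring" by (rule ring_from_type_algebra)
  have neg: "\<ominus>\<^bsub>ring_of_type_algebra\<^esub> x = - x" for x :: 'a
    by (rule minus_equality) auto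
  show "ideal I ring_of_type_algebra"
  proof (rule idealI)
    show "subgroup I (add_monoid ring_of_type_algebra)"
    proof (rule group.subgroupI)
      show "Group.group (add_monoid (ring_of_type_algebra :: 'a ring))" by (rule a_group)
      show "I \<noteq> {}" using ideal_in_0[OF I] by auto
      fix x y assume "x \<in> I" "y \<in> I"
      then show "x \<otimes>\<^bsub>add_monoid ring_of_type_algebra\<^esub> y \<in> I" using ideal_in_add[OF I] by simp
      show "inv\<^bsub>add_monoid ring_of_type_algebra\<^esub> x \<in> I"
        using neg[of x] ideal_in_minus[OF srng_UNIV I \<open>x \<in> I\<close>] by (simp add: a_inv_def)
    qed simp
  next
    fix a x assume "a \<in> I"
    then have "x * a \<in> I" by (rule ideal_in_mult[OF I UNIV_I])
    then show "x \<otimes>\<^bsub>ring_of_type_algebra\<^esub> a \<in> I" "a \<otimes>\<^bsub>ring_of_type_algebra\<^esub> x \<in> I"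
      by (simp_all add: mult.commute)
  qed (rule ring_axioms)
qed

definition prime_id :: "'a::comm_ring_1 set \<Rightarrow> bool" where
  "prime_id P \<longleftrightarrow> ideal_in UNIV P \<and> 1 \<notin> P \<and> (\<forall>x y. x * y \<in> P \<longrightarrow> x \<in> P \<or> y \<in> P)"

lemma primeideal_iff: "primeideal (P :: 'a::comm_ring_1 set) ring_of_type_algebra \<longleftrightarrow> prime_id P"
proof
  assume "primeideal P ring_of_type_algebra"
  then interpret primeideal P "ring_of_type_algebra :: 'a ring" .
  have "1 \<notin> P" using one_imp_carrier I_notcarr by auto
  moreover have "ideal_in UNIV P" using is_ideal by (simp add: ideal_iff)
  moreover have "x \<in> P \<or> y \<in> P" if "x * y \<in> P" for x y using I_prime[of x y] that by simp
  ultimately show "prime_id P" by (simp add: prime_id_def)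
next
  assume "prime_id P"
  then have P: "ideal_in UNIV P" "1 \<notin> P" "\<And>x y. x * y \<in> P \<Longrightarrow> x \<in> P \<or> y \<in> P"
    by (auto simp: prime_id_def)
  show "primeideal P ring_of_type_algebra"
  proof (rule primeidealI)
    show "carrier ring_of_type_algebra \<noteq> P" using P(2) by auto
  qed (use P(1,3) in \<open>simp_all add: ideal_iff cring_from_type_algebra\<close>)
qed

lemma genideal_iff: "genideal ring_of_type_algebra F = igen UNIV (F :: 'a::comm_ring_1 set)"
proof -
  interpret ring "ring_of_type_algebra :: 'a ring" by (rule ring_from_type_algebra)
  have "ideal (igen UNIV F) ring_of_type_algebra"
    by (simp add: ideal_iff ideal_in_igen srng_UNIV)
  then show ?thesis
  proof (intro antisym)
    assume "ideal (igen UNIV F) ring_of_type_algebra"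
    then show "genideal ring_of_type_algebra F \<subseteq> igen UNIV F"
      by (rule genideal_minimal) (auto intro: igen_base srng_UNIV)
    have "ideal_in UNIV (genideal ring_of_type_algebra F)"
      using genideal_ideal[of F] by (simp add: ideal_iff)
    then show "igen UNIV F \<subseteq> genideal ring_of_type_algebra F"
      by (rule igen_least) (use genideal_self[of F] in simp)
  qed
qed


section \<open>Regular systems of parameters\<close>

lemma Var_mpow1: "Var v - Const (z $ v) \<in> mpow z 1"
  using mpow_Suc[of 1 z 0 v] by simp

lemmas ideal_mpow_add = ideal_in_add[OF ideal_mpow]
lemmas ideal_mpow_mult = ideal_in_mult[OF ideal_mpow UNIV_I]

lemma const_mpow1: "f - Const (peval f z) \<in> mpow z 1"
proof (induction f rule: mpoly_induct)
  case (add f g)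
  have e: "f + g - Const (peval (f + g) z) = (f - Const (peval f z)) + (g - Const (peval g z))"
    by (simp add: peval_hom Const_simps)
  show ?case unfolding e by (rule ideal_mpow_add[OF add])
next
  case (mult f g)
  have e: "f * g - Const (peval (f * g) z) = g * (f - Const (peval f z)) + Const (peval f z) * (g - Const (peval g z))"
    by (simp add: peval_hom Const_simps algebra_simps)
  show ?case unfolding e by (rule ideal_mpow_add[OF ideal_mpow_mult[OF mult(1)] ideal_mpow_mult[OF mult(2)]])
next
  case (Const c)
  show ?case using ideal_in_0[OF ideal_mpow[of z 1]] by simp
qed (simp add: Var_mpow1 del: One_nat_def)

lemma taylor_mpow:
  fixes f :: "'v::finite mpoly"
  shows "f - Const (peval f z) - (\<Sum>v\<in>UNIV. Const (peval (pd v f) z) * (Var v - Const (z $ v))) \<in> mpow z 2"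
proof -
  define L where "L f = (\<Sum>v\<in>UNIV. Const (peval (pd v f) z) * (Var v - Const (z $ v)))" for f :: "'v mpoly"
  have "f - Const (peval f z) - L f \<in> mpow z 2"
  proof (induction f rule: mpoly_induct)
    case (Const c)
    show ?case using ideal_in_0[OF ideal_mpow[of z 2]] by (simp add: L_def peval_hom Const_simps del: mpow.simps)
  next
    case (Var u)
    have "L (Var u) = (\<Sum>v\<in>UNIV. if u = v then Var v - Const (z $ v) else 0)"
      unfolding L_def by (intro sum.cong refl) (simp add: peval_hom Const_simps)
    then show ?case using ideal_in_0[OF ideal_mpow[of z 2]] by (simp del: mpow.simps)
  next
    case (add f g)
    have "L (f + g) = L f + L g"
      by (simp add: L_def peval_hom Const_simps algebra_simps sum.distrib sum_subtractf)
    then have e: "f + g - Const (peval (f + g) z) - L (f + g) =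
        (f - Const (peval f z) - L f) + (g - Const (peval g z) - L g)"
      by (simp add: peval_hom Const_simps)
    show ?case unfolding e by (rule ideal_mpow_add[OF add])
  next
    case (mult f g)
    have "L (f * g) = Const (peval f z) * L g + Const (peval g z) * L f"
      unfolding L_def sum_distrib_left sum.distrib[symmetric]
      by (intro sum.cong refl) (simp add: peval_hom Const_simps algebra_simps)
    then have e: "f * g - Const (peval (f * g) z) - L (f * g) =
        Const (peval g z) * (f - Const (peval f z) - L f) + Const (peval f z) * (g - Const (peval g z) - L g)
        + (f - Const (peval f z)) * (g - Const (peval g z))"
      by (simp add: peval_hom Const_simps algebra_simps)
    have "(f - Const (peval f z)) * (g - Const (peval g z)) \<in> mpow z 2"
      using mpow_mult[OF const_mpow1 const_mpow1] by (simp only: one_add_one)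
    then show ?case
      unfolding e by (rule ideal_mpow_add[OF ideal_mpow_add[OF ideal_mpow_mult[OF mult(1)] ideal_mpow_mult[OF mult(2)]]])
  qed
  then show ?thesis by (simp only: L_def)
qed

text \<open>The inverse Jacobian gives a linear combination \<open>L\<close> of the parameters with
  the same differential as the coordinate.\<close>

lemma param_system_Var:
  fixes f :: "'v::finite \<Rightarrow> 'v mpoly"
  assumes "param_system z f"
  obtains L where "Var u - Const (z $ u) - subst Const f L \<in> mpow z 2"
proof -
  obtain A where A: "A ** jac f z = mat 1" using assms by (auto simp: param_system_def invertible_def)
  have f0: "peval (f i) z = 0" for i using assms by (simp add: param_system_def)
  have A': "(\<Sum>i\<in>UNIV. A $ u $ i * peval (pd v (f i)) z) = (if u = v then 1 else 0)" for u v
    using arg_cong[OF A, of "\<lambda>M. M $ u $ v"] by (simp add: matrix_matrix_mult_def jac_def mat_def)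
  define q where "q i = f i - Const (peval (f i) z) - (\<Sum>v\<in>UNIV. Const (peval (pd v (f i)) z) * (Var v - Const (z $ v)))" for i
  have q: "q i \<in> mpow z 2" for i unfolding q_def by (rule taylor_mpow)
  have fq: "f i = q i + (\<Sum>v\<in>UNIV. Const (peval (pd v (f i)) z) * (Var v - Const (z $ v)))" for i
    by (simp add: q_def f0 Const_simps)
  have "(\<Sum>i\<in>UNIV. Const (A $ u $ i) * f i) = (\<Sum>i\<in>UNIV. Const (A $ u $ i) * q i) +
      (\<Sum>i\<in>UNIV. \<Sum>v\<in>UNIV. Const (A $ u $ i * peval (pd v (f i)) z) * (Var v - Const (z $ v)))"
    by (subst fq) (simp add: distrib_left sum.distrib sum_distrib_left Const_simps mult.assoc)
  also have "(\<Sum>i\<in>UNIV. \<Sum>v\<in>UNIV. Const (A $ u $ i * peval (pd v (f i)) z) * (Var v - Const (z $ v))) =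
      (\<Sum>v\<in>UNIV. Const (\<Sum>i\<in>UNIV. A $ u $ i * peval (pd v (f i)) z) * (Var v - Const (z $ v)))"
    by (subst sum.swap) (simp add: rhom_sum[OF rhom_Const] sum_distrib_right)
  also have "\<dots> = (\<Sum>v\<in>UNIV. if u = v then Var v - Const (z $ v) else 0)"
    unfolding A' by (intro sum.cong refl) (simp add: Const_simps)
  finally have "Var u - Const (z $ u) - (\<Sum>i\<in>UNIV. Const (A $ u $ i) * f i) = (\<Sum>i\<in>UNIV. Const (- (A $ u $ i)) * q i)"
    by (simp add: Const_simps sum_negf)
  also have "\<dots> \<in> mpow z 2" by (intro ideal_in_sum[OF ideal_mpow] ideal_mpow_mult q)
  finally show ?thesis
    by (intro that[of "\<Sum>i\<in>UNIV. Const (A $ u $ i) * Var i"])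
      (simp add: subst_hom[OF rhom_Const] subst_Const[OF rhom_Const] subst_Var[OF rhom_Const])
qed

text \<open>One linear factor is replaced by its approximation \<open>L\<close> in the parameters
  and the cofactor by that of the induction hypothesis. The two errors have orders 2 + k and 1 + (k
  + 1).\<close>

lemma mpow_sub:
  fixes f :: "'v::finite \<Rightarrow> 'v mpoly"
  assumes f: "param_system z f" and "h \<in> mpow z k"
  shows "\<exists>G. h - subst Const f G \<in> mpow z (Suc k)"
  using assms(2)
proof (induction k arbitrary: h)
  case 0
  show ?case using const_mpow1[of h z]
    by (intro exI[of _ "Const (peval h z)"]) (simp add: subst_Const[OF rhom_Const] del: mpow.simps)
next
  case (Suc k)
  from Suc.prems have "h \<in> igen UNIV {(Var v - Const (z $ v)) * h | v h. h \<in> mpow z k}" by simp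
  then show ?case
  proof (induction rule: igen.induct)
    case igen_0
    show ?case using ideal_in_0[OF ideal_mpow[of z "Suc (Suc k)"]]
      by (intro exI[of _ 0]) (simp add: subst_0 del: mpow.simps)
  next
    case (igen_step b g x)
    then obtain v h' where g: "g = (Var v - Const (z $ v)) * h'" "h' \<in> mpow z k" by auto
    obtain G' where G': "x - subst Const f G' \<in> mpow z (Suc (Suc k))" using igen_step.IH by blast
    define r where "r = b * h'"
    have r: "r \<in> mpow z k" unfolding r_def using g by (intro ideal_mpow_mult)
    obtain G where G: "r - subst Const f G \<in> mpow z (Suc k)" using Suc.IH[OF r] by blast
    obtain L where L: "Var v - Const (z $ v) - subst Const f L \<in> mpow z 2" using param_system_Var[OF f] .
    have Lf: "subst Const f L \<in> mpow z 1"
    proof -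
      have "Var v - Const (z $ v) - subst Const f L \<in> mpow z 1"
        using L mpow_anti[of 1 2 z] by auto
      from ideal_in_diff[OF srng_UNIV ideal_mpow Var_mpow1[of v z] this] show ?thesis
        by (simp del: mpow.simps One_nat_def)
    qed
    have 1: "(Var v - Const (z $ v) - subst Const f L) * r \<in> mpow z (Suc (Suc k))"
      using mpow_mult[OF L r] by (simp only: add_2_eq_Suc)
    have 2: "subst Const f L * (r - subst Const f G) \<in> mpow z (Suc (Suc k))"
      using mpow_mult[OF Lf G] by (simp only: plus_1_eq_Suc)
    have e: "b * g + x - subst Const f (L * G + G') =
      ((Var v - Const (z $ v) - subst Const f L) * r + subst Const f L * (r - subst Const f G)) + (x - subst Const f G')"
      by (simp add: g r_def subst_hom[OF rhom_Const] algebra_simps)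
    show ?case by (rule exI[of _ "L * G + G'"], unfold e) (rule ideal_mpow_add[OF ideal_mpow_add[OF 1 2] G'])
  qed
qed

text \<open>Successive corrections by \<open>mpow_sub\<close>. This takes the place of the fact that
  the completed local ring is a power series ring in the parameters.\<close>

lemma param_system_sub:
  fixes f :: "'v::finite \<Rightarrow> 'v mpoly"
  assumes f: "param_system z f"
  shows "\<exists>G. h - subst Const f G \<in> mpow z k"
proof (induction k)
  case (Suc k)
  then obtain G where G: "h - subst Const f G \<in> mpow z k" by blast
  obtain G' where "(h - subst Const f G) - subst Const f G' \<in> mpow z (Suc k)" using mpow_sub[OF f G] by blast
  then show ?case by (intro exI[of _ "G + G'"]) (simp add: subst_hom[OF rhom_Const] diff_diff_eq del: mpow.simps)
qed simp

lemma fe_mpow: "arc z \<phi> \<Longrightarrow> h \<in> mpow z k \<Longrightarrow> i < k \<Longrightarrow> fps_nth (fe \<phi> h) i = 0"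
proof (induction k arbitrary: h i)
  case (Suc k)
  from Suc.prems(2) have "h \<in> igen UNIV {(Var v - Const (z $ v)) * h | v h. h \<in> mpow z k}" by simp
  then show ?case
  proof (induction rule: igen.induct)
    case igen_0
    show ?case by (simp add: fe_hom)
  next
    case (igen_step b g x)
    then obtain v h' where g: "g = (Var v - Const (z $ v)) * h'" "h' \<in> mpow z k" by auto
    define A where "A = fe \<phi> (b * (Var v - Const (z $ v)))"
    have A0: "fps_nth A 0 = 0"
      unfolding A_def arc_peval[OF Suc.prems(1)] by (simp add: peval_hom)
    have "fps_nth (fe \<phi> (b * g)) i = fps_nth (A * fe \<phi> h') i"
      by (simp add: A_def g fe_hom mult.assoc)
    also have "\<dots> = 0" unfolding fps_mult_nth
    proof (rule sum.neutral, rule ballI)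
      fix j assume "j \<in> {0..i}"
      show "fps_nth A j * fps_nth (fe \<phi> h') (i - j) = 0"
      proof (cases "j = 0")
        case False
        then have "i - j < k" using Suc.prems(3) \<open>j \<in> {0..i}\<close> by auto
        then show ?thesis using Suc.IH[OF Suc.prems(1) g(2)] by simp
      qed (simp add: A0)
    qed
    finally show ?case using igen_step.IH by (simp add: fe_hom)
  qed
qed simp

lemma prod_mpow:
  assumes "\<And>v. f v \<in> mpow z 1" shows "finite A \<Longrightarrow> (\<Prod>v\<in>A. f v ^ e v) \<in> mpow z (sum e A)"
proof (induction A rule: finite_induct)
  case (insert v A)
  have "f v ^ n \<in> mpow z n" for n
  proof (induction n)
    case (Suc n)
    show ?case using mpow_mult[OF assms[of v] Suc] by (simp only: power_Suc plus_1_eq_Suc)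
  qed simp
  then show ?case using insert mpow_mult[of "f v ^ e v" z "e v"] by (simp del: mpow.simps)
qed simp

lemma prod_igen:
  assumes "finite A" "v \<in> A" "e v > 0" "f v \<in> F"
  shows "(\<Prod>v\<in>A. f v ^ e v) \<in> igen UNIV F"
proof -
  obtain n where n: "e v = Suc n" using assms(3) by (cases "e v") auto
  have "(\<Prod>v\<in>A. f v ^ e v) = ((\<Prod>v\<in>A - {v}. f v ^ e v) * f v ^ n) * f v"
    using assms(1,2) by (simp add: prod.remove n algebra_simps)
  then show ?thesis using igen_mult[OF igen_base[OF assms(4) srng_UNIV] srng_UNIV UNIV_I] by metis
qed

text \<open>A polynomial in the parameters which vanishes on all arcs is tested on the arcs on which the
  parameters are linear.\<close>

lemma Ihat_closure:
  fixes f :: "'v::finite \<Rightarrow> 'v mpoly"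
  assumes f: "param_system z f" and h: "h \<in> Ihat z (f ` S)"
  shows "\<exists>i\<in>igen UNIV (f ` S). h - i \<in> mpow z k"
proof -
  note Im = ideal_in_igen[OF srng_UNIV subset_UNIV, of "f ` S"]
  \<comment> \<open>One order more than asked for, so that the coefficients of orders 0 to
    \<open>k\<close> on every arc can be read off from \<open>G\<close>.\<close>
  obtain G where G: "h - subst Const f G \<in> mpow z (Suc k)" using param_system_sub[OF f] by blast
  define a where "a m = Poly_Mapping.lookup G m" for m
  define deg where "deg m = (\<Sum>v\<in>Poly_Mapping.keys m. Poly_Mapping.lookup m v)" for m :: "'v \<Rightarrow>\<^sub>0 nat"
  \<comment> \<open>\<open>M1\<close> contributes to the ideal of the parameters in \<open>S\<close>
    and \<open>M2\<close> to the k-th power of the maximal ideal. The remaining monomials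
    \<open>M3\<close> are shown not to occur.\<close>
  define M1 where "M1 = {m \<in> Poly_Mapping.keys G. Poly_Mapping.keys m \<inter> S \<noteq> {}}"
  define M2 where "M2 = {m \<in> Poly_Mapping.keys G. Poly_Mapping.keys m \<inter> S = {} \<and> deg m > k}"
  define M3 where "M3 = {m \<in> Poly_Mapping.keys G. Poly_Mapping.keys m \<inter> S = {} \<and> deg m \<le> k}"
  have fin: "finite M1" "finite M2" "finite M3" by (auto simp: M1_def M2_def M3_def)
  have keys: "Poly_Mapping.keys G = M1 \<union> (M2 \<union> M3)" by (auto simp: M1_def M2_def M3_def)
  have "M3 = {}"
  proof -
    define G3 where "G3 = (\<Sum>m\<in>M3. Poly_Mapping.single m (a m))"
    have "peval G3 y = 0" for y
    proof -
      define \<tau> where "\<tau> v = (if v \<in> S then 0 else y $ v)" for v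
      obtain \<phi> where \<phi>: "arc z \<phi>" "\<And>i. fe \<phi> (f i) = fps_const (\<tau> i) * fps_X"
        by (rule param_system_arc[OF f, of "\<lambda>i. fps_const (\<tau> i) * fps_X"]) auto
      have "\<forall>g\<in>f ` S. fe \<phi> g = 0" by (auto simp: \<phi>(2) \<tau>_def)
      then have h0: "fe \<phi> h = 0" using h \<phi>(1) unfolding Ihat_def by blast
      have e: "fe \<phi> (subst Const f G) = (\<Sum>m\<in>Poly_Mapping.keys G. fps_const (a m * mon \<tau> m) * fps_X ^ deg m)"
      proof -
        have "mon (\<lambda>i. fps_const (\<tau> i) * fps_X) m = fps_const (mon \<tau> m) * fps_X ^ deg m" for m
          by (simp add: power_mult_distrib prod.distrib power_sum deg_def rhom_prod[OF rhom_fps_const])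
        moreover have "fe \<phi> (subst Const f G) = (\<Sum>m\<in>Poly_Mapping.keys G. fps_const (a m) * mon (\<lambda>i. fe \<phi> (f i)) m)"
          unfolding subst_def by (simp add: fe_hom fe_Const a_def)
        ultimately show ?thesis by (simp add: \<phi>(2) mult.assoc flip: fps_const_mult)
      qed
      have 0: "(\<Sum>m\<in>Poly_Mapping.keys G. if deg m = j then a m * mon \<tau> m else 0) = 0" if "j \<le> k" for j
      proof -
        have "fps_nth (fe \<phi> (h - subst Const f G)) j = 0" using fe_mpow[OF \<phi>(1) G] that by simp
        then have "fps_nth (fe \<phi> (subst Const f G)) j = 0" by (simp add: fe_hom h0)
        then have s: "(\<Sum>m\<in>Poly_Mapping.keys G. fps_nth (fps_const (a m * mon \<tau> m) * fps_X ^ deg m) j) = 0"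
          unfolding e fps_sum_nth .
        have "(\<Sum>m\<in>Poly_Mapping.keys G. if deg m = j then a m * mon \<tau> m else 0) =
          (\<Sum>m\<in>Poly_Mapping.keys G. fps_nth (fps_const (a m * mon \<tau> m) * fps_X ^ deg m) j)"
          by (intro sum.cong refl) (simp add: fps_X_power_nth)
        then show ?thesis using s by simp
      qed
      have mm: "mon \<tau> m = (if m \<in> M1 then 0 else mon (($) y) m)" if "m \<in> Poly_Mapping.keys G" for m
      proof (cases "m \<in> M1")
        case True
        then obtain v where "v \<in> Poly_Mapping.keys m" "v \<in> S" by (auto simp: M1_def)
        then show ?thesis using True by (auto simp: \<tau>_def in_keys_iff intro!: prod_zero bexI[of _ v])
      next
        case False
        then have "mon \<tau> m = mon (($) y) m"
          using that by (intro prod.cong refl) (auto simp: M1_def \<tau>_def)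
        then show ?thesis using False by simp
      qed
      have "peval G3 y = (\<Sum>m\<in>M3. a m * mon (($) y) m)"
        by (simp add: G3_def peval_def subst_sum rhom_id subst_single)
      also have "\<dots> = (\<Sum>m\<in>Poly_Mapping.keys G. if deg m \<le> k then a m * mon \<tau> m else 0)"
      proof (rule sum.mono_neutral_cong_left)
        show "M3 \<subseteq> Poly_Mapping.keys G" by (auto simp: M3_def)
        show "\<forall>m\<in>Poly_Mapping.keys G - M3. (if deg m \<le> k then a m * mon \<tau> m else 0) = 0"
        proof
          fix m assume m: "m \<in> Poly_Mapping.keys G - M3"
          show "(if deg m \<le> k then a m * mon \<tau> m else 0) = 0"
          proof (cases "deg m \<le> k")
            case True
            then have "m \<in> M1" using m by (auto simp: M1_def M3_def)
            then have "mon \<tau> m = 0" using mm[of m] m by simp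
            then show ?thesis by simp
          qed simp
        qed
        fix m assume m: "m \<in> M3"
        then have "m \<in> Poly_Mapping.keys G" "m \<notin> M1" "deg m \<le> k" by (auto simp: M1_def M3_def)
        then show "a m * mon (($) y) m = (if deg m \<le> k then a m * mon \<tau> m else 0)" using mm[of m] by simp
      qed simp
      also have "\<dots> = (\<Sum>m\<in>Poly_Mapping.keys G. \<Sum>j\<le>k. if deg m = j then a m * mon \<tau> m else 0)"
        by (intro sum.cong refl) (simp add: sum.delta)
      also have "\<dots> = 0" by (subst sum.swap) (simp add: 0)
      finally show ?thesis .
    qed
    then have "G3 = 0" using peval_nonzero_exists by metis
    then have "Poly_Mapping.lookup G3 m = 0" for m by simp
    moreover have "Poly_Mapping.lookup G3 m = a m" if "m \<in> M3" for m
      using that fin(3) by (simp add: G3_def lookup_sum lookup_single when_def)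
    ultimately have "m \<notin> M3" for m by (metis (mono_tags, lifting) M3_def a_def in_keys_iff mem_Collect_eq)
    then show ?thesis by blast
  qed
  define t where "t m = Const (a m) * mon f m" for m
  have Gf: "subst Const f G = (\<Sum>m\<in>M1. t m) + (\<Sum>m\<in>M2. t m)"
  proof -
    have "M1 \<inter> M2 = {}" by (auto simp: M1_def M2_def)
    then have "(\<Sum>m\<in>M1 \<union> M2. t m) = (\<Sum>m\<in>M1. t m) + (\<Sum>m\<in>M2. t m)" using fin by (intro sum.union_disjoint)
    moreover have "Poly_Mapping.keys G = M1 \<union> M2" using keys \<open>M3 = {}\<close> by simp
    ultimately show ?thesis by (simp add: subst_def t_def a_def)
  qed
  have f1: "f v \<in> mpow z 1" for v using const_mpow1[of "f v" z] f by (simp add: param_system_def Const_simps)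
  have "(\<Sum>m\<in>M2. t m) \<in> mpow z k"
  proof (rule ideal_in_sum[OF ideal_mpow])
    fix m assume m: "m \<in> M2"
    have "mon f m \<in> mpow z (deg m)" unfolding deg_def by (rule prod_mpow[OF f1]) simp
    then have "mon f m \<in> mpow z k" using m mpow_anti[of k "deg m" z] by (auto simp: M2_def)
    then show "t m \<in> mpow z k" unfolding t_def by (rule ideal_mpow_mult)
  qed
  moreover have "h - subst Const f G \<in> mpow z k" using G mpow_anti[of k "Suc k" z] by auto
  ultimately have "(h - subst Const f G) + (\<Sum>m\<in>M2. t m) \<in> mpow z k" by (rule ideal_mpow_add[rotated])
  then have "h - (\<Sum>m\<in>M1. t m) \<in> mpow z k" by (simp add: Gf)
  moreover have "(\<Sum>m\<in>M1. t m) \<in> igen UNIV (f ` S)"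
  proof (rule ideal_in_sum[OF Im])
    fix m assume "m \<in> M1"
    then obtain v where "v \<in> Poly_Mapping.keys m" "v \<in> S" by (auto simp: M1_def)
    then have "mon f m \<in> igen UNIV (f ` S)"
      by (intro prod_igen[of _ v]) (auto simp: in_keys_iff)
    then show "t m \<in> igen UNIV (f ` S)" unfolding t_def by (rule ideal_in_mult[OF Im UNIV_I])
  qed
  ultimately show ?thesis by blast
qed

text \<open>In the local ring at \<open>z\<close>, the ideal of the arcs is thus generated by the
  parameters in \<open>S\<close>: \<open>g\<close> becomes a unit there.\<close>

lemma Ihat_local:
  fixes f :: "'v::finite \<Rightarrow> 'v mpoly"
  assumes f: "param_system z f" and h: "h \<in> Ihat z (f ` S)"
  obtains g where "peval g z = 1" "g * h \<in> igen UNIV (f ` S)"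
  using krull_intersection[OF ideal_in_igen[OF srng_UNIV subset_UNIV] Ihat_closure[OF f h]] by blast

lemma param_system_arc0:
  fixes f :: "'v::finite \<Rightarrow> 'v mpoly"
  assumes "param_system z f"
  obtains \<phi> where "arc z \<phi>" "\<forall>g\<in>f ` S. fe \<phi> g = 0"
proof -
  obtain \<phi> where "arc z \<phi>" "\<And>i. fe \<phi> (f i) = 0"
    by (rule param_system_arc[OF assms, of "\<lambda>_. 0"]) simp_all
  then show ?thesis by (intro that[of \<phi>]) auto
qed

lemma Ihat_vanish:
  fixes f :: "'v::finite \<Rightarrow> 'v mpoly"
  assumes "param_system z f" "h \<in> Ihat z (f ` S)" shows "peval h z = 0"
proof -
  obtain \<phi> where \<phi>: "arc z \<phi>" "\<forall>g\<in>f ` S. fe \<phi> g = 0" using param_system_arc0[OF assms(1)] .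
  then have "fe \<phi> h = 0" using assms(2) unfolding Ihat_def by blast
  then show ?thesis using arc_peval[OF \<phi>(1), of h] by simp
qed

lemma prime_Ihat:
  fixes f :: "'v::finite \<Rightarrow> 'v mpoly"
  assumes f: "param_system z f" shows "prime_id (Ihat z (f ` S))"
  unfolding prime_id_def
proof (intro conjI allI impI)
  show "1 \<notin> Ihat z (f ` S)" using Ihat_vanish[OF f, of 1 S] by (auto simp: peval_hom)
qed (use ideal_Ihat Ihat_prime[OF f] in blast)+

lemma local_subset_prime:
  assumes P: "prime_id P" "P \<subseteq> {g. peval g z = 0}" "I \<subseteq> P" and g: "peval g z = 1" "g * h \<in> I"
  shows "h \<in> P"
proof -
  have "g \<notin> P" using P(2) g(1) by auto
  moreover have "g * h \<in> P" using P(3) g(2) by blast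
  ultimately show ?thesis using P(1) by (auto simp: prime_id_def)
qed

text \<open>The parameters outside \<open>S\<close> are added one at a time. The inclusions are
  strict because some arc has the new parameter equal to the power series variable and all others
  zero.\<close>

lemma chain_exists:
  fixes f :: "'v::finite \<Rightarrow> 'v mpoly"
  assumes f: "param_system z f"
  obtains P :: "nat \<Rightarrow> 'v mpoly set" where "\<And>i. prime_id (P i)" "\<And>i. Ihat z (f ` S) \<subseteq> P i"
    "\<And>i. P i \<subseteq> {g. peval g z = 0}" "\<And>i. i < card (- S) \<Longrightarrow> P i \<subset> P (Suc i)"
proof -
  obtain xs where xs: "set xs = - S" "distinct xs" using finite_distinct_list[of "- S"] by auto
  have len: "length xs = card (- S)" using xs distinct_card by metis
  define P where "P i = Ihat z (f ` (S \<union> set (take i xs)))" for i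
  show ?thesis
  proof (rule that[of P])
    show "prime_id (P i)" for i unfolding P_def by (rule prime_Ihat[OF f])
    show "Ihat z (f ` S) \<subseteq> P i" for i unfolding P_def by (intro Ihat_mono image_mono) auto
    show "P i \<subseteq> {g. peval g z = 0}" for i unfolding P_def using Ihat_vanish[OF f] by blast
    show "P i \<subset> P (Suc i)" if "i < card (- S)" for i
    proof
      show "P i \<subseteq> P (Suc i)"
        unfolding P_def using set_take_subset_set_take[of i "Suc i" xs] by (intro Ihat_mono image_mono) auto
      have i: "i < length xs" using that len by simp
      have "f (xs ! i) \<in> P (Suc i)" unfolding P_def
        using i by (intro subsetD[OF Ihat_superset] imageI) (simp add: take_Suc_conv_app_nth)
      moreover have "f (xs ! i) \<notin> P i"
      proof
        assume a: "f (xs ! i) \<in> P i"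
        obtain \<phi> where \<phi>: "arc z \<phi>" "\<And>j. fe \<phi> (f j) = (if j = xs ! i then fps_X else 0)"
          by (rule param_system_arc[OF f, of "\<lambda>j. if j = xs ! i then fps_X else 0"]) auto
        have "xs ! i \<notin> S" using nth_mem[OF i] xs by auto
        moreover have "xs ! i \<notin> set (take i xs)"
          using xs(2) i by (auto simp: in_set_conv_nth nth_eq_iff_index_eq)
        ultimately have "\<forall>g\<in>f ` (S \<union> set (take i xs)). fe \<phi> g = 0" using \<phi>(2) by auto
        then have "fe \<phi> (f (xs ! i)) = 0" using a \<phi>(1) unfolding P_def Ihat_def by blast
        then show False by (simp add: \<phi>(2))
      qed
      ultimately show "P i \<noteq> P (Suc i)" by blast
    qed
  qed
qed

section \<open>Dimension of local rings\<close>

definition coef_set :: "'v mpoly \<Rightarrow> complex set" where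
  "coef_set f = Poly_Mapping.lookup f ` Poly_Mapping.keys f"

abbreviation polys_over :: "complex set \<Rightarrow> 'v mpoly set" where
  "polys_over K \<equiv> sgen (Const ` K \<union> range Var)"

lemma polys_overI:
  assumes "coef_set f \<subseteq> K" shows "f \<in> polys_over K"
proof -
  note S = srng_sgen[of "Const ` K \<union> range Var"]
  have "(\<Sum>m\<in>Poly_Mapping.keys f. Const (Poly_Mapping.lookup f m) * mon Var m) \<in> polys_over K"
    by (intro srng_sum[OF S] srng_mult[OF S] srng_prod[OF S] srng_power[OF S])
      (use assms in \<open>auto simp: coef_set_def intro!: sgen_base\<close>)
  then show ?thesis by (simp flip: mpoly_eq_sum)
qed

lemma finite_coef_set: "finite (coef_set f)"
  by (simp add: coef_set_def)

lemma pd_0_1: "pd v 0 = 0" "pd v 1 = 0"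
  using pd_simps(1)[of v 0] pd_simps(1)[of v 1] by (simp_all add: Const_simps)

lemma pd_minus: "pd v (- f) = - pd v f"
  using pd_simps(3)[of v f "-f"] by (simp add: eq_neg_iff_add_eq_0 add.commute pd_0_1)

lemma pd_polys_over: "f \<in> polys_over K \<Longrightarrow> pd v f \<in> polys_over K"
proof (induction rule: sgen.induct)
  case (sgen_base x)
  then show ?case by (auto simp: srng_0[OF srng_sgen] srng_1[OF srng_sgen])
qed (auto simp: pd_0_1 pd_minus srng_0[OF srng_sgen] intro: sgen.intros)

lemma det_polys:
  fixes F :: "'n::finite \<Rightarrow> 'n \<Rightarrow> 'v::finite mpoly"
  shows "peval (det (\<chi> i j. F i j)) z = det (\<chi> i j. peval (F i j) z)"
    and "(\<And>i j. F i j \<in> polys_over K) \<Longrightarrow> det (\<chi> i j. F i j) \<in> polys_over K"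
proof -
  have s: "of_int (sign p) = (1 :: 'a::comm_ring_1) \<or> of_int (sign p) = (-1 :: 'a)" for p :: "'n \<Rightarrow> 'n"
    by (auto simp: sign_def)
  have "peval (of_int (sign p)) z = of_int (sign p)" for p :: "'n \<Rightarrow> 'n" and z :: "complex^'v"
    by (auto simp: sign_def peval_hom)
  then show "peval (det (\<chi> i j. F i j)) z = det (\<chi> i j. peval (F i j) z)"
    by (simp add: det_def peval_hom)
  note S = srng_sgen[of "Const ` K \<union> range Var"]
  have "of_int (sign p) \<in> polys_over K" for p :: "'n \<Rightarrow> 'n"
    by (auto simp: sign_def srng_1[OF S] srng_minus[OF S srng_1[OF S]])
  then show "(\<And>i j. F i j \<in> polys_over K) \<Longrightarrow> det (\<chi> i j. F i j) \<in> polys_over K"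
    unfolding det_def by (intro srng_sum[OF S] srng_mult[OF S] srng_prod[OF S]) auto
qed

lemma jac_mult: "(jac f z *v w) $ i = dd z w (f i)"
  by (simp add: jac_def matrix_vector_mult_def dd_pd)

lemma dd_sum_vec: "dd z (\<Sum>j\<in>J. a j *s w j) f = (\<Sum>j\<in>J. a j * dd z (w j) f)"
proof (induction J rule: infinite_finite_induct)
  case (insert j J)
  then show ?case by (simp add: dd_lin)
qed (auto simp: dd_pd)

text \<open>In a relation for \<open>y\<close> modulo \<open>P\<close>, the constant coefficient
  lies in \<open>P'\<close> since \<open>y\<close> does, hence in \<open>P0\<close> by hypothesis
  \<open>B\<close>. It can be subtracted, and then the factor \<open>y\<close> can be cancelled
  since \<open>y\<close> is outside \<open>P\<close>.\<close>

lemma transc_of_prime_chain: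
  assumes P: "prime_id P" "prime_id P'" "P0 \<subseteq> P" "P \<subseteq> P'" "y \<in> P'" "y \<notin> P"
    and B: "\<And>b. b \<in> B \<Longrightarrow> b \<in> P' \<Longrightarrow> b \<in> P0" and "srng B"
  shows "q \<in> PB B \<Longrightarrow> poly q y \<in> P \<Longrightarrow> Polynomial.coeff q n \<in> P0"
proof (induction q arbitrary: n)
  case 0
  have "0 \<in> P'" using P(2) by (auto simp: prime_id_def ideal_in_def)
  then show ?case using B[of 0] srng_0[OF \<open>srng B\<close>] by simp
next
  case (pCons a q)
  have I: "ideal_in UNIV P" "ideal_in UNIV P'" using P by (auto simp: prime_id_def)
  have a: "a \<in> B" "q \<in> PB B" using pCons.prems(1) \<open>srng B\<close> by (simp_all add: PB_pCons)
  have aq: "a + y * poly q y \<in> P" using pCons.prems(2) by simp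
  have "poly q y * y \<in> P'" using ideal_in_mult[OF I(2) UNIV_I P(5)] .
  then have "(a + y * poly q y) - poly q y * y \<in> P'"
    by (rule ideal_in_diff[OF srng_UNIV I(2) subsetD[OF P(4) aq]])
  then have aP: "a \<in> P0" using B[OF a(1)] by (simp add: mult.commute)
  then have "(a + y * poly q y) - a \<in> P" using P(3) by (intro ideal_in_diff[OF srng_UNIV I(1) aq]) auto
  then have "y * poly q y \<in> P" by simp
  then have "poly q y \<in> P" using P(1,6) by (auto simp: prime_id_def)
  then show ?case using pCons.IH[OF a(2)] aP by (cases n) auto
qed

text \<open>Elements that witness the strict inclusions are algebraically independent modulo
  \<open>P 0\<close>. Over the countable ring of the coefficients involved, \<open>P 0\<close> has a
  generic point with tangent vectors dual to them. All \<open>f i\<close> with \<open>i\<close> in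
  \<open>S\<close> are constant to first order along these vectors, and the Jacobian is still
  invertible there, which leaves room for at most \<open>card (- S)\<close> of them.\<close>

lemma chain_bound:
  fixes f :: "'v::finite \<Rightarrow> 'v mpoly" and P :: "nat \<Rightarrow> 'v mpoly set"
  assumes f: "param_system z f" and fP: "f ` S \<subseteq> P 0" and pr: "\<And>i. i \<le> l \<Longrightarrow> prime_id (P i)"
    and st: "\<And>i. i < l \<Longrightarrow> P i \<subset> P (Suc i)" and van: "P l \<subseteq> {g. peval g z = 0}"
  shows "l \<le> card (- S)"
proof -
  have mono: "P i \<subseteq> P j" if "i \<le> j" "j \<le> l" for i j
    using that
  proof (induction j)
    case (Suc j)
    then show ?case using st[of j] by (cases "i = Suc j") auto
  qed simp
  have "\<exists>x. x \<in> P (Suc i) \<and> x \<notin> P i" if "i < l" for i using st[OF that] by blast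
  then obtain x where x: "\<And>i. i < l \<Longrightarrow> x i \<in> P (Suc i) \<and> x i \<notin> P i" by metis
  \<comment> \<open>The chain is read from the top: a new element then lies in a prime that meets
    the ring generated by the earlier ones only inside \<open>P 0\<close>, as
    \<open>transc_of_prime_chain\<close> demands.\<close>
  define y where "y j = x (l - Suc j)" for j
  define C where "C = (\<Union>j<l. coef_set (y j)) \<union> (\<Union>i. coef_set (f i))"
  define K where "K = sgen C"
  have "finite C" by (simp add: C_def finite_coef_set)
  then have K: "srng K" "countable K"
    unfolding K_def by (simp_all add: srng_sgen countable_sgen countable_finite)
  have CK: "C \<subseteq> K" by (auto simp: K_def intro: sgen_base)
  have yR: "y j \<in> polys_over K" if "j < l" for j using CK that by (intro polys_overI) (auto simp: C_def)
  have fR: "f i \<in> polys_over K" for i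
  proof -
    have "coef_set (f i) \<subseteq> C" unfolding C_def by blast
    then show ?thesis using CK by (intro polys_overI) simp
  qed
  have P0: "prime_id (P 0)" using pr by simp
  have van0: "P 0 \<subseteq> {g. peval g z = 0}" using mono[of 0 l] van by auto
  have cP: "g = 0" if "g \<in> Const ` K" "g \<in> P l" for g
    using that van by (auto simp: Const_simps)
  define Bs where "Bs = rec_nat (Const ` K) (\<lambda>j B. adjoin B (y j))"
  have Bs: "Bs 0 = Const ` K" "\<And>j. Bs (Suc j) = adjoin (Bs j) (y j)" by (simp_all add: Bs_def)
  have sB: "srng (Bs j)" for j
  proof (induction j)
    case 0
    show ?case using K(1) unfolding srng_def Bs by (auto simp flip: Const_simps intro!: imageI)
  qed (simp add: Bs srng_adjoin)
  have 1: "\<forall>h\<in>Bs j. h \<in> P (l - j) \<longrightarrow> h \<in> P 0" if "j \<le> l" for j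
    using that
  proof (induction j)
    case 0
    show ?case
    proof (intro ballI impI)
      fix h assume "h \<in> Bs 0" "h \<in> P (l - 0)"
      then have "h = 0" using cP by (simp add: Bs)
      then show "h \<in> P 0" using P0 by (simp add: prime_id_def ideal_in_def)
    qed
  next
    case (Suc j)
    have s: "l - j = Suc (l - Suc j)" using Suc.prems by simp
    have xx: "y j \<in> P (l - j)" "y j \<notin> P (l - Suc j)" using x[of "l - Suc j"] Suc.prems by (auto simp: y_def s)
    show ?case
    proof (intro ballI impI)
      fix h assume h: "h \<in> Bs (Suc j)" "h \<in> P (l - Suc j)"
      then obtain q where q: "q \<in> PB (Bs j)" "h = poly q (y j)" by (auto simp: Bs adjoin_def)
      have "Polynomial.coeff q n \<in> P 0" for n
        by (rule transc_of_prime_chain[of "P (l - Suc j)" "P (l - j)" _ "y j" "Bs j" q])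
          (use Suc xx sB q h pr mono in auto)
      moreover have I0: "ideal_in UNIV (P 0)" using P0 by (simp add: prime_id_def)
      ultimately have "y j ^ n * Polynomial.coeff q n \<in> P 0" for n by (intro ideal_in_mult[OF I0 UNIV_I])
      then show "h \<in> P 0" unfolding q(2) poly_altdef
        by (intro ideal_in_sum[OF I0]) (simp add: mult.commute)
    qed
  qed
  have tr: "transc (Bs j) (P 0) (y j)" if j: "j < l" for j
    unfolding transc_def
  proof (intro ballI impI allI)
    fix q n assume q: "q \<in> PB (Bs j)" "poly q (y j) \<in> P 0"
    have s: "l - j = Suc (l - Suc j)" using j by simp
    have xx: "y j \<in> P (l - j)" "y j \<notin> P (l - Suc j)" using x[of "l - Suc j"] j by (auto simp: y_def s)
    have "poly q (y j) \<in> P (l - Suc j)" using q(2) mono[of 0 "l - Suc j"] by auto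
    then show "Polynomial.coeff q n \<in> P 0"
      by (intro transc_of_prime_chain[of "P (l - Suc j)" "P (l - j)" _ "y j" "Bs j" q])
        (use 1[of j] j xx sB q pr mono in auto)
  qed
  have prim: "prim (polys_over K) (P 0)"
    using P0 by (auto simp: prim_def prime_id_def ideal_in_def srng_sgen)
  have KP: "Const ` K \<inter> P 0 \<subseteq> {0}" using cP mono[of 0 l] by auto
  obtain \<zeta> w where \<zeta>: "\<And>g. g \<in> polys_over K \<Longrightarrow> peval g \<zeta> = 0 \<longleftrightarrow> g \<in> P 0"
    and w: "\<And>g i. g \<in> polys_over K \<Longrightarrow> g \<in> P 0 \<Longrightarrow> dd \<zeta> (w i) g = 0"
    and wy: "\<And>i j. j < l \<Longrightarrow> dd \<zeta> (w i) (y j) = (if i = j then 1 else 0)"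
    by (rule generic_point[OF K prim KP, where l = l and y = y and Bs = Bs, OF yR tr Bs]) (assumption | rule that)+
  \<comment> \<open>The Jacobian determinant is defined over \<open>K\<close> and nonzero at
    \<open>z\<close>. All elements of \<open>P 0\<close> vanish at \<open>z\<close>, so it lies
    outside \<open>P 0\<close> and cannot vanish at the generic point.\<close>
  define \<Delta> where "\<Delta> = det (\<chi> i v. pd v (f i))"
  have \<Delta>R: "\<Delta> \<in> polys_over K" unfolding \<Delta>_def by (intro det_polys(2) pd_polys_over fR)
  have \<Delta>e: "peval \<Delta> u = det (jac f u)" for u by (simp add: \<Delta>_def det_polys(1) jac_def)
  have "det (jac f z) \<noteq> 0" using f by (simp add: param_system_def invertible_det_nz)
  then have "\<Delta> \<notin> P 0" using van0 \<Delta>e[of z] by auto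
  then have "det (jac f \<zeta>) \<noteq> 0" using \<zeta>[OF \<Delta>R] \<Delta>e[of \<zeta>] by simp
  then have inv: "invertible (jac f \<zeta>)" by (simp add: invertible_det_nz)
  have "vec.dim {0 :: complex^'v} + card {..<l} \<le> vec.dim {u. \<forall>i\<in>S. (jac f \<zeta> *v u) $ i = 0}"
  proof (rule dim_mod[where e = w])
    show "{0} \<subseteq> {u. \<forall>i\<in>S. (jac f \<zeta> *v u) $ i = 0}" by simp
    show "w j \<in> {u. \<forall>i\<in>S. (jac f \<zeta> *v u) $ i = 0}" for j
      using w[OF fR] fP by (auto simp: jac_mult)
    fix a assume "(\<Sum>j\<in>{..<l}. a j *s w j) \<in> {0}"
    then have 0: "(\<Sum>j\<in>{..<l}. a j *s w j) = 0" by simp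
    show "\<forall>j\<in>{..<l}. a j = 0"
    proof
      fix i assume i: "i \<in> {..<l}"
      have "(\<Sum>j\<in>{..<l}. a j * dd \<zeta> (w j) (y i)) = dd \<zeta> 0 (y i)" by (simp add: 0 flip: dd_sum_vec)
      also have "\<dots> = 0" by (simp add: dd_pd)
      finally show "a i = 0" using i wy by (simp add: if_distrib[of "\<lambda>c. _ * c"] cong: if_cong)
    qed
  qed auto
  then show ?thesis by (simp add: dim_rows[OF inv])
qed

lemma local_krull_dim_alt:
  "local_krull_dim J z = Sup {enat l | l. \<exists>P :: nat \<Rightarrow> 'v::finite mpoly set.
     (\<forall>i\<le>l. prime_id (P i) \<and> J \<subseteq> P i \<and> P i \<subseteq> {g. peval g z = 0}) \<and> (\<forall>i<l. P i \<subset> P (Suc i))}"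
  by (simp add: local_krull_dim_def primeideal_iff vanishing_ideal_def)

theorem local_krull_dim_param_system:
  fixes f :: "'v::finite \<Rightarrow> 'v mpoly"
  assumes f: "param_system z f" and J: "f ` S \<subseteq> J" "J \<subseteq> Ihat z (f ` S)"
  shows "local_krull_dim J z = enat (card (- S))"
  unfolding local_krull_dim_alt
proof (intro antisym Sup_least Sup_upper)
  fix a assume "a \<in> {enat l | l. \<exists>P :: nat \<Rightarrow> 'v mpoly set.
     (\<forall>i\<le>l. prime_id (P i) \<and> J \<subseteq> P i \<and> P i \<subseteq> {g. peval g z = 0}) \<and> (\<forall>i<l. P i \<subset> P (Suc i))}"
  then obtain l P where a: "a = enat l" 
    and P: "\<forall>i\<le>l. prime_id (P i) \<and> J \<subseteq> P i \<and> P i \<subseteq> {g. peval g z = 0}" "\<forall>i<l. P i \<subset> P (Suc i)" by blast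
  have "J \<subseteq> P 0" using P(1) by simp
  then have JP: "f ` S \<subseteq> P 0" using J(1) by (rule subset_trans[rotated])
  have "l \<le> card (- S)"
    by (rule chain_bound[OF f, where P = P, OF JP]) (use P in auto)
  then show "a \<le> enat (card (- S))" by (simp add: a)
next
  obtain P :: "nat \<Rightarrow> 'v mpoly set" where P: "\<And>i. prime_id (P i)" "\<And>i. Ihat z (f ` S) \<subseteq> P i"
    "\<And>i. P i \<subseteq> {g. peval g z = 0}" "\<And>i. i < card (- S) \<Longrightarrow> P i \<subset> P (Suc i)"
    by (rule chain_exists[OF f, where S = S]) (rule that)
  then show "enat (card (- S)) \<in> {enat l | l. \<exists>P :: nat \<Rightarrow> 'v mpoly set.
     (\<forall>i\<le>l. prime_id (P i) \<and> J \<subseteq> P i \<and> P i \<subseteq> {g. peval g z = 0}) \<and> (\<forall>i<l. P i \<subset> P (Suc i))}"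
    using P(1,3,4) subset_trans[OF J(2) P(2)]
    by (intro CollectI exI[of _ "card (- S)"] conjI refl exI[of _ P]) simp_all
qed

lemma arc_first_order:
  fixes h :: "'v::finite mpoly"
  assumes "arc z \<phi>"
  shows "fps_nth (fe \<phi> h) 1 = dd z (\<chi> v. fps_nth (\<phi> v) 1) h"
proof -
  have z: "fps_nth (\<phi> v) 0 = z $ v" for v using assms by (simp add: arc_def)
  have ag: "agree 1 \<phi> (\<lambda>v. fps_const (z $ v))" by (simp add: agree_def z)
  have "fe (\<lambda>v. fps_const (z $ v)) h = fps_const (peval h z)"
    unfolding fev_def peval_def by (subst rhom_subst_comp[OF rhom_fps_const rhom_id(1)]) simp
  then show ?thesis using taylor_fps(2)[OF rhom_id(2) order.refl ag z, of h] by (simp add: dd_pd)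
qed

text \<open>A vector killed by the differentials of the parameters in \<open>S\<close> is the
  velocity of an arc on which the parameters are linear; \<open>J\<close> vanishes on this
  arc.\<close>

theorem tangent_space_param_system:
  fixes f :: "'v::finite \<Rightarrow> 'v mpoly"
  assumes f: "param_system z f" and J: "f ` S \<subseteq> J" "J \<subseteq> Ihat z (f ` S)"
  shows "tangent_space J z = {w. \<forall>i\<in>S. (jac f z *v w) $ i = 0}"
proof (intro equalityI subsetI)
  fix w assume "w \<in> tangent_space J z"
  then show "w \<in> {w. \<forall>i\<in>S. (jac f z *v w) $ i = 0}" using J(1) by (auto simp: tangent_space_dd jac_mult)
next
  fix w assume w: "w \<in> {w. \<forall>i\<in>S. (jac f z *v w) $ i = 0}"
  obtain \<phi> where \<phi>: "arc z \<phi>" "\<And>i. fe \<phi> (f i) = fps_const (dd z w (f i)) * fps_X"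
    by (rule param_system_arc[OF f, of "\<lambda>i. fps_const (dd z w (f i)) * fps_X"]) auto
  define u where "u = (\<chi> v. fps_nth (\<phi> v) 1)"
  have "dd z u (f i) = dd z w (f i)" for i
    using arc_first_order[OF \<phi>(1), of "f i"] by (simp add: \<phi>(2) u_def)
  then have "jac f z *v u = jac f z *v w" by (simp add: vec_eq_iff jac_mult)
  moreover obtain A where "A ** jac f z = mat 1" using f by (auto simp: param_system_def invertible_def)
  ultimately have uw: "u = w" by (metis matrix_vector_mul_assoc matrix_vector_mul_lid)
  have 0: "\<forall>g\<in>f ` S. fe \<phi> g = 0" using w by (auto simp: \<phi>(2) jac_mult)
  have "dd z w h = 0" if "h \<in> J" for h
  proof -
    have "fe \<phi> h = 0" using subsetD[OF J(2) that] 0 \<phi>(1) unfolding Ihat_def by blast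
    then show ?thesis using arc_first_order[OF \<phi>(1), of h] uw by (simp add: u_def)
  qed
  then show "w \<in> tangent_space J z" by (simp add: tangent_space_dd)
qed

section \<open>Regularity from independent gradients\<close>

definition grad :: "complex^'v \<Rightarrow> 'v mpoly \<Rightarrow> complex^'v::finite" where
  "grad z f = (\<chi> v. peval (pd v f) z)"

lemma dotp_grad: "dotp (grad z f) w = dd z w f"
  by (simp add: dotp_def grad_def dd_pd)

lemma param_system_extend:
  fixes b :: "'v::finite \<Rightarrow> complex^'v"
  assumes inv: "invertible (\<chi> i. b i)" and g: "\<And>i. i \<in> S \<Longrightarrow> peval (g i) z = 0" "\<And>i. i \<in> S \<Longrightarrow> grad z (g i) = b i"
  obtains f where "param_system z f" "\<And>i. i \<in> S \<Longrightarrow> f i = g i" "jac f z = (\<chi> i. b i)"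
proof -
  define f where "f i = (if i \<in> S then g i else \<Sum>v\<in>UNIV. Const (b i $ v) * (Var v - Const (z $ v)))" for i
  have p: "pd u (f i) = (\<Sum>v\<in>UNIV. Const (b i $ v) * (if v = u then 1 else 0))" if "i \<notin> S" for i u
  proof -
    have s: "pd u (sum F A) = (\<Sum>v\<in>A. pd u (F v))" for F :: "'v \<Rightarrow> 'v mpoly" and A
      by (induction A rule: infinite_finite_induct) (auto simp: pd_0_1)
    have d: "pd u (x - y) = pd u x - pd u y" for x y :: "'v mpoly"
      using pd_simps(3)[of u x "-y"] by (simp add: pd_minus)
    show ?thesis using that by (simp add: f_def s d)
  qed
  have "peval (pd u (f i)) z = b i $ u" for i u
  proof (cases "i \<in> S")
    case True
    then show ?thesis using arg_cong[OF g(2)[OF True], of "\<lambda>x. x $ u"] by (simp add: f_def grad_def)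
  next
    case False
    then show ?thesis
      by (simp add: p peval_hom if_distrib[of "\<lambda>f. peval f z"] if_distrib[of "\<lambda>a. _ * a"] cong: if_cong)
  qed
  then have j: "jac f z = (\<chi> i. b i)" by (simp add: jac_def vec_eq_iff)
  have "peval (f i) z = 0" for i using g(1) by (simp add: f_def peval_hom)
  then have "param_system z f" using inv j by (simp add: param_system_def)
  then show ?thesis by (intro that[of f]) (auto simp: f_def j)
qed

text \<open>The hypothesis \<open>dim\<close> makes the codimension of the tangent space of
  \<open>G0\<close> at least the number of equations, so their gradients are distinct and
  independent and \<open>G0\<close> is part of a system of parameters. The ideal \<open>J\<close>
  only has to be enclosed between \<open>G0\<close> and its ideal of arcs; this is how the ideal of
  the fibre is handled.\<close>

theorem smooth_at:
  fixes J :: "'v::finite mpoly set"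
  assumes fin: "finite G0" and J: "G0 \<subseteq> J" "J \<subseteq> Ihat z G0" and van: "\<And>g. g \<in> G0 \<Longrightarrow> peval g z = 0"
    and dim: "vec.dim {w. \<forall>g\<in>G0. dd z w g = 0} + card G0 \<le> CARD('v)"
  shows "vec.dim (tangent_space J z) + card G0 = CARD('v)"
    "local_krull_dim J z = enat (vec.dim (tangent_space J z))"
proof -
  obtain b :: "'v \<Rightarrow> complex^'v" and S where b: "b ` S \<subseteq> grad z ` G0" "inj b" "invertible (\<chi> i. b i)"
    "grad z ` G0 \<subseteq> vec.span (b ` S)"
    by (rule choose_rows[of "{}" "grad z ` G0"]) (auto simp: vec.independent_empty)
  have T: "{w. \<forall>g\<in>G0. dd z w g = 0} = {w. \<forall>i\<in>S. ((\<chi> i. b i) *v w) $ i = 0}"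
    using rows_ann[OF b(1,4)] by (simp add: dotp_grad)
  have cS: "card (- S) + card S = CARD('v)" 
    using card_Un_disjoint[of "- S" S] by simp
  have "card S = card (b ` S)" using b(2) by (simp add: card_image inj_on_subset[OF b(2)])
  also have "\<dots> \<le> card (grad z ` G0)" using fin b(1) by (intro card_mono) auto
  finally have 1: "card S \<le> card (grad z ` G0)" .
  have 2: "card (grad z ` G0) \<le> card G0" using fin by (rule card_image_le)
  have 3: "card G0 \<le> card S" using dim cS unfolding T dim_rows[OF b(3)] by linarith
  have "\<exists>h. h \<in> G0 \<and> grad z h = b i" if "i \<in> S" for i
    using subsetD[OF b(1) imageI[OF that]] by (metis image_iff)
  then have "\<exists>h. \<forall>i\<in>S. h i \<in> G0 \<and> grad z (h i) = b i" by (intro bchoice) blast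
  then obtain h where h: "\<And>i. i \<in> S \<Longrightarrow> h i \<in> G0" "\<And>i. i \<in> S \<Longrightarrow> grad z (h i) = b i" by blast
  have "inj_on h S" using h(2) b(2) by (metis injD inj_onI)
  then have "card (h ` S) = card S" by (rule card_image)
  then have hS: "h ` S = G0" using h(1) fin 1 2 3 by (intro card_subset_eq) auto
  obtain f where f: "param_system z f" "\<And>i. i \<in> S \<Longrightarrow> f i = h i" "jac f z = (\<chi> i. b i)"
    by (rule param_system_extend[OF b(3), of S h z]) (use h van in auto)
  have fS: "f ` S = G0" using f(2) hS by (metis image_cong)
  have "tangent_space J z = {w. \<forall>i\<in>S. (jac f z *v w) $ i = 0}"
    by (rule tangent_space_param_system[OF f(1)]) (use J fS in auto)
  then have d: "vec.dim (tangent_space J z) = card (- S)" using dim_rows[OF b(3)] f(3) by simp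
  show "vec.dim (tangent_space J z) + card G0 = CARD('v)" using d cS 1 2 3 by linarith
  show "local_krull_dim J z = enat (vec.dim (tangent_space J z))"
    unfolding d by (rule local_krull_dim_param_system[OF f(1)]) (use J fS in auto)
qed

theorem local_generators:
  fixes J :: "'v::finite mpoly set"
  assumes J: "ideal_in UNIV J" "J \<subseteq> {g. peval g x = 0}"
    and kd: "local_krull_dim J x = enat n"
    and f: "param_system x f" "f ` S \<subseteq> J" "card (- S) = n" and h: "h \<in> J"
  obtains g where "peval g x = 1" "g * h \<in> igen UNIV (f ` S)"
proof -
  define A where "A = {l. \<exists>P :: nat \<Rightarrow> 'v mpoly set.
     (\<forall>i\<le>l. prime_id (P i) \<and> J \<subseteq> P i \<and> P i \<subseteq> {g. peval g x = 0}) \<and> (\<forall>i<l. P i \<subset> P (Suc i))}"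
  have S: "Sup {enat l | l. l \<in> A} = enat n" using kd by (simp add: local_krull_dim_alt A_def)
  have m: "prime_id {g :: 'v mpoly. peval g x = 0}"
    by (auto simp: prime_id_def ideal_in_def peval_hom)
  have "\<exists>l\<in>A. n \<le> l"
  proof (cases n)
    case 0
    have "0 \<in> A" unfolding A_def using m J(2) by (intro CollectI exI[of _ "\<lambda>_. {g. peval g x = 0}"]) auto
    then show ?thesis using 0 by blast
  next
    case (Suc n')
    show ?thesis
    proof (rule ccontr)
      assume "\<not> ?thesis"
      then have "l \<le> n'" if "l \<in> A" for l using Suc that by (meson not_less_eq_eq)
      then have "Sup {enat l | l. l \<in> A} \<le> enat n'" by (intro Sup_least) auto
      then show False unfolding S using Suc by simp
    qed
  qed
  then obtain l P where l: "n \<le> l" and P: "\<forall>i\<le>l. prime_id (P i) \<and> J \<subseteq> P i \<and> P i \<subseteq> {g. peval g x = 0}"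
    "\<forall>i<l. P i \<subset> P (Suc i)" unfolding A_def by blast
  have pr: "prime_id (P i)" and JP: "J \<subseteq> P i" and vP: "P i \<subseteq> {g. peval g x = 0}" if "i \<le> l" for i
    using P(1) that by auto
  have IP: "Ihat x (f ` S) \<subseteq> P 0"
  proof
    fix k assume "k \<in> Ihat x (f ` S)"
    then obtain g where g: "peval g x = 1" "g * k \<in> igen UNIV (f ` S)" by (rule Ihat_local[OF f(1)])
    have "ideal_in UNIV (P 0)" using pr[of 0] by (simp add: prime_id_def)
    then have "igen UNIV (f ` S) \<subseteq> P 0" using f(2) JP[of 0] by (intro igen_least) auto
    then show "k \<in> P 0" using local_subset_prime[OF pr[of 0] vP[of 0] _ g] by simp
  qed
  have "Ihat x (f ` S) = P 0"
  proof (rule ccontr)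
    assume ne: "Ihat x (f ` S) \<noteq> P 0"
    \<comment> \<open>The chain \<open>P\<close> with one more prime below it.\<close>
    define P' where "P' i = (case i of 0 \<Rightarrow> Ihat x (f ` S) | Suc j \<Rightarrow> P j)" for i
    have "Suc l \<le> card (- S)"
    proof (rule chain_bound[OF f(1), of S P'])
      show "f ` S \<subseteq> P' 0" by (simp add: P'_def Ihat_superset)
      show "prime_id (P' i)" if "i \<le> Suc l" for i
        using that pr prime_Ihat[OF f(1)] by (cases i) (auto simp: P'_def)
      show "P' i \<subset> P' (Suc i)" if "i < Suc l" for i
        using that P(2) IP ne by (cases i) (auto simp: P'_def)
      show "P' (Suc l) \<subseteq> {g. peval g x = 0}" using vP by (simp add: P'_def)
    qed
    then show False using f(3) l by simp
  qed
  then have "h \<in> Ihat x (f ` S)" using h JP[of 0] by auto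
  then show ?thesis by (rule Ihat_local[OF f(1)]) (rule that)
qed

section \<open>Divisors on lines\<close>

text \<open>Restriction to the line a + t b over any algebra. It is used for the universal line, for
  complex lines (\<open>clin\<close>) and for lines that vary along a formal arc.\<close>

definition lin :: "(complex \<Rightarrow> 'a::comm_ring_1) \<Rightarrow> ('m \<Rightarrow> 'a) \<Rightarrow> ('m \<Rightarrow> 'a) \<Rightarrow> 'm mpoly \<Rightarrow> 'a poly" where
  "lin h a b F = subst (\<lambda>c. [:h c:]) (\<lambda>l. [:a l, b l:]) F"

definition divisor_poly :: "('r::finite \<Rightarrow> 'a::comm_ring_1) \<Rightarrow> ('r \<Rightarrow> nat) \<Rightarrow> 'a poly" where
  "divisor_poly u k = (\<Prod>q\<in>UNIV. [:- u q, 1:] ^ k q)"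

lemma rhom_lin: "rhom h \<Longrightarrow> rhom (lin h a b)"
  unfolding lin_def by (intro rhom_subst rhom_comp[OF rhom_pCons])

lemma lin_Const: "rhom h \<Longrightarrow> lin h a b (Const c) = [:h c:]"
  and lin_Var: "rhom h \<Longrightarrow> lin h a b (Var l) = [:a l, b l:]"
  by (simp_all add: lin_def subst_Const subst_Var rhom_comp[OF rhom_pCons])

lemmas lin_hom = rhomD[OF rhom_lin] rhom_sum[OF rhom_lin] rhom_prod[OF rhom_lin] rhom_power[OF rhom_lin]

lemma map_poly_pair: "rhom g \<Longrightarrow> map_poly g [:x, y:] = [:g x, g y:]"
  by (simp add: map_poly_pCons rhom_0)

lemma map_poly_lin:
  assumes g: "rhom g" and h: "rhom h"
  shows "map_poly g (lin h a b F) = lin (\<lambda>c. g (h c)) (\<lambda>l. g (a l)) (\<lambda>l. g (b l)) F"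
proof -
  have "map_poly g [:c:] = [:g c:]" for c using map_poly_pair[OF g, of c 0] rhom_0[OF g] by simp
  then show ?thesis
    unfolding lin_def
    by (subst rhom_subst_comp[OF rhom_map_poly[OF g] rhom_comp[OF rhom_pCons h]])
      (simp only: map_poly_pair[OF g])
qed

lemma map_poly_divisor_poly: assumes g: "rhom g" shows "map_poly g (divisor_poly u k) = divisor_poly (\<lambda>q. g (u q)) k"
  unfolding divisor_poly_def rhom_prod[OF rhom_map_poly[OF g]] rhom_power[OF rhom_map_poly[OF g]]
  by (simp only: map_poly_pair[OF g] rhom_minus[OF g] rhom_1[OF g])

lemma poly_lin:
  assumes h: "rhom h"
  shows "poly (lin h a b F) t = subst h (\<lambda>l. a l + t * b l) F"
  unfolding lin_def by (subst rhom_subst_comp[OF rhom_poly rhom_comp[OF rhom_pCons h]]) simp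

definition mon_deg :: "nat \<Rightarrow> 'a::comm_ring_1 poly \<Rightarrow> bool" where
  "mon_deg n D \<longleftrightarrow> Polynomial.coeff D n = 1 \<and> (\<forall>i>n. Polynomial.coeff D i = 0)"

lemma mon_deg_mult: assumes "mon_deg n p" "mon_deg m q" shows "mon_deg (n + m) (p * q)"
proof -
  have z: "Polynomial.coeff p i * Polynomial.coeff q (N - i) = 0" if "N - i > m \<or> i > n" for i N
    using assms that by (auto simp: mon_deg_def)
  have "Polynomial.coeff (p * q) (n + m) = (\<Sum>i\<le>n + m. if i = n then 1 else 0)"
    unfolding coeff_mult
  proof (intro sum.cong refl)
    fix i assume "i \<in> {..n + m}"
    show "Polynomial.coeff p i * Polynomial.coeff q (n + m - i) = (if i = n then 1 else 0)"
    proof (cases "i = n")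
      case True
      then show ?thesis using assms by (simp add: mon_deg_def)
    next
      case False
      then show ?thesis using z[of "n + m" i] \<open>i \<in> {..n + m}\<close> by (cases "i < n") auto
    qed
  qed
  moreover have "Polynomial.coeff (p * q) N = 0" if "N > n + m" for N
    unfolding coeff_mult by (intro sum.neutral ballI z) (use that in auto)
  ultimately show ?thesis by (simp add: mon_deg_def)
qed

lemma mon_deg_1: "mon_deg 0 1"
  by (simp add: mon_deg_def)

lemma mon_deg_power: "mon_deg n p \<Longrightarrow> mon_deg (j * n) (p ^ j)"
  by (induction j) (auto simp: mon_deg_1 intro: mon_deg_mult)

lemma mon_deg_divisor_poly:
  fixes u :: "'r::finite \<Rightarrow> 'a::comm_ring_1"
  shows "mon_deg (\<Sum>q\<in>UNIV. k q) (divisor_poly u k)"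
proof -
  have l: "mon_deg 1 [:- x, 1:]" for x :: 'a
    by (auto simp: mon_deg_def coeff_pCons split: nat.splits)
  have "mon_deg (\<Sum>q\<in>A. k q) (\<Prod>q\<in>A. [:- u q, 1:] ^ k q)" for A
  proof (induction A rule: infinite_finite_induct)
    case (insert q A)
    then show ?case using mon_deg_mult[OF mon_deg_power[OF l[of "u q"], of "k q"]] by simp
  qed (auto simp: mon_deg_1)
  then show ?thesis by (simp add: divisor_poly_def)
qed

lemma mon_deg_degree: "mon_deg n D \<Longrightarrow> Polynomial.degree D = n"
  unfolding mon_deg_def by (intro antisym degree_le le_degree) auto

lemma monic_div:
  assumes D: "mon_deg n D" and B: "srng B" "D \<in> PB B" "q \<in> PB B"
  obtains s r where "s \<in> PB B" "r \<in> PB B" "q = D * s + r" "\<And>i. i \<ge> n \<Longrightarrow> Polynomial.coeff r i = 0"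
proof -
  have d: "Polynomial.degree D = n" using D by (rule mon_deg_degree)
  then have 1: "Polynomial.lead_coeff D = 1" using D by (simp add: mon_deg_def)
  obtain k s r where "s \<in> PB B" "r \<in> PB B" "Polynomial.smult (Polynomial.lead_coeff D ^ k) q = D * s + r"
    "\<And>i. i \<ge> Polynomial.degree D \<Longrightarrow> Polynomial.coeff r i = 0" by (rule pseudo_division[OF B]) blast
  then show ?thesis using that d 1 by simp
qed

text \<open>The top coefficient of \<open>s\<close> appears unchanged as a coefficient of
  \<open>D * s + r\<close>, beyond the reach of \<open>r\<close>. So it lies in \<open>J\<close> and
  can be peeled off, until only \<open>r\<close> is left.\<close>

lemma monic_rem_ideal:
  assumes D: "mon_deg n D" and J: "ideal_in UNIV J" and r: "\<And>i. i \<ge> n \<Longrightarrow> Polynomial.coeff r i = 0"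
    and m: "\<And>i. Polynomial.coeff (D * s + r) i \<in> J"
  shows "Polynomial.coeff r i \<in> J"
proof -
  have "\<forall>i. Polynomial.coeff (D * s + r) i \<in> J \<Longrightarrow> \<forall>i\<ge>N. Polynomial.coeff s i = 0 \<Longrightarrow> \<forall>i. Polynomial.coeff r i \<in> J" for N s
  proof (induction N arbitrary: s)
    case 0
    then have "s = 0" by (auto simp: poly_eq_iff)
    then show ?case using 0 by simp
  next
    case (Suc N)
    define c where "c = Polynomial.coeff s N"
    have "Polynomial.coeff (D * s) (n + N) = (\<Sum>i\<le>n + N. if i = n then c else 0)"
      unfolding coeff_mult
    proof (intro sum.cong refl)
      fix i assume i: "i \<in> {..n + N}"
      show "Polynomial.coeff D i * Polynomial.coeff s (n + N - i) = (if i = n then c else 0)"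
      proof (cases "i = n")
        case False
        then have "i > n \<or> n + N - i \<ge> Suc N" using i by auto
        then show ?thesis using D Suc.prems(2) False by (auto simp: mon_deg_def)
      qed (use D in \<open>simp add: mon_deg_def c_def\<close>)
    qed
    then have "Polynomial.coeff (D * s + r) (n + N) = c" using r by simp
    then have c: "c \<in> J" using Suc.prems(1) by metis
    define s' where "s' = s - Polynomial.monom c N"
    have "Polynomial.coeff (D * s' + r) i \<in> J" for i
    proof -
      have "Polynomial.coeff (D * Polynomial.monom c N) i \<in> J"
        unfolding coeff_mult coeff_monom
        by (intro ideal_in_sum[OF J]) (use c ideal_in_0[OF J] ideal_in_mult[OF J UNIV_I c] in auto)
      moreover have "D * s' + r = (D * s + r) - D * Polynomial.monom c N"
        by (simp add: s'_def algebra_simps)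
      ultimately show ?thesis using ideal_in_diff[OF srng_UNIV J] Suc.prems(1) by (simp only: coeff_diff)
    qed
    moreover have "\<forall>i\<ge>N. Polynomial.coeff s' i = 0"
    proof (intro allI impI)
      fix i assume "N \<le> i"
      then show "Polynomial.coeff s' i = 0"
        using Suc.prems(2) by (cases "i = N") (auto simp: s'_def c_def)
    qed
    ultimately show ?case using Suc.IH by blast
  qed
  from this[of s "Suc (Polynomial.degree s)"] show ?thesis
    using m coeff_eq_0[of s] by (auto simp: Suc_le_eq)
qed

lemma monic_dvd_low:
  assumes D: "mon_deg n D" and r: "\<And>i. i \<ge> n \<Longrightarrow> Polynomial.coeff r i = 0" and d: "D dvd r"
  shows "r = 0"
proof -
  obtain s where s: "r = D * s" using d by (elim dvdE)
  have "Polynomial.coeff r i \<in> {0}" for i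
    by (rule monic_rem_ideal[OF D _ r, of "{0}" "- s"]) (auto simp: s ideal_in_def)
  then show ?thesis by (simp add: poly_eq_iff)
qed

lemma divisor_poly_split:
  assumes "k q > 0"
  shows "divisor_poly u k = [:- u q, 1:] * divisor_poly u (k(q := k q - 1))"
proof -
  obtain n where n: "k q = Suc n" using assms by (cases "k q") auto
  have "divisor_poly u k = [:- u q, 1:] ^ k q * (\<Prod>q'\<in>UNIV - {q}. [:- u q', 1:] ^ k q')"
    by (simp add: divisor_poly_def prod.remove[of UNIV q])
  also have "(\<Prod>q'\<in>UNIV - {q}. [:- u q', 1:] ^ k q') = (\<Prod>q'\<in>UNIV - {q}. [:- u q', 1:] ^ (k(q := n)) q')"
    by (rule prod.cong) auto
  also have "[:- u q, 1:] ^ k q * \<dots> = [:- u q, 1:] * ([:- u q, 1:] ^ (k(q := n)) q * \<dots>)"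
    by (simp add: n mult.assoc del: mult_pCons_left mult_pCons_right)
  also have "[:- u q, 1:] ^ (k(q := n)) q * (\<Prod>q'\<in>UNIV - {q}. [:- u q', 1:] ^ (k(q := n)) q') = divisor_poly u (k(q := n))"
    unfolding divisor_poly_def by (rule prod.remove[symmetric]) auto
  finally show ?thesis by (simp add: n)
qed

lemma divisor_poly_nonzero: "divisor_poly u k \<noteq> (0 :: 'a::idom poly)"
  using mon_deg_divisor_poly[of k u] by (auto simp: mon_deg_def)

lemma divisor_poly_dvd_mono: assumes "\<And>q. k' q \<le> k q" shows "divisor_poly u k' dvd divisor_poly u k"
  unfolding divisor_poly_def by (rule prod_dvd_prod) (use assms in \<open>auto intro: le_imp_power_dvd\<close>)

text \<open>Linear factors are split off one at a time: the next one divides \<open>G * S\<close>,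
  where \<open>S\<close> is the current cofactor, and so divides \<open>S\<close>. Over power series
  the factors for different indices need not be comaximal even when they are distinct, so the local
  divisibilities cannot simply be combined by the Chinese remainder theorem.\<close>

lemma divisor_poly_dvd_local:
  fixes u :: "'r::finite \<Rightarrow> 'a::idom"
  assumes G: "\<And>q. k q > 0 \<Longrightarrow> \<exists>G. divisor_poly u k dvd G * F \<and> poly G (u q) \<noteq> 0"
  shows "divisor_poly u k dvd F"
proof -
  have "divisor_poly u k' dvd F" if "\<And>q. k' q \<le> k q" "(\<Sum>q\<in>UNIV. k' q) = N" for N k'
    using that
  proof (induction N arbitrary: k')
    case 0
    then have "k' q = 0" for q by simp
    then show ?case by (simp add: divisor_poly_def)
  next
    case (Suc N)
    then obtain q where q: "k' q > 0" by (metis gr0I sum.neutral nat.distinct(1))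
    define k'' where "k'' = k'(q := k' q - 1)"
    have s: "(\<Sum>q\<in>UNIV. k' q) = k' q + (\<Sum>q\<in>UNIV - {q}. k' q)" by (rule sum.remove) auto
    have "(\<Sum>q\<in>UNIV. k'' q) = k'' q + (\<Sum>q\<in>UNIV - {q}. k'' q)" by (rule sum.remove) auto
    also have "(\<Sum>q\<in>UNIV - {q}. k'' q) = (\<Sum>q\<in>UNIV - {q}. k' q)" by (rule sum.cong) (auto simp: k''_def)
    finally have "(\<Sum>q\<in>UNIV. k'' q) = N" using s Suc.prems(2) q by (simp add: k''_def)
    moreover have "k'' p \<le> k p" for p
      using Suc.prems(1)[of p] by (auto simp: k''_def)
    ultimately have "divisor_poly u k'' dvd F" by (intro Suc.IH) auto
    then obtain S where S: "F = divisor_poly u k'' * S" by (elim dvdE)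
    obtain G where G: "divisor_poly u k dvd G * F" "poly G (u q) \<noteq> 0"
      using G[of q] q Suc.prems(1)[of q] by auto
    have k': "divisor_poly u k' = [:- u q, 1:] * divisor_poly u k''" unfolding k''_def by (rule divisor_poly_split[where k = k' and q = q, OF q])
    have "divisor_poly u k' dvd G * F" by (rule dvd_trans[OF divisor_poly_dvd_mono G(1)]) (rule Suc.prems(1))
    moreover have "G * F = (G * S) * divisor_poly u k''" by (simp add: S)
    ultimately have "[:- u q, 1:] dvd G * S"
      using divisor_poly_nonzero[of u k''] unfolding k' by (simp only: dvd_mult_cancel_right simp_thms)
    then have "poly (G * S) (u q) = 0" by (simp only: poly_eq_0_iff_dvd)
    then have "poly S (u q) = 0" using G(2) by simp
    then have "[:- u q, 1:] dvd S" by (simp only: poly_eq_0_iff_dvd)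
    then show ?case unfolding k' S by (subst mult.commute) (rule mult_dvd_mono, auto)
  qed
  then show ?thesis by auto
qed

section \<open>First-order deformations of aligned divisors\<close>

text \<open>The divisor divided by one factor \<open>t - u q\<close>, hence a building block of its
  derivative. If \<open>k q = 0\<close>, the truncated subtraction is harmless because
  \<open>D'\<close> multiplies the term by \<open>k q\<close>.\<close>

definition Dq :: "('r::finite \<Rightarrow> complex) \<Rightarrow> ('r \<Rightarrow> nat) \<Rightarrow> 'r \<Rightarrow> complex poly" where
  "Dq u k q = divisor_poly u (k(q := k q - 1))"

lemma Dq_prod: "Dq u k q = [:- u q, 1:] ^ (k q - 1) * (\<Prod>q'\<in>UNIV - {q}. [:- u q', 1:] ^ k q')"
  unfolding Dq_def divisor_poly_def by (subst prod.remove[of UNIV q]) (auto intro!: prod.cong arg_cong2[of _ _ _ _ "(*)"])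

definition D' :: "('r::finite \<Rightarrow> complex) \<Rightarrow> ('r \<Rightarrow> nat) \<Rightarrow> ('r \<Rightarrow> complex) \<Rightarrow> complex poly" where
  "D' u k u' = - (\<Sum>q\<in>UNIV. Polynomial.smult (of_nat (k q) * u' q) (Dq u k q))"

abbreviation "clin \<equiv> lin (\<lambda>c. c)"

definition dF :: "('m::finite \<Rightarrow> complex) \<Rightarrow> ('m \<Rightarrow> complex) \<Rightarrow> ('m \<Rightarrow> complex poly) \<Rightarrow> 'm mpoly \<Rightarrow> complex poly" where
  "dF a b s F = (\<Sum>l\<in>UNIV. clin a b (pd l F) * s l)"

lemmas clin_hom = lin_hom[OF rhom_id(2)]
lemmas clin_simps = lin_Const[OF rhom_id(2)] lin_Var[OF rhom_id(2)]

lemma dF_simps: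
  "dF a b s (Const c) = 0" "dF a b s (Var l) = s l" "dF a b s (F + G) = dF a b s F + dF a b s G"
  "dF a b s (F * G) = clin a b F * dF a b s G + dF a b s F * clin a b G"
proof -
  show "dF a b s (Var l) = s l"
  proof -
    have "dF a b s (Var l) = (\<Sum>v\<in>UNIV. if l = v then s v else 0)"
      unfolding dF_def by (intro sum.cong refl) (simp add: clin_hom)
    then show ?thesis by simp
  qed
qed (simp_all add: dF_def clin_hom algebra_simps sum.distrib sum_distrib_left)

lemma dF_lin: "dF a b (\<lambda>l. s l + s' l) F = dF a b s F + dF a b s' F" "dF a b (\<lambda>l. p * s l) F = p * dF a b s F"
  by (simp_all add: dF_def algebra_simps sum.distrib sum_distrib_left)

lemma dF_diff: "dF a b (\<lambda>l. s l - s' l) F = dF a b s F - dF a b s' F"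
  by (simp add: dF_def algebra_simps sum_subtractf)

lemma D'_lin:
  fixes u :: "'r::finite \<Rightarrow> complex"
  shows "D' u k (\<lambda>q. v q + v' q) = D' u k v + D' u k v'" "D' u k (\<lambda>q. c * v q) = Polynomial.smult c (D' u k v)"
  "D' u k (\<lambda>_. 0) = 0"
proof -
  show "D' u k (\<lambda>q. v q + v' q) = D' u k v + D' u k v'"
    by (simp add: D'_def algebra_simps sum.distrib smult_add_left)
  have "Polynomial.smult c (sum f A) = (\<Sum>x\<in>A. Polynomial.smult c (f x))" for f :: "'r \<Rightarrow> complex poly" and A
    by (induction A rule: infinite_finite_induct) (auto simp: smult_add_right)
  then show "D' u k (\<lambda>q. c * v q) = Polynomial.smult c (D' u k v)"
    by (simp add: D'_def algebra_simps)
qed (simp add: D'_def)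

text \<open>\<open>Dq u k q\<close> times \<open>t - u q\<close> is the divisor, so modulo the
  divisor \<open>t\<close> acts on the q-th summand as \<open>u q\<close>. This turns the velocities
  of first-order deformations into a module over the polynomials in \<open>t\<close>.\<close>

lemma D'_shift:
  assumes k: "\<And>q. k q > 0"
  shows "divisor_poly u k dvd [:0, 1:] * D' u k v - D' u k (\<lambda>q. u q * v q)"
proof -
  have "divisor_poly u k dvd [:0, 1:] * Polynomial.smult c (Dq u k q) - Polynomial.smult (c * u q) (Dq u k q)" for c q
  proof -
    have "[:0, 1:] * Polynomial.smult c (Dq u k q) - Polynomial.smult (c * u q) (Dq u k q) =
      [:c:] * ([:- u q, 1:] * Dq u k q)"
      by (simp add: algebra_simps)
    also have "[:- u q, 1:] * Dq u k q = divisor_poly u k" unfolding Dq_def by (rule divisor_poly_split[symmetric, OF k])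
    finally show ?thesis by (metis dvd_triv_right)
  qed
  then have "divisor_poly u k dvd (\<Sum>q\<in>UNIV. [:0, 1:] * Polynomial.smult (of_nat (k q) * v q) (Dq u k q)
     - Polynomial.smult (of_nat (k q) * v q * u q) (Dq u k q))" by (rule dvd_sum)
  also have "\<dots> = - ([:0, 1:] * D' u k v - D' u k (\<lambda>q. u q * v q))"
    by (simp only: D'_def sum_subtractf sum_distrib_left mult_minus_right minus_diff_eq minus_minus diff_minus_eq_add mult.assoc)
      (simp add: mult.commute mult.left_commute)
  finally show ?thesis by (simp only: dvd_minus_iff)
qed

text \<open>Translating \<open>t\<close> forward has the same effect as moving all roots backward at
  unit speed.\<close>

lemma pderiv_divisor_poly: "Polynomial.pderiv (divisor_poly u k) = D' u k (\<lambda>_. - 1)"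
proof -
  have "Polynomial.pderiv (divisor_poly u k) = (\<Sum>q\<in>UNIV. (\<Prod>q'\<in>UNIV - {q}. [:- u q', 1:] ^ k q') * Polynomial.pderiv ([:- u q, 1:] ^ k q))"
    unfolding divisor_poly_def by (rule pderiv_prod)
  also have "\<dots> = (\<Sum>q\<in>UNIV. Polynomial.smult (of_nat (k q)) (Dq u k q))"
  proof (intro sum.cong refl)
    fix q
    note Dq_prod[of u k q]
    moreover have "Polynomial.pderiv ([:- u q, 1:] ^ k q) = Polynomial.smult (of_nat (k q)) ([:- u q, 1:] ^ (k q - 1))"
      by (simp add: pderiv_power pderiv_pCons)
    ultimately show "(\<Prod>q'\<in>UNIV - {q}. [:- u q', 1:] ^ k q') * Polynomial.pderiv ([:- u q, 1:] ^ k q) =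
      Polynomial.smult (of_nat (k q)) (Dq u k q)" by (simp add: mult.commute)
  qed
  finally show ?thesis by (simp add: D'_def sum_negf)
qed

lemma pderiv_clin: "Polynomial.pderiv (clin a b F) = dF a b (\<lambda>l. [:b l:]) F"
proof (induction F rule: mpoly_induct)
  case (mult F G)
  then show ?case by (simp add: clin_hom dF_simps pderiv_mult algebra_simps)
qed (simp_all add: clin_simps clin_hom dF_simps pderiv_add pderiv_pCons)

section \<open>Generic smoothness\<close>

text \<open>On the line through a non-zero of \<open>f\<close> and one of \<open>g\<close>, both
  restrict to nonzero polynomials in one variable.\<close>

lemma mpoly_mult_nonzero:
  fixes f g :: "'v::finite mpoly"
  assumes "f \<noteq> 0" "g \<noteq> 0" shows "f * g \<noteq> 0"
proof -
  obtain y where y: "peval f y \<noteq> 0" using peval_nonzero_exists[OF assms(1)] .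
  obtain z where z: "peval g z \<noteq> 0" using peval_nonzero_exists[OF assms(2)] .
  obtain p where p: "\<And>t. poly p t = peval f (y + t *s (z - y))" by (rule line_poly[of f y "z - y"]) (rule that)
  obtain q where q: "\<And>t. poly q t = peval g (y + t *s (z - y))" by (rule line_poly[of g y "z - y"]) (rule that)
  have "poly p 0 \<noteq> 0" "poly q 1 \<noteq> 0" using y z by (simp_all add: p q)
  then have "p * q \<noteq> 0" by auto
  then obtain t where "poly (p * q) t \<noteq> 0" using poly_all_0_iff_0 by blast
  then have "peval (f * g) (y + t *s (z - y)) \<noteq> 0" by (simp add: p q peval_hom)
  then show ?thesis by (metis rhom_0[OF rhom_peval])
qed

lemma ideal_in_adjoin:
  assumes R: "srng R" and P: "ideal_in R P" and x: "x \<in> R"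
  shows "ideal_in R {p + r * x | p r. p \<in> P \<and> r \<in> R}" (is "ideal_in R ?Q")
  unfolding ideal_in_def
proof (intro conjI ballI subsetI)
  fix y assume "y \<in> ?Q"
  then show "y \<in> R" using ideal_in_sub[OF P] x by (auto intro!: srng_add[OF R] srng_mult[OF R])
next
  have "0 = 0 + 0 * x" by simp
  then show "0 \<in> ?Q" using ideal_in_0[OF P] srng_0[OF R] by blast
next
  fix y z assume "y \<in> ?Q" "z \<in> ?Q"
  then obtain p r p' r' where "y = p + r * x" "z = p' + r' * x" "p \<in> P" "r \<in> R" "p' \<in> P" "r' \<in> R" by blast
  moreover from this have "y + z = (p + p') + (r + r') * x" by (simp add: algebra_simps)
  ultimately show "y + z \<in> ?Q" using ideal_in_add[OF P] srng_add[OF R] by blast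
next
  fix b y assume "b \<in> R" "y \<in> ?Q"
  then obtain p r where "y = p + r * x" "p \<in> P" "r \<in> R" by blast
  moreover from this have "b * y = b * p + (b * r) * x" by (simp add: algebra_simps)
  ultimately show "b * y \<in> ?Q" using ideal_in_mult[OF P \<open>b \<in> R\<close>] srng_mult[OF R \<open>b \<in> R\<close>] by blast
qed

text \<open>Zorn's lemma: an ideal maximal among those that avoid a multiplicative set is
  prime.\<close>

lemma maximal_avoiding_ideal:
  assumes R: "srng R" and I0: "ideal_in R I0" and M: "M \<subseteq> R" "1 \<in> M" "\<And>x y. x \<in> M \<Longrightarrow> y \<in> M \<Longrightarrow> x * y \<in> M" "I0 \<inter> M = {}"
  obtains P where "prim R P" "I0 \<subseteq> P" "P \<inter> M = {}"
proof -
  define A where "A = {P. ideal_in R P \<and> I0 \<subseteq> P \<and> P \<inter> M = {}}"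
  have "\<exists>P\<in>A. \<forall>X\<in>A. P \<subseteq> X \<longrightarrow> X = P"
  proof (rule subset_Zorn_nonempty)
    show "A \<noteq> {}" using I0 M by (auto simp: A_def)
    fix C assume C: "C \<noteq> {}" "subset.chain A C"
    have CA: "c \<in> A" if "c \<in> C" for c using C(2) that by (auto simp: subset.chain_def)
    have id: "ideal_in R c" if "c \<in> C" for c using CA[OF that] by (simp add: A_def)
    have "ideal_in R (\<Union>C)"
      unfolding ideal_in_def
    proof (intro conjI ballI)
      show "\<Union>C \<subseteq> R" using ideal_in_sub[OF id] by blast
      show "0 \<in> \<Union>C" using C(1) ideal_in_0[OF id] by blast
    next
      fix x y assume "x \<in> \<Union>C" "y \<in> \<Union>C"
      then obtain c d where cd: "c \<in> C" "d \<in> C" "x \<in> c" "y \<in> d" by blast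
      then have "c \<subseteq> d \<or> d \<subseteq> c" using C(2) by (auto simp: subset.chain_def)
      then show "x + y \<in> \<Union>C" using cd ideal_in_add[OF id[OF cd(1)]] ideal_in_add[OF id[OF cd(2)]] by blast
    next
      fix b x assume "b \<in> R" "x \<in> \<Union>C"
      then obtain c where c: "c \<in> C" "x \<in> c" by blast
      then show "b * x \<in> \<Union>C" using ideal_in_mult[OF id[OF c(1)] \<open>b \<in> R\<close> c(2)] by blast
    qed
    moreover have "I0 \<subseteq> \<Union>C" using C(1) CA by (auto simp: A_def)
    moreover have "\<Union>C \<inter> M = {}" using CA by (auto simp: A_def)
    ultimately show "\<Union>C \<in> A" by (simp add: A_def)
  qed
  then obtain P where P: "P \<in> A" and max: "\<And>X. X \<in> A \<Longrightarrow> P \<subseteq> X \<Longrightarrow> X = P" by blast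
  have Pi: "ideal_in R P" "I0 \<subseteq> P" "P \<inter> M = {}" using P by (auto simp: A_def)
  have meet: "\<exists>p r. p \<in> P \<and> r \<in> R \<and> p + r * x \<in> M" if x: "x \<in> R" "x \<notin> P" for x
  proof (rule ccontr)
    assume n: "\<not> ?thesis"
    define Q where "Q = {p + r * x | p r. p \<in> P \<and> r \<in> R}"
    have PQ: "P \<subseteq> Q"
    proof
      fix p assume "p \<in> P"
      moreover have "p = p + 0 * x" by simp
      ultimately show "p \<in> Q" unfolding Q_def using srng_0[OF R] by blast
    qed
    have "x = 0 + 1 * x" by simp
    then have xQ: "x \<in> Q" unfolding Q_def using ideal_in_0[OF Pi(1)] srng_1[OF R] by blast
    have "Q \<inter> M = {}" using n unfolding Q_def by blast
    then have "Q \<in> A" using ideal_in_adjoin[OF R Pi(1) x(1)] PQ Pi(2) unfolding A_def Q_def by blast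
    then show False using max[OF _ PQ] xQ x(2) by blast
  qed
  have "x \<in> P \<or> y \<in> P" if xy: "x \<in> R" "y \<in> R" "x * y \<in> P" for x y
  proof (rule ccontr)
    assume "\<not> ?thesis"
    then obtain p r p' r' where *: "p \<in> P" "r \<in> R" "p + r * x \<in> M" "p' \<in> P" "r' \<in> R" "p' + r' * y \<in> M"
      using meet[OF xy(1)] meet[OF xy(2)] by blast
    have "(p + r * x) * (p' + r' * y) = ((p' + r' * y) * p + (r * x) * p') + (r * r') * (x * y)"
      by (simp add: algebra_simps)
    moreover have "p' + r' * y \<in> R" "r * x \<in> R" "r * r' \<in> R" using * xy M(1) by (auto intro: srng_mult[OF R])
    ultimately have "(p + r * x) * (p' + r' * y) \<in> P"
      using ideal_in_add[OF Pi(1)] ideal_in_mult[OF Pi(1)] * xy by simp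
    then show False using M(3)[OF *(3,6)] Pi(3) by blast
  qed
  then have "prim R P" using Pi(1,3) R M(2) unfolding prim_def ideal_in_def by blast
  then show ?thesis using that Pi by blast
qed

lemma srng_image: assumes h: "rhom h" and A: "srng A" shows "srng (h ` A)"
  unfolding srng_def
proof (intro conjI ballI)
  show "1 \<in> h ` A" using srng_1[OF A] by (intro image_eqI[of _ _ 1]) (simp_all add: rhom_1[OF h])
next
  fix x assume "x \<in> h ` A"
  then obtain a where a: "a \<in> A" "x = h a" by blast
  then show "- x \<in> h ` A" using srng_minus[OF A a(1)]
    by (intro image_eqI[of _ _ "- a"]) (simp_all add: rhom_minus[OF h])
  fix y assume "y \<in> h ` A"
  then obtain b where b: "b \<in> A" "y = h b" by blast
  show "x + y \<in> h ` A" using srng_add[OF A a(1) b(1)] a b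
    by (intro image_eqI[of _ _ "a + b"]) (simp_all add: rhom_add[OF h])
  show "x * y \<in> h ` A" using srng_mult[OF A a(1) b(1)] a b
    by (intro image_eqI[of _ _ "a * b"]) (simp_all add: rhom_mult[OF h])
qed

text \<open>The point \<open>\<zeta>\<close> is generic over \<open>K\<close> in a component of the closure of \<open>Z\<close> that dominates the target of \<open>\<theta>\<close>;
  in characteristic zero the tangent map of \<open>\<theta>\<close> is onto there.\<close>

theorem generic_bad_point:
  fixes Z :: "(complex^'v::finite) set" and \<theta> :: "'m::finite \<Rightarrow> 'v mpoly"
  assumes K: "srng K" "countable K" and \<theta>: "\<And>i. \<theta> i \<in> polys_over K" "g \<in> polys_over K"
    and gZ: "\<And>z. z \<in> Z \<Longrightarrow> peval g z \<noteq> 0"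
    and H: "\<And>H. H \<noteq> 0 \<Longrightarrow> \<exists>z\<in>Z. peval H (\<chi> i. peval (\<theta> i) z) \<noteq> 0"
  obtains \<zeta> and w :: "'m \<Rightarrow> complex^'v" where "peval g \<zeta> \<noteq> 0"
    "\<And>f. f \<in> polys_over K \<Longrightarrow> (\<And>z. z \<in> Z \<Longrightarrow> peval f z = 0) \<Longrightarrow> peval f \<zeta> = 0"
    "\<And>f i. f \<in> polys_over K \<Longrightarrow> (\<And>z. z \<in> Z \<Longrightarrow> peval f z = 0) \<Longrightarrow> dd \<zeta> (w i) f = 0"
    "\<And>i j. dd \<zeta> (w i) (\<theta> j) = (if i = j then 1 else 0)"
proof -
  define R where "R = (polys_over K :: 'v mpoly set)"
  have R: "srng R" by (simp add: R_def srng_sgen)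
  define sb where "sb = subst Const \<theta>"
  have sb: "rhom sb" unfolding sb_def by (rule rhom_subst[OF rhom_Const])
  have sbV: "sb (Const c) = Const c" "sb (Var i) = \<theta> i" for c i
    by (simp_all add: sb_def subst_Const[OF rhom_Const] subst_Var[OF rhom_Const])
  have sbR: "sb H \<in> R" if "H \<in> polys_over K" for H
    using that
  proof induction
    case (sgen_base x)
    then show ?case using \<theta> by (auto simp: sbV R_def intro: sgen.sgen_base)
  qed (auto simp: rhomD[OF sb] intro: srngD[OF R])
  have sbe: "peval (sb H) z = peval H (\<chi> i. peval (\<theta> i) z)" for H z
    by (simp add: sb_def peval_subst_Const)
  define I0 where "I0 = {f \<in> R. \<forall>z\<in>Z. peval f z = 0}"
  \<comment> \<open>A prime that avoids the nonzero polynomials in the \<theta> i keeps these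
    algebraically independent, so its component dominates the target; avoiding the powers of
    \<open>g\<close> keeps the open conditions at the generic point.\<close>
  define M where "M = {sb H * g ^ e | H e. H \<in> polys_over K \<and> H \<noteq> 0}"
  have MI: "sb H * g ^ e \<in> M" if "H \<in> polys_over K" "H \<noteq> 0" for H e using that unfolding M_def by blast
  have one: "(1 :: 'm mpoly) \<in> polys_over K" "(1 :: 'm mpoly) \<noteq> 0" by (auto intro: sgen_1)
  have "\<exists>P. prim R P \<and> I0 \<subseteq> P \<and> P \<inter> M = {}"
  proof -
    have I0: "ideal_in R I0"
      unfolding ideal_in_def I0_def by (auto simp: peval_hom srngD[OF R])
    have M1: "M \<subseteq> R"
      unfolding M_def using sbR \<theta>(2) by (auto intro!: srng_mult[OF R] srng_power[OF R] simp: R_def[symmetric])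
    have M2: "1 \<in> M" using MI[OF one, of 0] by (simp add: rhom_1[OF sb])
    have M3: "x * y \<in> M" if xy: "x \<in> M" "y \<in> M" for x y
    proof -
      obtain H e H' e' where *: "x = sb H * g ^ e" "y = sb H' * g ^ e'" "H \<in> polys_over K" "H \<noteq> 0"
        "H' \<in> polys_over K" "H' \<noteq> 0" using xy unfolding M_def by blast
      have "x * y = sb (H * H') * g ^ (e + e')" by (simp add: * rhom_mult[OF sb] power_add algebra_simps)
      then show ?thesis using MI[OF sgen_mult[OF *(3,5)] mpoly_mult_nonzero[OF *(4,6)]] by simp
    qed
    have "f \<notin> I0" if fM: "f \<in> M" for f
    proof
      assume f0: "f \<in> I0"
      obtain h e where *: "f = sb h * g ^ e" "h \<noteq> 0" using fM unfolding M_def by blast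
      obtain z where z: "z \<in> Z" "peval h (\<chi> i. peval (\<theta> i) z) \<noteq> 0" using H[OF *(2)] by blast
      then have "peval f z \<noteq> 0" using gZ[OF z(1)] by (simp add: * peval_hom sbe)
      then show False using f0 z(1) by (auto simp: I0_def)
    qed
    then have M4: "I0 \<inter> M = {}" by blast
    obtain P where "prim R P" "I0 \<subseteq> P" "P \<inter> M = {}"
      by (rule maximal_avoiding_ideal[OF R I0 M1 M2 M3 M4])
    then show ?thesis by blast
  qed
  then obtain P where P: "prim R P" "I0 \<subseteq> P" "P \<inter> M = {}" by blast
  have PM: "H = 0" if "sb H \<in> P" "H \<in> polys_over K" for H
    using MI[OF that(2), of 0] that(1) P(3) by auto
  define l where "l = CARD('m)"
  obtain e where e: "bij_betw e {..<l} (UNIV :: 'm set)"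
    using ex_bij_betw_nat_finite[of "UNIV :: 'm set"] by (auto simp: l_def atLeast0LessThan)
  define y where "y j = \<theta> (e j)" for j
  define Bs where "Bs = rec_nat (Const ` K) (\<lambda>j B. adjoin B (y j))"
  have Bs: "Bs 0 = Const ` K" "\<And>j. Bs (Suc j) = adjoin (Bs j) (y j)" by (simp_all add: Bs_def)
  define A where "A j = sgen (Const ` K \<union> Var ` e ` {..<j})" for j
  have sA: "srng (A j)" for j by (simp add: A_def srng_sgen)
  have Amono: "A i \<subseteq> A j" if "i \<le> j" for i j unfolding A_def using that by (intro sgen_mono) auto
  have AR: "A j \<subseteq> polys_over K" for j unfolding A_def by (intro sgen_mono) auto
  have simg: "srng (sb ` A j)" for j
    by (rule srng_image[OF sb sA])
  have BA: "Bs j \<subseteq> sb ` A j" for j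
  proof (induction j)
    case 0
    show ?case
    proof
      fix x assume "x \<in> Bs 0"
      then obtain c where c: "c \<in> K" "x = sb (Const c)" by (auto simp: Bs sbV)
      then show "x \<in> sb ` A 0" by (auto simp: A_def intro: sgen_base)
    qed
  next
    case (Suc j)
    have "sb (Var (e j)) \<in> sb ` A (Suc j)" by (intro imageI) (auto simp: A_def intro: sgen_base)
    then show ?case unfolding Bs
      by (intro adjoin_least simg) (use Suc Amono[of j "Suc j"] in \<open>auto simp: sbV y_def\<close>)
  qed
  have indep: "peval h v = peval h v'" if "h \<in> A j" "\<And>i. i < j \<Longrightarrow> v $ e i = v' $ e i" for h j v v'
    using that(1) unfolding A_def
  proof induction
    case (sgen_base x)
    then show ?case using that(2) by auto
  qed (auto simp: peval_hom)
  have tr: "transc (Bs j) P (y j)" if j: "j < l" for j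
    unfolding transc_def
  proof (intro ballI impI)
    fix q assume q: "q \<in> PB (Bs j)" "poly q (y j) \<in> P"
    have "\<exists>h. h \<in> A j \<and> sb h = Polynomial.coeff q n" for n
      using PB_D[OF q(1), of n] BA[of j] by (metis image_iff subsetD)
    then obtain h where h: "\<And>n. h n \<in> A j" "\<And>n. sb (h n) = Polynomial.coeff q n" by metis
    \<comment> \<open>The relation lifts along \<open>sb\<close> to \<open>G\<close>, which is zero
      because \<open>P\<close> avoids \<open>M\<close>. The coefficients \<open>h n\<close> do not
      involve the variable \<open>e j\<close>, so each of them vanishes.\<close>
    define G where "G = (\<Sum>n\<le>Polynomial.degree q. h n * Var (e j) ^ n)"
    have "sb G = poly q (y j)"
      by (simp add: G_def poly_altdef rhom_sum[OF sb] rhom_mult[OF sb] rhom_power[OF sb] sbV h y_def)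
    moreover have "G \<in> polys_over K"
      unfolding G_def using h(1) AR by (intro srng_sum[OF srng_sgen] sgen_mult srng_power[OF srng_sgen]) (auto intro: sgen_base)
    ultimately have G0: "G = 0" using PM q(2) by simp
    have hz: "h n = 0" if n: "n \<le> Polynomial.degree q" for n
    proof (rule ccontr)
      assume "h n \<noteq> 0"
      then obtain v where v: "peval (h n) v \<noteq> 0" using peval_nonzero_exists by blast
      define p where "p = (\<Sum>n\<le>Polynomial.degree q. Polynomial.monom (peval (h n) v) n)"
      have "poly p t = 0" for t
      proof -
        define v' where "v' = (\<chi> i. if i = e j then t else v $ i)"
        have ne: "e i \<noteq> e j" if "i < j" for i using e that j by (auto simp: bij_betw_def inj_on_def)
        have "peval (h n) v' = peval (h n) v" for n
          by (rule indep[OF h(1)]) (use ne in \<open>auto simp: v'_def\<close>)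
        then have "poly p t = peval G v'"
          by (simp add: p_def G_def poly_sum poly_monom peval_hom v'_def)
        then show ?thesis by (simp add: G0 peval_hom)
      qed
      then have "p = 0" using poly_all_0_iff_0 by blast
      moreover have "Polynomial.coeff p n = peval (h n) v" using n by (simp add: p_def coeff_sum)
      ultimately show False using v by simp
    qed
    show "\<forall>n. Polynomial.coeff q n \<in> P"
    proof
      fix n
      have "Polynomial.coeff q n = 0"
        using hz[of n] h(2)[of n] rhom_0[OF sb] coeff_eq_0[of q n] by (cases "n \<le> Polynomial.degree q") auto
      then show "Polynomial.coeff q n \<in> P" using P(1) by (simp add: prim_def)
    qed
  qed
  have KP: "Const ` K \<inter> P \<subseteq> {0}"
  proof
    fix x assume "x \<in> Const ` K \<inter> P"
    then obtain c where c: "c \<in> K" "x = Const c" "sb (Const c) \<in> P" by (auto simp: sbV)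
    then have "Const c = (0 :: 'm mpoly)" by (intro PM) (auto intro: sgen_base)
    from arg_cong[OF this, of "\<lambda>f. peval f 0"] show "x \<in> {0}" by (simp add: c peval_hom Const_simps)
  qed
  obtain \<zeta> w where \<zeta>: "\<And>f. f \<in> polys_over K \<Longrightarrow> peval f \<zeta> = 0 \<longleftrightarrow> f \<in> P"
    and w: "\<And>f i. f \<in> polys_over K \<Longrightarrow> f \<in> P \<Longrightarrow> dd \<zeta> (w i) f = 0"
    and wy: "\<And>i j. j < l \<Longrightarrow> dd \<zeta> (w i) (y j) = (if i = j then 1 else 0)"
    by (rule generic_point[OF K P(1)[unfolded R_def] KP, where l = l and y = y and Bs = Bs, OF _ tr Bs])
      (use \<theta>(1) in \<open>auto simp: y_def\<close>)
  have "\<exists>j. j < l \<and> e j = i" for i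
  proof -
    have "i \<in> e ` {..<l}" using e by (simp add: bij_betw_def)
    then show ?thesis by auto
  qed
  then obtain e' where e': "\<And>i. e' i < l" "\<And>i. e (e' i) = i" by metis
  show ?thesis
  proof (rule that[of \<zeta> "\<lambda>i. w (e' i)"])
    have "g \<in> M" using MI[OF one, of 1] by (simp add: rhom_1[OF sb])
    then show "peval g \<zeta> \<noteq> 0" using \<zeta>[OF \<theta>(2)] P(3) by blast
  next
    fix f :: "'v mpoly" assume f: "f \<in> polys_over K" "\<And>z. z \<in> Z \<Longrightarrow> peval f z = 0"
    then have fP: "f \<in> P" using P(2) by (auto simp: I0_def R_def)
    then show "peval f \<zeta> = 0" using \<zeta>[OF f(1)] by simp
    show "dd \<zeta> (w (e' i)) f = 0" for i using w[OF f(1) fP] .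
  next
    fix i j :: 'm
    have "dd \<zeta> (w (e' i)) (y (e' j)) = (if e' i = e' j then 1 else 0)" by (rule wy[OF e'(1)])
    moreover have "e' i = e' j \<longleftrightarrow> i = j" using e'(2) by metis
    ultimately show "dd \<zeta> (w (e' i)) (\<theta> j) = (if i = j then 1 else 0)" by (simp add: y_def e'(2))
  qed
qed

section \<open>Tangent vectors of the scheme of aligned divisors\<close>

text \<open>The vector \<open>s(t)\<close> is the velocity of the point \<open>a + t b\<close> and \<open>u'\<close> that of \<open>u\<close>: to first order, the
  divisor stays in the hypersurface \<open>F = 0\<close>.\<close>

definition first_order :: "('m::finite \<Rightarrow> complex) \<Rightarrow> ('m \<Rightarrow> complex) \<Rightarrow> ('r::finite \<Rightarrow> complex) \<Rightarrow> ('r \<Rightarrow> nat) \<Rightarrow>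
    ('m \<Rightarrow> complex poly) \<Rightarrow> ('r \<Rightarrow> complex) \<Rightarrow> 'm mpoly \<Rightarrow> bool" where
  "first_order a b u k s u' F \<longleftrightarrow> (\<exists>Q. clin a b F = divisor_poly u k * Q \<and> divisor_poly u k dvd dF a b s F - D' u k u' * Q)"

text \<open>The divisor is a nonzero polynomial, so the quotient \<open>Q\<close> is unique and any
  known one may be used.\<close>

lemma TcD: "first_order a b u k s u' F \<Longrightarrow> clin a b F = divisor_poly u k * Q \<Longrightarrow> divisor_poly u k dvd dF a b s F - D' u k u' * Q"
  using divisor_poly_nonzero[of u k] by (auto simp: first_order_def)

lemma first_order_add:
  assumes "first_order a b u k s u1 F" "first_order a b u k s' u2 F"
  shows "first_order a b u k (\<lambda>l. s l + s' l) (\<lambda>q. u1 q + u2 q) F"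
proof -
  obtain Q where Q: "clin a b F = divisor_poly u k * Q" using assms(1) by (auto simp: first_order_def)
  have e: "dF a b (\<lambda>l. s l + s' l) F - D' u k (\<lambda>q. u1 q + u2 q) * Q =
    (dF a b s F - D' u k u1 * Q) + (dF a b s' F - D' u k u2 * Q)"
    by (simp add: dF_lin D'_lin algebra_simps)
  show ?thesis unfolding first_order_def
    by (intro exI[of _ Q] conjI Q, unfold e) (rule dvd_add[OF TcD[OF assms(1) Q] TcD[OF assms(2) Q]])
qed

lemma first_order_smult:
  assumes "first_order a b u k s u1 F" shows "first_order a b u k (\<lambda>l. [:c:] * s l) (\<lambda>q. c * u1 q) F"
proof -
  obtain Q where Q: "clin a b F = divisor_poly u k * Q" using assms(1) by (auto simp: first_order_def)
  have e: "dF a b (\<lambda>l. [:c:] * s l) F - D' u k (\<lambda>q. c * u1 q) * Q = [:c:] * (dF a b s F - D' u k u1 * Q)"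
    unfolding dF_lin(2) D'_lin(2) by (simp add: smult_diff_right)
  show ?thesis unfolding first_order_def
    by (intro exI[of _ Q] conjI Q, unfold e) (rule dvd_mult[OF TcD[OF assms(1) Q]])
qed

lemma first_order_shift:
  assumes "first_order a b u k s u1 F" and k: "\<And>q. k q > 0"
  shows "first_order a b u k (\<lambda>l. [:0, 1:] * s l) (\<lambda>q. u q * u1 q) F"
proof -
  obtain Q where Q: "clin a b F = divisor_poly u k * Q" using assms(1) by (auto simp: first_order_def)
  have e: "dF a b (\<lambda>l. [:0, 1:] * s l) F - D' u k (\<lambda>q. u q * u1 q) * Q =
    [:0, 1:] * (dF a b s F - D' u k u1 * Q) + ([:0, 1:] * D' u k u1 - D' u k (\<lambda>q. u q * u1 q)) * Q"
    unfolding dF_lin(2) by (simp only: algebra_simps)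
  show ?thesis unfolding first_order_def
    by (intro exI[of _ Q] conjI Q, unfold e) (rule dvd_add[OF dvd_mult[OF TcD[OF assms(1) Q]] dvd_mult2[OF D'_shift[OF k]]])
qed

lemma first_order_D: assumes "divisor_poly u k dvd clin a b F" shows "first_order a b u k (\<lambda>l. divisor_poly u k * s l) (\<lambda>_. 0) F"
proof -
  obtain Q where Q: "clin a b F = divisor_poly u k * Q" using assms by (elim dvdE)
  then show ?thesis unfolding first_order_def by (intro exI[of _ Q]) (simp add: dF_lin D'_lin)
qed

lemma first_order_0: "divisor_poly u k dvd clin a b F \<Longrightarrow> first_order a b u k (\<lambda>l. 0) (\<lambda>_. 0) F"
  using first_order_D[of u k a b F "\<lambda>_. 0"] by simp

text \<open>Reparametrizing the line by a translation moves every \<open>a + t b\<close> with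
  velocity \<open>b\<close>, while the fixed points of the divisor change their coordinates at speed
  -1. Algebraically this is the t-derivative of \<open>clin a b F = D Q\<close>.\<close>

lemma first_order_b: assumes "divisor_poly u k dvd clin a b F" shows "first_order a b u k (\<lambda>l. [:b l:]) (\<lambda>_. - 1) F"
proof -
  obtain Q where Q: "clin a b F = divisor_poly u k * Q" using assms by (elim dvdE)
  have "dF a b (\<lambda>l. [:b l:]) F = divisor_poly u k * Polynomial.pderiv Q + D' u k (\<lambda>_. - 1) * Q"
    by (simp add: pderiv_mult pderiv_divisor_poly Q mult.commute flip: pderiv_clin)
  then show ?thesis unfolding first_order_def using Q by (intro exI[of _ Q]) simp
qed

lemma homogeneous_scale:
  assumes F: "\<forall>m\<in>Poly_Mapping.keys F. (\<Sum>v\<in>Poly_Mapping.keys m. Poly_Mapping.lookup m v) = e"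
  shows "subst h (\<lambda>l. c * x l) F = c ^ e * subst h x F"
  unfolding subst_def sum_distrib_left
proof (intro sum.cong refl)
  fix m assume m: "m \<in> Poly_Mapping.keys F"
  have "mon (\<lambda>l. c * x l) m = c ^ (\<Sum>v\<in>Poly_Mapping.keys m. Poly_Mapping.lookup m v) * mon x m"
    by (simp add: power_mult_distrib prod.distrib power_sum)
  then show "h (Poly_Mapping.lookup F m) * mon (\<lambda>l. c * x l) m = c ^ e * (h (Poly_Mapping.lookup F m) * mon x m)"
    using F m by (simp add: mult.left_commute)
qed

text \<open>Euler's relation, from the scaling of the argument by \<open>1 + \<epsilon>\<close>.\<close>

lemma first_order_euler:
  fixes F :: "'m::finite mpoly"
  assumes "divisor_poly u k dvd clin a b F" and F: "homogeneous F"
  shows "first_order a b u k (\<lambda>l. [:a l, b l:]) (\<lambda>_. 0) F"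
proof -
  obtain Q where Q: "clin a b F = divisor_poly u k * Q" using assms by (elim dvdE)
  obtain e where e: "\<forall>m\<in>Poly_Mapping.keys F. (\<Sum>v\<in>Poly_Mapping.keys m. Poly_Mapping.lookup m v) = e"
    using F by (auto simp: homogeneous_def)
  define x where "x l = [:a l, b l:]" for l
  have "dF a b x F = Polynomial.coeff (subst (\<lambda>c. [:[:c:]:]) (\<lambda>l. [:x l, x l:]) F) 1"
    unfolding chain_rule[OF rhom_pCons] by (simp add: dF_def lin_def x_def)
  also have "(\<lambda>l. [:x l, x l:]) = (\<lambda>l. [:1, 1:] * [:x l:])" by simp
  also have "subst (\<lambda>c. [:[:c:]:]) \<dots> F = [:1, 1:] ^ e * subst (\<lambda>c. [:[:c:]:]) (\<lambda>l. [:x l:]) F"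
    by (rule homogeneous_scale[OF e])
  also have "subst (\<lambda>c. [:[:c:]:]) (\<lambda>l. [:x l:]) F = [:clin a b F:]"
    unfolding lin_def x_def by (subst rhom_subst_comp[OF rhom_pCons rhom_pCons]) simp
  also have "Polynomial.coeff ([:1, 1:] ^ e * [:clin a b F:]) 1 = Polynomial.coeff ([:1, 1:] ^ e) 1 * clin a b F"
    by (simp add: coeff_mult_1 mult.commute)
  finally have "divisor_poly u k dvd dF a b x F" using assms(1) by simp
  then show ?thesis unfolding first_order_def using Q by (intro exI[of _ Q]) (simp add: D'_lin x_def[abs_def])
qed

text \<open>In the product rule for \<open>g * F\<close>, the term with the derivative of
  \<open>g\<close> carries the factor \<open>clin a b F\<close>, which the divisor divides.\<close>

lemma first_order_igen:
  assumes "f \<in> igen UNIV V" "\<And>F. F \<in> V \<Longrightarrow> first_order a b u k s u' F" shows "first_order a b u k s u' f"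
  using assms(1)
proof (induction rule: igen.induct)
  case igen_0
  show ?case unfolding first_order_def by (intro exI[of _ 0]) (simp add: clin_hom dF_def pd_0_1)
next
  case (igen_step g F x)
  obtain Q where Q: "clin a b F = divisor_poly u k * Q" using assms(2)[OF igen_step(2)] by (auto simp: first_order_def)
  obtain Q' where Q': "clin a b x = divisor_poly u k * Q'" using igen_step.IH by (auto simp: first_order_def)
  note 1 = TcD[OF assms(2)[OF igen_step(2)] Q] and 2 = TcD[OF igen_step.IH Q']
  have "clin a b (g * F + x) = divisor_poly u k * (clin a b g * Q + Q')"
    by (simp add: clin_hom Q Q' algebra_simps)
  moreover have "dF a b s (g * F + x) - D' u k u' * (clin a b g * Q + Q') =
    (clin a b g * (dF a b s F - D' u k u' * Q) + (dF a b s x - D' u k u' * Q')) + divisor_poly u k * (dF a b s g * Q)"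
    by (simp add: dF_simps Q algebra_simps)
  moreover have "divisor_poly u k dvd (clin a b g * (dF a b s F - D' u k u' * Q) + (dF a b s x - D' u k u' * Q')) + divisor_poly u k * (dF a b s g * Q)"
    using 1 2 by (intro dvd_add dvd_mult dvd_triv_left)
  ultimately show ?case unfolding first_order_def by (intro exI[of _ "clin a b g * Q + Q'"]) simp
qed

lemma poly_as_shifted_sum:
  fixes p :: "complex poly"
  shows "p = (\<Sum>i\<le>Polynomial.degree p. [:Polynomial.coeff (pcompose p [:w, 1:]) i:] * [:- w, 1:] ^ i)"
proof -
  define r where "r = pcompose p [:w, 1:]"
  have "pcompose r [:- w, 1:] = pcompose p (pcompose [:w, 1:] [:- w, 1:])" by (simp add: r_def pcompose_assoc)
  also have "pcompose [:w, 1:] [:- w, 1:] = [:0, 1:]" by (simp add: pcompose_pCons)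
  finally have p: "pcompose r [:- w, 1:] = p" by simp
  have d: "Polynomial.degree r = Polynomial.degree p" by (simp add: r_def degree_pcompose)
  have "pcompose r [:- w, 1:] = poly (map_poly (\<lambda>x. [:x:]) r) [:- w, 1:]" by (rule pcompose_altdef)
  also have "\<dots> = (\<Sum>i\<le>Polynomial.degree r. [:Polynomial.coeff r i:] * [:- w, 1:] ^ i)"
  proof -
    have "Polynomial.degree (map_poly (\<lambda>x. [:x:]) r) = Polynomial.degree r"
      by (rule degree_map_poly) auto
    then show ?thesis by (simp add: poly_altdef coeff_map_poly)
  qed
  finally show ?thesis unfolding p d unfolding r_def .
qed

text \<open>The constant vectors generate a submodule \<open>C\<close> of the quotient \<open>\<complex>[t]\<^sup>m / N\<close> with \<open>C \<subseteq> (t - w) C\<close>; since a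
  monic polynomial annihilates the quotient, \<open>(t - w) C\<close> is stable under \<open>t - w\<close> and hence everything.\<close>

lemma module_argument:
  fixes N :: "('m::finite \<Rightarrow> complex poly) set"
  assumes D: "mon_deg \<kappa> D" "\<kappa> > 0"
    and add: "\<And>s s'. s \<in> N \<Longrightarrow> s' \<in> N \<Longrightarrow> (\<lambda>l. s l + s' l) \<in> N"
    and mult: "\<And>p s. s \<in> N \<Longrightarrow> (\<lambda>l. p * s l) \<in> N"
    and DN: "\<And>s. (\<lambda>l. D * s l) \<in> N"
    and hyp: "\<And>e. \<exists>b. (\<lambda>l. [:e l:] - [:- w, 1:] * [:b l:]) \<in> N"
  shows "\<exists>b. (\<lambda>l. s l - [:- w, 1:] * [:b l:]) \<in> N"
proof -
  define \<tau> where "\<tau> = [:- w, 1:]"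
  define E where "E s s' \<longleftrightarrow> (\<lambda>l. s l - s' l) \<in> N" for s s' :: "'m \<Rightarrow> complex poly"
  have E_mult: "E (\<lambda>l. p * s l) (\<lambda>l. p * s' l)" if "E s s'" for p s s'
    using mult[of "\<lambda>l. s l - s' l" p] that by (simp add: E_def algebra_simps)
  have E_add: "E (\<lambda>l. s l + r l) (\<lambda>l. s' l + r' l)" if "E s s'" "E r r'" for s s' r r'
    using add[of "\<lambda>l. s l - s' l" "\<lambda>l. r l - r' l"] that by (simp add: E_def algebra_simps)
  have E_refl: "E s s" for s
    using DN[of "\<lambda>_. 0"] by (simp add: E_def)
  have E_trans: "E s s''" if "E s s'" "E s' s''" for s s' s''
    using add[of "\<lambda>l. s l - s' l" "\<lambda>l. s' l - s'' l"] that by (simp add: E_def)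
  have E_sym: "E s' s" if "E s s'" for s s'
    using mult[of "\<lambda>l. s l - s' l" "- 1"] that by (simp add: E_def)
  have E_sum: "E (\<lambda>l. \<Sum>i\<in>I. s i l) (\<lambda>l. \<Sum>i\<in>I. s' i l)" if "\<And>i. i \<in> I \<Longrightarrow> E (s i) (s' i)" for I :: "nat set" and s s'
    using that by (induction I rule: infinite_finite_induct) (auto intro: E_refl E_add)
  \<comment> \<open>Only a choice for each constant vector; linearity is not claimed. Iterating it
    writes \<open>e\<close> as \<open>\<tau> ^ i\<close> times a constant vector, for every
    \<open>i\<close>.\<close>
  obtain \<beta> where \<beta>: "E (\<lambda>l. [:e l:]) (\<lambda>l. \<tau> * [:\<beta> e l:])" for e
    using hyp unfolding E_def \<tau>_def by metis
  have it: "E (\<lambda>l. [:e l:]) (\<lambda>l. \<tau> ^ i * [:(\<beta> ^^ i) e l:])" for e i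
  proof (induction i)
    case 0
    show ?case using E_refl by simp
  next
    case (Suc i)
    have "E (\<lambda>l. \<tau> ^ i * [:(\<beta> ^^ i) e l:]) (\<lambda>l. \<tau> ^ i * (\<tau> * [:\<beta> ((\<beta> ^^ i) e) l:]))"
      by (rule E_mult[OF \<beta>])
    then have "E (\<lambda>l. \<tau> ^ i * [:(\<beta> ^^ i) e l:]) (\<lambda>l. \<tau> ^ Suc i * [:(\<beta> ^^ Suc i) e l:])"
      by (simp only: power_Suc2 mult.assoc funpow.simps o_apply)
    then show ?case by (rule E_trans[OF Suc])
  qed
  define V where "V = {s. \<exists>b. E s (\<lambda>l. \<tau> * [:b l:])}"
  have V_E: "s \<in> V" if "E s s'" "s' \<in> V" for s s' using that E_trans by (auto simp: V_def)
  have V_add: "(\<lambda>l. s l + s' l) \<in> V" if ss: "s \<in> V" "s' \<in> V" for s s'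
  proof -
    obtain b b' where "E s (\<lambda>l. \<tau> * [:b l:])" "E s' (\<lambda>l. \<tau> * [:b' l:])" using ss by (auto simp: V_def)
    then have "E (\<lambda>l. s l + s' l) (\<lambda>l. \<tau> * [:b l:] + \<tau> * [:b' l:])" by (rule E_add)
    also have "(\<lambda>l. \<tau> * [:b l:] + \<tau> * [:b' l:]) = (\<lambda>l. \<tau> * [:b l + b' l:])"
      by (simp add: smult_add_left)
    finally show ?thesis unfolding V_def by (intro CollectI exI[of _ "\<lambda>l. b l + b' l"])
  qed
  have V_0: "(\<lambda>_. 0) \<in> V" unfolding V_def using E_refl by (intro CollectI exI[of _ "\<lambda>_. 0"]) simp
  have V_sum: "(\<lambda>l. \<Sum>i\<in>I. s i l) \<in> V" if "\<And>i. i \<in> I \<Longrightarrow> s i \<in> V" for I :: "nat set" and s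
    using that by (induction I rule: infinite_finite_induct) (auto intro: V_0 V_add)
  have V_const: "(\<lambda>l. [:e l:]) \<in> V" for e unfolding V_def using \<beta> by blast
  \<comment> \<open>Let \<open>s\<close> be \<open>\<tau> b\<close> modulo \<open>N\<close>, and
    write \<open>b\<close> as \<open>\<tau>^(\<kappa> - 1) b1\<close>. Then \<open>\<tau> s\<close>
    becomes \<open>\<tau>\<close> times \<open>\<tau>^\<kappa> b1\<close>. The monic
    \<open>D\<close> reduces \<open>\<tau>^\<kappa> b1\<close> to lower powers of
    \<open>\<tau>\<close> times \<open>b1\<close>, and each of these is congruent to a constant
    vector again.\<close>
  have V_\<tau>: "(\<lambda>l. \<tau> * s l) \<in> V" if sV: "s \<in> V" for s
  proof -
    obtain b where b: "E s (\<lambda>l. \<tau> * [:b l:])" using sV by (auto simp: V_def)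
    obtain j where j: "\<kappa> = Suc j" using D(2) by (cases \<kappa>) auto
    define b1 where "b1 = (\<beta> ^^ j) b"
    define d where "d i = Polynomial.coeff (pcompose D [:w, 1:]) i" for i
    have dD: "Polynomial.degree D = \<kappa>" using D(1) by (rule mon_deg_degree)
    have "d \<kappa> = Polynomial.lead_coeff (pcompose D [:w, 1:])" using dD by (simp add: d_def degree_pcompose)
    also have "\<dots> = 1" using D(1) dD by (subst lead_coeff_comp) (auto simp: mon_deg_def)
    finally have d\<kappa>: "d \<kappa> = 1" .
    have "D = (\<Sum>i\<le>\<kappa>. [:d i:] * \<tau> ^ i)" using poly_as_shifted_sum[of D w] by (simp only: dD d_def \<tau>_def)
    also have "\<dots> = \<tau> ^ \<kappa> + (\<Sum>i<\<kappa>. [:d i:] * \<tau> ^ i)"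
      by (simp add: d\<kappa> lessThan_Suc_atMost[symmetric])
    finally have \<tau>\<kappa>: "\<tau> ^ \<kappa> = D + (\<Sum>i<\<kappa>. [:- d i:] * \<tau> ^ i)" by (simp add: sum_negf)
    have step: "E (\<lambda>l. \<tau> ^ i * [:b1 l:]) (\<lambda>l. [:(\<beta> ^^ (j - i)) b l:])" if ij: "i \<le> j" for i
    proof -
      have "(\<beta> ^^ (i + (j - i))) b = (\<beta> ^^ i) ((\<beta> ^^ (j - i)) b)" by (simp only: funpow_add o_apply)
      then have "(\<beta> ^^ i) ((\<beta> ^^ (j - i)) b) = b1" using ij by (simp add: b1_def)
      then show ?thesis using E_sym[OF it[of "(\<beta> ^^ (j - i)) b" i]] by (simp only:)
    qed
    have "E (\<lambda>l. D * [:b1 l:] + (\<Sum>i<\<kappa>. [:- d i:] * (\<tau> ^ i * [:b1 l:]))) (\<lambda>l. 0 + (\<Sum>i<\<kappa>. [:- d i:] * [:(\<beta> ^^ (j - i)) b l:]))"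
    proof (rule E_add)
      show "E (\<lambda>l. D * [:b1 l:]) (\<lambda>l. 0)" using DN[of "\<lambda>l. [:b1 l:]"] by (simp only: E_def diff_0_right)
      show "E (\<lambda>l. \<Sum>i<\<kappa>. [:- d i:] * (\<tau> ^ i * [:b1 l:])) (\<lambda>l. \<Sum>i<\<kappa>. [:- d i:] * [:(\<beta> ^^ (j - i)) b l:])"
        by (intro E_sum E_mult step) (simp add: j)
    qed
    moreover have "(\<lambda>l. D * [:b1 l:] + (\<Sum>i<\<kappa>. [:- d i:] * (\<tau> ^ i * [:b1 l:]))) = (\<lambda>l. \<tau> ^ \<kappa> * [:b1 l:])"
      unfolding \<tau>\<kappa> distrib_right sum_distrib_right by (simp only: mult.assoc)
    moreover have "(\<lambda>l. 0 + (\<Sum>i<\<kappa>. [:- d i:] * [:(\<beta> ^^ (j - i)) b l:])) = (\<lambda>l. [:\<Sum>i<\<kappa>. - d i * (\<beta> ^^ (j - i)) b l:])"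
      by (simp add: rhom_sum[OF rhom_pCons] mult.commute)
    ultimately have k1: "E (\<lambda>l. \<tau> ^ \<kappa> * [:b1 l:]) (\<lambda>l. [:\<Sum>i<\<kappa>. - d i * (\<beta> ^^ (j - i)) b l:])" by simp
    have t1: "E (\<lambda>l. \<tau> * s l) (\<lambda>l. \<tau> * (\<tau> * [:b l:]))" by (rule E_mult[OF b])
    have t2: "E (\<lambda>l. \<tau> * (\<tau> * [:b l:])) (\<lambda>l. \<tau> * (\<tau> * (\<tau> ^ j * [:b1 l:])))"
      unfolding b1_def by (intro E_mult it)
    have t3: "(\<lambda>l. \<tau> * (\<tau> * (\<tau> ^ j * [:b1 l:]))) = (\<lambda>l. \<tau> * (\<tau> ^ \<kappa> * [:b1 l:]))"
      by (simp only: j power_Suc mult.assoc)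
    have "E (\<lambda>l. \<tau> * s l) (\<lambda>l. \<tau> * [:\<Sum>i<\<kappa>. - d i * (\<beta> ^^ (j - i)) b l:])"
      by (rule E_trans[OF E_trans[OF t1 t2[unfolded t3]] E_mult[OF k1]])
    then show ?thesis
      unfolding V_def by (intro CollectI exI[of _ "\<lambda>l. \<Sum>i<\<kappa>. - d i * (\<beta> ^^ (j - i)) b l"])
  qed
  have V_pow: "(\<lambda>l. \<tau> ^ i * [:e l:]) \<in> V" for i e
  proof (induction i)
    case (Suc i)
    show ?case using V_\<tau>[OF Suc] by (simp only: power_Suc mult.assoc)
  qed (use V_const in simp)
  define n where "n = Max (range (\<lambda>l. Polynomial.degree (s l)))"
  have n: "Polynomial.degree (s l) \<le> n" for l unfolding n_def by (intro Max_ge) auto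
  have "s l = (\<Sum>i\<le>n. \<tau> ^ i * [:Polynomial.coeff (pcompose (s l) [:w, 1:]) i:])" for l
  proof -
    have "s l = (\<Sum>i\<le>Polynomial.degree (s l). \<tau> ^ i * [:Polynomial.coeff (pcompose (s l) [:w, 1:]) i:])"
      using poly_as_shifted_sum[of "s l" w] by (simp only: \<tau>_def mult.commute)
    also have "\<dots> = (\<Sum>i\<le>n. \<tau> ^ i * [:Polynomial.coeff (pcompose (s l) [:w, 1:]) i:])"
      by (rule sum.mono_neutral_left) (use n[of l] in \<open>auto simp: coeff_eq_0 degree_pcompose\<close>)
    finally show ?thesis .
  qed
  then have "s = (\<lambda>l. \<Sum>i\<le>n. \<tau> ^ i * [:Polynomial.coeff (pcompose (s l) [:w, 1:]) i:])" by (intro ext)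
  also have "\<dots> \<in> V" by (intro V_sum V_pow)
  finally show ?thesis by (simp add: V_def E_def \<tau>_def)
qed

lemma poly_clin: "poly (clin a b F) t = peval F (\<chi> l. a l + t * b l)"
  unfolding poly_lin[OF rhom_id(2)] by (simp add: peval_def id_def)

text \<open>At one point of the divisor a constant vector produces the required values, because the
  differentials are independent there. What is left is divisible by the corresponding linear factor,
  and the quotient is treated with one multiplicity less.\<close>

lemma dF_surjective:
  fixes f :: "nat \<Rightarrow> 'm::finite mpoly" and u :: "'r::finite \<Rightarrow> complex"
  assumes s: "\<And>q y. \<exists>s. \<forall>j<c. dd (\<chi> l. a l + u q * b l) s (f j) = y j"
  shows "\<exists>s. \<forall>j<c. divisor_poly u k dvd y j - dF a b s (f j)"
proof -
  have "\<exists>s. \<forall>j<c. divisor_poly u k dvd y j - dF a b s (f j)" if "(\<Sum>q\<in>UNIV. k q) = n" for n k y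
    using that
  proof (induction n arbitrary: k y)
    case 0
    then have "k q = 0" for q by simp
    then show ?case by (simp add: divisor_poly_def)
  next
    case (Suc n)
    then obtain q where q: "k q > 0" by (metis gr0I sum.neutral nat.distinct(1))
    define k' where "k' = k(q := k q - 1)"
    have "(\<Sum>q\<in>UNIV. k q) = k q + (\<Sum>q\<in>UNIV - {q}. k q)" by (rule sum.remove) auto
    moreover have "(\<Sum>q\<in>UNIV. k' q) = k' q + (\<Sum>q\<in>UNIV - {q}. k' q)" by (rule sum.remove) auto
    moreover have "(\<Sum>q\<in>UNIV - {q}. k' q) = (\<Sum>q\<in>UNIV - {q}. k q)" by (rule sum.cong) (auto simp: k'_def)
    ultimately have k': "(\<Sum>q\<in>UNIV. k' q) = n" using Suc.prems q by (simp add: k'_def)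
    obtain s0 where s0: "\<forall>j<c. dd (\<chi> l. a l + u q * b l) s0 (f j) = poly (y j) (u q)"
      using s[of q "\<lambda>j. poly (y j) (u q)"] by blast
    define c0 where "c0 l = [:s0 $ l:]" for l
    have "[:- u q, 1:] dvd y j - dF a b c0 (f j)" if "j < c" for j
    proof -
      have "poly (dF a b c0 (f j)) (u q) = dd (\<chi> l. a l + u q * b l) s0 (f j)"
        by (simp add: dF_def poly_sum poly_clin dd_pd c0_def mult.commute)
      then have "poly (y j - dF a b c0 (f j)) (u q) = 0" using s0 that by simp
      then show ?thesis by (simp only: poly_eq_0_iff_dvd)
    qed
    then have "\<forall>j. \<exists>y'. j < c \<longrightarrow> y j - dF a b c0 (f j) = [:- u q, 1:] * y'" by (metis dvdE)
    then obtain y' where y': "\<And>j. j < c \<Longrightarrow> y j - dF a b c0 (f j) = [:- u q, 1:] * y' j" by metis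
    obtain s1 where s1: "\<forall>j<c. divisor_poly u k' dvd y' j - dF a b s1 (f j)" using Suc.IH[OF k'] by blast
    show ?case
    proof (intro exI[of _ "\<lambda>l. c0 l + [:- u q, 1:] * s1 l"] allI impI)
      fix j assume j: "j < c"
      have "y j - dF a b (\<lambda>l. c0 l + [:- u q, 1:] * s1 l) (f j) = [:- u q, 1:] * (y' j - dF a b s1 (f j))"
        unfolding dF_lin(1)[of a b c0] dF_lin(2) using y'[OF j]
        by (simp only: right_diff_distrib diff_diff_eq[symmetric])
      moreover have "divisor_poly u k = [:- u q, 1:] * divisor_poly u k'" unfolding k'_def by (rule divisor_poly_split[where k = k and q = q, OF q])
      ultimately show "divisor_poly u k dvd y j - dF a b (\<lambda>l. c0 l + [:- u q, 1:] * s1 l) (f j)"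
        using s1 j by (simp only: mult_dvd_mono dvd_refl)
    qed
  qed
  then show ?thesis by blast
qed

text \<open>Deformations that keep \<open>a + w b\<close> fixed have \<open>a' = - w b'\<close>, so
  the point with coordinate t has velocity \<open>(t - w) b'\<close>. The components
  \<open>Inl\<close> hold b' and the components \<open>Inr\<close> hold u'.\<close>

definition tangent_pairs :: "'m mpoly set \<Rightarrow> ('m::finite \<Rightarrow> complex) \<Rightarrow> ('m \<Rightarrow> complex) \<Rightarrow> ('r::finite \<Rightarrow> complex) \<Rightarrow> complex \<Rightarrow>
    ('r \<Rightarrow> nat) \<Rightarrow> (complex^('m + 'r)) set" where
  "tangent_pairs V a b u w k = {v. \<forall>F\<in>V. first_order a b u k (\<lambda>l. [:- w, 1:] * [:v $ Inl l:]) (\<lambda>q. v $ Inr q) F}"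

lemma subspace_tangent_pairs:
  assumes "\<And>F. F \<in> V \<Longrightarrow> divisor_poly u k dvd clin a b F"
  shows "vec.subspace (tangent_pairs V a b u w k)"
proof (rule vec.subspaceI)
  show "0 \<in> tangent_pairs V a b u w k" using first_order_0[OF assms] by (simp add: tangent_pairs_def)
next
  fix x y assume "x \<in> tangent_pairs V a b u w k" "y \<in> tangent_pairs V a b u w k"
  then have "first_order a b u k (\<lambda>l. [:- w, 1:] * [:x $ Inl l:] + [:- w, 1:] * [:y $ Inl l:]) (\<lambda>q. x $ Inr q + y $ Inr q) F" if "F \<in> V" for F
    using that unfolding tangent_pairs_def by (intro first_order_add) blast+
  moreover have "(\<lambda>l. [:- w, 1:] * [:x $ Inl l:] + [:- w, 1:] * [:y $ Inl l:]) = (\<lambda>l. [:- w, 1:] * [:(x + y) $ Inl l:])"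
    by (simp add: algebra_simps)
  ultimately show "x + y \<in> tangent_pairs V a b u w k" by (simp add: tangent_pairs_def)
next
  fix c x assume "x \<in> tangent_pairs V a b u w k"
  then have "first_order a b u k (\<lambda>l. [:c:] * ([:- w, 1:] * [:x $ Inl l:])) (\<lambda>q. c * x $ Inr q) F" if "F \<in> V" for F
    using that unfolding tangent_pairs_def by (intro first_order_smult) blast
  moreover have "(\<lambda>l. [:c:] * ([:- w, 1:] * [:x $ Inl l:])) = (\<lambda>l. [:- w, 1:] * [:(c *s x) $ Inl l:])"
    by (simp add: algebra_simps)
  ultimately show "c *s x \<in> tangent_pairs V a b u w k" by (simp add: tangent_pairs_def)
qed

text \<open>The hypothesis \<open>tan\<close> says that the point \<open>a + w b\<close> moves in all directions along first-order deformations.\<close>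

theorem dim_TT_le:
  fixes V :: "'m::finite mpoly set" and u :: "'r::finite \<Rightarrow> complex" and f :: "nat \<Rightarrow> 'm mpoly"
  assumes k: "\<And>q. k q > 0" and D: "\<And>F. F \<in> V \<Longrightarrow> divisor_poly u k dvd clin a b F"
    and f: "\<And>j. j < c \<Longrightarrow> f j \<in> igen UNIV V"
    and surj: "\<And>q y. \<exists>s. \<forall>j<c. dd (\<chi> l. a l + u q * b l) s (f j) = y j"
    and tan: "\<And>i. \<exists>a' b' u' \<delta>. (\<forall>F\<in>V. first_order a b u k (\<lambda>l. [:a' l, b' l:]) u' F) \<and>
      (\<forall>l. a' l + w * b' l + \<delta> * b l = (if l = i then 1 else 0))"
  shows "vec.dim (tangent_pairs V a b u w k) + (\<Sum>q\<in>UNIV. k q) * c \<le> CARD('m) + CARD('r)"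
proof -
  define \<kappa> where "\<kappa> = (\<Sum>q\<in>UNIV. k q)"
  define \<tau> where "\<tau> = [:- w, 1:]"
  define N where "N = {s. \<exists>u'. \<forall>F\<in>V. first_order a b u k s u' F}"
  have mD: "mon_deg \<kappa> (divisor_poly u k)" unfolding \<kappa>_def by (rule mon_deg_divisor_poly)
  have \<kappa>: "\<kappa> > 0" unfolding \<kappa>_def using k by (simp add: sum_pos)
  have N_add: "(\<lambda>l. s l + s' l) \<in> N" if ss: "s \<in> N" "s' \<in> N" for s s'
  proof -
    obtain u1 u2 where "\<forall>F\<in>V. first_order a b u k s u1 F" "\<forall>F\<in>V. first_order a b u k s' u2 F" using ss by (auto simp: N_def)
    then have "\<forall>F\<in>V. first_order a b u k (\<lambda>l. s l + s' l) (\<lambda>q. u1 q + u2 q) F" by (intro ballI first_order_add) blast+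
    then show ?thesis unfolding N_def by blast
  qed
  have N_c: "(\<lambda>l. [:c:] * s l) \<in> N" if ss: "s \<in> N" for s c
  proof -
    obtain u1 where "\<forall>F\<in>V. first_order a b u k s u1 F" using ss by (auto simp: N_def)
    then have "\<forall>F\<in>V. first_order a b u k (\<lambda>l. [:c:] * s l) (\<lambda>q. c * u1 q) F" by (intro ballI first_order_smult) blast
    then show ?thesis unfolding N_def by blast
  qed
  have N_t: "(\<lambda>l. [:0, 1:] * s l) \<in> N" if ss: "s \<in> N" for s
  proof -
    obtain u1 where "\<forall>F\<in>V. first_order a b u k s u1 F" using ss by (auto simp: N_def)
    then have "\<forall>F\<in>V. first_order a b u k (\<lambda>l. [:0, 1:] * s l) (\<lambda>q. u q * u1 q) F" by (intro ballI first_order_shift k) blast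
    then show ?thesis unfolding N_def by blast
  qed
  have N_0: "(\<lambda>_. 0) \<in> N" unfolding N_def using first_order_0[OF D] by blast
  have N_mult: "(\<lambda>l. p * s l) \<in> N" if s: "s \<in> N" for p s
  proof (induction p)
    case 0
    show ?case using N_0 by simp
  next
    case (pCons c p)
    have "(\<lambda>l. [:c:] * s l + [:0, 1:] * (p * s l)) \<in> N" by (rule N_add[OF N_c[OF s] N_t[OF pCons(2)]])
    moreover have "(\<lambda>l. [:c:] * s l + [:0, 1:] * (p * s l)) = (\<lambda>l. pCons c p * s l)" by simp
    ultimately show ?case by simp
  qed
  have N_D: "(\<lambda>l. divisor_poly u k * s l) \<in> N" for s unfolding N_def using first_order_D[OF D] by blast
  have N_b: "(\<lambda>l. [:b l:]) \<in> N" unfolding N_def using first_order_b[OF D] by blast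
  \<comment> \<open>Modulo \<open>N\<close>, where \<open>b\<close> lies, \<open>tan\<close>
    provides a velocity \<open>a' + t b' + \<delta> b\<close>. By its last equation this is the i-th
    unit vector plus \<open>(t - w) b'\<close>.\<close>
  have unit: "\<exists>b'. (\<lambda>l. [:if l = i then 1 else 0:] - \<tau> * [:b' l:]) \<in> N" for i
  proof -
    obtain a' b' u' \<delta> where T: "\<forall>F\<in>V. first_order a b u k (\<lambda>l. [:a' l, b' l:]) u' F"
      and e: "\<forall>l. a' l + w * b' l + \<delta> * b l = (if l = i then 1 else 0)" using tan[of i] by blast
    have "(\<lambda>l. [:a' l, b' l:] + [:\<delta>:] * [:b l:]) \<in> N" using T by (intro N_add N_c N_b) (auto simp: N_def)
    moreover have "[:a' l, b' l:] + [:\<delta>:] * [:b l:] = [:if l = i then 1 else 0:] - \<tau> * [:- b' l:]" for l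
    proof -
      have "a' l + \<delta> * b l = (if l = i then 1 else 0) - w * b' l" using e[rule_format, of l] by (simp only: eq_diff_eq add_ac)
      then show ?thesis by (cases "l = i") (simp_all add: \<tau>_def mult.commute)
    qed
    ultimately have "(\<lambda>l. [:if l = i then 1 else 0:] - \<tau> * [:- b' l:]) \<in> N" by (simp only:)
    then show ?thesis by (rule exI[of _ "\<lambda>l. - b' l"])
  qed
  have hyp: "\<exists>b'. (\<lambda>l. [:e l:] - \<tau> * [:b' l:]) \<in> N" for e
  proof -
    obtain B where B: "\<And>i. (\<lambda>l. [:if l = i then 1 else 0:] - \<tau> * [:B i l:]) \<in> N" using unit by metis
    have "(\<lambda>l. \<Sum>i\<in>I. [:e i:] * ([:if l = i then 1 else 0:] - \<tau> * [:B i l:])) \<in> N" for I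
    proof (induction I rule: infinite_finite_induct)
      case (insert i I)
      show ?case unfolding sum.insert[OF insert(1,2)] by (rule N_add[OF N_c[OF B] insert(3)])
    qed (simp_all add: N_0)
    moreover have "(\<Sum>i\<in>UNIV. [:e i:] * ([:if l = i then 1 else 0:] - \<tau> * [:B i l:])) = [:e l:] - \<tau> * [:\<Sum>i\<in>UNIV. e i * B i l:]" for l
    proof -
      have "(\<Sum>i\<in>UNIV. [:e i:] * [:if l = i then 1 else 0:]) = (\<Sum>i\<in>UNIV. if l = i then [:e i:] else 0)"
        by (intro sum.cong refl) simp
      moreover have "(\<Sum>i\<in>UNIV. [:e i:] * (\<tau> * [:B i l:])) = \<tau> * [:\<Sum>i\<in>UNIV. e i * B i l:]"
        unfolding rhom_sum[OF rhom_pCons] rhom_mult[OF rhom_pCons] sum_distrib_left by (simp only: mult_ac)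
      ultimately show ?thesis by (simp add: right_diff_distrib sum_subtractf del: mult_pCons_left mult_pCons_right)
    qed
    ultimately have "(\<lambda>l. [:e l:] - \<tau> * [:\<Sum>i\<in>UNIV. e i * B i l:]) \<in> N" by (metis (no_types, lifting) ext)
    then show ?thesis by (rule exI[of _ "\<lambda>l. \<Sum>i\<in>UNIV. e i * B i l"])
  qed
  have all: "\<exists>b'. (\<lambda>l. s l - \<tau> * [:b' l:]) \<in> N" for s
    using module_argument[OF mD \<kappa> N_add N_mult N_D hyp[unfolded \<tau>_def]] unfolding \<tau>_def .
  have "\<forall>j. \<exists>Q. j < c \<longrightarrow> clin a b (f j) = divisor_poly u k * Q"
  proof
    fix j
    show "\<exists>Q. j < c \<longrightarrow> clin a b (f j) = divisor_poly u k * Q"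
      using first_order_igen[OF f first_order_0[OF D], of j] by (auto simp: first_order_def)
  qed
  then obtain Q where Q: "\<And>j. j < c \<Longrightarrow> clin a b (f j) = divisor_poly u k * Q j" by metis
  \<comment> \<open>Modulo the divisor, the family of all \<open>\<phi> j v\<close> is the
    obstruction to the pair \<open>v\<close> being a first-order deformation for the
    \<open>f j\<close>. It has to be shown to take all values.\<close>
  define \<phi> where "\<phi> j v = dF a b (\<lambda>l. \<tau> * [:v $ Inl l:]) (f j) - D' u k (\<lambda>q. v $ Inr q) * Q j" for j and v :: "complex^('m + 'r)"
  have \<phi>_add: "\<phi> j (v + v') = \<phi> j v + \<phi> j v'" for j v v'
  proof -
    have "(\<lambda>l. \<tau> * [:(v + v') $ Inl l:]) = (\<lambda>l. \<tau> * [:v $ Inl l:] + \<tau> * [:v' $ Inl l:])"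
      by (simp add: smult_add_left)
    then show ?thesis unfolding \<phi>_def by (simp add: dF_lin D'_lin algebra_simps)
  qed
  have \<phi>_smult: "\<phi> j (x *s v) = [:x:] * \<phi> j v" for j x v
  proof -
    have "(\<lambda>l. \<tau> * [:(x *s v) $ Inl l:]) = (\<lambda>l. [:x:] * (\<tau> * [:v $ Inl l:]))"
      by (simp add: mult.commute)
    then show ?thesis unfolding \<phi>_def
      by (simp only: dF_lin D'_lin right_diff_distrib vector_smult_component) (simp add: algebra_simps)
  qed
  have \<phi>_0: "\<phi> j 0 = 0" for j using \<phi>_smult[of j 0 0] by simp
  have "\<exists>v. \<forall>j<c. divisor_poly u k dvd \<phi> j v - y j" for y
  proof -
    obtain s where s: "\<forall>j<c. divisor_poly u k dvd y j - dF a b s (f j)" using dF_surjective[of c a u b f k y, OF surj] by blast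
    obtain b' where "(\<lambda>l. s l - \<tau> * [:b' l:]) \<in> N" using all by blast
    then obtain u' where u': "\<And>F. F \<in> V \<Longrightarrow> first_order a b u k (\<lambda>l. s l - \<tau> * [:b' l:]) u' F" by (auto simp: N_def)
    \<comment> \<open>\<open>s\<close> has the prescribed derivatives \<open>y\<close> and differs
      from \<open>\<tau> b'\<close> by an element of \<open>N\<close>. The root velocity
      \<open>u'\<close> of that element enters with the opposite sign.\<close>
    define v :: "complex^('m + 'r)" where "v = (\<chi> i. case i of Inl l \<Rightarrow> b' l | Inr q \<Rightarrow> - 1 * u' q)"
    have "divisor_poly u k dvd \<phi> j v - y j" if j: "j < c" for j
    proof -
      have 1: "divisor_poly u k dvd dF a b (\<lambda>l. s l - \<tau> * [:b' l:]) (f j) - D' u k u' * Q j"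
        by (rule TcD[OF first_order_igen[OF f[OF j] u'] Q[OF j]])
      have "(\<lambda>q. v $ Inr q) = (\<lambda>q. - 1 * u' q)" by (simp add: v_def)
      then have 2: "D' u k (\<lambda>q. v $ Inr q) = - D' u k u'" unfolding D'_lin(2)[symmetric] by (simp only: D'_lin) simp
      have vl: "(\<lambda>l. \<tau> * [:v $ Inl l:]) = (\<lambda>l. \<tau> * [:b' l:])" by (simp add: v_def)
      have "- (y j - dF a b s (f j)) - (dF a b (\<lambda>l. s l - \<tau> * [:b' l:]) (f j) - D' u k u' * Q j) = \<phi> j v - y j"
        unfolding \<phi>_def 2 dF_diff vl by (simp add: algebra_simps)
      moreover have "divisor_poly u k dvd - (y j - dF a b s (f j))" using s j by (simp only: dvd_minus_iff)
      ultimately show ?thesis using dvd_diff[OF _ 1] by metis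
    qed
    then show ?thesis by blast
  qed
  then have "\<exists>E. \<forall>y. \<forall>j<c. divisor_poly u k dvd \<phi> j (E y) - y j" by (intro choice allI)
  then obtain E where E: "\<And>y j. j < c \<Longrightarrow> divisor_poly u k dvd \<phi> j (E y) - y j" by blast
  \<comment> \<open>Preimages of the monomials of degree below \<kappa> in each of the
    \<open>c\<close> components. These monomials are independent modulo the divisor, so the
    \<open>e p\<close> are independent modulo the tangent pairs.\<close>
  define e where "e p = E (\<lambda>j. if j = snd p then Polynomial.monom 1 (fst p) else 0)" for p
  have comb: "divisor_poly u k dvd \<phi> j (\<Sum>p\<in>J. x p *s e p) - (\<Sum>p\<in>J. [:x p:] * (if j = snd p then Polynomial.monom 1 (fst p) else 0))"
    if "j < c" for j x J
  proof (induction J rule: infinite_finite_induct)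
    case (insert p J)
    have "\<phi> j (\<Sum>p\<in>insert p J. x p *s e p) - (\<Sum>p\<in>insert p J. [:x p:] * (if j = snd p then Polynomial.monom 1 (fst p) else 0)) =
      [:x p:] * (\<phi> j (e p) - (if j = snd p then Polynomial.monom 1 (fst p) else 0)) +
      (\<phi> j (\<Sum>p\<in>J. x p *s e p) - (\<Sum>p\<in>J. [:x p:] * (if j = snd p then Polynomial.monom 1 (fst p) else 0)))"
      unfolding sum.insert[OF insert(1,2)] \<phi>_add \<phi>_smult right_diff_distrib by (simp only: diff_add_eq add_diff_eq diff_diff_eq2 diff_diff_eq add_ac)
    moreover have "divisor_poly u k dvd \<phi> j (e p) - (if j = snd p then Polynomial.monom 1 (fst p) else 0)"
      unfolding e_def by (rule E[OF that])
    ultimately show ?case using insert(3) by (simp only: dvd_add dvd_mult)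
  qed (simp_all add: \<phi>_0)
  have "vec.dim (tangent_pairs V a b u w k) + card ({..<\<kappa>} \<times> {..<c}) \<le> vec.dim (UNIV :: (complex^('m + 'r)) set)"
  proof (rule dim_mod[of _ _ _ e])
    show "vec.subspace (tangent_pairs V a b u w k)" by (rule subspace_tangent_pairs[OF D])
    fix x assume x: "(\<Sum>p\<in>{..<\<kappa>} \<times> {..<c}. x p *s e p) \<in> tangent_pairs V a b u w k"
    show "\<forall>p\<in>{..<\<kappa>} \<times> {..<c}. x p = 0"
    proof
      fix p assume p: "p \<in> {..<\<kappa>} \<times> {..<c}"
      define j where "j = snd p"
      have j: "j < c" using p by (auto simp: j_def)
      define r where "r = (\<Sum>p\<in>{..<\<kappa>} \<times> {..<c}. [:x p:] * (if j = snd p then Polynomial.monom 1 (fst p) else 0))"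
      have "first_order a b u k (\<lambda>l. \<tau> * [:(\<Sum>p\<in>{..<\<kappa>} \<times> {..<c}. x p *s e p) $ Inl l:]) (\<lambda>q. (\<Sum>p\<in>{..<\<kappa>} \<times> {..<c}. x p *s e p) $ Inr q) (f j)"
        by (rule first_order_igen[OF f[OF j]]) (use x in \<open>simp only: tangent_pairs_def \<tau>_def mem_Collect_eq Ball_def\<close>)
      then have "divisor_poly u k dvd \<phi> j (\<Sum>p\<in>{..<\<kappa>} \<times> {..<c}. x p *s e p)" unfolding \<phi>_def by (rule TcD[OF _ Q[OF j]])
      then have d: "divisor_poly u k dvd r" using comb[OF j, of x "{..<\<kappa>} \<times> {..<c}"] unfolding r_def[symmetric]
        by (simp only: dvd_diff_right_iff)
      have cr: "Polynomial.coeff r i = (\<Sum>p\<in>{..<\<kappa>} \<times> {..<c}. if p = (i, j) then x p else 0)" for i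
        unfolding r_def Polynomial.coeff_sum by (intro sum.cong refl) auto
      have "r = 0"
      proof (rule monic_dvd_low[OF mD _ d])
        fix i assume "i \<ge> \<kappa>"
        then show "Polynomial.coeff r i = 0" unfolding cr by (intro sum.neutral) auto
      qed
      moreover have "Polynomial.coeff r (fst p) = x p"
        using p unfolding cr by (simp add: j_def)
      ultimately show "x p = 0" by simp
    qed
  qed auto
  then show ?thesis by (simp add: \<kappa>_def card_cart_basis)
qed

section \<open>Quasi-projective varieties\<close>

definition hdeg :: "nat \<Rightarrow> 'v mpoly \<Rightarrow> bool" where
  "hdeg e F \<longleftrightarrow> (\<forall>m\<in>Poly_Mapping.keys F. (\<Sum>v\<in>Poly_Mapping.keys m. Poly_Mapping.lookup m v) = e)"

lemma homogeneous_hdeg: "homogeneous F \<longleftrightarrow> (\<exists>e. hdeg e F)"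
  by (simp add: homogeneous_def hdeg_def)

lemma hdeg_Const: "hdeg 0 (Const c)"
  by (auto simp: hdeg_def Const_def split: if_splits)

lemma hdeg_Var: "hdeg 1 (Var v)"
  by (auto simp: hdeg_def Var_def split: if_splits)

lemma hdeg_add: "hdeg e F \<Longrightarrow> hdeg e G \<Longrightarrow> hdeg e (F + G)"
  unfolding hdeg_def using Poly_Mapping.keys_add[of F G] by blast

lemma hdeg_0: "hdeg e 0"
  by (simp add: hdeg_def)

lemma hdeg_sum: "(\<And>i. i \<in> I \<Longrightarrow> hdeg e (F i)) \<Longrightarrow> hdeg e (sum F I)"
  by (induction I rule: infinite_finite_induct) (auto simp: hdeg_0 intro: hdeg_add)

lemma hdeg_mult:
  assumes "hdeg d F" "hdeg e G" shows "hdeg (d + e) (F * G)"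
  unfolding hdeg_def
proof
  fix m assume "m \<in> Poly_Mapping.keys (F * G)"
  then obtain m1 m2 where m: "m = m1 + m2" "m1 \<in> Poly_Mapping.keys F" "m2 \<in> Poly_Mapping.keys G"
    using keys_mult[of F G] by blast
  define A where "A = Poly_Mapping.keys m1 \<union> Poly_Mapping.keys m2"
  have s: "(\<Sum>v\<in>Poly_Mapping.keys m'. Poly_Mapping.lookup m' v) = (\<Sum>v\<in>A. Poly_Mapping.lookup m' v)"
    if "Poly_Mapping.keys m' \<subseteq> A" for m' :: "'a \<Rightarrow>\<^sub>0 nat"
    by (rule sum.mono_neutral_left) (use that in \<open>auto simp: A_def in_keys_iff\<close>)
  have "Poly_Mapping.keys m \<subseteq> A" unfolding m(1) A_def by (rule Poly_Mapping.keys_add)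
  then have "(\<Sum>v\<in>Poly_Mapping.keys m. Poly_Mapping.lookup m v) =
    (\<Sum>v\<in>A. Poly_Mapping.lookup m1 v) + (\<Sum>v\<in>A. Poly_Mapping.lookup m2 v)"
    unfolding s[OF \<open>Poly_Mapping.keys m \<subseteq> A\<close>] by (simp add: m(1) lookup_add sum.distrib)
  also have "\<dots> = d + e"
    using assms m(2,3) s[of m1] s[of m2] unfolding hdeg_def A_def by auto
  finally show "(\<Sum>v\<in>Poly_Mapping.keys m. Poly_Mapping.lookup m v) = d + e" .
qed

lemma hdeg_power: "hdeg d F \<Longrightarrow> hdeg (i * d) (F ^ i)"
proof (induction i)
  case 0
  show ?case using hdeg_Const[of 1] by (simp add: Const_simps)
qed (auto intro: hdeg_mult)

lemma hdeg_scale: "hdeg e F \<Longrightarrow> peval F (c *s x) = c ^ e * peval F x"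
  unfolding hdeg_def using homogeneous_scale[of F e id c "($) x"] by (simp add: peval_def)

lemma homogeneous_mult: "homogeneous F \<Longrightarrow> homogeneous G \<Longrightarrow> homogeneous (F * G)"
  unfolding homogeneous_hdeg using hdeg_mult by blast

lemma homogeneous_prod: "(\<And>i. i \<in> I \<Longrightarrow> homogeneous (F i)) \<Longrightarrow> homogeneous (prod F I)"
proof (induction I rule: infinite_finite_induct)
  case (insert i I)
  then show ?case by (auto intro: homogeneous_mult)
qed (use hdeg_Const[of 1] in \<open>auto simp: homogeneous_hdeg Const_simps\<close>)

lemma span_1: "vec.span {x} = range (\<lambda>c. c *s x)"
  by (rule vec.span_singleton)

lemma form_on_point:
  assumes "homogeneous F" shows "(\<exists>y\<in>vec.span {x}. peval F y \<noteq> 0) \<longleftrightarrow> peval F x \<noteq> 0"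
proof -
  obtain e where e: "hdeg e F" using assms by (auto simp: homogeneous_hdeg)
  show ?thesis using hdeg_scale[OF e] vec.span_base[of x "{x}"] by (auto simp: span_1)
qed

lemma vanishing_forms_span:
  "F \<in> vanishing_forms X \<Longrightarrow> vec.span {x} \<in> X \<Longrightarrow> peval F x = 0"
  unfolding vanishing_forms_def using vec.span_base[of x "{x}"] by blast

text \<open>The product of two forms is a form, so the generating sets of the topology are closed
  under binary intersection and already form a basis.\<close>

lemma zariski_basis:
  fixes P :: "(complex^'m::finite) set"
  assumes "openin zariski U" "P \<in> U"
  obtains F where "homogeneous F" "P \<in> proj_space" "\<exists>x\<in>P. peval F x \<noteq> 0"
    "\<And>Q. Q \<in> proj_space \<Longrightarrow> \<exists>x\<in>Q. peval F x \<noteq> 0 \<Longrightarrow> Q \<in> U"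
proof -
  define G where "G F P U \<longleftrightarrow> homogeneous F \<and> P \<in> proj_space \<and> (\<exists>x\<in>P. peval F x \<noteq> 0) \<and>
    (\<forall>Q\<in>proj_space. (\<exists>x\<in>Q. peval F x \<noteq> 0) \<longrightarrow> Q \<in> U)" for F P and U :: "(complex^'m) set set"
  have G_mono: "G F P U'" if "G F P U" "U \<subseteq> U'" for F P U U' using that unfolding G_def by (meson subsetD)
  have G_Int: "G (F1 * F2) P (U1 \<inter> U2)" if 1: "G F1 P U1" and 2: "G F2 P U2" for F1 F2 P U1 U2
  proof -
    have F1: "homogeneous F1" "P \<in> proj_space" "\<exists>x\<in>P. peval F1 x \<noteq> 0"
      "\<And>Q. Q \<in> proj_space \<Longrightarrow> \<exists>x\<in>Q. peval F1 x \<noteq> 0 \<Longrightarrow> Q \<in> U1" using 1 by (simp_all only: G_def simp_thms)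
    have F2: "homogeneous F2" "\<exists>x\<in>P. peval F2 x \<noteq> 0"
      "\<And>Q. Q \<in> proj_space \<Longrightarrow> \<exists>x\<in>Q. peval F2 x \<noteq> 0 \<Longrightarrow> Q \<in> U2" using 2 by (simp_all only: G_def simp_thms)
    have h: "homogeneous (F1 * F2)" by (rule homogeneous_mult[OF F1(1) F2(1)])
    have iff: "(\<exists>x\<in>Q. peval (F1 * F2) x \<noteq> 0) \<longleftrightarrow> (\<exists>x\<in>Q. peval F1 x \<noteq> 0) \<and> (\<exists>x\<in>Q. peval F2 x \<noteq> 0)"
      if Q: "Q \<in> proj_space" for Q
    proof -
      obtain y where y: "Q = vec.span {y}" using Q by (auto simp: proj_space_def)
      show ?thesis unfolding y form_on_point[OF h] form_on_point[OF F1(1)] form_on_point[OF F2(1)]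
        by (simp add: peval_hom)
    qed
    show ?thesis unfolding G_def
    proof (intro conjI ballI impI h F1(2))
      show "\<exists>x\<in>P. peval (F1 * F2) x \<noteq> 0" unfolding iff[OF F1(2)] using F1(3) F2(2) by (rule conjI)
      fix Q assume Q: "Q \<in> proj_space" "\<exists>x\<in>Q. peval (F1 * F2) x \<noteq> 0"
      note q = Q(2)[unfolded iff[OF Q(1)]]
      show "Q \<in> U1 \<inter> U2" by (rule IntI[OF F1(4)[OF Q(1) conjunct1[OF q]] F2(3)[OF Q(1) conjunct2[OF q]]])
    qed
  qed
  have "generate_topology_on {{P \<in> proj_space. \<exists>x\<in>P. peval F x \<noteq> 0} | F. homogeneous F} U"
    using assms(1) by (simp add: zariski_def openin_topology_generated_by_iff)
  then have "\<forall>P\<in>U. \<exists>F. G F P U"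
  proof (induction rule: generate_topology_on.induct)
    case (Int U1 U2)
    show ?case
    proof
      fix P assume P: "P \<in> U1 \<inter> U2"
      then obtain F1 F2 where "G F1 P U1" "G F2 P U2" using Int.IH by (elim IntE) blast
      then show "\<exists>F. G F P (U1 \<inter> U2)" using G_Int by blast
    qed
  next
    case (UN K)
    show ?case
    proof
      fix P assume "P \<in> \<Union>K"
      then obtain V where V: "V \<in> K" "P \<in> V" by blast
      then obtain F where "G F P V" using UN.IH[OF V(1)] by blast
      then show "\<exists>F. G F P (\<Union>K)" using G_mono[of F P V "\<Union>K"] V(1) by blast
    qed
  next
    case (Basis B)
    then obtain F where F: "homogeneous F" "B = {P \<in> proj_space. \<exists>x\<in>P. peval F x \<noteq> 0}" by blast
    then have "\<And>P. P \<in> B \<Longrightarrow> G F P B" by (simp add: G_def)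
    then show ?case by blast
  qed simp
  then obtain F where "G F P U" using assms(2) by blast
  then show ?thesis using that[of F] by (simp only: G_def simp_thms)
qed

lemma openin_zariski_form: "homogeneous F \<Longrightarrow> openin zariski {P \<in> proj_space. \<exists>x\<in>P. peval F x \<noteq> 0}"
  unfolding zariski_def by (rule topology_generated_by_Basis) blast

lemma topspace_zariski: "topspace (zariski :: (complex^'m::finite) set topology) = proj_space"
proof
  show "topspace zariski \<subseteq> (proj_space :: (complex^'m) set set)"
    using openin_topspace zariski_basis by (metis subsetI)
  have "homogeneous (1 :: 'm mpoly)" using hdeg_Const[of 1] by (auto simp: homogeneous_hdeg Const_simps)
  from openin_zariski_form[OF this] have "openin zariski {P :: (complex^'m) set. P \<in> proj_space \<and> P \<noteq> {}}"
    by (simp add: peval_hom ex_in_conv)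
  then have "{P :: (complex^'m) set. P \<in> proj_space \<and> P \<noteq> {}} \<subseteq> topspace zariski" by (rule openin_subset)
  moreover have "P \<noteq> {}" if "P \<in> proj_space" for P :: "(complex^'m) set"
    using that vec.span_zero by (auto simp: proj_space_def)
  ultimately show "(proj_space :: (complex^'m) set set) \<subseteq> topspace zariski" by blast
qed

lemma igen_finite: assumes "x \<in> igen B F" obtains F0 where "finite F0" "F0 \<subseteq> F" "x \<in> igen B F0"
proof -
  have mono: "igen B F1 \<subseteq> igen B F2" if "F1 \<subseteq> F2" for F1 F2
  proof
    fix y assume "y \<in> igen B F1"
    then show "y \<in> igen B F2" by induction (use that in \<open>auto intro: igen.intros\<close>)
  qed
  have "\<exists>F0. finite F0 \<and> F0 \<subseteq> F \<and> x \<in> igen B F0"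
    using assms
  proof induction
    case igen_0
    show ?case by (intro exI[of _ "{}"]) (auto intro: igen.igen_0)
  next
    case (igen_step b f x)
    then obtain F0 where "finite F0" "F0 \<subseteq> F" "x \<in> igen B F0" by blast
    then have "b * f + x \<in> igen B (insert f F0)" using igen_step mono[of F0 "insert f F0"] by (auto intro: igen.igen_step)
    then show ?case using \<open>finite F0\<close> \<open>F0 \<subseteq> F\<close> igen_step(2) by (intro exI[of _ "insert f F0"]) auto
  qed
  then show ?thesis using that by blast
qed

text \<open>The generators are found in \<open>F\<close> itself: each of the finitely many
  generators of the ideal uses finitely many elements of \<open>F\<close>. A finite set of forms
  thus remains a set of forms.\<close>

lemma noeth_generators:
  assumes B: "noeth B" and F: "F \<subseteq> B" obtains F0 where "finite F0" "F0 \<subseteq> F" "F \<subseteq> igen B F0"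
proof -
  have s: "srng B" using B by (simp add: noeth_def)
  obtain G where G: "finite G" "G \<subseteq> igen B F" "igen B F \<subseteq> igen B G"
    using B ideal_in_igen[OF s F] by (auto simp: noeth_def)
  have "\<forall>g\<in>G. \<exists>F0. finite F0 \<and> F0 \<subseteq> F \<and> g \<in> igen B F0" using G(2) igen_finite by (metis subsetD)
  then obtain f where f: "\<And>g. g \<in> G \<Longrightarrow> finite (f g) \<and> f g \<subseteq> F \<and> g \<in> igen B (f g)" by metis
  define F0 where "F0 = (\<Union>g\<in>G. f g)"
  have F0: "finite F0" "F0 \<subseteq> F" using f G(1) by (auto simp: F0_def)
  have id: "ideal_in B (igen B F0)" by (rule ideal_in_igen[OF s]) (use F0(2) F in blast)
  have "g \<in> igen B F0" if g: "g \<in> G" for g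
  proof -
    have "f g \<subseteq> igen B F0" using igen_base[OF _ s, of _ F0 ] g by (auto simp: F0_def)
    then show ?thesis using f[OF g] igen_least[OF id] by blast
  qed
  then have "igen B G \<subseteq> igen B F0" by (intro igen_least[OF id] subsetI)
  then have "F \<subseteq> igen B F0" using G(3) igen_base[OF _ s, of _ F] by blast
  then show ?thesis using that F0 by blast
qed

lemma peval_igen_0:
  assumes "f \<in> igen UNIV V" "\<And>F. F \<in> V \<Longrightarrow> peval F x = 0" shows "peval f x = 0"
  using assms(1) by induction (auto simp: peval_hom assms(2))

text \<open>Finitely many forms certify that a point satisfying all vanishing forms lies in
  \<open>X\<close> and not just in its closure. This makes membership in \<open>X\<close> a finite
  union of polynomial conditions, as needed for generic points.\<close>

lemma quasi_projective_cover:
  fixes X :: "(complex^'m::finite) set set"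
  assumes X: "quasi_projective X"
  obtains \<H> where "finite \<H>" "\<And>H. H \<in> \<H> \<Longrightarrow> homogeneous H"
    "\<And>x. vec.span {x} \<in> X \<Longrightarrow> \<exists>H\<in>\<H>. peval H x \<noteq> 0"
    "\<And>H x. H \<in> \<H> \<Longrightarrow> peval H x \<noteq> 0 \<Longrightarrow> x \<noteq> 0 \<Longrightarrow> (\<And>F. F \<in> vanishing_forms X \<Longrightarrow> peval F x = 0) \<Longrightarrow> vec.span {x} \<in> X"
proof -
  obtain U C where U: "openin zariski U" and C: "closedin zariski C" and XUC: "X = U \<inter> C"
    using X by (auto simp: quasi_projective_def)
  \<comment> \<open>All forms whose non-zero locus lies in the open set \<open>U\<close>; finitely
    many of them generate the same ideal and so have the same common zeros.\<close>
  define \<G> where "\<G> = {H. homogeneous H \<and> (\<forall>Q\<in>proj_space. (\<exists>x\<in>Q. peval H x \<noteq> 0) \<longrightarrow> Q \<in> U)}"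
  obtain \<H> where \<H>: "finite \<H>" "\<H> \<subseteq> \<G>" "\<G> \<subseteq> igen UNIV \<H>" by (rule noeth_generators[OF noeth_mpoly, of \<G>]) auto
  have inC: "vec.span {x} \<in> C" if x: "x \<noteq> 0" "\<And>F. F \<in> vanishing_forms X \<Longrightarrow> peval F x = 0" for x
  proof (rule ccontr)
    assume n: "vec.span {x} \<notin> C"
    have p: "vec.span {x} \<in> proj_space" using x(1) by (auto simp: proj_space_def)
    have "openin zariski (topspace zariski - C)" using C by (simp add: closedin_def)
    moreover have "vec.span {x} \<in> topspace zariski - C" using n p by (simp add: topspace_zariski)
    ultimately obtain F where F: "homogeneous F" "\<exists>y\<in>vec.span {x}. peval F y \<noteq> 0"
      "\<And>Q. Q \<in> proj_space \<Longrightarrow> \<exists>x\<in>Q. peval F x \<noteq> 0 \<Longrightarrow> Q \<in> topspace zariski - C" by (rule zariski_basis) blast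
    have "C \<subseteq> proj_space" using closedin_subset[OF C] by (simp add: topspace_zariski)
    then have "F \<in> vanishing_forms X" using F(1,3) unfolding vanishing_forms_def XUC by blast
    then show False using x(2) F(2) unfolding form_on_point[OF F(1)] by blast
  qed
  show ?thesis
  proof (rule that[OF \<H>(1)])
    fix H assume "H \<in> \<H>" then show "homogeneous H" using \<H>(2) by (auto simp: \<G>_def)
  next
    fix x assume "vec.span {x} \<in> X"
    then have "vec.span {x} \<in> U" using XUC by blast
    with U obtain H where H: "homogeneous H" "\<exists>y\<in>vec.span {x}. peval H y \<noteq> 0"
      "\<And>Q. Q \<in> proj_space \<Longrightarrow> \<exists>x\<in>Q. peval H x \<noteq> 0 \<Longrightarrow> Q \<in> U" by (rule zariski_basis) blast
    have "H \<in> \<G>" unfolding \<G>_def using H(1,3) by blast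
    then have "H \<in> igen UNIV \<H>" using \<H>(3) by blast
    then show "\<exists>H\<in>\<H>. peval H x \<noteq> 0" using peval_igen_0[of H \<H> x] H(2) unfolding form_on_point[OF H(1)] by blast
  next
    fix H x assume H: "H \<in> \<H>" "peval H x \<noteq> 0" and x: "x \<noteq> 0" "\<And>F. F \<in> vanishing_forms X \<Longrightarrow> peval F x = 0"
    have "vec.span {x} \<in> proj_space" using x(1) by (auto simp: proj_space_def)
    then have "vec.span {x} \<in> U" using H \<H>(2) vec.span_base[of x "{x}"] unfolding \<G>_def by blast
    then show "vec.span {x} \<in> X" using inC[OF x] XUC by blast
  qed
qed

section \<open>Homogenization and affine pieces of a projective variety\<close>

definition linear_form :: "complex^'m \<Rightarrow> 'm::finite mpoly" where
  "linear_form \<xi> = (\<Sum>l\<in>UNIV. Const (\<xi> $ l) * Var l)"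

lemma peval_linear_form: "peval (linear_form \<xi>) x = dotp \<xi> x"
  by (simp add: linear_form_def peval_hom dotp_def)

lemma dd_linear_form: "dd x w (linear_form \<xi>) = dotp \<xi> w"
  by (simp add: linear_form_def dd_sum dotp_def)

lemma hdeg_linear_form: "hdeg 1 (linear_form \<xi>)"
  unfolding linear_form_def by (intro hdeg_sum) (use hdeg_mult[OF hdeg_Const hdeg_Var] in simp)

text \<open>Monomials are filled up with powers of the linear form, which is 1 modulo
  \<open>linear_form \<xi> - 1\<close>. The claim for all large degrees lets two summands be brought
  to the same degree.\<close>

lemma homogenize:
  fixes f :: "'m::finite mpoly"
  shows "\<exists>d0. \<forall>d\<ge>d0. \<exists>F h. hdeg d F \<and> F = f + h * (linear_form \<xi> - 1)"
proof -
  have pw: "\<exists>h. linear_form \<xi> ^ i = 1 + h * (linear_form \<xi> - 1)" for i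
  proof (induction i)
    case (Suc i)
    then obtain h where "linear_form \<xi> ^ i = 1 + h * (linear_form \<xi> - 1)" by blast
    then have "linear_form \<xi> ^ Suc i = linear_form \<xi> * (1 + h * (linear_form \<xi> - 1))" by (simp only: power_Suc)
    also have "\<dots> = 1 + (1 + h * linear_form \<xi>) * (linear_form \<xi> - 1)" by (simp add: algebra_simps)
    finally have "linear_form \<xi> ^ Suc i = 1 + (1 + h * linear_form \<xi>) * (linear_form \<xi> - 1)" .
    then show ?case by blast
  qed (auto intro: exI[of _ 0])
  show ?thesis
  proof (induction f rule: mpoly_induct)
    case (Const c)
    show ?case
    proof (intro exI[of _ "0::nat"] allI impI)
      fix d
      obtain h where h: "linear_form \<xi> ^ d = 1 + h * (linear_form \<xi> - 1)" using pw by blast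
      have "hdeg d (Const c * linear_form \<xi> ^ d)" using hdeg_mult[OF hdeg_Const hdeg_power[OF hdeg_linear_form]] by simp
      moreover have "Const c * linear_form \<xi> ^ d = Const c + (Const c * h) * (linear_form \<xi> - 1)" by (simp add: h algebra_simps)
      ultimately show "\<exists>F h. hdeg d F \<and> F = Const c + h * (linear_form \<xi> - 1)" by blast
    qed
  next
    case (Var v)
    show ?case
    proof (intro exI[of _ "1::nat"] allI impI)
      fix d :: nat assume d: "1 \<le> d"
      obtain h where h: "linear_form \<xi> ^ (d - 1) = 1 + h * (linear_form \<xi> - 1)" using pw by blast
      have "hdeg (1 + (d - 1) * 1) (Var v * linear_form \<xi> ^ (d - 1))" by (rule hdeg_mult[OF hdeg_Var hdeg_power[OF hdeg_linear_form]])
      then have "hdeg d (Var v * linear_form \<xi> ^ (d - 1))" using d by simp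
      moreover have "Var v * linear_form \<xi> ^ (d - 1) = Var v + (Var v * h) * (linear_form \<xi> - 1)" unfolding h by (simp add: algebra_simps)
      ultimately show "\<exists>F h. hdeg d F \<and> F = Var v + h * (linear_form \<xi> - 1)" by blast
    qed
  next
    case (add f g)
    obtain d1 d2 where d1: "\<forall>d\<ge>d1. \<exists>F h. hdeg d F \<and> F = f + h * (linear_form \<xi> - 1)"
      and d2: "\<forall>d\<ge>d2. \<exists>F h. hdeg d F \<and> F = g + h * (linear_form \<xi> - 1)" using add by blast
    show ?case
    proof (intro exI[of _ "d1 + d2"] allI impI)
      fix d assume d: "d1 + d2 \<le> d"
      obtain F h where 1: "hdeg d F" "F = f + h * (linear_form \<xi> - 1)" using d1 d by (meson add_leD1)
      obtain G h' where 2: "hdeg d G" "G = g + h' * (linear_form \<xi> - 1)" using d2 d by (meson add_leD2)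
      have "F + G = f + g + (h + h') * (linear_form \<xi> - 1)" by (simp add: 1 2 algebra_simps)
      then show "\<exists>F h. hdeg d F \<and> F = f + g + h * (linear_form \<xi> - 1)" using hdeg_add[OF 1(1) 2(1)] by blast
    qed
  next
    case (mult f g)
    obtain d1 d2 where d1: "\<forall>d\<ge>d1. \<exists>F h. hdeg d F \<and> F = f + h * (linear_form \<xi> - 1)"
      and d2: "\<forall>d\<ge>d2. \<exists>F h. hdeg d F \<and> F = g + h * (linear_form \<xi> - 1)" using mult by blast
    show ?case
    proof (intro exI[of _ "d1 + d2"] allI impI)
      fix d assume d: "d1 + d2 \<le> d"
      obtain F h where 1: "hdeg d1 F" "F = f + h * (linear_form \<xi> - 1)" using d1 by blast
      have "d2 \<le> d - d1" using d by simp
      then obtain G h' where 2: "hdeg (d - d1) G" "G = g + h' * (linear_form \<xi> - 1)" using d2 by blast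
      have "F * G = f * g + (f * h' + h * g + h * h' * (linear_form \<xi> - 1)) * (linear_form \<xi> - 1)" by (simp add: 1 2 algebra_simps)
      moreover have "hdeg d (F * G)" using hdeg_mult[OF 1(1) 2(1)] d by simp
      ultimately show "\<exists>F h. hdeg d F \<and> F = f * g + h * (linear_form \<xi> - 1)" by blast
    qed
  qed
qed

lemma span_scale: fixes x :: "complex^'m" assumes "c \<noteq> 0" shows "vec.span {c *s x} = vec.span {x}"
proof
  have "c *s x \<in> vec.span {x}" by (intro vec.span_scale vec.span_base) simp
  then show "vec.span {c *s x} \<subseteq> vec.span {x}" by (intro vec.span_minimal vec.subspace_span) simp
  have "inverse c *s (c *s x) \<in> vec.span {c *s x}" by (intro vec.span_scale vec.span_base) simp
  then have "x \<in> vec.span {c *s x}" using assms by (simp add: vector_smult_assoc)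
  then show "vec.span {x} \<subseteq> vec.span {c *s x}" by (intro vec.span_minimal vec.subspace_span) simp
qed

definition affine_part :: "(complex^'m::finite) set set \<Rightarrow> complex^'m \<Rightarrow> (complex^'m) set" where
  "affine_part X \<xi> = {x. dotp \<xi> x = 1 \<and> vec.span {x} \<in> X}"

text \<open>A homogenization of \<open>f\<close> vanishes at the points of \<open>X\<close> outside
  the hyperplane \<xi> = 0. One more factor \<open>linear_form \<xi>\<close> makes it vanish on the
  rest of \<open>X\<close> and changes nothing modulo \<open>linear_form \<xi> - 1\<close>.\<close>

lemma vanishing_ideal_homogenize:
  assumes f: "f \<in> vanishing_ideal (affine_part X \<xi>)" and X: "X \<subseteq> proj_space"
  obtains F h where "F \<in> vanishing_forms X" "F = f + h * (linear_form \<xi> - 1)"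
proof -
  obtain d F h where F: "hdeg d F" "F = f + h * (linear_form \<xi> - 1)" using homogenize[of f \<xi>] by blast
  have "f + (h + F) * (linear_form \<xi> - 1) = (f + h * (linear_form \<xi> - 1)) + F * (linear_form \<xi> - 1)" by (simp only: distrib_right add.assoc)
  also have "\<dots> = linear_form \<xi> * F" unfolding F(2)[symmetric] by (simp add: algebra_simps)
  finally have "linear_form \<xi> * F = f + (h + F) * (linear_form \<xi> - 1)" by (rule sym)
  moreover have "linear_form \<xi> * F \<in> vanishing_forms X"
    unfolding vanishing_forms_def
  proof (intro CollectI conjI ballI)
    show "homogeneous (linear_form \<xi> * F)" using hdeg_mult[OF hdeg_linear_form F(1)] by (auto simp: homogeneous_hdeg)
    fix P x assume P: "P \<in> X" "x \<in> P"
    show "peval (linear_form \<xi> * F) x = 0"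
    proof (cases "dotp \<xi> x = 0")
      case False
      obtain x1 where x1: "P = vec.span {x1}" using X P(1) by (auto simp: proj_space_def)
      obtain \<mu> where \<mu>: "x = \<mu> *s x1" using P(2) by (auto simp: x1 span_1)
      have "\<mu> \<noteq> 0" using False by (auto simp: \<mu> dotp_lin)
      define y where "y = inverse (dotp \<xi> x) *s x"
      have "vec.span {y} = P" unfolding y_def x1 using False \<open>\<mu> \<noteq> 0\<close> by (simp add: span_scale \<mu>)
      then have "y \<in> affine_part X \<xi>" using False P(1) by (simp add: affine_part_def y_def dotp_lin)
      then have "peval f y = 0" "dotp \<xi> y = 1" using f by (auto simp: vanishing_ideal_def affine_part_def)
      then have "peval F y = 0" by (simp add: F(2) peval_hom peval_linear_form)
      moreover have "x = dotp \<xi> x *s y" using False by (simp add: y_def vector_smult_assoc)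
      ultimately have "peval F x = 0" using hdeg_scale[OF F(1), of "dotp \<xi> x" y] by simp
      then show ?thesis by (simp add: peval_hom)
    qed (simp add: peval_hom peval_linear_form)
  qed
  ultimately show ?thesis using that by blast
qed

lemma ideal_vanishing_ideal: "ideal_in UNIV (vanishing_ideal W)"
  by (auto simp: ideal_in_def vanishing_ideal_def peval_hom)

lemma vanishing_forms_affine_part: "vanishing_forms X \<subseteq> vanishing_ideal (affine_part X \<xi>)"
  using vanishing_forms_span by (fastforce simp: vanishing_ideal_def affine_part_def)

lemma grad_dd: "grad z f = (\<chi> v. dd z (axis v 1) f)"
proof -
  have "dd z (axis v 1) f = (\<Sum>u\<in>UNIV. if u = v then peval (pd u f) z else 0)" for v
    unfolding dd_pd by (intro sum.cong refl) (auto simp: axis_def)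
  then show ?thesis by (simp add: grad_def)
qed

lemma smooth_charts_affine_part:
  assumes sm: "smooth_of_dim (variety_charts X) (int n)" and x: "x \<in> affine_part X \<xi>"
  shows "vec.dim (tangent_space (vanishing_ideal (affine_part X \<xi>)) x) = n"
    "local_krull_dim (vanishing_ideal (affine_part X \<xi>)) x = enat n"
proof -
  have "affine_part X \<xi> = {x. (\<Sum>l\<in>UNIV. \<xi> $ l * x $ l) = 1 \<and> vec.span {x} \<in> X}" by (simp add: affine_part_def dotp_def)
  then have "(vanishing_ideal (affine_part X \<xi>), affine_part X \<xi>) \<in> variety_charts X"
    unfolding variety_charts_def by blast
  then have "int (vec.dim (tangent_space (vanishing_ideal (affine_part X \<xi>)) x)) = int n \<and>
     local_krull_dim (vanishing_ideal (affine_part X \<xi>)) x = enat (nat (int n))"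
    using sm x unfolding smooth_of_dim_def by blast
  then show "vec.dim (tangent_space (vanishing_ideal (affine_part X \<xi>)) x) = n"
    "local_krull_dim (vanishing_ideal (affine_part X \<xi>)) x = enat n" by simp_all
qed

lemma tangent_space_forms:
  fixes X :: "(complex^'m::finite) set set"
  assumes X: "X \<subseteq> proj_space" and x: "x \<in> affine_part X \<xi>"
  shows "tangent_space (vanishing_ideal (affine_part X \<xi>)) x = {w. \<forall>g\<in>insert \<xi> (grad x ` vanishing_forms X). dotp g w = 0}"
  unfolding tangent_space_dd
proof (intro equalityI subsetI CollectI ballI)
  fix w g assume w: "w \<in> {w. \<forall>f\<in>vanishing_ideal (affine_part X \<xi>). dd x w f = 0}" and g: "g \<in> insert \<xi> (grad x ` vanishing_forms X)"
  have w': "dd x w f = 0" if "f \<in> vanishing_ideal (affine_part X \<xi>)" for f using w that by blast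
  have "linear_form \<xi> - 1 \<in> vanishing_ideal (affine_part X \<xi>)" by (simp add: vanishing_ideal_def affine_part_def peval_hom peval_linear_form)
  from w'[OF this] have "dotp \<xi> w = 0" by (simp add: dd_linear_form)
  moreover have "dotp (grad x F) w = 0" if "F \<in> vanishing_forms X" for F
    unfolding dotp_grad by (rule w') (use that vanishing_forms_affine_part in blast)
  ultimately show "dotp g w = 0" using g by blast
next
  fix w f assume w: "w \<in> {w. \<forall>g\<in>insert \<xi> (grad x ` vanishing_forms X). dotp g w = 0}" and f: "f \<in> vanishing_ideal (affine_part X \<xi>)"
  obtain F h where F: "F \<in> vanishing_forms X" "F = f + h * (linear_form \<xi> - 1)" by (rule vanishing_ideal_homogenize[OF f X])
  have "dotp \<xi> w = 0" "dd x w F = 0" using w F(1) by (auto simp flip: dotp_grad)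
  moreover have "dotp \<xi> x = 1" using x by (simp add: affine_part_def)
  ultimately show "dd x w f = 0" unfolding F(2) by (simp add: dd_linear_form peval_hom peval_linear_form)
qed

text \<open>The gradients of the vanishing forms and \<open>\<xi>\<close> have rank m - n = c + 1 at
  \<open>x\<close>, so \<open>c\<close> forms have gradients independent modulo
  \<open>\<xi>\<close>. The last conclusion is for any \<open>f\<close> with the same differentials
  at \<open>x\<close>: a later family has to serve at several points at once, and by
  \<open>local_generators\<close> only differentials matter.\<close>

lemma local_forms:
  fixes X :: "(complex^'m::finite) set set"
  assumes X: "X \<subseteq> proj_space" and sm: "smooth_of_dim (variety_charts X) (int n)" and m: "CARD('m) = n + c + 1"
    and x: "x \<in> affine_part X \<xi>"
  obtains F :: "nat \<Rightarrow> 'm mpoly" where "\<And>j. j < c \<Longrightarrow> F j \<in> vanishing_forms X"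
    "\<And>y. \<exists>s. \<forall>j<c. dd x s (F j) = y j"
    "\<And>f h. \<lbrakk>\<And>j. j < c \<Longrightarrow> f j \<in> vanishing_ideal (affine_part X \<xi>); \<And>j w. j < c \<Longrightarrow> dd x w (f j) = dd x w (F j);
       h \<in> vanishing_forms X\<rbrakk> \<Longrightarrow> \<exists>g. peval g x = 1 \<and> g * h \<in> igen UNIV (insert (linear_form \<xi> - 1) (f ` {..<c}))"
proof -
  define G where "G = insert \<xi> (grad x ` vanishing_forms X)"
  have \<xi>x: "dotp \<xi> x = 1" using x by (simp add: affine_part_def)
  then have "\<xi> \<noteq> 0" by (auto simp: dotp_lin)
  then have ind: "vec.independent {\<xi>}" by (simp add: vec.dependent_single)
  have \<xi>G: "{\<xi>} \<subseteq> G" by (simp add: G_def)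
  obtain b :: "'m \<Rightarrow> complex^'m" and S where bS: "b ` S \<subseteq> G" "{\<xi>} \<subseteq> b ` S" "b ` (- S) \<subseteq> range (\<lambda>v. axis v 1)"
    "inj b" "invertible (\<chi> i. b i)" "G \<subseteq> vec.span (b ` S)"
    by (rule choose_rows[OF \<xi>G ind]) (rule that)
  have "vec.dim {w. \<forall>i\<in>S. ((\<chi> i. b i) *v w) $ i = 0} = n"
    using smooth_charts_affine_part(1)[OF sm x] unfolding tangent_space_forms[OF X x] G_def[symmetric] rows_ann[OF bS(1,6)] .
  then have cS: "card (- S) = n" unfolding dim_rows[OF bS(5)] .
  obtain i0 where i0: "i0 \<in> S" "b i0 = \<xi>" using bS(2) by auto
  have "card S + card (- S) = CARD('m)" using card_Un_disjoint[of S "- S"] by simp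
  then have "card (S - {i0}) = c" using cS m i0(1) by simp
  then obtain e where e: "bij_betw e {..<c} (S - {i0})"
    using ex_bij_betw_nat_finite[of "S - {i0}"] by (auto simp: atLeast0LessThan)
  have eS: "e j \<in> S - {i0}" if "j < c" for j using e that by (auto simp: bij_betw_def)
  have "\<exists>F. j < c \<longrightarrow> F \<in> vanishing_forms X \<and> grad x F = b (e j)" for j
  proof (cases "j < c")
    case True
    have "b (e j) \<noteq> \<xi>" using eS[OF True] i0(2) bS(4) by (auto dest: injD)
    then have "b (e j) \<in> grad x ` vanishing_forms X" using bS(1) eS[OF True] unfolding G_def by blast
    then show ?thesis by auto
  qed simp
  then obtain F where F: "\<And>j. j < c \<Longrightarrow> F j \<in> vanishing_forms X" "\<And>j. j < c \<Longrightarrow> grad x (F j) = b (e j)" by metis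
  show ?thesis
  proof (rule that[OF F(1)])
    fix y :: "nat \<Rightarrow> complex"
    obtain B where B: "(\<chi> i. b i) ** B = mat 1" using bS(5) by (auto simp: invertible_def)
    define y' where "y' = (\<chi> i. y (the_inv_into {..<c} e i))"
    have "dd x (B *v y') (F j) = y j" if j: "j < c" for j
    proof -
      have "dd x (B *v y') (F j) = dotp (b (e j)) (B *v y')" by (simp flip: dotp_grad F(2)[OF j])
      also have "\<dots> = ((\<chi> i. b i) *v (B *v y')) $ e j" by (simp only: matvec_dotp)
      also have "\<dots> = y' $ e j" by (simp only: matrix_vector_mul_assoc B matrix_vector_mul_lid)
      also have "\<dots> = y j" using e j by (simp add: y'_def bij_betw_def the_inv_into_f_f)
      finally show ?thesis .
    qed
    then show "\<exists>s. \<forall>j<c. dd x s (F j) = y j" by blast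
  next
    fix f h assume f: "\<And>j. j < c \<Longrightarrow> f j \<in> vanishing_ideal (affine_part X \<xi>)" "\<And>j w. j < c \<Longrightarrow> dd x w (f j) = dd x w (F j)"
      and h: "h \<in> vanishing_forms X"
    define g where "g i = (if i = i0 then linear_form \<xi> - 1 else f (the_inv_into {..<c} e i))" for i
    have gV: "g i \<in> vanishing_ideal (affine_part X \<xi>) \<and> grad x (g i) = b i \<and> g i \<in> insert (linear_form \<xi> - 1) (f ` {..<c})" if i: "i \<in> S" for i
    proof (cases "i = i0")
      case True
      have "grad x (linear_form \<xi> - 1) = \<xi>" unfolding grad_dd by (simp add: dd_linear_form dotp_def axis_def vec_eq_iff if_distrib[of "\<lambda>x. _ * x"] cong: if_cong)
      then show ?thesis using True i0(2) by (simp add: g_def vanishing_ideal_def affine_part_def peval_hom peval_linear_form)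
    next
      case False
      then have "i \<in> e ` {..<c}" using e i by (auto simp: bij_betw_def)
      then obtain j where j: "j < c" "i = e j" by auto
      have "g i = f j" using False e j by (simp add: g_def bij_betw_def the_inv_into_f_f)
      moreover have "grad x (f j) = b i" using F(2)[OF j(1)] f(2)[OF j(1)] unfolding grad_dd j(2) by simp
      ultimately show ?thesis using f(1)[OF j(1)] j(1) by simp
    qed
    have xv: "peval q x = 0" if "q \<in> vanishing_ideal (affine_part X \<xi>)" for q using that x by (simp add: vanishing_ideal_def)
    obtain p where p: "param_system x p" "\<And>i. i \<in> S \<Longrightarrow> p i = g i"
      by (rule param_system_extend[OF bS(5), of S g x]) (use gV xv in auto)
    have pS: "p ` S = g ` S" using p(2) by simp
    obtain q where q: "peval q x = 1" "q * h \<in> igen UNIV (p ` S)"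
    proof (rule local_generators[OF ideal_vanishing_ideal _ smooth_charts_affine_part(2)[OF sm x] p(1) _ cS])
      show "vanishing_ideal (affine_part X \<xi>) \<subseteq> {g. peval g x = 0}" using xv by blast
      show "p ` S \<subseteq> vanishing_ideal (affine_part X \<xi>)" unfolding pS using gV by blast
      show "h \<in> vanishing_ideal (affine_part X \<xi>)" using h vanishing_forms_affine_part by blast
    qed
    have "p ` S \<subseteq> igen UNIV (insert (linear_form \<xi> - 1) (f ` {..<c}))"
      unfolding pS using gV igen_base[OF _ srng_UNIV] by blast
    then have "q * h \<in> igen UNIV (insert (linear_form \<xi> - 1) (f ` {..<c}))"
      using q(2) igen_least[OF ideal_in_igen[OF srng_UNIV subset_UNIV]] by blast
    then show "\<exists>g. peval g x = 1 \<and> g * h \<in> igen UNIV (insert (linear_form \<xi> - 1) (f ` {..<c}))" using q(1) by blast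
  qed
qed

text \<open>The local equations at the different points of the divisor are glued by Lagrange interpolation in the
  coordinate \<open>\<eta>\<close> of the line.\<close>

lemma forms_along_line:
  fixes X :: "(complex^'m::finite) set set" and u :: "'r::finite \<Rightarrow> complex"
  assumes X: "X \<subseteq> proj_space" and sm: "smooth_of_dim (variety_charts X) (int n)" and m: "CARD('m) = n + c + 1"
    and fr: "dotp \<xi> a = 1" "dotp \<xi> b = 0" "dotp \<eta> a = 0" "dotp \<eta> b = 1"
    and x: "\<And>q. vec.span {a + u q *s b} \<in> X"
  obtains f :: "nat \<Rightarrow> 'm mpoly" where "\<And>j. j < c \<Longrightarrow> f j \<in> igen UNIV (vanishing_forms X)"
    "\<And>q y. \<exists>s. \<forall>j<c. dd (a + u q *s b) s (f j) = y j"
    "\<And>q h. h \<in> vanishing_forms X \<Longrightarrow>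
       \<exists>g. peval g (a + u q *s b) = 1 \<and> g * h \<in> igen UNIV (insert (linear_form \<xi> - 1) (f ` {..<c}))"
proof -
  define x where "x q = a + u q *s b" for q
  have xa: "x q \<in> affine_part X \<xi>" for q using x by (simp add: affine_part_def x_def dotp_lin fr)
  have \<eta>x: "dotp \<eta> (x q) = u q" for q by (simp add: x_def dotp_lin fr)
  define Q where "Q q F \<longleftrightarrow> (\<forall>j<c. F j \<in> vanishing_forms X) \<and> (\<forall>y. \<exists>s. \<forall>j<c. dd (x q) s (F j) = y j) \<and>
    (\<forall>f h. (\<forall>j<c. f j \<in> vanishing_ideal (affine_part X \<xi>)) \<longrightarrow> (\<forall>j w. j < c \<longrightarrow> dd (x q) w (f j) = dd (x q) w (F j)) \<longrightarrow>
       h \<in> vanishing_forms X \<longrightarrow> (\<exists>g. peval g (x q) = 1 \<and> g * h \<in> igen UNIV (insert (linear_form \<xi> - 1) (f ` {..<c}))))"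
    for q and F :: "nat \<Rightarrow> 'm mpoly"
  have "\<exists>F. Q q F" for q
  proof (rule local_forms[OF X sm m xa[of q]])
    fix F assume F: "\<And>j. j < c \<Longrightarrow> F j \<in> vanishing_forms X" "\<And>y. \<exists>s. \<forall>j<c. dd (x q) s (F j) = y j"
      "\<And>f h. \<lbrakk>\<And>j. j < c \<Longrightarrow> f j \<in> vanishing_ideal (affine_part X \<xi>); \<And>j w. j < c \<Longrightarrow> dd (x q) w (f j) = dd (x q) w (F j);
        h \<in> vanishing_forms X\<rbrakk> \<Longrightarrow> \<exists>g. peval g (x q) = 1 \<and> g * h \<in> igen UNIV (insert (linear_form \<xi> - 1) (f ` {..<c}))"
    have "Q q F" unfolding Q_def
      by (intro conjI allI impI) (rule F(1), assumption, rule F(2), rule F(3), simp_all)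
    then show ?thesis by blast
  qed
  then obtain F where QF: "\<And>q. Q q (F q)" by metis
  have F: "F q j \<in> vanishing_forms X" if "j < c" for q j using QF[of q] that by (simp only: Q_def)
  have F2: "\<exists>s. \<forall>j<c. dd (x q) s (F q j) = y j" for q y using QF[of q] by (simp only: Q_def)
  have loc: "\<exists>g. peval g (x q) = 1 \<and> g * h \<in> igen UNIV (insert (linear_form \<xi> - 1) (f ` {..<c}))"
    if "\<And>j. j < c \<Longrightarrow> f j \<in> vanishing_ideal (affine_part X \<xi>)" "\<And>j w. j < c \<Longrightarrow> dd (x q) w (f j) = dd (x q) w (F q j)"
      "h \<in> vanishing_forms X" for q f h
    using QF[of q] that unfolding Q_def by blast
  \<comment> \<open>The points of the divisor may coincide, while interpolation needs distinct
    nodes: one index is chosen for each value of \<open>u\<close>.\<close>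
  define r where "r \<upsilon> = (SOME q. u q = \<upsilon>)" for \<upsilon>
  have ur: "u (r (u q)) = u q" for q unfolding r_def by (rule someI[of _ q]) simp
  have xr: "x (r (u q)) = x q" for q by (simp add: x_def ur)
  define L :: "complex \<Rightarrow> 'm mpoly" where "L \<upsilon> = (\<Prod>\<upsilon>'\<in>range u - {\<upsilon>}. Const (1 / (\<upsilon> - \<upsilon>')) * (linear_form \<eta> - Const \<upsilon>'))" for \<upsilon>
  have L: "peval (L \<upsilon>) (x q) = (if \<upsilon> = u q then 1 else 0)" for \<upsilon> q
  proof (cases "\<upsilon> = u q")
    case True
    then show ?thesis by (auto simp: L_def peval_hom peval_linear_form \<eta>x intro!: prod.neutral)
  next
    case False
    then show ?thesis by (auto simp: L_def peval_hom peval_linear_form \<eta>x)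
  qed
  define f where "f j = (\<Sum>\<upsilon>\<in>range u. L \<upsilon> * F (r \<upsilon>) j)" for j
  have f1: "f j \<in> igen UNIV (vanishing_forms X)" if "j < c" for j
    unfolding f_def
    by (intro ideal_in_sum[OF ideal_in_igen[OF srng_UNIV subset_UNIV]] igen_mult[OF igen_base] srng_UNIV UNIV_I F that)
  have fdd: "dd (x q) w (f j) = dd (x q) w (F (r (u q)) j)" if j: "j < c" for q w j
  proof -
    have v: "peval (F p j) (x q) = 0" for p
      by (rule vanishing_forms_span[OF F[OF j]]) (use x in \<open>simp add: x_def\<close>)
    \<comment> \<open>The forms vanish at all points of the divisor, so the derivatives of the
      interpolating factors \<open>L\<close> drop out.\<close>
    have "dd (x q) w (f j) = (\<Sum>\<upsilon>\<in>range u. if \<upsilon> = u q then dd (x q) w (F (r \<upsilon>) j) else 0)"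
      unfolding f_def dd_sum by (intro sum.cong refl) (simp add: L v)
    then show ?thesis by simp
  qed
  show ?thesis
  proof (rule that[OF f1])
    show "\<exists>s. \<forall>j<c. dd (a + u q *s b) s (f j) = y j" for q y
      using F2[of "r (u q)" y] fdd[of _ q] unfolding xr x_def[symmetric] by simp
    fix q h assume h: "h \<in> vanishing_forms X"
    have "\<exists>g. peval g (x (r (u q))) = 1 \<and> g * h \<in> igen UNIV (insert (linear_form \<xi> - 1) (f ` {..<c}))"
    proof (rule loc[OF _ _ h])
      fix j assume j: "j < c"
      show "f j \<in> vanishing_ideal (affine_part X \<xi>)"
        using f1[OF j] igen_least[OF ideal_vanishing_ideal vanishing_forms_affine_part] by blast
      show "dd (x (r (u q))) w (f j) = dd (x (r (u q))) w (F (r (u q)) j)" for w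
        unfolding xr by (rule fdd[OF j])
    qed
    then show "\<exists>g. peval g (a + u q *s b) = 1 \<and> g * h \<in> igen UNIV (insert (linear_form \<xi> - 1) (f ` {..<c}))"
      unfolding xr unfolding x_def .
  qed
qed

section \<open>Remainders\<close>

lemma restrict_to_line_lin: "restrict_to_line F = lin Const (\<lambda>l. Var (a_var l)) (\<lambda>l. Var (b_var l)) F"
  by (simp add: restrict_to_line_def lin_def)

lemma divisor_equation_divisor_poly: "divisor_equation k = divisor_poly (\<lambda>q. Var (u_var q)) k"
  by (simp add: divisor_equation_def divisor_poly_def)

lemma polys_over_Const: "c \<in> K \<Longrightarrow> Const c \<in> polys_over K"
  and polys_over_Var: "Var v \<in> polys_over K"
  by (rule sgen.sgen_base, simp)+

lemma restrict_polys_over: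
  assumes "F \<in> polys_over K" shows "restrict_to_line F \<in> PB (polys_over K :: ('m, 'r) inc_var mpoly set)"
proof -
  note s = srng_sgen[of "Const ` K \<union> range (Var :: ('m, 'r) inc_var \<Rightarrow> _)"]
  show ?thesis
    using assms
  proof (induction rule: sgen.induct)
    case (sgen_base x)
    then show ?case
      by (auto simp: restrict_to_line_lin lin_Const[OF rhom_Const] lin_Var[OF rhom_Const] PB_pCons[OF s] PB_0[OF s] intro: polys_over_Const polys_over_Var)
  qed (simp_all add: restrict_to_line_lin lin_hom[OF rhom_Const] srngD[OF srng_PB[OF s]])
qed

lemma divisor_polys_over: "divisor_equation k \<in> PB (polys_over K)"
proof -
  note s = srng_sgen[of "Const ` K \<union> range (Var :: ('m, 'r) inc_var \<Rightarrow> _)"]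
  have "[:- Var (u_var q), 1:] \<in> PB (polys_over K :: ('m, 'r) inc_var mpoly set)" for q
    by (simp add: PB_pCons[OF s] PB_0[OF s] srng_1[OF s] srng_minus[OF s] polys_over_Var)
  then show ?thesis unfolding divisor_equation_def by (intro srng_prod srng_power srng_PB s)
qed

lemma polys_over_self: "F \<in> polys_over (coef_set F)"
  by (rule polys_overI) simp

lemma remainder_exists:
  fixes k :: "'r::finite \<Rightarrow> nat" and F :: "'m mpoly"
  shows "\<exists>R. \<exists>S. R \<in> PB (polys_over (coef_set F)) \<and> (\<forall>i\<ge>\<Sum>q\<in>UNIV. k q. Polynomial.coeff R i = 0) \<and>
    restrict_to_line F = divisor_equation k * S + R"
  by (rule monic_div[OF mon_deg_divisor_poly[of k "\<lambda>q. Var (u_var q)", folded divisor_equation_divisor_poly] srng_sgen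
    divisor_polys_over restrict_polys_over[OF polys_over_self[of F]]]) blast

text \<open>The coefficients are kept over the ring generated by those of \<open>F\<close>, so that
  one countable ring contains the coefficients of all equations of a chart.\<close>

definition remainder :: "('r::finite \<Rightarrow> nat) \<Rightarrow> 'm mpoly \<Rightarrow> ('m, 'r) inc_var mpoly poly" where
  "remainder k F = (SOME R. \<exists>S. R \<in> PB (polys_over (coef_set F)) \<and> (\<forall>i\<ge>\<Sum>q\<in>UNIV. k q. Polynomial.coeff R i = 0) \<and>
    restrict_to_line F = divisor_equation k * S + R)"

lemma remainder_spec:
  obtains S where "restrict_to_line F = divisor_equation k * S + remainder k F"
  using someI_ex[OF remainder_exists[of F k]] unfolding remainder_def by blast

lemma remainder_high: "i \<ge> (\<Sum>q\<in>UNIV. k q) \<Longrightarrow> Polynomial.coeff (remainder k F) i = 0"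
  using someI_ex[OF remainder_exists[of F k]] unfolding remainder_def by blast

lemma remainder_polys_over:
  assumes "coef_set F \<subseteq> K" shows "Polynomial.coeff (remainder k F) i \<in> polys_over K"
proof -
  have "remainder k F \<in> PB (polys_over (coef_set F))"
    using someI_ex[OF remainder_exists[of F k]] unfolding remainder_def by blast
  then show ?thesis using sgen_mono[of "Const ` coef_set F \<union> range Var" "Const ` K \<union> range Var"] assms by (auto simp: PB_def)
qed

lemma peval_restrict:
  "map_poly (\<lambda>f. peval f y) (restrict_to_line F) = clin (\<lambda>l. y $ a_var l) (\<lambda>l. y $ b_var l) F"
  unfolding restrict_to_line_lin by (simp add: map_poly_lin[OF rhom_peval rhom_Const])

lemma peval_divisor: "map_poly (\<lambda>f. peval f y) (divisor_equation k) = divisor_poly (\<lambda>q. y $ u_var q) k"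
  unfolding divisor_equation_divisor_poly by (simp add: map_poly_divisor_poly[OF rhom_peval])

lemma coeff_map_rhom: "rhom h \<Longrightarrow> Polynomial.coeff (map_poly h p) i = h (Polynomial.coeff p i)"
  by (simp add: coeff_map_poly rhom_0)

lemma dvd_remainder:
  assumes e: "P = D * (S :: 'a::comm_ring_1 poly) + R" and D: "mon_deg n D" and R: "\<And>i. i \<ge> n \<Longrightarrow> Polynomial.coeff R i = 0"
  shows "D dvd P \<longleftrightarrow> R = 0"
proof
  assume "D dvd P"
  then have "D dvd P - D * S" by (simp add: dvd_diff)
  then have "D dvd R" by (simp add: e)
  from monic_dvd_low[OF D _ this] show "R = 0" using R by blast
qed (simp add: e)

text \<open>Division by a monic polynomial commutes with a change of the coefficient ring. The lemma
  is applied at complex points and on formal arcs.\<close>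

lemma dvd_iff_Rm_rhom:
  fixes g :: "('m::finite, 'r::finite) inc_var mpoly \<Rightarrow> 'a::comm_ring_1"
  assumes g: "rhom g"
  shows "divisor_poly (\<lambda>q. g (Var (u_var q))) k dvd lin (\<lambda>c. g (Const c)) (\<lambda>l. g (Var (a_var l))) (\<lambda>l. g (Var (b_var l))) F \<longleftrightarrow>
    (\<forall>i. g (Polynomial.coeff (remainder k F) i) = 0)"
proof -
  note h = rhom_map_poly[OF g]
  obtain S where "restrict_to_line F = divisor_equation k * S + remainder k F" by (rule remainder_spec)
  then have "map_poly g (restrict_to_line F) = map_poly g (divisor_equation k) * map_poly g S + map_poly g (remainder k F)"
    by (simp add: rhom_mult[OF h] rhom_add[OF h])
  then have e: "lin (\<lambda>c. g (Const c)) (\<lambda>l. g (Var (a_var l))) (\<lambda>l. g (Var (b_var l))) F = divisor_poly (\<lambda>q. g (Var (u_var q))) k * map_poly g S + map_poly g (remainder k F)"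
    by (simp add: restrict_to_line_lin divisor_equation_divisor_poly map_poly_lin[OF g rhom_Const] map_poly_divisor_poly[OF g])
  have "Polynomial.coeff (map_poly g (remainder k F)) i = 0" if "i \<ge> (\<Sum>q\<in>UNIV. k q)" for i
    by (simp add: remainder_high[OF that] coeff_map_rhom[OF g] rhom_0[OF g])
  then have "divisor_poly (\<lambda>q. g (Var (u_var q))) k dvd lin (\<lambda>c. g (Const c)) (\<lambda>l. g (Var (a_var l))) (\<lambda>l. g (Var (b_var l))) F \<longleftrightarrow> map_poly g (remainder k F) = 0"
    by (rule dvd_remainder[OF e mon_deg_divisor_poly])
  then show ?thesis by (simp add: poly_eq_iff coeff_map_rhom[OF g])
qed

lemma dvd_iff_remainder:
  fixes y :: "complex^('m::finite, 'r::finite) inc_var"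
  shows "divisor_poly (\<lambda>q. y $ u_var q) k dvd clin (\<lambda>l. y $ a_var l) (\<lambda>l. y $ b_var l) F \<longleftrightarrow> (\<forall>i. peval (Polynomial.coeff (remainder k F) i) y = 0)"
  using dvd_iff_Rm_rhom[OF rhom_peval[of y], of k F] by simp

section \<open>Derivatives of the universal division with remainder\<close>

definition dp :: "complex^'v \<Rightarrow> complex^'v \<Rightarrow> 'v mpoly poly \<Rightarrow> complex poly" where
  "dp y v P = map_poly (dd y v) P"

lemma coeff_dp: "Polynomial.coeff (dp y v P) i = dd y v (Polynomial.coeff P i)"
  by (simp add: dp_def coeff_map_poly)

lemma dp_add: "dp y v (P + Q) = dp y v P + dp y v Q"
  and dp_const: "dp y v [:c:] = [:dd y v c:]"
  and dp_linear: "dp y v [:c, d:] = [:dd y v c, dd y v d:]"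
  and dp_0: "dp y v 0 = 0"
  and dp_1: "dp y v 1 = 0"
  by (auto simp: poly_eq_iff coeff_dp coeff_pCons split: nat.splits)

lemma dp_mult: "dp y v (P * Q) = map_poly (\<lambda>f. peval f y) P * dp y v Q + dp y v P * map_poly (\<lambda>f. peval f y) Q"
  by (simp add: poly_eq_iff coeff_dp coeff_mult dd_sum coeff_map_rhom[OF rhom_peval] sum.distrib)

lemma dp_prod:
  "finite A \<Longrightarrow> dp y v (\<Prod>q\<in>A. P q) = (\<Sum>q\<in>A. (\<Prod>q'\<in>A - {q}. map_poly (\<lambda>f. peval f y) (P q')) * dp y v (P q))"
proof (induction A rule: finite_induct)
  case (insert x A)
  let ?h = "map_poly (\<lambda>f. peval f y)"
  have "(\<Sum>q\<in>A. (\<Prod>q'\<in>insert x A - {q}. ?h (P q')) * dp y v (P q)) = (\<Sum>q\<in>A. ?h (P x) * ((\<Prod>q'\<in>A - {q}. ?h (P q')) * dp y v (P q)))"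
  proof (intro sum.cong refl)
    fix q assume "q \<in> A"
    then have "insert x A - {q} = insert x (A - {q})" using insert by auto
    then show "(\<Prod>q'\<in>insert x A - {q}. ?h (P q')) * dp y v (P q) = ?h (P x) * ((\<Prod>q'\<in>A - {q}. ?h (P q')) * dp y v (P q))"
      using insert by (simp add: mult.assoc)
  qed
  moreover have "insert x A - {x} = A" using insert by auto
  ultimately show ?case using insert
    by (simp add: dp_mult rhom_prod[OF rhom_map_poly[OF rhom_peval]] sum_distrib_left mult.commute)
qed (simp add: dp_1)

lemma dp_power: "dp y v (P ^ n) = of_nat n * map_poly (\<lambda>f. peval f y) P ^ (n - 1) * dp y v P"
proof (induction n)
  case (Suc n)
  then show ?case by (cases n) (simp_all add: dp_mult rhom_mult[OF rhom_map_poly[OF rhom_peval]] rhom_power[OF rhom_map_poly[OF rhom_peval]] algebra_simps)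
qed (simp add: dp_1)

lemma dp_divisor: "dp y v (divisor_equation k) = D' (\<lambda>q. y $ u_var q) k (\<lambda>q. v $ u_var q)"
proof -
  let ?h = "map_poly (\<lambda>f. peval f y)"
  note h = rhom_map_poly[OF rhom_peval[of y]]
  define u where "u q = y $ u_var q" for q
  have hl: "?h [:- Var (u_var q), 1:] = [:- u q, 1:]" for q
    by (simp only: map_poly_pair[OF rhom_peval]) (simp add: peval_hom u_def)
  have "dp y v (divisor_equation k) =
    (\<Sum>q\<in>UNIV. (\<Prod>q'\<in>UNIV - {q}. [:- u q', 1:] ^ k q') * (of_nat (k q) * [:- u q, 1:] ^ (k q - 1) * [:- (v $ u_var q):]))"
    unfolding divisor_equation_def by (simp add: dp_prod rhom_power[OF h] dp_power hl dp_linear)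
  also have "\<dots> = (\<Sum>q\<in>UNIV. - Polynomial.smult (of_nat (k q) * v $ u_var q) (Dq u k q))"
  proof (intro sum.cong refl)
    fix q
    note Dq_prod[of u k q]
    moreover have "of_nat (k q) = [:of_nat (k q) :: complex:]" by (simp add: of_nat_poly)
    ultimately show "(\<Prod>q'\<in>UNIV - {q}. [:- u q', 1:] ^ k q') * (of_nat (k q) * [:- u q, 1:] ^ (k q - 1) * [:- (v $ u_var q):]) =
      - Polynomial.smult (of_nat (k q) * v $ u_var q) (Dq u k q)"
      by (simp add: mult_ac)
  qed
  finally show ?thesis by (simp add: D'_def u_def[abs_def] sum_negf)
qed

lemma dp_restrict:
  "dp y v (restrict_to_line F) = dF (\<lambda>l. y $ a_var l) (\<lambda>l. y $ b_var l) (\<lambda>l. [:v $ a_var l, v $ b_var l:]) F"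
proof (induction F rule: mpoly_induct)
  case (mult F G)
  then show ?case
    by (simp add: restrict_to_line_lin lin_hom[OF rhom_Const] dp_mult dF_simps map_poly_lin[OF rhom_peval rhom_Const])
qed (simp_all add: restrict_to_line_lin lin_hom[OF rhom_Const] lin_Const[OF rhom_Const] lin_Var[OF rhom_Const] dF_simps dp_add dp_const dp_linear)

text \<open>Differentiating \<open>F = D S + R\<close> at a point where \<open>R\<close> vanishes
  gives \<open>dF - D' S = D dS + dR\<close>. The degree of \<open>dR\<close> is less than that of
  \<open>D\<close>, so \<open>D\<close> divides the left side only if \<open>dR = 0\<close>. Thus
  first-order deformations are tangent vectors of the scheme cut out by the remainders.\<close>

theorem first_order_iff_remainder:
  fixes y :: "complex^('m::finite, 'r::finite) inc_var"
  assumes "divisor_poly (\<lambda>q. y $ u_var q) k dvd clin (\<lambda>l. y $ a_var l) (\<lambda>l. y $ b_var l) F"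
  shows "first_order (\<lambda>l. y $ a_var l) (\<lambda>l. y $ b_var l) (\<lambda>q. y $ u_var q) k (\<lambda>l. [:v $ a_var l, v $ b_var l:]) (\<lambda>q. v $ u_var q) F
    \<longleftrightarrow> (\<forall>i. dd y v (Polynomial.coeff (remainder k F) i) = 0)"
proof -
  let ?h = "\<lambda>f. peval f y"
  let ?a = "\<lambda>l. y $ a_var l" and ?b = "\<lambda>l. y $ b_var l" and ?u = "\<lambda>q. y $ u_var q"
  note h = rhom_map_poly[OF rhom_peval[of y]]
  obtain S where S: "restrict_to_line F = divisor_equation k * S + remainder k F" by (rule remainder_spec)
  have "map_poly ?h (remainder k F) = 0" using assms by (simp add: dvd_iff_remainder poly_eq_iff coeff_map_rhom[OF rhom_peval])
  then have Q: "clin ?a ?b F = divisor_poly ?u k * map_poly ?h S"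
    unfolding peval_restrict[symmetric] peval_divisor[symmetric] by (simp add: S rhomD[OF h])
  have "dF ?a ?b (\<lambda>l. [:v $ a_var l, v $ b_var l:]) F - D' ?u k (\<lambda>q. v $ u_var q) * map_poly ?h S = divisor_poly ?u k * dp y v S + dp y v (remainder k F)"
    unfolding dp_restrict[symmetric] S dp_add dp_mult peval_divisor dp_divisor by simp
  then have iff: "divisor_poly ?u k dvd dF ?a ?b (\<lambda>l. [:v $ a_var l, v $ b_var l:]) F - D' ?u k (\<lambda>q. v $ u_var q) * map_poly ?h S \<longleftrightarrow> dp y v (remainder k F) = 0"
    by (rule dvd_remainder[OF _ mon_deg_divisor_poly]) (simp add: coeff_dp remainder_high)
  have "dp y v (remainder k F) = 0 \<longleftrightarrow> (\<forall>i. dd y v (Polynomial.coeff (remainder k F) i) = 0)" by (simp add: poly_eq_iff coeff_dp)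
  then show ?thesis unfolding iff[symmetric] using TcD[OF _ Q] Q unfolding first_order_def by blast
qed

definition rename_vars :: "('a \<Rightarrow> 'b) \<Rightarrow> 'a mpoly \<Rightarrow> 'b mpoly" where
  "rename_vars e = subst Const (\<lambda>v. Var (e v))"

lemma rhom_rename_vars: "rhom (rename_vars e)"
  unfolding rename_vars_def by (rule rhom_subst[OF rhom_Const])

lemma rename_vars_simps: "rename_vars e (Const c) = Const c" "rename_vars e (Var v) = Var (e v)"
  by (simp_all add: rename_vars_def subst_Const subst_Var rhom_Const)

lemma peval_rename_vars: "peval (rename_vars e f) z = peval f (\<chi> v. z $ e v)"
  unfolding rename_vars_def by (simp add: peval_subst_Const)

lemma dd_rename_vars: "dd z w (rename_vars e f) = dd (\<chi> v. z $ e v) (\<chi> v. w $ e v) f"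
  by (induction f rule: mpoly_induct) (simp_all add: rename_vars_simps rhomD[OF rhom_rename_vars] peval_rename_vars)

lemma rename_vars_polys_over: "f \<in> polys_over K \<Longrightarrow> rename_vars e f \<in> polys_over K"
proof (induction rule: sgen.induct)
  case (sgen_base x)
  then show ?case by (auto simp: rename_vars_simps intro: sgen.sgen_base)
qed (auto simp: rhomD[OF rhom_rename_vars] intro: sgen.intros)

lemma subst_polys_over:
  assumes \<theta>: "\<And>i. \<theta> i \<in> polys_over K" and f: "f \<in> polys_over K"
  shows "subst Const \<theta> f \<in> polys_over K"
  using f
proof (induction rule: sgen.induct)
  case (sgen_base x)
  then show ?case using \<theta> by (auto simp: subst_Const subst_Var rhom_Const intro: sgen.sgen_base)
qed (auto simp: subst_hom[OF rhom_Const] intro: sgen.intros)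

text \<open>On a ray through a point \<open>x\<close> of the cone, \<open>H\<close> is a polynomial
  in the scalar whose coefficients are the values at \<open>x\<close> of the homogeneous components.
  It vanishes for all nonzero scalars, so every component vanishes at \<open>x\<close>.\<close>

lemma conic_homogeneous:
  fixes H :: "'m::finite mpoly"
  assumes H: "H \<noteq> 0" "\<And>x. x \<in> T \<Longrightarrow> peval H x = 0" and T: "\<And>x c. x \<in> T \<Longrightarrow> c \<noteq> 0 \<Longrightarrow> c *s x \<in> T"
  obtains H' where "H' \<noteq> 0" "homogeneous H'" "\<And>x. x \<in> T \<Longrightarrow> peval H' x = 0"
proof -
  define dg where "dg m = (\<Sum>v\<in>Poly_Mapping.keys m. Poly_Mapping.lookup m v)" for m :: "'m \<Rightarrow>\<^sub>0 nat"
  define C where "C d = (\<Sum>m\<in>{m \<in> Poly_Mapping.keys H. dg m = d}. Poly_Mapping.single m (Poly_Mapping.lookup H m))" for d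
  have Cd: "hdeg d (C d)" for d
    unfolding C_def by (intro hdeg_sum) (auto simp: hdeg_def dg_def split: if_splits)
  define E where "E = Max (dg ` Poly_Mapping.keys H)"
  have HC: "H = (\<Sum>d\<le>E. C d)"
  proof -
    have "(\<Sum>d\<le>E. C d) = (\<Sum>m\<in>Poly_Mapping.keys H. Poly_Mapping.single m (Poly_Mapping.lookup H m))"
      unfolding C_def by (rule sum.group) (auto simp: E_def)
    then show ?thesis by (simp flip: poly_mapping_sum_single)
  qed
  have "\<exists>d. C d \<noteq> 0" using H(1) HC by (metis sum.neutral)
  then obtain d where d: "C d \<noteq> 0" by blast
  have dE: "d \<le> E"
  proof (rule ccontr)
    assume "\<not> d \<le> E"
    then have "{m \<in> Poly_Mapping.keys H. dg m = d} = {}" by (auto simp: E_def)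
    then have "C d = 0" by (simp only: C_def sum.empty)
    then show False using d by blast
  qed
  have "peval (C d) x = 0" if x: "x \<in> T" for x
  proof -
    define p where "p = (\<Sum>d\<le>E. Polynomial.monom (peval (C d) x) d)"
    have "poly p c = peval H (c *s x)" for c
      unfolding p_def by (subst HC) (simp add: poly_sum poly_monom peval_hom hdeg_scale[OF Cd] mult.commute)
    then have "poly p c = 0" if "c \<noteq> 0" for c using H(2)[OF T[OF x that]] by simp
    then have "UNIV - {0} \<subseteq> {c. poly p c = 0}" by blast
    then have "p = 0" using poly_roots_finite[of p] by (metis finite_Diff2 finite.intros finite_subset infinite_UNIV_char_0)
    then have "Polynomial.coeff p d = 0" by simp
    then show ?thesis using dE by (simp add: p_def coeff_sum)
  qed
  then show ?thesis using that[of "C d"] d Cd by (auto simp: homogeneous_hdeg)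
qed

section \<open>The dimension bound at a general point\<close>

lemma quasi_projective_subset: "quasi_projective X \<Longrightarrow> X \<subseteq> proj_space"
  using openin_subset[of zariski] by (auto simp: quasi_projective_def topspace_zariski)

lemma sum_UNIV_sum:
  fixes f :: "'a::finite + 'b::finite \<Rightarrow> 'c::comm_monoid_add"
  shows "(\<Sum>x\<in>UNIV. f x) = (\<Sum>x\<in>UNIV. f (Inl x)) + (\<Sum>x\<in>UNIV. f (Inr x))"
proof -
  have "(\<Sum>x\<in>UNIV <+> UNIV. f x) = (\<Sum>x\<in>UNIV. f (Inl x)) + (\<Sum>x\<in>UNIV. f (Inr x))"
    by (subst sum.Plus) (simp_all add: o_def)
  then show ?thesis by simp
qed

lemma tangent_pairs_igen:
  assumes "V \<subseteq> igen UNIV V0" "V0 \<subseteq> V" shows "tangent_pairs V a b u w k = tangent_pairs V0 a b u w k"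
  unfolding tangent_pairs_def using assms first_order_igen[of _ V0] by blast

lemma dvd_igen:
  assumes "\<And>F. F \<in> V0 \<Longrightarrow> D dvd clin a b F" "F \<in> igen UNIV V0" shows "D dvd clin a b F"
  using assms(2) by induction (simp_all add: clin_hom assms(1))

text \<open>The equations of \<open>tangent_pairs\<close>, with coefficients that are polynomials in the variables of the bundle.\<close>

definition trow :: "(('m, 'r) inc_var \<Rightarrow> 'v) \<Rightarrow> 'v \<Rightarrow> ('r::finite \<Rightarrow> nat) \<Rightarrow> 'm::finite mpoly \<Rightarrow> nat \<Rightarrow> 'm + 'r \<Rightarrow> 'v mpoly" where
  "trow e e' k F i s = (case s of
     Inl l \<Rightarrow> rename_vars e (pd (b_var l) (Polynomial.coeff (remainder k F) i)) - Var e' * rename_vars e (pd (a_var l) (Polynomial.coeff (remainder k F) i))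
   | Inr q \<Rightarrow> rename_vars e (pd (u_var q) (Polynomial.coeff (remainder k F) i)))"

lemma trow_polys_over:
  assumes "coef_set F \<subseteq> K" shows "trow e e' k F i s \<in> polys_over K"
  unfolding trow_def
  by (auto split: sum.split intro!: srngD[OF srng_sgen] rename_vars_polys_over pd_polys_over remainder_polys_over[OF assms] polys_over_Var)

lemma tangent_pairs_trow:
  fixes z :: "complex^'v::finite" and k :: "'r::finite \<Rightarrow> nat" and e :: "('m::finite, 'r) inc_var \<Rightarrow> 'v"
  assumes D: "\<And>F. F \<in> V \<Longrightarrow> divisor_poly (\<lambda>q. z $ e (u_var q)) k dvd clin (\<lambda>l. z $ e (a_var l)) (\<lambda>l. z $ e (b_var l)) F"
  shows "tangent_pairs V (\<lambda>l. z $ e (a_var l)) (\<lambda>l. z $ e (b_var l)) (\<lambda>q. z $ e (u_var q)) (z $ e') k =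
    {v. \<forall>g\<in>{(\<chi> s. peval (trow e e' k F i s) z) | F i. F \<in> V}. dotp g v = 0}"
proof -
  define y where "y = (\<chi> v. z $ e v)"
  have "first_order (\<lambda>l. z $ e (a_var l)) (\<lambda>l. z $ e (b_var l)) (\<lambda>q. z $ e (u_var q)) k (\<lambda>l. [:- (z $ e'), 1:] * [:v $ Inl l:]) (\<lambda>q. v $ Inr q) F \<longleftrightarrow>
    (\<forall>i. dotp (\<chi> s. peval (trow e e' k F i s) z) v = 0)" if F: "F \<in> V" for F v
  proof -
    \<comment> \<open>The velocity of \<open>(a, b, u)\<close> that belongs to the pair
      \<open>v\<close>, with \<open>a' = - w b'\<close>.\<close>
    define v' :: "complex^('m, 'r) inc_var" where
      "v' = (\<chi> x. case x of Inl l \<Rightarrow> - (z $ e') * v $ Inl l | Inr (Inl l) \<Rightarrow> v $ Inl l | Inr (Inr q) \<Rightarrow> v $ Inr q)"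
    have "(\<lambda>l. [:- (z $ e'), 1:] * [:v $ Inl l:]) = (\<lambda>l. [:v' $ a_var l, v' $ b_var l:])" by (simp add: v'_def mult.commute)
    moreover have "(\<lambda>q. v $ Inr q) = (\<lambda>q. v' $ u_var q)" by (simp add: v'_def)
    moreover have "dotp (\<chi> s. peval (trow e e' k F i s) z) v = dd y v' (Polynomial.coeff (remainder k F) i)" for i
    proof -
      let ?\<rho> = "Polynomial.coeff (remainder k F) i"
      have "dotp (\<chi> s. peval (trow e e' k F i s) z) v =
        (\<Sum>l\<in>UNIV. (peval (pd (b_var l) ?\<rho>) y - z $ e' * peval (pd (a_var l) ?\<rho>) y) * v $ Inl l) + (\<Sum>q\<in>UNIV. peval (pd (u_var q) ?\<rho>) y * v $ Inr q)"
        unfolding dotp_def sum_UNIV_sum by (simp add: trow_def peval_hom peval_rename_vars y_def)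
      also have "\<dots> = dd y v' ?\<rho>"
        unfolding dd_pd sum_UNIV_sum by (simp add: v'_def left_diff_distrib sum_subtractf sum_negf mult.assoc mult.left_commute)
      finally show ?thesis .
    qed
    moreover have "divisor_poly (\<lambda>q. y $ u_var q) k dvd clin (\<lambda>l. y $ a_var l) (\<lambda>l. y $ b_var l) F" using D[OF F] by (simp add: y_def)
    ultimately show ?thesis using first_order_iff_remainder[of y k F v'] by (simp add: y_def)
  qed
  then show ?thesis unfolding tangent_pairs_def by blast
qed

text \<open>Cramer's rule for one minor. A nonzero minor is a polynomial condition and can be passed
  on to a generic point, unlike the existence of \<open>\<xi>\<close> and
  \<open>\<eta>\<close>.\<close>

lemma frame_exists:
  fixes a b :: "complex^'m::finite"
  assumes "a $ l1 * b $ l2 - a $ l2 * b $ l1 \<noteq> 0"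
  obtains \<xi> \<eta> where "dotp \<xi> a = 1" "dotp \<xi> b = 0" "dotp \<eta> a = 0" "dotp \<eta> b = 1"
proof -
  define \<delta> where "\<delta> = a $ l1 * b $ l2 - a $ l2 * b $ l1"
  have ax: "dotp (axis l 1) v = v $ l" for l and v :: "complex^'m"
    by (simp add: dotp_def axis_def if_distrib[of "\<lambda>x. x * _"] cong: if_cong)
  have comb: "dotp (p *s axis l1 1 + q *s axis l2 1) v = p * v $ l1 + q * v $ l2" for p q and v :: "complex^'m"
    by (simp add: dotp_lin ax)
  have d: "\<delta> \<noteq> 0" using assms by (simp add: \<delta>_def)
  show ?thesis
  proof (rule that[of "(b $ l2 / \<delta>) *s axis l1 1 + (- (b $ l1) / \<delta>) *s axis l2 1"
      "(- (a $ l2) / \<delta>) *s axis l1 1 + (a $ l1 / \<delta>) *s axis l2 1"], unfold comb)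
    show "b $ l2 / \<delta> * a $ l1 + - (b $ l1) / \<delta> * a $ l2 = 1"
      using d by (simp add: divide_simps) (simp add: \<delta>_def algebra_simps)
    show "b $ l2 / \<delta> * b $ l1 + - (b $ l1) / \<delta> * b $ l2 = 0" by (simp add: mult.commute)
    show "- (a $ l2) / \<delta> * a $ l1 + a $ l1 / \<delta> * a $ l2 = 0" by (simp add: mult.commute)
    show "- (a $ l2) / \<delta> * b $ l1 + a $ l1 / \<delta> * b $ l2 = 1"
      using d by (simp add: divide_simps) (simp add: \<delta>_def algebra_simps)
  qed
qed

text \<open>The additional variable \<open>None\<close> scales the point \<open>a + w b\<close>, so that the bad points form a cone and \<open>H\<close> can be
  taken homogeneous.\<close>

lemma good_form_piece:
  fixes X :: "(complex^'m::finite) set set" and k :: "'r::finite \<Rightarrow> nat" and h :: "'r \<Rightarrow> 'm mpoly"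
  assumes X: "X \<subseteq> proj_space" and sm: "smooth_of_dim (variety_charts X) (int n)" and m: "CARD('m) = n + c + 1"
    and k: "\<And>q. k q > 0"
    and h: "\<And>q x. peval (h q) x \<noteq> 0 \<Longrightarrow> x \<noteq> 0 \<Longrightarrow> \<forall>F\<in>vanishing_forms X. peval F x = 0 \<Longrightarrow> vec.span {x} \<in> X"
    and \<F>: "finite \<F>" "\<F> \<subseteq> vanishing_forms X" "vanishing_forms X \<subseteq> igen UNIV \<F>"
  shows "\<exists>H. H \<noteq> 0 \<and> homogeneous H \<and> (\<forall>a b u w. peval H (\<chi> l. a l + w * b l) \<noteq> 0 \<longrightarrow> a l1 * b l2 - a l2 * b l1 \<noteq> 0 \<longrightarrow>
    (\<forall>q. peval (h q) (\<chi> l. a l + u q * b l) \<noteq> 0) \<longrightarrow> (\<forall>F\<in>vanishing_forms X. divisor_poly u k dvd clin a b F) \<longrightarrow>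
       vec.dim (tangent_pairs (vanishing_forms X) a b u w k) + (\<Sum>q\<in>UNIV. k q) * c \<le> CARD('m) + CARD('r))"
proof -
  let ?V = "vanishing_forms X"
  define e where "e v = Some (Some v)" for v :: "('m, 'r) inc_var"
  define A where "A z l = z $ e (a_var l)" for z :: "complex^('m, 'r) inc_var option option" and l
  define B where "B z l = z $ e (b_var l)" for z :: "complex^('m, 'r) inc_var option option" and l
  define U where "U z q = z $ e (u_var q)" for z :: "complex^('m, 'r) inc_var option option" and q
  define W where "W z = z $ Some None" for z :: "complex^('m, 'r) inc_var option option"
  define good where "good z \<longleftrightarrow> (\<forall>F\<in>?V. divisor_poly (U z) k dvd clin (A z) (B z) F)" for z
  define dim where "dim z = vec.dim (tangent_pairs ?V (A z) (B z) (U z) (W z) k)" for z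
  define Z where "Z = {z. z $ None \<noteq> 0 \<and> A z l1 * B z l2 - A z l2 * B z l1 \<noteq> 0 \<and> (\<forall>q. peval (h q) (\<chi> l. A z l + U z q * B z l) \<noteq> 0) \<and>
    good z \<and> \<not> dim z + (\<Sum>q\<in>UNIV. k q) * c \<le> CARD('m) + CARD('r)}"
  define \<theta> :: "'m \<Rightarrow> ('m, 'r) inc_var option option mpoly" where
    "\<theta> l = Var None * (Var (e (a_var l)) + Var (Some None) * Var (e (b_var l)))" for l
  have p\<theta>: "peval (\<theta> l) z = z $ None * (A z l + W z * B z l)" for l z
    by (simp add: \<theta>_def peval_hom A_def B_def W_def)
  \<comment> \<open>One polynomial for all the open conditions on the bad points, so that the
    generic point inherits them.\<close>
  define g where "g = Var None * (Var (e (a_var l1)) * Var (e (b_var l2)) - Var (e (a_var l2)) * Var (e (b_var l1))) *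
    (\<Prod>q\<in>UNIV. subst Const (\<lambda>l. Var (e (a_var l)) + Var (e (u_var q)) * Var (e (b_var l))) (h q))"
  have pg: "peval g z = z $ None * (A z l1 * B z l2 - A z l2 * B z l1) * (\<Prod>q\<in>UNIV. peval (h q) (\<chi> l. A z l + U z q * B z l))" for z
    by (simp add: g_def peval_hom A_def B_def U_def peval_subst_Const)
  \<comment> \<open>The finite family \<open>\<F>\<close> represents all vanishing forms, so that
    finitely many coefficients, and with them a countable ring, suffice.\<close>
  define K where "K = sgen ((\<Union>F\<in>\<F>. coef_set F) \<union> (\<Union>q\<in>UNIV. coef_set (h q)))"
  have K: "srng K" "countable K"
    unfolding K_def by (rule srng_sgen) (intro countable_sgen countable_finite, simp add: \<F>(1) finite_coef_set)
  have cF: "coef_set F \<subseteq> K" if "F \<in> \<F>" for F using that by (auto simp: K_def intro!: sgen.sgen_base)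
  have ch: "h q \<in> polys_over K" for q by (rule polys_overI) (auto simp: K_def intro!: sgen.sgen_base)
  note pK = srngD[OF srng_sgen] polys_over_Var
  have gK: "g \<in> polys_over K" unfolding g_def by (intro srng_prod[OF srng_sgen] subst_polys_over ch pK)
  have \<theta>K: "\<theta> l \<in> polys_over K" for l unfolding \<theta>_def by (intro pK)
  have "\<exists>H. H \<noteq> 0 \<and> (\<forall>z\<in>Z. peval H (\<chi> l. peval (\<theta> l) z) = 0)"
  proof (rule ccontr)
    assume no: "\<not> ?thesis"
    have gZ: "peval g z \<noteq> 0" if "z \<in> Z" for z using that by (simp add: pg Z_def)
    have HZ: "\<exists>z\<in>Z. peval H (\<chi> i. peval (\<theta> i) z) \<noteq> 0" if "H \<noteq> 0" for H using no that by blast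
    obtain \<zeta> t where \<zeta>: "peval g \<zeta> \<noteq> 0"
      and van: "\<And>f. f \<in> polys_over K \<Longrightarrow> (\<And>z. z \<in> Z \<Longrightarrow> peval f z = 0) \<Longrightarrow> peval f \<zeta> = 0"
      and tanK: "\<And>f i. f \<in> polys_over K \<Longrightarrow> (\<And>z. z \<in> Z \<Longrightarrow> peval f z = 0) \<Longrightarrow> dd \<zeta> (t i) f = 0"
      and t\<theta>: "\<And>i j. dd \<zeta> (t i) (\<theta> j) = (if i = j then 1 else 0)"
      apply (rule generic_bad_point[OF K \<theta>K gK gZ HZ], assumption, assumption)
      subgoal premises p by (rule that) (fact p)+
      done
    have rK: "rename_vars e (Polynomial.coeff (remainder k F) i) \<in> polys_over K" if "F \<in> \<F>" for F i
      by (rule rename_vars_polys_over[OF remainder_polys_over[OF cF[OF that]]])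
    have rZ: "peval (rename_vars e (Polynomial.coeff (remainder k F) i)) z = 0" if "F \<in> \<F>" "z \<in> Z" for F i z
      using that \<F>(2) dvd_iff_remainder[of "\<chi> v. z $ e v" k F]
      by (auto simp: Z_def good_def peval_rename_vars A_def[abs_def] B_def[abs_def] U_def[abs_def])
    have D0: "divisor_poly (U \<zeta>) k dvd clin (A \<zeta>) (B \<zeta>) F" if F: "F \<in> \<F>" for F
      using van[OF rK[OF F] rZ[OF F]] dvd_iff_remainder[of "\<chi> v. \<zeta> $ e v" k F] by (simp add: peval_rename_vars A_def[abs_def] B_def[abs_def] U_def[abs_def])
    have D: "divisor_poly (U \<zeta>) k dvd clin (A \<zeta>) (B \<zeta>) F" if F: "F \<in> ?V" for F
      by (rule dvd_igen[of \<F>]) (use D0 F \<F>(3) in auto)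
    have nz: "\<zeta> $ None \<noteq> 0" "A \<zeta> l1 * B \<zeta> l2 - A \<zeta> l2 * B \<zeta> l1 \<noteq> 0" "\<And>q. peval (h q) (\<chi> l. A \<zeta> l + U \<zeta> q * B \<zeta> l) \<noteq> 0"
      using \<zeta> by (auto simp: pg)
    define a where "a = (\<chi> l. A \<zeta> l)"
    define b where "b = (\<chi> l. B \<zeta> l)"
    have xq: "(\<chi> l. A \<zeta> l + U \<zeta> q * B \<zeta> l) = a + U \<zeta> q *s b" for q by (simp add: a_def b_def vec_eq_iff)
    have "a $ l1 * b $ l2 - a $ l2 * b $ l1 \<noteq> 0" using nz(2) by (simp add: a_def b_def)
    then obtain \<xi> \<eta> where fr: "dotp \<xi> a = 1" "dotp \<xi> b = 0" "dotp \<eta> a = 0" "dotp \<eta> b = 1" by (rule frame_exists)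
    have xX: "vec.span {a + U \<zeta> q *s b} \<in> X" for q
    proof (rule h[of q])
      show "peval (h q) (a + U \<zeta> q *s b) \<noteq> 0" using nz(3)[of q] by (simp add: xq)
      have "dotp \<xi> (a + U \<zeta> q *s b) = 1" by (simp add: dotp_lin fr)
      then show "a + U \<zeta> q *s b \<noteq> 0" by (metis dotp_lin(6) zero_neq_one)
      show "\<forall>F\<in>?V. peval F (a + U \<zeta> q *s b) = 0"
      proof
        fix F assume "F \<in> ?V"
        have "divisor_poly (U \<zeta>) k = [:- U \<zeta> q, 1:] * divisor_poly (U \<zeta>) (k(q := k q - 1))" by (rule divisor_poly_split[OF k])
        then have "[:- U \<zeta> q, 1:] dvd clin (A \<zeta>) (B \<zeta>) F" using D[OF \<open>F \<in> ?V\<close>] by (metis dvd_mult_left)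
        then have "poly (clin (A \<zeta>) (B \<zeta>) F) (U \<zeta> q) = 0" by (simp only: poly_eq_0_iff_dvd)
        then show "peval F (a + U \<zeta> q *s b) = 0" by (simp add: poly_clin xq)
      qed
    qed
    obtain f where f: "\<And>j. j < c \<Longrightarrow> f j \<in> igen UNIV ?V" "\<And>q y. \<exists>s. \<forall>j<c. dd (a + U \<zeta> q *s b) s (f j) = y j"
      by (rule forms_along_line[OF X sm m fr xX]) (rule that)
    have bound: "dim \<zeta> + (\<Sum>q\<in>UNIV. k q) * c \<le> CARD('m) + CARD('r)"
      unfolding dim_def
    proof (rule dim_TT_le[OF k D f(1)])
      show "\<exists>s. \<forall>j<c. dd (\<chi> l. A \<zeta> l + U \<zeta> q * B \<zeta> l) s (f j) = y j" for q y unfolding xq by (rule f(2))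
      fix i
      \<comment> \<open>The direction \<open>t i\<close> moves the scaled point by the i-th unit
        vector. The change of the scalar contributes a multiple of \<open>(a, b)\<close>, a
        first-order deformation by Euler's relation, and the change of w contributes a multiple of
        \<open>b\<close>.\<close>
      define a' where "a' l = \<zeta> $ None * A (t i) l + t i $ None * A \<zeta> l" for l
      define b' where "b' l = \<zeta> $ None * B (t i) l + t i $ None * B \<zeta> l" for l
      define u' where "u' q = \<zeta> $ None * U (t i) q + t i $ None * 0" for q
      have "first_order (A \<zeta>) (B \<zeta>) (U \<zeta>) k (\<lambda>l. [:A (t i) l, B (t i) l:]) (\<lambda>q. U (t i) q) F" if F: "F \<in> \<F>" for F
      proof -
        have "dd (\<chi> v. \<zeta> $ e v) (\<chi> v. t i $ e v) (Polynomial.coeff (remainder k F) j) = 0" for j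
          using tanK[OF rK[OF F] rZ[OF F]] by (simp add: dd_rename_vars)
        then show ?thesis using first_order_iff_remainder[of "\<chi> v. \<zeta> $ e v" k F "\<chi> v. t i $ e v"] D0[OF F]
          by (simp add: A_def[abs_def] B_def[abs_def] U_def[abs_def])
      qed
      then have "first_order (A \<zeta>) (B \<zeta>) (U \<zeta>) k (\<lambda>l. [:A (t i) l, B (t i) l:]) (\<lambda>q. U (t i) q) F" if "F \<in> ?V" for F
        using first_order_igen[of F \<F>] that \<F>(3) by blast
      then have "first_order (A \<zeta>) (B \<zeta>) (U \<zeta>) k (\<lambda>l. [:\<zeta> $ None:] * [:A (t i) l, B (t i) l:] + [:t i $ None:] * [:A \<zeta> l, B \<zeta> l:]) u' F" if "F \<in> ?V" for F
        unfolding u'_def using that D[OF that]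
        by (intro first_order_add first_order_smult first_order_euler) (auto simp: vanishing_forms_def)
      moreover have "(\<lambda>l. [:\<zeta> $ None:] * [:A (t i) l, B (t i) l:] + [:t i $ None:] * [:A \<zeta> l, B \<zeta> l:]) = (\<lambda>l. [:a' l, b' l:])"
        by (simp add: a'_def b'_def mult.commute)
      ultimately have T: "\<forall>F\<in>?V. first_order (A \<zeta>) (B \<zeta>) (U \<zeta>) k (\<lambda>l. [:a' l, b' l:]) u' F" by simp
      have "a' l + W \<zeta> * b' l + (\<zeta> $ None * W (t i)) * B \<zeta> l = (if l = i then 1 else 0)" for l
      proof -
        have "dd \<zeta> (t i) (\<theta> l) = \<zeta> $ None * (A (t i) l + (W \<zeta> * B (t i) l + W (t i) * B \<zeta> l)) + t i $ None * (A \<zeta> l + W \<zeta> * B \<zeta> l)"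
          by (simp add: \<theta>_def peval_hom A_def B_def W_def)
        then show ?thesis unfolding t\<theta> a'_def b'_def by (auto simp: algebra_simps)
      qed
      with T show "\<exists>a' b' u' \<delta>. (\<forall>F\<in>?V. first_order (A \<zeta>) (B \<zeta>) (U \<zeta>) k (\<lambda>l. [:a' l, b' l:]) u' F) \<and>
        (\<forall>l. a' l + W \<zeta> * b' l + \<delta> * B \<zeta> l = (if l = i then 1 else 0))" by blast
    qed
    define G where "G z = {(\<chi> s. peval (trow e (Some None) k F i s) z) | F i. F \<in> \<F>}" for z
    have TTG: "tangent_pairs ?V (A z) (B z) (U z) (W z) k = {v. \<forall>g\<in>G z. dotp g v = 0}"
      if "\<And>F. F \<in> \<F> \<Longrightarrow> divisor_poly (U z) k dvd clin (A z) (B z) F" for z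
      unfolding tangent_pairs_igen[OF \<F>(3,2)] G_def
      using tangent_pairs_trow[of \<F> z e k "Some None"] that unfolding A_def[abs_def] B_def[abs_def] U_def[abs_def] W_def by blast
    \<comment> \<open>Independent rows of the linear system at \<open>\<zeta>\<close>, completed by
      unit vectors. Their determinant is a polynomial over \<open>K\<close> that is nonzero at
      \<open>\<zeta>\<close>, hence at some bad point, where the rank is then at least as large and
      the bound holds.\<close>
    obtain r :: "'m + 'r \<Rightarrow> complex^('m + 'r)" and S where rS: "r ` S \<subseteq> G \<zeta>" "{} \<subseteq> r ` S" "r ` (- S) \<subseteq> range (\<lambda>v. axis v 1)"
      "inj r" "invertible (\<chi> i. r i)" "G \<zeta> \<subseteq> vec.span (r ` S)"
      by (rule choose_rows[OF empty_subsetI vec.independent_empty, of "G \<zeta>"]) (rule that)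
    have T\<zeta>: "tangent_pairs ?V (A \<zeta>) (B \<zeta>) (U \<zeta>) (W \<zeta>) k = {v. \<forall>g\<in>G \<zeta>. dotp g v = 0}"
      by (rule TTG) (rule D0)
    have "dim \<zeta> = card (- S)"
      unfolding dim_def T\<zeta> rows_ann[OF rS(1,6)] by (rule dim_rows[OF rS(5)])
    have "\<exists>M. (\<forall>t. M t \<in> polys_over K) \<and> r s = (\<chi> t. peval (M t) \<zeta>) \<and> (s \<in> S \<longrightarrow> (\<forall>z. (\<chi> t. peval (M t) z) \<in> G z))" for s
    proof (cases "s \<in> S")
      case True
      then obtain F i where F: "F \<in> \<F>" "r s = (\<chi> s. peval (trow e (Some None) k F i s) \<zeta>)" using rS(1) by (auto simp: G_def)
      show ?thesis
        by (rule exI[of _ "trow e (Some None) k F i"]) (use F trow_polys_over[OF cF[OF F(1)]] in \<open>auto simp: G_def\<close>)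
    next
      case False
      then obtain v where "r s = axis v 1" using rS(3) by auto
      then have "r s = (\<chi> t. peval (if t = v then 1 else 0) \<zeta>)" by (auto simp: vec_eq_iff axis_def peval_hom)
      then show ?thesis using False by (intro exI[of _ "\<lambda>t. if t = v then 1 else 0"]) (auto intro: pK)
    qed
    then obtain M where M: "\<And>s t. M s t \<in> polys_over K" "\<And>s. r s = (\<chi> t. peval (M s t) \<zeta>)"
      "\<And>s z. s \<in> S \<Longrightarrow> (\<chi> t. peval (M s t) z) \<in> G z" by metis
    have "peval (det (\<chi> i j. M i j)) \<zeta> \<noteq> 0"
      using rS(5) unfolding det_polys(1) invertible_det_nz M(2) by simp
    moreover have "det (\<chi> i j. M i j) \<in> polys_over K" by (rule det_polys(2)) (rule M(1))
    ultimately obtain z where z: "z \<in> Z" "peval (det (\<chi> i j. M i j)) z \<noteq> 0" using van by blast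
    define r' where "r' s = (\<chi> t. peval (M s t) z)" for s
    have inv: "invertible (\<chi> i. r' i)" using z(2) unfolding det_polys(1) invertible_det_nz r'_def by simp
    have gz: "divisor_poly (U z) k dvd clin (A z) (B z) F" if "F \<in> \<F>" for F using z(1) that \<F>(2) by (auto simp: Z_def good_def)
    have Tz: "tangent_pairs ?V (A z) (B z) (U z) (W z) k = {v. \<forall>g\<in>G z. dotp g v = 0}"
      by (rule TTG) (rule gz)
    have "tangent_pairs ?V (A z) (B z) (U z) (W z) k \<subseteq> {v. \<forall>s\<in>S. ((\<chi> i. r' i) *v v) $ s = 0}"
      unfolding Tz matvec_dotp using M(3) by (auto simp: r'_def)
    then have "dim z \<le> card (- S)" unfolding dim_def dim_rows[OF inv, symmetric] by (rule vec.dim_subset)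
    then show False using z(1) bound \<open>dim \<zeta> = card (- S)\<close> by (simp add: Z_def)
  qed
  then obtain H where H: "H \<noteq> 0" "\<And>z. z \<in> Z \<Longrightarrow> peval H (\<chi> l. peval (\<theta> l) z) = 0" by blast
  define T where "T = (\<lambda>z. \<chi> l. peval (\<theta> l) z) ` Z"
  have "s *s x \<in> T" if x: "x \<in> T" and s: "s \<noteq> 0" for x s
  proof -
    obtain z where z: "z \<in> Z" "x = (\<chi> l. peval (\<theta> l) z)" using x by (auto simp: T_def)
    define z' where "z' = (\<chi> v. if v = None then s * z $ None else z $ v)"
    have "A z' = A z" "B z' = B z" "U z' = U z" "W z' = W z" "z' $ None = s * z $ None"
      by (auto simp: z'_def A_def B_def U_def W_def e_def)
    then have "z' \<in> Z" "s *s x = (\<chi> l. peval (\<theta> l) z')"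
      using z(1) s by (auto simp: Z_def dim_def good_def z(2) vec_eq_iff p\<theta>)
    then show ?thesis unfolding T_def by blast
  qed
  then obtain H' where H': "H' \<noteq> 0" "homogeneous H'" "\<And>x. x \<in> T \<Longrightarrow> peval H' x = 0"
    by (rule conic_homogeneous[OF H(1), of T, rotated]) (use H(2) in \<open>auto simp: T_def\<close>)
  show ?thesis
  proof (intro exI[of _ H'] conjI allI impI H'(1,2))
    fix a b u w
    assume *: "peval H' (\<chi> l. a l + w * b l) \<noteq> 0" "a l1 * b l2 - a l2 * b l1 \<noteq> 0" "\<forall>q. peval (h q) (\<chi> l. a l + u q * b l) \<noteq> 0"
      "\<forall>F\<in>?V. divisor_poly u k dvd clin a b F"
    define z :: "complex^('m, 'r) inc_var option option" where "z = (\<chi> v. case v of None \<Rightarrow> 1 | Some None \<Rightarrow> w |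
      Some (Some (Inl l)) \<Rightarrow> a l | Some (Some (Inr (Inl l))) \<Rightarrow> b l | Some (Some (Inr (Inr q))) \<Rightarrow> u q)"
    have z: "A z = a" "B z = b" "U z = u" "W z = w" "z $ None = 1"
      by (auto simp: z_def A_def B_def U_def W_def e_def)
    have "z \<notin> Z"
    proof
      assume "z \<in> Z"
      then have "peval H' (\<chi> l. peval (\<theta> l) z) = 0" using H'(3) by (auto simp: T_def)
      then show False using *(1) by (simp add: p\<theta> z)
    qed
    then show "vec.dim (tangent_pairs ?V a b u w k) + (\<Sum>q\<in>UNIV. k q) * c \<le> CARD('m) + CARD('r)"
      using *(2-4) unfolding Z_def dim_def good_def by (simp add: z)
  qed
qed

text \<open>\<open>good_form_piece\<close> fixes a minor of \<open>(a, b)\<close> and, for each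
  point of the divisor, a form that certifies membership in \<open>X\<close>. There are finitely
  many such choices, and the product of their forms serves all of them.\<close>

theorem good_form:
  fixes X :: "(complex^'m::finite) set set" and k :: "'r::finite \<Rightarrow> nat"
  assumes qp: "quasi_projective X" and sm: "smooth_of_dim (variety_charts X) (int n)" and m: "CARD('m) = n + c + 1"
    and k: "\<And>q. k q > 0"
  obtains H where "H \<noteq> 0" "homogeneous H"
    "\<And>a b u w l1 l2. \<lbrakk>peval H (\<chi> l. a l + w * b l) \<noteq> 0; a l1 * b l2 - a l2 * b l1 \<noteq> 0; \<And>q. vec.span {\<chi> l. a l + u q * b l} \<in> X;
       \<And>F. F \<in> vanishing_forms X \<Longrightarrow> divisor_poly u k dvd clin a b F\<rbrakk> \<Longrightarrow>
       vec.dim (tangent_pairs (vanishing_forms X) a b u w k) + (\<Sum>q\<in>UNIV. k q) * c \<le> CARD('m) + CARD('r)"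
proof -
  let ?V = "vanishing_forms X"
  obtain \<H> where \<H>: "finite \<H>" "\<And>H. H \<in> \<H> \<Longrightarrow> homogeneous H" "\<And>x. vec.span {x} \<in> X \<Longrightarrow> \<exists>H\<in>\<H>. peval H x \<noteq> 0"
    "\<And>H x. H \<in> \<H> \<Longrightarrow> peval H x \<noteq> 0 \<Longrightarrow> x \<noteq> 0 \<Longrightarrow> (\<And>F. F \<in> ?V \<Longrightarrow> peval F x = 0) \<Longrightarrow> vec.span {x} \<in> X"
    apply (rule quasi_projective_cover[OF qp])
    subgoal premises p by (rule that) (fact p)+
    done
  obtain \<F> where \<F>: "finite \<F>" "\<F> \<subseteq> ?V" "?V \<subseteq> igen UNIV \<F>" by (rule noeth_generators[OF noeth_mpoly, of ?V]) auto
  define good where "good H l1 l2 h \<longleftrightarrow> (\<forall>a b u w. peval H (\<chi> l. a l + w * b l) \<noteq> 0 \<longrightarrow> a l1 * b l2 - a l2 * b l1 \<noteq> 0 \<longrightarrow>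
    (\<forall>q. peval (h q) (\<chi> l. a l + u q * b l) \<noteq> 0) \<longrightarrow> (\<forall>F\<in>?V. divisor_poly u k dvd clin a b F) \<longrightarrow>
       vec.dim (tangent_pairs ?V a b u w k) + (\<Sum>q\<in>UNIV. k q) * c \<le> CARD('m) + CARD('r))" for H l1 l2 h
  define P :: "('m \<times> 'm \<times> ('r \<Rightarrow> 'm mpoly)) set" where "P = UNIV \<times> UNIV \<times> (PiE UNIV (\<lambda>_. \<H>))"
  have P: "finite P" unfolding P_def by (intro finite_cartesian_product finite_PiE) (auto simp: \<H>(1))
  have ex: "\<exists>H. H \<noteq> 0 \<and> homogeneous H \<and> good H l1 l2 h" if "(l1, l2, h) \<in> P" for l1 l2 h
  proof -
    have h: "h q \<in> \<H>" for q using that by (auto simp: P_def PiE_def)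
    show ?thesis unfolding good_def
    proof (rule good_form_piece[OF quasi_projective_subset[OF qp] sm m])
      show "k q > 0" for q by (rule k)
      show "vec.span {x} \<in> X" if x: "peval (h q) x \<noteq> 0" "x \<noteq> 0" "\<forall>F\<in>?V. peval F x = 0" for q x
        using \<H>(4)[OF h x(1,2)] x(3) by blast
    qed (use \<F> in auto)
  qed
  then have "\<exists>\<Phi>. \<forall>p\<in>P. \<Phi> p \<noteq> 0 \<and> homogeneous (\<Phi> p) \<and> good (\<Phi> p) (fst p) (fst (snd p)) (snd (snd p))"
    by (intro bchoice) auto
  then obtain \<Phi> where \<Phi>: "\<And>p. p \<in> P \<Longrightarrow> \<Phi> p \<noteq> 0" "\<And>p. p \<in> P \<Longrightarrow> homogeneous (\<Phi> p)"
    "\<And>p. p \<in> P \<Longrightarrow> good (\<Phi> p) (fst p) (fst (snd p)) (snd (snd p))" by blast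
  have nz: "(\<Prod>p\<in>Q. \<Phi> p) \<noteq> 0" if "finite Q" "Q \<subseteq> P" for Q
    using that
  proof (induction Q)
    case empty
    have "peval (1 :: 'm mpoly) 0 \<noteq> peval 0 0" by (simp add: peval_hom)
    then show ?case by auto
  qed (use \<Phi>(1) in \<open>simp add: mpoly_mult_nonzero\<close>)
  show ?thesis
  proof (rule that[of "\<Prod>p\<in>P. \<Phi> p"])
    show "(\<Prod>p\<in>P. \<Phi> p) \<noteq> 0" by (rule nz[OF P subset_refl])
    show "homogeneous (\<Prod>p\<in>P. \<Phi> p)" by (rule homogeneous_prod[OF \<Phi>(2)])
    fix a b u w l1 l2
    assume *: "peval (\<Prod>p\<in>P. \<Phi> p) (\<chi> l. a l + w * b l) \<noteq> 0" "a l1 * b l2 - a l2 * b l1 \<noteq> 0" "\<And>q. vec.span {\<chi> l. a l + u q * b l} \<in> X"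
      "\<And>F. F \<in> ?V \<Longrightarrow> divisor_poly u k dvd clin a b F"
    have "\<exists>h. \<forall>q. h q \<in> \<H> \<and> peval (h q) (\<chi> l. a l + u q * b l) \<noteq> 0"
      by (intro choice allI) (use \<H>(3)[OF *(3)] in blast)
    then obtain h where h: "\<And>q. h q \<in> \<H>" "\<And>q. peval (h q) (\<chi> l. a l + u q * b l) \<noteq> 0" by blast
    have p: "(l1, l2, h) \<in> P" using h(1) by (auto simp: P_def PiE_def)
    have "peval (\<Phi> (l1, l2, h)) (\<chi> l. a l + w * b l) \<noteq> 0"
      using *(1) p P by (auto simp: peval_hom)
    then show "vec.dim (tangent_pairs ?V a b u w k) + (\<Sum>q\<in>UNIV. k q) * c \<le> CARD('m) + CARD('r)"
      using \<Phi>(3)[OF p] *(2,4) h(2) unfolding good_def by simp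
  qed
qed

section \<open>The fibres\<close>

text \<open>The smallest ideal with the universal property gets explicit generators: by
  \<open>monic_rem_ideal\<close>, containment of the divisor over \<open>J\<close> forces the
  coefficients of the remainders into \<open>J\<close>.\<close>

lemma OH_ideal_eq:
  "OH_ideal X k \<xi> \<eta> = igen UNIV (frame_equations \<xi> \<eta> \<union> {Polynomial.coeff (remainder k F) i | F i. F \<in> vanishing_forms X})"
    (is "_ = igen UNIV ?G")
proof
  note id = ideal_in_igen[OF srng_UNIV subset_UNIV, of ?G]
  have "divisor_contained X k (igen UNIV ?G)"
    unfolding divisor_contained_def
  proof
    fix F assume F: "F \<in> vanishing_forms X"
    obtain S where "restrict_to_line F = divisor_equation k * S + remainder k F" by (rule remainder_spec)
    then have "restrict_to_line F - divisor_equation k * S = remainder k F" by simp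
    then show "\<exists>Q. \<forall>i. Polynomial.coeff (restrict_to_line F - divisor_equation k * Q) i \<in> igen UNIV ?G"
      using F by (intro exI[of _ S]) (auto intro!: igen_base srng_UNIV)
  qed
  moreover have "frame_equations \<xi> \<eta> \<subseteq> igen UNIV ?G" by (auto intro: igen_base srng_UNIV)
  ultimately show "OH_ideal X k \<xi> \<eta> \<subseteq> igen UNIV ?G" unfolding OH_ideal_def ideal_iff using id by blast
  show "igen UNIV ?G \<subseteq> OH_ideal X k \<xi> \<eta>"
    unfolding OH_ideal_def
  proof (rule Inter_greatest)
    fix J assume "J \<in> {J. poly_ideal J \<and> frame_equations \<xi> \<eta> \<subseteq> J \<and> divisor_contained X k J}"
    then have J: "ideal_in UNIV J" "frame_equations \<xi> \<eta> \<subseteq> J" "divisor_contained X k J" by (auto simp: ideal_iff)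
    have "Polynomial.coeff (remainder k F) i \<in> J" if F: "F \<in> vanishing_forms X" for F i
    proof -
      obtain S where S: "restrict_to_line F = divisor_equation k * S + remainder k F" by (rule remainder_spec)
      obtain Q where Q: "\<And>i. Polynomial.coeff (restrict_to_line F - divisor_equation k * Q) i \<in> J"
        using J(3) F unfolding divisor_contained_def by blast
      have "restrict_to_line F - divisor_equation k * Q = divisor_equation k * (S - Q) + remainder k F" by (simp add: S algebra_simps)
      with Q have Q': "\<And>i. Polynomial.coeff (divisor_equation k * (S - Q) + remainder k F) i \<in> J" by simp
      show ?thesis
        by (rule monic_rem_ideal[OF mon_deg_divisor_poly[of k "\<lambda>q. Var (u_var q)", folded divisor_equation_divisor_poly] J(1)])
          (use remainder_high Q' in auto)
    qed
    then have "?G \<subseteq> J" using J(2) by auto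
    then show "igen UNIV ?G \<subseteq> J" by (rule igen_least[OF J(1)])
  qed
qed

text \<open>Needed because the interpolated equations along a line are combinations of forms and not
  forms themselves.\<close>

lemma remainder_igen:
  assumes J: "ideal_in UNIV J" and V: "\<And>F i. F \<in> V \<Longrightarrow> Polynomial.coeff (remainder k F) i \<in> J" and f: "f \<in> igen UNIV V"
  shows "Polynomial.coeff (remainder k f) i \<in> J"
proof -
  have "\<exists>Q R. (\<forall>i. Polynomial.coeff R i \<in> J) \<and> restrict_to_line f = divisor_equation k * Q + R"
    using f
  proof induction
    case igen_0
    show ?case by (intro exI[of _ 0]) (simp add: restrict_to_line_lin lin_hom[OF rhom_Const] ideal_in_0[OF J])
  next
    case (igen_step g F x)
    obtain Q R where QR: "\<And>i. Polynomial.coeff R i \<in> J" "restrict_to_line x = divisor_equation k * Q + R" using igen_step.IH by blast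
    obtain S where S: "restrict_to_line F = divisor_equation k * S + remainder k F" by (rule remainder_spec)
    have "restrict_to_line (g * F + x) = restrict_to_line g * restrict_to_line F + restrict_to_line x"
      by (simp add: restrict_to_line_lin lin_hom[OF rhom_Const])
    also have "\<dots> = divisor_equation k * (restrict_to_line g * S + Q) + (restrict_to_line g * remainder k F + R)"
      by (simp add: S QR(2) algebra_simps)
    finally have 1: "restrict_to_line (g * F + x) = \<dots>" .
    have "Polynomial.coeff (restrict_to_line g * remainder k F) i \<in> J" for i
      unfolding coeff_mult by (intro ideal_in_sum[OF J] ideal_in_mult[OF J] V igen_step UNIV_I)
    then have 2: "\<forall>i. Polynomial.coeff (restrict_to_line g * remainder k F + R) i \<in> J" using QR(1) by (simp add: ideal_in_add[OF J])
    from 1 2 show ?case by blast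
  qed
  then obtain Q R where QR: "\<And>i. Polynomial.coeff R i \<in> J" "restrict_to_line f = divisor_equation k * Q + R" by blast
  obtain S where S: "restrict_to_line f = divisor_equation k * S + remainder k f" by (rule remainder_spec)
  have "divisor_equation k * Q + R = divisor_equation k * S + remainder k f" using S QR(2) by simp
  then have "divisor_equation k * (S - Q) + remainder k f = R" by (simp add: algebra_simps)
  then have "\<And>i. Polynomial.coeff (divisor_equation k * (S - Q) + remainder k f) i \<in> J" using QR(1) by simp
  then show ?thesis
    by (rule monic_rem_ideal[OF mon_deg_divisor_poly[of k "\<lambda>q. Var (u_var q)", folded divisor_equation_divisor_poly] J, rotated]) (rule remainder_high)
qed

lemma first_order_\<tau>:
  assumes "first_order a b u k s u1 F" and k: "\<And>q. k q > 0"
  shows "first_order a b u k (\<lambda>l. [:- w, 1:] * s l) (\<lambda>q. (u q - w) * u1 q) F"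
proof -
  have "first_order a b u k (\<lambda>l. [:0, 1:] * s l + [:- w:] * s l) (\<lambda>q. u q * u1 q + - w * u1 q) F"
    by (intro first_order_add first_order_shift first_order_smult assms)
  moreover have "[:0, 1:] * s l + [:- w:] * s l = [:- w, 1:] * s l" for l
    unfolding distrib_right[symmetric] by simp
  moreover have "(\<lambda>q. u q * u1 q + - w * u1 q) = (\<lambda>q. (u q - w) * u1 q)" by (simp add: algebra_simps)
  ultimately show ?thesis by (simp only:)
qed

lemma lin_line:
  assumes h: "rhom h" shows "lin h a b (linear_form \<xi>) = [:\<Sum>l\<in>UNIV. h (\<xi> $ l) * a l, \<Sum>l\<in>UNIV. h (\<xi> $ l) * b l:]"
proof -
  have "lin h a b (linear_form \<xi>) = (\<Sum>l\<in>UNIV. [:h (\<xi> $ l) * a l, h (\<xi> $ l) * b l:])"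
    by (simp add: linear_form_def lin_hom[OF h] lin_Const[OF h] lin_Var[OF h] mult.commute)
  also have "\<dots> = [:\<Sum>l\<in>UNIV. h (\<xi> $ l) * a l, \<Sum>l\<in>UNIV. h (\<xi> $ l) * b l:]"
    by (rule poly_eqI) (simp add: Polynomial.coeff_sum coeff_pCons split: nat.splits)
  finally show ?thesis .
qed

text \<open>The two extra dimensions come from the reparametrizations of the line, which move \<open>b\<close> and \<open>a\<close> within it.\<close>

lemma dim_TT_normalized:
  fixes V :: "'m::finite mpoly set" and k :: "'r::finite \<Rightarrow> nat" and a b :: "complex^'m"
  assumes k: "\<And>q. k q > 0" and V: "\<And>F. F \<in> V \<Longrightarrow> homogeneous F" and D: "\<And>F. F \<in> V \<Longrightarrow> divisor_poly u k dvd clin (($) a) (($) b) F"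
    and fr: "dotp \<xi> a = 1" "dotp \<xi> b = 0" "dotp \<eta> a = 0" "dotp \<eta> b = 1"
    and T: "vec.subspace T" "T \<subseteq> tangent_pairs V (($) a) (($) b) u w k"
      "\<And>v. v \<in> T \<Longrightarrow> dotp \<xi> (\<chi> l. v $ Inl l) = 0" "\<And>v. v \<in> T \<Longrightarrow> dotp \<eta> (\<chi> l. v $ Inl l) = 0"
  shows "vec.dim T + 2 \<le> vec.dim (tangent_pairs V (($) a) (($) b) u w k)"
proof -
  \<comment> \<open>The products of \<open>t - w\<close> with the deformations of velocities
    \<open>b\<close> and \<open>a\<close>. The latter is Euler's \<open>a + t b\<close> minus
    \<open>t b\<close>, which gives it the root velocity \<open>u\<close>.\<close>
  define e :: "bool \<Rightarrow> complex^('m + 'r)" where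
    "e i = (\<chi> s. case s of Inl l \<Rightarrow> (if i then b $ l else a $ l) | Inr q \<Rightarrow> (if i then (u q - w) * - 1 else (u q - w) * (u q)))" for i
  have "e True \<in> tangent_pairs V (($) a) (($) b) u w k"
    unfolding tangent_pairs_def using first_order_\<tau>[OF first_order_b[OF D] k, of _ w] by (simp add: e_def)
  moreover have "first_order (($) a) (($) b) u k (\<lambda>l. [:- w, 1:] * [:a $ l:]) (\<lambda>q. (u q - w) * u q) F" if F: "F \<in> V" for F
  proof (rule first_order_\<tau>[OF _ k])
    have "first_order (($) a) (($) b) u k (\<lambda>l. [:a $ l, b $ l:] + [:- 1:] * ([:0, 1:] * [:b $ l:])) (\<lambda>q. 0 + - 1 * (u q * - 1)) F"
      by (intro first_order_add first_order_smult first_order_shift first_order_euler first_order_b D V F k)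
    then show "first_order (($) a) (($) b) u k (\<lambda>l. [:a $ l:]) u F" by simp
  qed
  then have "e False \<in> tangent_pairs V (($) a) (($) b) u w k"
    unfolding tangent_pairs_def by (simp add: e_def)
  ultimately have e: "e i \<in> tangent_pairs V (($) a) (($) b) u w k" for i by (cases i) auto
  have "vec.dim T + card (UNIV :: bool set) \<le> vec.dim (tangent_pairs V (($) a) (($) b) u w k)"
  proof (rule dim_mod[OF T(1,2) _ e])
    fix x assume "(\<Sum>j\<in>UNIV. x j *s e j) \<in> T"
    then have *: "x True *s e True + x False *s e False \<in> T" by (simp add: UNIV_bool add.commute)
    have v: "(\<chi> l. (x True *s e True + x False *s e False) $ Inl l) = x True *s b + x False *s a"
      by (simp add: vec_eq_iff e_def)
    have "x False = 0" using T(3)[OF *] unfolding v by (simp add: dotp_lin fr)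
    moreover have "x True = 0" using T(4)[OF *] unfolding v by (simp add: dotp_lin fr)
    ultimately show "\<forall>j\<in>UNIV. x j = 0" by (simp add: UNIV_bool)
  qed simp
  then show ?thesis by simp
qed

lemma dim_inj_le:
  fixes T :: "(complex^'a::finite) set" and g :: "complex^'a \<Rightarrow> complex^'b::finite"
  assumes T: "vec.subspace T" and add: "\<And>v w. g (v + w) = g v + g w" and sc: "\<And>c v. g (c *s v) = c *s g v"
    and inj: "\<And>v. v \<in> T \<Longrightarrow> g v = 0 \<Longrightarrow> v = 0"
  shows "vec.subspace (g ` T)" "vec.dim (g ` T) = vec.dim T"
proof -
  have lin: "Vector_Spaces.linear (*s) (*s) g" by unfold_locales (auto simp: add sc)
  then interpret g: Vector_Spaces.linear "(*s)" "(*s)" g .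
  show "vec.subspace (g ` T)" by (rule g.subspace_image[OF T])
  have "inj_on g T"
  proof (rule inj_onI)
    fix x y assume xy: "x \<in> T" "y \<in> T" "g x = g y"
    then have "g (x - y) = 0" by (simp add: g.diff)
    moreover have "x - y \<in> T" by (rule vec.subspace_diff[OF T xy(1,2)])
    ultimately show "x = y" using inj[of "x - y"] by simp
  qed
  then show "vec.dim (g ` T) = vec.dim T"
    by (intro vec.dim_image_eq[OF lin]) (simp add: vec.span_eq_iff[THEN iffD2, OF T])
qed

lemma OH_point_facts:
  fixes y :: "complex^('m::finite, 'r::finite) inc_var" and a b :: "complex^'m"
  assumes y: "y \<in> OH_points X k \<xi> \<eta>" and a: "\<And>l. a $ l = y $ a_var l" and b: "\<And>l. b $ l = y $ b_var l" and u: "\<And>q. u q = y $ u_var q"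
  shows "dotp \<xi> a = 1" "dotp \<xi> b = 0" "dotp \<eta> a = 0" "dotp \<eta> b = 1"
    "F \<in> vanishing_forms X \<Longrightarrow> divisor_poly u k dvd clin (($) a) (($) b) F" "vec.span {a + u q *s b} \<in> X"
proof -
  have z: "peval f y = 0" if "f \<in> frame_equations \<xi> \<eta> \<union> {Polynomial.coeff (remainder k F) i | F i. F \<in> vanishing_forms X}" for f
    using y igen_base[OF that srng_UNIV] unfolding OH_points_def zeros_def OH_ideal_eq by blast
  have p: "peval (\<Sum>l\<in>UNIV. Const (\<xi> $ l) * Var (a_var l)) y = dotp \<xi> a" "peval (\<Sum>l\<in>UNIV. Const (\<xi> $ l) * Var (b_var l)) y = dotp \<xi> b" for \<xi>
    by (simp_all add: peval_hom dotp_def a b)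
  show "dotp \<xi> a = 1" "dotp \<xi> b = 0" "dotp \<eta> a = 0" "dotp \<eta> b = 1"
    using z[of "(\<Sum>l\<in>UNIV. Const (\<xi> $ l) * Var (a_var l)) - 1"] z[of "\<Sum>l\<in>UNIV. Const (\<xi> $ l) * Var (b_var l)"]
      z[of "\<Sum>l\<in>UNIV. Const (\<eta> $ l) * Var (a_var l)"] z[of "(\<Sum>l\<in>UNIV. Const (\<eta> $ l) * Var (b_var l)) - 1"]
    by (simp_all add: frame_equations_def p peval_hom(6) peval_hom(1))
  have ab: "($) a = (\<lambda>l. y $ a_var l)" "($) b = (\<lambda>l. y $ b_var l)" "u = (\<lambda>q. y $ u_var q)" by (auto simp: a b u)
  show "divisor_poly u k dvd clin (($) a) (($) b) F" if "F \<in> vanishing_forms X"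
    unfolding ab dvd_iff_remainder by (intro allI z) (use that in blast)
  have "(\<chi> l. y $ a_var l + y $ u_var q * y $ b_var l) = a + u q *s b" by (simp add: vec_eq_iff a b u)
  then show "vec.span {a + u q *s b} \<in> X" using y unfolding OH_points_def by (metis (no_types, lifting) mem_Collect_eq)
qed

text \<open>Near \<open>z\<close> the fibre is described by m + 3 + k c equations \<open>G0\<close>
  in 2 m + r + 1 variables. Their tangent space embeds into \<open>tangent_pairs\<close> with
  codimension at least 2, so \<open>bound\<close> yields the codimension that
  \<open>smooth_at\<close> requires. The remaining work is to place the ideal of the fibre between
  \<open>G0\<close> and its ideal of arcs.\<close>

theorem fibre_smooth_at:
  fixes X :: "(complex^'m::finite) set set" and k :: "'r::finite \<Rightarrow> nat" and z :: "complex^('m, 'r) inc_var option"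
    and a b :: "complex^'m"
  assumes X: "X \<subseteq> proj_space" and sm: "smooth_of_dim (variety_charts X) (int n)" and m: "CARD('m) = n + c + 1"
    and k: "\<And>q. k q > 0"
    and a: "\<And>l. a $ l = z $ Some (a_var l)" and b: "\<And>l. b $ l = z $ Some (b_var l)" and u: "\<And>q. u q = z $ Some (u_var q)"
    and w: "w = z $ None"
    and fr: "dotp \<xi> a = 1" "dotp \<xi> b = 0" "dotp \<eta> a = 0" "dotp \<eta> b = 1"
    and D: "\<And>F. F \<in> vanishing_forms X \<Longrightarrow> divisor_poly u k dvd clin (($) a) (($) b) F"
    and xX: "\<And>q. vec.span {a + u q *s b} \<in> X"
    and bound: "vec.dim (tangent_pairs (vanishing_forms X) (($) a) (($) b) u w k) + (\<Sum>q\<in>UNIV. k q) * c \<le> CARD('m) + CARD('r)"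
    and J: "J = igen UNIV (igen UNIV (rename_vars Some ` OH_ideal X k \<xi> \<eta>) \<union> theta_equations (vec.span {a + w *s b}))"
  shows "vec.dim (tangent_space J z) + 2 + (\<Sum>q\<in>UNIV. k q) * c = CARD('m) + CARD('r)"
    "local_krull_dim J z = enat (vec.dim (tangent_space J z))"
proof -
  let ?V = "vanishing_forms X"
  define \<kappa> where "\<kappa> = (\<Sum>q\<in>UNIV. k q)"
  define p where "p = a + w *s b"
  obtain f :: "nat \<Rightarrow> 'm mpoly" where f: "\<And>j. j < c \<Longrightarrow> f j \<in> igen UNIV ?V"
    and loc: "\<And>q h. h \<in> ?V \<Longrightarrow> \<exists>g. peval g (a + u q *s b) = 1 \<and> g * h \<in> igen UNIV (insert (linear_form \<xi> - 1) (f ` {..<c}))"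
    by (rule forms_along_line[OF X sm m fr xX]) (rule that)
  define y :: "'m \<Rightarrow> ('m, 'r) inc_var option mpoly" where "y l = Var (Some (a_var l)) + Var None * Var (Some (b_var l))" for l
  define LA :: "complex^'m \<Rightarrow> ('m, 'r) inc_var option mpoly" where "LA \<xi> = (\<Sum>l\<in>UNIV. Const (\<xi> $ l) * Var (Some (a_var l)))" for \<xi>
  define LB :: "complex^'m \<Rightarrow> ('m, 'r) inc_var option mpoly" where "LB \<xi> = (\<Sum>l\<in>UNIV. Const (\<xi> $ l) * Var (Some (b_var l)))" for \<xi>
  define Ly where "Ly \<xi> = (\<Sum>l\<in>UNIV. Const (\<xi> $ l) * y l)" for \<xi>
  have Ly: "Ly \<xi> = LA \<xi> + Var None * LB \<xi>" for \<xi>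
    by (simp add: Ly_def LA_def LB_def y_def sum_distrib_left sum.distrib algebra_simps)
  define \<rho> where "\<rho> s = rename_vars Some (Polynomial.coeff (remainder k (f (fst s))) (snd s))" for s
  \<comment> \<open>Since \<open>\<xi>\<close> takes the value 1 on both a + w b and
    \<open>p\<close>, proportionality is replaced by equality. The frame equations for
    \<open>a\<close> become consequences, and the k c remainder coefficients of the local equations
    replace those of all forms.\<close>
  define G0 where "G0 = range (\<lambda>l. y l - Const (p $ l)) \<union> {LB \<xi>, LB \<eta> - 1, Var None - Const w} \<union> \<rho> ` ({..<c} \<times> {..<\<kappa>})"
  have fin: "finite G0" by (simp add: G0_def)
  have cG0: "card G0 \<le> CARD('m) + 3 + \<kappa> * c"
  proof -
    have 1: "card (range (\<lambda>l. y l - Const (p $ l))) \<le> CARD('m)" by (rule card_image_le) simp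
    have 2: "card {LB \<xi>, LB \<eta> - 1, Var None - Const w} \<le> 3" by (auto simp: card_insert_if)
    have "card (\<rho> ` ({..<c} \<times> {..<\<kappa>})) \<le> card ({..<c} \<times> {..<\<kappa>})" by (rule card_image_le) simp
    then have 3: "card (\<rho> ` ({..<c} \<times> {..<\<kappa>})) \<le> \<kappa> * c" by (simp add: mult.commute)
    have "card G0 \<le> card (range (\<lambda>l. y l - Const (p $ l)) \<union> {LB \<xi>, LB \<eta> - 1, Var None - Const w}) + card (\<rho> ` ({..<c} \<times> {..<\<kappa>}))"
      unfolding G0_def by (rule card_Un_le)
    also have "card (range (\<lambda>l. y l - Const (p $ l)) \<union> {LB \<xi>, LB \<eta> - 1, Var None - Const w}) \<le>
      card (range (\<lambda>l. y l - Const (p $ l))) + card {LB \<xi>, LB \<eta> - 1, Var None - Const w}" by (rule card_Un_le)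
    finally show ?thesis using 1 2 3 by linarith
  qed
  have \<xi>p: "dotp \<xi> p = 1" and \<eta>p: "dotp \<eta> p = w" by (simp_all add: p_def dotp_lin fr)
  have pspan: "p \<in> vec.span {a + w *s b}" unfolding p_def by (rule vec.span_base) simp
  have Jid: "ideal_in UNIV J" unfolding J by (rule ideal_in_igen[OF srng_UNIV subset_UNIV])
  have J_OH: "rename_vars Some g \<in> J" if "g \<in> OH_ideal X k \<xi> \<eta>" for g
    unfolding J using that by (auto intro!: igen_base srng_UNIV)
  have J_th: "g \<in> J" if "g \<in> theta_equations (vec.span {a + w *s b})" for g
    unfolding J using that by (auto intro!: igen_base srng_UNIV)
  have OHid: "ideal_in UNIV (OH_ideal X k \<xi> \<eta>)" unfolding OH_ideal_eq by (rule ideal_in_igen[OF srng_UNIV subset_UNIV])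
  have fJ: "rename_vars Some g \<in> J" if "g \<in> frame_equations \<xi> \<eta>" for g
    using that unfolding OH_ideal_eq by (intro J_OH[unfolded OH_ideal_eq] igen_base srng_UNIV) simp
  have renL: "rename_vars Some (\<Sum>l\<in>UNIV. Const (\<xi> $ l) * Var (a_var l)) = LA \<xi>" "rename_vars Some (\<Sum>l\<in>UNIV. Const (\<xi> $ l) * Var (b_var l)) = LB \<xi>" for \<xi>
    by (simp_all add: LA_def LB_def rhom_sum[OF rhom_rename_vars] rhomD[OF rhom_rename_vars] rename_vars_simps)
  have frJ: "LA \<xi> - 1 \<in> J" "LA \<eta> \<in> J" "LB \<xi> \<in> J" "LB \<eta> - 1 \<in> J"
    using fJ[of "(\<Sum>l\<in>UNIV. Const (\<xi> $ l) * Var (a_var l)) - 1"] fJ[of "\<Sum>l\<in>UNIV. Const (\<xi> $ l) * Var (b_var l)"]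
      fJ[of "\<Sum>l\<in>UNIV. Const (\<eta> $ l) * Var (a_var l)"] fJ[of "(\<Sum>l\<in>UNIV. Const (\<eta> $ l) * Var (b_var l)) - 1"]
    by (simp_all add: frame_equations_def renL rhom_diff[OF rhom_rename_vars] rhom_1[OF rhom_rename_vars])
  note Jadd = ideal_in_add[OF Jid] and Jmult = ideal_in_mult[OF Jid UNIV_I] and Jdiff = ideal_in_diff[OF srng_UNIV Jid] and Jsum = ideal_in_sum[OF Jid]
  \<comment> \<open>Contracting the proportionality equations with \<open>\<xi>\<close> gives
    \<open>y j = p j \<xi>(y)\<close>, and the frame equations give
    \<open>\<xi>(y) = 1\<close>.\<close>
  have yJ: "y j - Const (p $ j) \<in> J" for j
  proof -
    have "(\<Sum>i\<in>UNIV. Const (\<xi> $ i) * (Const (p $ i) * y j - Const (p $ j) * y i)) \<in> J"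
      by (intro Jsum Jmult J_th) (use pspan in \<open>auto simp: theta_equations_def y_def Let_def\<close>)
    moreover have "(\<Sum>i\<in>UNIV. Const (\<xi> $ i) * (Const (p $ i) * y j - Const (p $ j) * y i)) = Const (dotp \<xi> p) * y j - Const (p $ j) * Ly \<xi>"
      by (simp add: dotp_def Ly_def rhom_sum[OF rhom_Const] Const_simps sum_distrib_left sum_distrib_right sum_subtractf algebra_simps)
    ultimately have "(y j - Const (p $ j) * Ly \<xi>) + Const (p $ j) * ((LA \<xi> - 1) + Var None * LB \<xi>) \<in> J"
      using frJ by (intro Jadd Jmult) (simp_all add: \<xi>p Const_simps)
    moreover have "(y j - Const (p $ j) * Ly \<xi>) + Const (p $ j) * ((LA \<xi> - 1) + Var None * LB \<xi>) = y j - Const (p $ j)"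
      unfolding Ly by (simp add: algebra_simps)
    ultimately show ?thesis by simp
  qed
  have LyJ: "Ly \<xi>' - Const (dotp \<xi>' p) = (\<Sum>i\<in>UNIV. Const (\<xi>' $ i) * (y i - Const (p $ i)))" for \<xi>'
    by (simp add: Ly_def dotp_def rhom_sum[OF rhom_Const] Const_simps sum_subtractf algebra_simps)
  \<comment> \<open>Applied to the universal point, \<open>\<eta>\<close> gives the variable
    \<open>None\<close> by the frame equations and the constant \<open>\<eta>(p) = w\<close> by
    \<open>yJ\<close>.\<close>
  have wJ: "Var None - Const w \<in> J"
  proof -
    have "(Ly \<eta> - Const (dotp \<eta> p)) - LA \<eta> - Var None * (LB \<eta> - 1) \<in> J"
      unfolding LyJ by (intro Jdiff Jsum Jmult yJ frJ)
    moreover have "(Ly \<eta> - Const (dotp \<eta> p)) - LA \<eta> - Var None * (LB \<eta> - 1) = Var None - Const w"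
      unfolding Ly \<eta>p by (simp add: algebra_simps)
    ultimately show ?thesis by simp
  qed
  have "Polynomial.coeff (remainder k F) i \<in> OH_ideal X k \<xi> \<eta>" if "F \<in> ?V" for F i
    unfolding OH_ideal_eq using that by (intro igen_base srng_UNIV) auto
  then have \<rho>J: "\<rho> s \<in> J" if "fst s < c" for s
    unfolding \<rho>_def by (intro J_OH remainder_igen[OF OHid _ f[OF that]])
  have G0J: "G0 \<subseteq> J" using yJ frJ wJ \<rho>J by (auto simp: G0_def)
  have Df: "divisor_poly u k dvd clin (($) a) (($) b) (f j)" if "j < c" for j
    by (rule dvd_igen[OF _ f[OF that]]) (rule D)
  define z' where "z' = (\<chi> v. z $ Some v)"
  have z': "($) a = (\<lambda>l. z' $ a_var l)" "($) b = (\<lambda>l. z' $ b_var l)" "u = (\<lambda>q. z' $ u_var q)" by (auto simp: z'_def a b u)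
  have van: "peval g z = 0" if "g \<in> G0" for g
  proof -
    have "peval (y l - Const (p $ l)) z = 0" for l by (simp add: y_def p_def peval_hom a b w)
    moreover have "peval (LB \<xi>') z = dotp \<xi>' b" for \<xi>' by (simp add: LB_def peval_hom dotp_def b)
    moreover have "peval (\<rho> s) z = 0" if "fst s < c" for s
      using Df[OF that] unfolding z' dvd_iff_remainder by (simp add: \<rho>_def peval_rename_vars z'_def)
    ultimately show ?thesis using that by (auto simp: G0_def peval_hom fr w)
  qed
  have JI: "J \<subseteq> Ihat z G0"
  proof -
    have key: "fe \<phi> g = 0" if \<phi>: "arc z \<phi>" and \<phi>0: "\<forall>g\<in>G0. fe \<phi> g = 0"
      and g: "g \<in> rename_vars Some ` OH_ideal X k \<xi> \<eta> \<union> theta_equations (vec.span {a + w *s b})" for \<phi> g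
    proof -
      define A where "A l = \<phi> (Some (a_var l))" for l
      define B where "B l = \<phi> (Some (b_var l))" for l
      define U where "U q = \<phi> (Some (u_var q))" for q
      note fe = fe_hom fe_Const fe_Var
      have fy: "fe \<phi> (y l) = fps_const (p $ l)" for l
      proof -
        have "fe \<phi> (y l - Const (p $ l)) = 0" using \<phi>0 by (auto simp: G0_def)
        then show ?thesis by (simp add: fe)
      qed
      have fw: "\<phi> None = fps_const w"
      proof -
        have "fe \<phi> (Var None - Const w) = 0" using \<phi>0 by (auto simp: G0_def)
        then show ?thesis by (simp add: fe)
      qed
      have fLB: "fe \<phi> (LB \<xi>) = 0" using \<phi>0 by (auto simp: G0_def)
      have "fe \<phi> (LB \<eta> - 1) = 0" using \<phi>0 by (auto simp: G0_def)
      then have fLB': "fe \<phi> (LB \<eta>) = 1" by (simp add: fe)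
      have fLy: "fe \<phi> (Ly \<xi>') = fps_const (dotp \<xi>' p)" for \<xi>'
        by (simp add: Ly_def fe fy dotp_def rhom_sum[OF rhom_fps_const])
      have fLA: "fe \<phi> (LA \<xi>) = 1" using fLy[of \<xi>] by (simp add: Ly fe fLB \<xi>p)
      have fLA': "fe \<phi> (LA \<eta>) = 0" using fLy[of \<eta>] by (simp add: Ly fe fLB' \<eta>p fw)
      define h where "h r = fe \<phi> (rename_vars Some r)" for r
      have h: "rhom h" unfolding h_def by (rule rhom_comp[OF rhom_fev[OF rhom_id(2)] rhom_rename_vars])
      have hV: "h (Const r) = fps_const r" "h (Var (a_var l)) = A l" "h (Var (b_var l)) = B l" "h (Var (u_var q)) = U q" for r l q
        by (simp_all add: h_def rename_vars_simps fe A_def B_def U_def)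
      define L where "L = lin fps_const A B"
      have Lr: "rhom L" unfolding L_def by (rule rhom_lin[OF rhom_fps_const])
      have dvd: "divisor_poly U k dvd L F \<longleftrightarrow> (\<forall>i. h (Polynomial.coeff (remainder k F) i) = 0)" for F
        using dvd_iff_Rm_rhom[OF h, of k F] by (simp add: hV L_def)
      have Lf: "divisor_poly U k dvd L (f j)" if "j < c" for j
        unfolding dvd
      proof
        fix i
        show "h (Polynomial.coeff (remainder k (f j)) i) = 0"
        proof (cases "i < \<kappa>")
          case True
          then have "\<rho> (j, i) \<in> G0" using that by (auto simp: G0_def)
          then have "fe \<phi> (\<rho> (j, i)) = 0" using \<phi>0 by blast
          then show ?thesis by (simp add: h_def \<rho>_def)
        next
          case False
          then show ?thesis using remainder_high[of k i "f j"] by (simp add: \<kappa>_def rhom_0[OF h])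
        qed
      qed
      have "L (linear_form \<xi>) = [:fe \<phi> (LA \<xi>), fe \<phi> (LB \<xi>):]"
        unfolding L_def lin_line[OF rhom_fps_const] by (simp add: LA_def LB_def fe A_def B_def)
      then have L\<xi>: "L (linear_form \<xi> - 1) = 0" by (simp add: rhomD[OF Lr] fLA fLB pCons_one)
      have Lig: "divisor_poly U k dvd L r" if "r \<in> igen UNIV (insert (linear_form \<xi> - 1) (f ` {..<c}))" for r
        using that by induction (use Lf in \<open>auto simp: rhomD[OF Lr] L\<xi>[unfolded rhomD[OF Lr]] intro!: dvd_add dvd_mult\<close>)
      \<comment> \<open>On the arc, divisibility is known for the \<open>c\<close> local equations
        only. By \<open>loc\<close> a multiple \<open>g * F\<close> is a combination of them and of
        \<open>linear_form \<xi> - 1\<close>, and at the moving q-th point \<open>g\<close> is a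
        power series with constant term 1.\<close>
      have LV: "divisor_poly U k dvd L F" if F: "F \<in> ?V" for F
      proof (rule divisor_poly_dvd_local)
        fix q
        obtain g where g: "peval g (a + u q *s b) = 1" "g * F \<in> igen UNIV (insert (linear_form \<xi> - 1) (f ` {..<c}))" using loc[OF F] by blast
        define \<psi> where "\<psi> l = A l + U q * B l" for l
        have "arc (a + u q *s b) \<psi>" using \<phi> by (simp add: arc_def \<psi>_def A_def B_def U_def a b u)
        then have "fps_nth (fe \<psi> g) 0 = 1" using arc_peval g(1) by metis
        moreover have "poly (L g) (U q) = fe \<psi> g" by (simp add: L_def poly_lin[OF rhom_fps_const] fev_def \<psi>_def)
        ultimately have "poly (L g) (U q) \<noteq> 0" by auto
        then show "\<exists>G. divisor_poly U k dvd G * L F \<and> poly G (U q) \<noteq> 0" using Lig[OF g(2)] by (auto simp: rhom_mult[OF Lr])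
      qed
      have OH0: "OH_ideal X k \<xi> \<eta> \<subseteq> {r. h r = 0}"
        unfolding OH_ideal_eq
      proof (rule igen_least)
        show "ideal_in UNIV {r. h r = 0}" by (auto simp: ideal_in_def rhomD[OF h])
        have "h (\<Sum>l\<in>UNIV. Const (\<xi>' $ l) * Var (a_var l)) = fe \<phi> (LA \<xi>')" "h (\<Sum>l\<in>UNIV. Const (\<xi>' $ l) * Var (b_var l)) = fe \<phi> (LB \<xi>')" for \<xi>'
          by (simp_all add: h_def renL)
        then have "frame_equations \<xi> \<eta> \<subseteq> {r. h r = 0}"
          by (auto simp: frame_equations_def rhom_diff[OF h] rhom_1[OF h] fLA fLA' fLB fLB')
        moreover have "{Polynomial.coeff (remainder k F) i | F i. F \<in> ?V} \<subseteq> {r. h r = 0}" using LV dvd by blast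
        ultimately show "frame_equations \<xi> \<eta> \<union> {Polynomial.coeff (remainder k F) i | F i. F \<in> ?V} \<subseteq> {r. h r = 0}" by blast
      qed
      show ?thesis
      proof (cases "g \<in> rename_vars Some ` OH_ideal X k \<xi> \<eta>")
        case True
        then show ?thesis using OH0 by (auto simp: h_def)
      next
        case False
        then have "g \<in> theta_equations (vec.span {a + w *s b})" using g by blast
        then obtain x i j where x: "x \<in> vec.span {a + w *s b}" "g = Const (x $ i) * y j - Const (x $ j) * y i"
          by (auto simp: theta_equations_def y_def Let_def)
        obtain s where "x = s *s p" using x(1) by (auto simp: span_1 p_def)
        then show ?thesis by (simp add: x(2) fe fy mult_ac)
      qed
    qed
    have "rename_vars Some ` OH_ideal X k \<xi> \<eta> \<union> theta_equations (vec.span {a + w *s b}) \<subseteq> Ihat z G0"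
      unfolding Ihat_def by (intro subsetI CollectI allI impI) (rule key)
    then have "igen UNIV (rename_vars Some ` OH_ideal X k \<xi> \<eta>) \<union> theta_equations (vec.span {a + w *s b}) \<subseteq> Ihat z G0"
      using igen_least[OF ideal_Ihat, of "rename_vars Some ` OH_ideal X k \<xi> \<eta>" z G0] by blast
    then show ?thesis unfolding J by (rule igen_least[OF ideal_Ihat])
  qed
  define T where "T = {v. \<forall>g\<in>G0. dd z v g = 0}"
  have T: "vec.subspace T" unfolding T_def by (intro vec.subspaceI) (auto simp: dd_lin dd_pd[of z 0])
  \<comment> \<open>On \<open>T\<close> the component \<open>None\<close> vanishes and a' = - w b',
    so \<open>\<pi>\<close> loses no information.\<close>
  define \<pi> :: "complex^('m, 'r) inc_var option \<Rightarrow> complex^('m + 'r)" where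
    "\<pi> v = (\<chi> s. case s of Inl l \<Rightarrow> v $ Some (b_var l) | Inr q \<Rightarrow> v $ Some (u_var q))" for v
  have Tf: "v $ None = 0" "dotp \<xi> (\<chi> l. v $ Some (b_var l)) = 0" "dotp \<eta> (\<chi> l. v $ Some (b_var l)) = 0"
    "v $ Some (a_var l) = - w * v $ Some (b_var l)" "\<And>s. fst s < c \<Longrightarrow> snd s < \<kappa> \<Longrightarrow> dd z v (\<rho> s) = 0" if v: "v \<in> T" for v l
  proof -
    have 0: "dd z v g = 0" if "g \<in> G0" for g using v that by (simp add: T_def)
    have "dd z v (Var None - Const w) = 0" by (rule 0) (simp add: G0_def)
    then show n: "v $ None = 0" by simp
    have "dd z v (LB \<xi>) = 0" by (rule 0) (simp add: G0_def)
    then show "dotp \<xi> (\<chi> l. v $ Some (b_var l)) = 0" by (simp add: LB_def dd_sum dotp_def)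
    have "dd z v (LB \<eta> - 1) = 0" by (rule 0) (simp add: G0_def)
    then show "dotp \<eta> (\<chi> l. v $ Some (b_var l)) = 0" by (simp add: LB_def dd_sum dotp_def)
    have "dd z v (y l - Const (p $ l)) = 0" by (rule 0) (simp add: G0_def)
    then show "v $ Some (a_var l) = - w * v $ Some (b_var l)" by (simp add: y_def n w eq_neg_iff_add_eq_0)
    show "dd z v (\<rho> s) = 0" if "fst s < c" "snd s < \<kappa>" for s by (rule 0) (use that in \<open>auto simp: G0_def mem_Times_iff\<close>)
  qed
  have \<pi>T: "\<pi> v \<in> tangent_pairs ?V (($) a) (($) b) u w k" if v: "v \<in> T" for v
  proof -
    define v' where "v' = (\<chi> i. v $ Some i)"
    define s where "s l = [:v' $ a_var l, v' $ b_var l:]" for l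
    have s: "s = (\<lambda>l. [:- w, 1:] * [:\<pi> v $ Inl l:])" using Tf(4)[OF v] by (auto simp: s_def v'_def \<pi>_def mult.commute)
    have uv: "(\<lambda>q. \<pi> v $ Inr q) = (\<lambda>q. v' $ u_var q)" by (simp add: \<pi>_def v'_def)
    have Tcf: "first_order (($) a) (($) b) u k s (\<lambda>q. v' $ u_var q) (f j)" if j: "j < c" for j
    proof -
      have "dd z' v' (Polynomial.coeff (remainder k (f j)) i) = 0" for i
      proof (cases "i < \<kappa>")
        case True
        then show ?thesis using Tf(5)[OF v, of "(j, i)"] j by (simp add: \<rho>_def dd_rename_vars z'_def v'_def)
      next
        case False
        then show ?thesis using remainder_high[of k i "f j"] by (simp add: \<kappa>_def)
      qed
      then show ?thesis using first_order_iff_remainder[of z' k "f j" v'] Df[OF j] unfolding z' s_def[abs_def] by blast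
    qed
    have c\<xi>: "clin (($) a) (($) b) (linear_form \<xi> - 1) = 0"
      using fr(1,2) by (simp add: clin_hom lin_line[OF rhom_id(2)] dotp_def pCons_one)
    have "dF (($) a) (($) b) s (linear_form \<xi>) = (\<Sum>l\<in>UNIV. [:\<xi> $ l:] * s l)"
    proof -
      have "dF (($) a) (($) b) s 0 = 0" by (simp add: dF_def pd_0_1 clin_hom)
      then have "dF (($) a) (($) b) s (sum r I) = (\<Sum>i\<in>I. dF (($) a) (($) b) s (r i))" for r and I :: "'m set"
        by (induction I rule: infinite_finite_induct) (simp_all add: dF_simps)
      then show ?thesis by (simp add: linear_form_def dF_simps clin_simps)
    qed
    also have "\<dots> = [:- w, 1:] * (\<Sum>l\<in>UNIV. [:\<xi> $ l * \<pi> v $ Inl l:])"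
      unfolding s sum_distrib_left by (intro sum.cong refl) (simp add: mult_ac)
    also have "(\<Sum>l\<in>UNIV. [:\<xi> $ l * \<pi> v $ Inl l:]) = [:dotp \<xi> (\<chi> l. v $ Some (b_var l)):]"
      unfolding dotp_def rhom_sum[OF rhom_pCons] by (simp add: \<pi>_def)
    finally have "dF (($) a) (($) b) s (linear_form \<xi>) = 0" by (simp add: Tf(2)[OF v])
    moreover have "dF (($) a) (($) b) s (linear_form \<xi> - 1) = dF (($) a) (($) b) s (linear_form \<xi>)"
      using dF_simps(3)[of "($) a" "($) b" s "linear_form \<xi>" "Const (- 1)"] dF_simps(1)[of "($) a" "($) b" s "- 1"] by (simp add: Const_simps)
    ultimately have first_order\<xi>: "first_order (($) a) (($) b) u k s (\<lambda>q. v' $ u_var q) (linear_form \<xi> - 1)"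
      unfolding first_order_def using c\<xi> by (intro exI[of _ 0]) simp
    have Tcg: "first_order (($) a) (($) b) u k s (\<lambda>q. v' $ u_var q) r" if "r \<in> igen UNIV (insert (linear_form \<xi> - 1) (f ` {..<c}))" for r
      by (rule first_order_igen[OF that]) (use first_order\<xi> Tcf in auto)
    have "first_order (($) a) (($) b) u k s (\<lambda>q. v' $ u_var q) F" if F: "F \<in> ?V" for F
    proof -
      obtain Q where Q: "clin (($) a) (($) b) F = divisor_poly u k * Q" using D[OF F] by (elim dvdE)
      let ?E = "dF (($) a) (($) b) s F - D' u k (\<lambda>q. v' $ u_var q) * Q"
      \<comment> \<open>The localization of \<open>LV\<close> to first order: multiplying
        \<open>F\<close> by \<open>g\<close> multiplies the obstruction by \<open>g\<close> modulo
        the divisor, and \<open>g\<close> is 1 at the q-th point.\<close>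
      have "divisor_poly u k dvd ?E"
      proof (rule divisor_poly_dvd_local)
        fix q
        obtain g where g: "peval g (a + u q *s b) = 1" "g * F \<in> igen UNIV (insert (linear_form \<xi> - 1) (f ` {..<c}))" using loc[OF F] by blast
        let ?g = "clin (($) a) (($) b) g"
        have "clin (($) a) (($) b) (g * F) = divisor_poly u k * (?g * Q)" by (simp add: clin_hom Q mult.left_commute)
        from TcD[OF Tcg[OF g(2)] this]
        have "divisor_poly u k dvd dF (($) a) (($) b) s (g * F) - D' u k (\<lambda>q. v' $ u_var q) * (?g * Q)" .
        moreover have "dF (($) a) (($) b) s (g * F) - D' u k (\<lambda>q. v' $ u_var q) * (?g * Q) = ?g * ?E + divisor_poly u k * (dF (($) a) (($) b) s g * Q)"
          by (simp add: dF_simps Q algebra_simps)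
        ultimately have "divisor_poly u k dvd ?g * ?E" by (metis dvd_add_left_iff dvd_triv_left)
        moreover have "poly ?g (u q) = 1"
          using g(1) by (simp add: poly_clin plus_vec_def vector_scalar_mult_def)
        ultimately show "\<exists>G. divisor_poly u k dvd G * ?E \<and> poly G (u q) \<noteq> 0" by (metis zero_neq_one)
      qed
      then show ?thesis unfolding first_order_def using Q by blast
    qed
    then show ?thesis unfolding tangent_pairs_def mem_Collect_eq s[symmetric] uv by blast
  qed
  have \<pi>lin: "\<pi> (v + v') = \<pi> v + \<pi> v'" "\<pi> (x *s v) = x *s \<pi> v" for v v' x
    by (auto simp: \<pi>_def vec_eq_iff split: sum.split)
  have \<pi>inj: "v = 0" if v: "v \<in> T" "\<pi> v = 0" for v
  proof -
    have b0: "v $ Some (b_var l) = 0" for l using v(2) by (auto simp: \<pi>_def vec_eq_iff dest: spec[of _ "Inl l"])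
    have u0: "v $ Some (u_var q) = 0" for q using v(2) by (auto simp: \<pi>_def vec_eq_iff dest: spec[of _ "Inr q"])
    have a0: "v $ Some (a_var l) = 0" for l using Tf(4)[OF v(1), of l] b0 by simp
    have "v $ i = 0" for i
    proof (cases i)
      case None
      then show ?thesis using Tf(1)[OF v(1)] by simp
    next
      case (Some i')
      have "v $ Some i' = 0"
      proof (cases i')
        case (Inr j)
        then show ?thesis by (cases j) (simp_all add: b0 u0)
      qed (simp add: a0)
      then show ?thesis by (simp add: Some)
    qed
    then show ?thesis by (simp add: vec_eq_iff)
  qed
  note \<pi>dim = dim_inj_le[OF T \<pi>lin \<pi>inj]
  have hom: "\<And>F. F \<in> ?V \<Longrightarrow> homogeneous F" by (simp add: vanishing_forms_def)
  have "vec.dim (\<pi> ` T) + 2 \<le> vec.dim (tangent_pairs ?V (($) a) (($) b) u w k)"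
  proof (rule dim_TT_normalized[OF k hom D fr \<pi>dim(1)])
    show "\<pi> ` T \<subseteq> tangent_pairs ?V (($) a) (($) b) u w k" using \<pi>T by blast
    have "(\<chi> l. \<pi> v $ Inl l) = (\<chi> l. v $ Some (b_var l))" for v by (simp add: \<pi>_def)
    then show "dotp \<xi> (\<chi> l. v $ Inl l) = 0" "dotp \<eta> (\<chi> l. v $ Inl l) = 0" if "v \<in> \<pi> ` T" for v
      using that Tf(2,3) by auto
  qed
  then have dT: "vec.dim T + 2 + \<kappa> * c \<le> CARD('m) + CARD('r)" using bound by (simp add: \<pi>dim(2) \<kappa>_def)
  have cv: "CARD(('m, 'r) inc_var option) = 2 * CARD('m) + CARD('r) + 1" by simp
  \<comment> \<open>The two bounds add up to (m + r - 2 - k c) + (m + 3 + k c), the number of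
    variables.\<close>
  have le: "vec.dim {v. \<forall>g\<in>G0. dd z v g = 0} + card G0 \<le> CARD(('m, 'r) inc_var option)"
    using dT cG0 unfolding T_def cv by linarith
  note sa = smooth_at[OF fin G0J JI van le]
  show "local_krull_dim J z = enat (vec.dim (tangent_space J z))" by (rule sa(2))
  have "tangent_space J z \<subseteq> T" using G0J by (auto simp: tangent_space_dd T_def)
  then have "vec.dim (tangent_space J z) \<le> vec.dim T" by (rule vec.dim_subset)
  then show "vec.dim (tangent_space J z) + 2 + (\<Sum>q\<in>UNIV. k q) * c = CARD('m) + CARD('r)"
    using sa(1) dT cG0 unfolding \<kappa>_def[symmetric] cv by linarith
qed

theorem theorem1p6:
  fixes X :: "(complex^'m::finite) set set"
    and k :: "'r::finite \<Rightarrow> nat"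
    and n c N :: nat
  assumes "CARD('m) = N + 1"
    and "N = n + c"
    and "quasi_projective X"
    and "connectedin zariski X"
    and "smooth_of_dim (variety_charts X) (int n)"
    and "\<And>q. k q > 0"
  shows "\<exists>U. openin zariski U \<and> U \<noteq> {} \<and>
           (\<forall>P\<in>U. smooth_of_dim (theta_fibre X k P)
              (int N - 1 + int CARD('r) - int (\<Sum>q\<in>UNIV. k q) * int c))"
proof -
  note X = quasi_projective_subset[OF assms(3)]
  have m: "CARD('m) = n + c + 1" using assms(1,2) by simp
  define good where "good H \<longleftrightarrow> (\<forall>a b u w l1 l2. peval H (\<chi> l. a l + w * b l) \<noteq> 0 \<longrightarrow> a l1 * b l2 - a l2 * b l1 \<noteq> 0 \<longrightarrow>
    (\<forall>q. vec.span {\<chi> l. a l + u q * b l} \<in> X) \<longrightarrow> (\<forall>F\<in>vanishing_forms X. divisor_poly u k dvd clin a b F) \<longrightarrow>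
       vec.dim (tangent_pairs (vanishing_forms X) a b u w k) + (\<Sum>q\<in>UNIV. k q) * c \<le> CARD('m) + CARD('r))" for H
  obtain H where H: "H \<noteq> 0" "homogeneous H" "good H"
    apply (rule good_form[where k = k, OF assms(3,5) m assms(6)])
    subgoal premises p for H by (rule that[OF p(2,3)], unfold good_def, intro allI impI p(4)) blast+
    done
  define U where "U = {P \<in> proj_space. \<exists>x\<in>P. peval H x \<noteq> 0}"
  have "openin zariski U" unfolding U_def by (rule openin_zariski_form[OF H(2)])
  moreover have "U \<noteq> {}"
  proof -
    fix l :: 'm
    have "Var l \<noteq> (0 :: 'm mpoly)"
    proof
      assume "Var l = (0 :: 'm mpoly)"
      then have "peval (Var l) (\<chi> i. 1) = peval (0 :: 'm mpoly) (\<chi> i. 1)" by (simp only:)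
      then show False by (simp add: peval_hom)
    qed
    \<comment> \<open>The factor \<open>Var l\<close> excludes the zero vector, at which a constant
      \<open>H\<close> would be nonzero without defining a projective point.\<close>
    from mpoly_mult_nonzero[OF this H(1)] obtain x where x: "peval (Var l * H) x \<noteq> 0" by (rule peval_nonzero_exists)
    then have "x \<noteq> 0" "peval H x \<noteq> 0" by (auto simp: peval_hom)
    then have "vec.span {x} \<in> U" using vec.span_base[of x "{x}"] unfolding U_def proj_space_def by blast
    then show ?thesis by blast
  qed
  moreover have "smooth_of_dim (theta_fibre X k P) (int N - 1 + int CARD('r) - int (\<Sum>q\<in>UNIV. k q) * int c)" if P: "P \<in> U" for P
    unfolding smooth_of_dim_def
  proof (intro ballI, clarify)
    fix J W z assume JW: "(J, W) \<in> theta_fibre X k P" and zW: "z \<in> W"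
    obtain \<xi> \<eta> where J: "J = ideal_gen (ideal_gen (rename_vars Some ` OH_ideal X k \<xi> \<eta>) \<union> theta_equations P)"
      and W: "W = {z. (\<chi> v. z $ Some v) \<in> OH_points X k \<xi> \<eta> \<and> theta z = P}"
      using JW unfolding theta_fibre_def OH_bundle_def OH_def rename_vars_def by auto
    define a :: "complex^'m" where "a = (\<chi> l. z $ Some (a_var l))"
    define b :: "complex^'m" where "b = (\<chi> l. z $ Some (b_var l))"
    define u where "u q = z $ Some (u_var q)" for q
    define w where "w = z $ None"
    define y where "y = (\<chi> v. z $ Some v)"
    have y: "y \<in> OH_points X k \<xi> \<eta>" using zW unfolding W y_def by blast
    have abu: "\<And>l. a $ l = y $ a_var l" "\<And>l. b $ l = y $ b_var l" "\<And>q. u q = y $ u_var q"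
      by (simp_all add: a_def b_def u_def y_def)
    note of = OH_point_facts[OF y abu]
    have Pw: "P = vec.span {a + w *s b}"
      using zW unfolding W by (auto simp: theta_def a_def b_def w_def plus_vec_def vector_scalar_mult_def)
    have "peval H (a + w *s b) \<noteq> 0" using P form_on_point[OF H(2)] by (simp add: U_def Pw)
    \<comment> \<open>If all minors vanished, then \<open>\<xi>(a) \<eta>(b)\<close> would equal
      \<open>\<xi>(b) \<eta>(a)\<close>, whereas the frame equations make them 1 and 0.\<close>
    moreover have "\<exists>l1 l2. a $ l1 * b $ l2 - a $ l2 * b $ l1 \<noteq> 0"
    proof (rule ccontr)
      assume "\<not> ?thesis"
      then have ab: "a $ l1 * b $ l2 = a $ l2 * b $ l1" for l1 l2 by simp
      have "dotp \<xi> a * dotp \<eta> b = (\<Sum>l1\<in>UNIV. \<Sum>l2\<in>UNIV. \<xi> $ l1 * \<eta> $ l2 * (a $ l1 * b $ l2))"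
        unfolding dotp_def sum_product by (simp add: mult_ac)
      also have "\<dots> = (\<Sum>l1\<in>UNIV. \<Sum>l2\<in>UNIV. \<xi> $ l1 * \<eta> $ l2 * (a $ l2 * b $ l1))"
        by (simp only: ab)
      also have "\<dots> = dotp \<xi> b * dotp \<eta> a"
        unfolding dotp_def sum_product by (simp add: mult_ac)
      finally show False by (simp add: of)
    qed
    ultimately have bound: "vec.dim (tangent_pairs (vanishing_forms X) (($) a) (($) b) u w k) + (\<Sum>q\<in>UNIV. k q) * c \<le> CARD('m) + CARD('r)"
      using H(3)[unfolded good_def, rule_format, of "($) a" w "($) b" _ _ u] of(5,6)
      by (auto simp: plus_vec_def vector_scalar_mult_def)
    have fib: "vec.dim (tangent_space J z) + 2 + (\<Sum>q\<in>UNIV. k q) * c = CARD('m) + CARD('r)"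
      "local_krull_dim J z = enat (vec.dim (tangent_space J z))"
      by (rule fibre_smooth_at[OF X assms(5) m assms(6) _ _ _ _ of bound, of z];
        simp add: a_def b_def u_def w_def J genideal_iff Pw)+
    \<comment> \<open>The expected dimension may be negative, hence the passage to integers. In that
      case this equation is contradictory, so the fibre has no points.\<close>
    have "int (vec.dim (tangent_space J z)) + 2 + int (\<Sum>q\<in>UNIV. k q) * int c = int N + 1 + int CARD('r)"
      using arg_cong[OF fib(1), of int] assms(1) by simp
    then have d: "int (vec.dim (tangent_space J z)) = int N - 1 + int CARD('r) - int (\<Sum>q\<in>UNIV. k q) * int c" by linarith
    show "int (vec.dim (tangent_space J z)) = int N - 1 + int CARD('r) - int (\<Sum>q\<in>UNIV. k q) * int c \<and>
      local_krull_dim J z = enat (nat (int N - 1 + int CARD('r) - int (\<Sum>q\<in>UNIV. k q) * int c))"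
      unfolding d[symmetric] fib(2) by simp
  qed
  ultimately show ?thesis by blast
qed

end
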